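(* Let $m\ge0$ be an integer and let $\mathbf{x}_0:[0,\infty)\to\mathbb{R}^3$, $\mathbf{x}_0=(x_0^1,x_0^2,x_0^3)$, satisfy $\partial_s^2\mathbf{x}_0\in H^{2+m}(\mathbb{R}_+)$, $|\partial_s\mathbf{x}_0(s)|=1$ for all $s\ge0$, $x_0^3(0)=0$, and suppose that $\mathbf{v}_0:=\partial_s\mathbf{x}_0$ satisfies the compatibility condition $(A)_{[(2+m)/2]}$. Then there exists a unique solution $\mathbf{x}(s,t)$ of \[ \mathbf{x}_t=\mathbf{x}_s\times\mathbf{x}_{ss}\ (s>0,\ t>0),\qquad \mathbf{x}(s,0)=\mathbf{x}_0(s)\ (s>0),\qquad \mathbf{x}_s(0,t)=\mathbf{e}_3\ (t>0) \] such that \[ \mathbf{x}-\mathbf{x}_0\in C\bigl([0,\infty);H^{4+m}(\mathbb{R}_+)\bigr)\cap C^1\bigl([0,\infty);H^{2+m}(\mathbb{R}_+)\bigr), \] and $|\mathbf{x}_s|\equiv1$.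
   Context: $\mathbb{R}_+=\{s>0\}$; $H^k(\mathbb{R}_+)$ is the $L^2$-Sobolev space of order $k$; $C^j([0,\infty);X)$ denotes $j$ times continuously differentiable functions of $t$ with values in the Banach space $X$; vector-valued functions belong to a function space if each component does. $\mathbf{e}_3=(0,0,1)$, $\times$ is the cross product in $\mathbb{R}^3$, subscripts denote partial derivatives. $[r]$ is the largest integer not exceeding $r$. For $n\in\{0,1,2,\dots\}$, a function $\mathbf{v}_0:[0,\infty)\to\mathbb{R}^3$ satisfies the compatibility condition $(A)_n$ if for every $0\le k\le n$: when $k=0$, $\mathbf{v}_0(0)=\mathbf{e}_3$; when $k\ge1$, $\bigl(\mathbf{v}_0\times\partial_s^{2k}\mathbf{v}_0\bigr)\big|_{s=0}=\mathbf{0}$ (traces at $s=0$). *)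

theory Defs
  imports "HOL-Analysis.Analysis" "HOL-Analysis.Cross3"
begin

definition test_fun :: "(real \<Rightarrow> real) \<Rightarrow> bool" where
  "test_fun \<phi> \<longleftrightarrow>
     (\<forall>n x. (deriv ^^ n) \<phi> differentiable (at x)) \<and>
     compact (closure {x. \<phi> x \<noteq> 0}) \<and> closure {x. \<phi> x \<noteq> 0} \<subseteq> {0<..}"

definition L2_pos :: "(real \<Rightarrow> real) \<Rightarrow> bool" where
  "L2_pos f \<longleftrightarrow> f \<in> borel_measurable (lebesgue_on {0<..}) \<and>
                 integrable (lebesgue_on {0<..}) (\<lambda>x. (f x)\<^sup>2)"

definition weak_deriv :: "(real \<Rightarrow> real) \<Rightarrow> (real \<Rightarrow> real) \<Rightarrow> bool" where
  "weak_deriv f g \<longleftrightarrow>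
     (\<forall>\<phi>. test_fun \<phi> \<longrightarrow>
        integrable (lebesgue_on {0<..}) (\<lambda>x. f x * deriv \<phi> x) \<and>
        integrable (lebesgue_on {0<..}) (\<lambda>x. g x * \<phi> x) \<and>
        (LINT x|lebesgue_on {0<..}. f x * deriv \<phi> x) = - (LINT x|lebesgue_on {0<..}. g x * \<phi> x))"

definition sobolev_derivs :: "nat \<Rightarrow> (real \<Rightarrow> real) \<Rightarrow> (nat \<Rightarrow> real \<Rightarrow> real) \<Rightarrow> bool" where
  "sobolev_derivs k f g \<longleftrightarrow> g 0 = f \<and> (\<forall>j\<le>k. L2_pos (g j)) \<and>
                            (\<forall>j<k. weak_deriv (g j) (g (Suc j)))"

definition Hk :: "nat \<Rightarrow> (real \<Rightarrow> real) set" where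
  "Hk k = {f. \<exists>g. sobolev_derivs k f g}"

text \<open>j-th weak derivative of an H^k function (well defined a.e.).\<close>
definition wder :: "nat \<Rightarrow> nat \<Rightarrow> (real \<Rightarrow> real) \<Rightarrow> (real \<Rightarrow> real)" where
  "wder k j f = (SOME g. sobolev_derivs k f g) j"

definition Hk_norm :: "nat \<Rightarrow> (real \<Rightarrow> real) \<Rightarrow> real" where
  "Hk_norm k f = sqrt (\<Sum>j\<le>k. LINT x|lebesgue_on {0<..}. (wder k j f x)\<^sup>2)"

definition trace0 :: "(real \<Rightarrow> real) \<Rightarrow> real" where
  "trace0 g = (THE c. \<exists>h. continuous_on {0..} h \<and>
                 (AE s in lebesgue_on {0<..}. h s = g s) \<and> h 0 = c)"

definition C0H :: "nat \<Rightarrow> (real \<Rightarrow> real \<Rightarrow> real) \<Rightarrow> bool" where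
  "C0H k u \<longleftrightarrow> (\<forall>t\<ge>0. (\<lambda>s. u s t) \<in> Hk k) \<and>
     (\<forall>t0\<ge>0. ((\<lambda>t. Hk_norm k (\<lambda>s. u s t - u s t0)) \<longlongrightarrow> 0) (at t0 within {0..}))"

definition C1H :: "nat \<Rightarrow> (real \<Rightarrow> real \<Rightarrow> real) \<Rightarrow> bool" where
  "C1H k u \<longleftrightarrow> (\<forall>t\<ge>0. (\<lambda>s. u s t) \<in> Hk k) \<and>
     (\<exists>w. C0H k w \<and>
        (\<forall>t0\<ge>0. ((\<lambda>t. Hk_norm k (\<lambda>s. (u s t - u s t0) / (t - t0) - w s t0)) \<longlongrightarrow> 0)
                    (at t0 within {0..})))"

definition e3 :: "real^3" where "e3 = axis 3 1"

definition dtrace0 :: "nat \<Rightarrow> nat \<Rightarrow> (real \<Rightarrow> real^3) \<Rightarrow> real^3" where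
  "dtrace0 k j a = (\<chi> i. trace0 (wder k j (\<lambda>s. a s $ i)))"

text \<open>Compatibility condition (A)_n for v0, where a0 = d/ds v0 is in H^k componentwise,
  so that d^(2l)/ds^(2l) v0 = d^(2l-1)/ds^(2l-1) a0 (weak derivative).\<close>
definition compat_A :: "nat \<Rightarrow> (real \<Rightarrow> real^3) \<Rightarrow> (real \<Rightarrow> real^3) \<Rightarrow> nat \<Rightarrow> bool" where
  "compat_A n v0 a0 k \<longleftrightarrow> v0 0 = e3 \<and>
     (\<forall>l. 1 \<le> l \<and> l \<le> n \<longrightarrow> cross3 (v0 0) (dtrace0 k (2*l - 1) a0) = 0)"

definition xs :: "(real \<Rightarrow> real \<Rightarrow> real^3) \<Rightarrow> real \<Rightarrow> real \<Rightarrow> real^3" where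
  "xs x s t = vector_derivative (\<lambda>s'. x s' t) (at s)"

definition solves_LIA :: "(real \<Rightarrow> real^3) \<Rightarrow> (real \<Rightarrow> real \<Rightarrow> real^3) \<Rightarrow> bool" where
  "solves_LIA x0 x \<longleftrightarrow>
     (\<forall>s>0. \<forall>t>0. (\<lambda>s'. x s' t) differentiable (at s) \<and>
                  (\<lambda>s'. xs x s' t) differentiable (at s) \<and>
                  ((\<lambda>t'. x s t') has_vector_derivative
                      cross3 (xs x s t) (vector_derivative (\<lambda>s'. xs x s' t) (at s))) (at t)) \<and>
     (\<forall>s>0. x s 0 = x0 s) \<and>
     (\<forall>t>0. ((\<lambda>s. x s t) has_vector_derivative e3) (at 0 within {0..}))"

end

theory Submission
 imports Defs "HOL-Probability.Sinc_Integral" "HOL-Real_Asymp.Real_Asymp"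
begin

text \<open>Existence goes through the cubic Schroedinger equation. For a parallel frame v, m = e + i f along the
 curve, with v_s = Re (conj q m) and m_s = - q v, the flow turns into q_t = i (q_ss + |q|^2 q / 2), which is
 globally solvable: mass and energy bound q in H^1, and tame product estimates propagate the higher norms.
 Reflecting v0 by diag(-1, -1, 1) yields initial data on the whole line with q even; the compatibility
 condition says that no smoothness is lost at s = 0. Evenness persists, so q_s = 0 at s = 0, and there
 v_t = Re (conj (i q_s) m) vanishes, which keeps the boundary value of v. The frame is transported
 in t by v_t = Re (conj (i q_s) m), m_t = - i q_s v + (i/2) |q|^2 m, linear equations in a space of bounded
 continuous functions; by Gronwall's inequality the frame equations in s persist. Then
 x = x0 + (integral over t of Re (conj (i q) m)).

 For uniqueness, the difference z of two solutions y, x satisfies z_t = y_s \<times> z_ss + z_s \<times> x_ss and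
 z_st = y_s \<times> z_sss + z_s \<times> x_sss; in the time derivative of the energy |z_s|^2 + |z_ss|^2
 the terms of top order cancel and Gronwall's inequality gives z = 0.\<close>

text \<open>In terms of x the equation is quasilinear and degenerate, since its leading term is a
  cross product with x_s. For q it is semilinear, and the boundary condition becomes a parity. A
  parallel frame is used instead of the Frenet frame because the curvature |q| may vanish; the rate
  |q|^2/2 at which m rotates in t is the one that leaves no further term in the equation for q. As
  diag(-1, -1, 1) is the rotation by pi about e3, the reflected v0 is the tangent of the curve
  continued by its mirror image in a plane orthogonal to e3. Hence the frame equations in s are kept
  in integrated form, and the time derivative of their defects is found by integration by parts. The
  curve has two more derivatives than q, because the first s-derivative of x - x0 is v - v0 and the
  second is a difference of two terms Re (conj q m). For uniqueness, boundary terms are absent since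
  z_s, and therefore z_st, vanishes at s = 0.\<close>

abbreviation (input) ev :: "(real \<Rightarrow>\<^sub>C complex) => real => complex" where "ev == apply_bcontfun"
notation (input) has_vector_derivative (infix "hvd" 50)
notation (input) LIMSEQ ("((_)/ ----> (_))" [60,60] 60)
notation (input) tendsto (infixr "--->" 55)
abbreviation (input) at0 :: "real => real filter" where "at0 t == at t within {0..}"
abbreviation (input) cont0 :: "(real => 'a::topological_space) => bool" where "cont0 f == continuous_on {0..} f"
abbreviation (input) Lpos :: "real measure" where "Lpos == lebesgue_on {0<..}"

lemmas lin = bounded_linear.linear
lemmas lin_hvd = bounded_linear.has_vector_derivative and bil_hvd = bounded_bilinear.has_vector_derivative
lemmas lin_cont = bounded_linear.continuous_on and bil_cont = bounded_bilinear.continuous_on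
lemmas Bint_cong = Bochner_Integration.integral_cong and Bint_bound = Bochner_Integration.integrable_bound
lemmas hrd_iff = has_real_derivative_iff_has_vector_derivative

section \<open>The Hilbert space of square integrable functions on the line\<close>

definition sqi :: "(real => complex) => bool" where
 "sqi f \<longleftrightarrow> f \<in> borel_measurable borel \<and> integrable lborel (%x. (cmod (f x))^2)"

lemma sqi_measurable [measurable_dest]: "sqi f ==> f \<in> borel_measurable borel"
 by (simp add: sqi_def)

lemma sqi_integrable: "sqi f ==> integrable lborel (%x. (cmod (f x))^2)"
 by (simp add: sqi_def)

lemma sqi_bound:
 assumes [measurable]: "f \<in> borel_measurable borel" and "sqi g"
  and le: "!!x. cmod (f x) <= C * cmod (g x)"
 shows "sqi f"
proof -
 have "integrable lborel (%x. (cmod (f x))^2)"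
 proof (rule Bint_bound)
  show "integrable lborel (%x. C^2 * (cmod (g x))^2)"
   using assms(2) by (auto simp: sqi_def)
  show "AE x in lborel. norm ((cmod (f x))^2) <= norm (C^2 * (cmod (g x))^2)"
   using le by (auto simp flip: power_mult_distrib intro!: power_mono)
 qed measurable
 thus ?thesis by (simp add: sqi_def)
qed

lemma sqi_add: assumes "sqi f" "sqi g" shows "sqi (%x. f x + g x)"
proof -
 note [measurable] = sqi_measurable[OF assms(1)] sqi_measurable[OF assms(2)]
 have "integrable lborel (%x. (cmod (f x + g x))^2)"
 proof (rule Bint_bound)
  show "integrable lborel (%x. 2 * (cmod (f x))^2 + 2 * (cmod (g x))^2)"
   using assms by (auto simp: sqi_def)
  have "(cmod (f x + g x))^2 <= 2 * (cmod (f x))^2 + 2 * (cmod (g x))^2" for x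
  proof -
   have "(cmod (f x + g x))^2 <= (cmod (f x) + cmod (g x))^2"
    by (intro power_mono norm_triangle_ineq) auto
   also have "... <= 2 * (cmod (f x))^2 + 2 * (cmod (g x))^2"
    using sum_squares_bound[of "cmod (f x)" "cmod (g x)"] by (simp add: power2_sum)
   finally show ?thesis .
  qed
  thus "AE x in lborel. norm ((cmod (f x + g x))^2) <= norm (2 * (cmod (f x))^2 + 2 * (cmod (g x))^2)"
   by auto
 qed measurable
 thus ?thesis by (simp add: sqi_def)
qed

lemma sqi_cmult: "sqi f ==> sqi (%x. c * f x)"
 by (rule sqi_bound[where C = "cmod c" and g = f]) (auto simp: norm_mult sqi_def)

lemma sqi_scaleR: "sqi f ==> sqi (%x. r *\<^sub>R f x)"
 using sqi_cmult[of f "of_real r"] by (simp add: scaleR_conv_of_real)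

lemma sqi_uminus: "sqi f ==> sqi (%x. - f x)"
 using sqi_cmult[of f "-1"] by simp

lemma sqi_diff: "sqi f ==> sqi g ==> sqi (%x. f x - g x)"
 using sqi_add[OF _ sqi_uminus] by force

lemma sqi_zero: "sqi (%x. 0)"
 by (simp add: sqi_def)

lemma sqi_mult_integrable:
 assumes "sqi f" "sqi g" shows "integrable lborel (%x. f x * g x)"
proof (rule Bint_bound)
 note [measurable] = sqi_measurable[OF assms(1)] sqi_measurable[OF assms(2)]
 show "integrable lborel (%x. (cmod (f x))^2 + (cmod (g x))^2)"
  using assms by (auto simp: sqi_def)
 show "AE x in lborel. norm (f x * g x) <= norm ((cmod (f x))^2 + (cmod (g x))^2)"
 proof (rule AE_I2)
  fix x
  have "0 <= cmod (f x) * cmod (g x)" by simp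
  hence "cmod (f x) * cmod (g x) <= (cmod (f x))^2 + (cmod (g x))^2"
   using sum_squares_bound[of "cmod (f x)" "cmod (g x)"] by linarith
  thus "norm (f x * g x) <= norm ((cmod (f x))^2 + (cmod (g x))^2)"
   by (simp add: norm_mult)
 qed
 show "(%x. f x * g x) \<in> borel_measurable lborel" by measurable
qed

lemma borel_measurable_cnj [measurable (raw)]:
 "f \<in> borel_measurable M ==> (%x. cnj (f x)) \<in> borel_measurable M"
 by (rule borel_measurable_continuous_on[OF continuous_on_cnj[OF continuous_on_id]])

lemma sqi_cnj: "sqi f ==> sqi (%x. cnj (f x))"
 by (rule sqi_bound[where C = 1 and g = f]) (auto simp: sqi_def)

lemma inner_complex_Re: "x \<bullet> y = Re (x * cnj y)" for x y :: complex
 by (simp add: inner_complex_def)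

lemma sqi_inner_integrable: "sqi f ==> sqi g ==> integrable lborel (%x. f x \<bullet> g x)"
 using integrable_Re[OF sqi_mult_integrable[OF _ sqi_cnj]] by (simp add: inner_complex_Re)

definition l2rel :: "(real => complex) => (real => complex) => bool" where
 "l2rel f g \<longleftrightarrow> sqi f \<and> sqi g \<and> (AE x in lborel. f x = g x)"

quotient_type l2 = "real => complex" / partial: l2rel
 morphisms rep_l2 abs_l2
proof (rule part_equivpI)
 show "\<exists>x. l2rel x x" using sqi_zero by (auto simp: l2rel_def)
 show "symp l2rel" by (auto simp: symp_def l2rel_def eq_commute)
 show "transp l2rel" unfolding transp_def l2rel_def by (auto elim: AE_mp)
qed

lemma abs_rep_l2 [simp]: "abs_l2 (rep_l2 u) = u"
 using Quotient_l2 by (simp add: Quotient_def)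

lemma rep_l2_sqi: "sqi (rep_l2 u)"
 using Quotient_l2 by (metis Quotient_rep_reflp l2rel_def)

lemma rep_l2_measurable [measurable]: "rep_l2 u \<in> borel_measurable borel"
 using rep_l2_sqi by (simp add: sqi_def)

lemma rep_abs_l2: "sqi f ==> AE x in lborel. rep_l2 (abs_l2 f) x = f x"
proof -
 assume "sqi f"
 hence "l2rel f f" by (simp add: l2rel_def)
 hence "l2rel (rep_l2 (abs_l2 f)) f"
  using Quotient_l2 by (metis Quotient_rep_abs)
 thus ?thesis by (simp add: l2rel_def)
qed

lemma l2_eqI: "AE x in lborel. rep_l2 u x = rep_l2 v x ==> u = v"
 using Quotient_l2 rep_l2_sqi by (metis Quotient_rel_rep l2rel_def)

lemma abs_l2_eqI: "sqi f ==> AE x in lborel. rep_l2 u x = f x ==> u = abs_l2 f"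
 by (rule l2_eqI, use rep_abs_l2 in force)

instantiation l2 :: real_inner
begin

lift_definition zero_l2 :: l2 is "%_. 0" by (simp add: l2rel_def sqi_zero)
lift_definition plus_l2 :: "l2 => l2 => l2" is "%f g x. f x + g x"
 by (auto simp: l2rel_def sqi_add)
lift_definition minus_l2 :: "l2 => l2 => l2" is "%f g x. f x - g x"
 by (auto simp: l2rel_def sqi_diff)
lift_definition uminus_l2 :: "l2 => l2" is "%f x. - f x"
 by (auto simp: l2rel_def sqi_uminus)
lift_definition scaleR_l2 :: "real => l2 => l2" is "%r f x. r *\<^sub>R f x"
 by (auto simp: l2rel_def sqi_scaleR)
lift_definition inner_l2 :: "l2 => l2 => real" is "%f g. LINT x|lborel. f x \<bullet> g x"
proof -
 fix f f' g g' assume a: "l2rel f f'" "l2rel g g'"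
 hence [measurable]: "f \<in> borel_measurable borel" "f' \<in> borel_measurable borel"
   "g \<in> borel_measurable borel" "g' \<in> borel_measurable borel"
  by (auto simp: l2rel_def sqi_def)
 show "(LINT x|lborel. f x \<bullet> g x) = (LINT x|lborel. f' x \<bullet> g' x)"
  by (rule integral_cong_AE) (use a in "auto simp: l2rel_def")
qed

definition norm_l2 :: "l2 => real" where "norm_l2 u = sqrt (u \<bullet> u)"
definition sgn_l2 :: "l2 => l2" where "sgn_l2 u = scaleR (inverse (norm u)) u"
definition dist_l2 :: "l2 => l2 => real" where "dist_l2 u v = norm (u - v)"
definition uniformity_l2 :: "(l2 \<times> l2) filter"
 where "uniformity_l2 = (INF e\<in>{0 <..}. principal {(x, y). dist x y < e})"
definition open_l2 :: "l2 set => bool"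
 where "open_l2 S = (\<forall>x\<in>S. \<forall>\<^sub>F (x', y) in uniformity. x' = x --> y \<in> S)"

instance
proof
 fix a b c :: l2 and r s :: real
 show "a + b + c = a + (b + c)" by transfer (auto simp: l2rel_def sqi_add algebra_simps)
 show "a + b = b + a" by transfer (auto simp: l2rel_def sqi_add algebra_simps)
 show "0 + a = a" by transfer (auto simp: l2rel_def sqi_add algebra_simps)
 show "- a + a = 0" by transfer (auto simp: l2rel_def sqi_zero)
 show "a - b = a + - b" by transfer (auto simp: l2rel_def sqi_diff sqi_add sqi_uminus)
 show "r *\<^sub>R (a + b) = r *\<^sub>R a + r *\<^sub>R b"
  by transfer (auto simp: l2rel_def sqi_add sqi_scaleR algebra_simps)
 show "(r + s) *\<^sub>R a = r *\<^sub>R a + s *\<^sub>R a"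
  by transfer (auto simp: l2rel_def sqi_add sqi_scaleR algebra_simps)
 show "r *\<^sub>R s *\<^sub>R a = (r * s) *\<^sub>R a"
  by transfer (auto simp: l2rel_def sqi_add sqi_scaleR algebra_simps)
 show "1 *\<^sub>R a = a"
  by transfer (auto simp: l2rel_def sqi_add sqi_scaleR algebra_simps)
 show "sgn a = inverse (norm a) *\<^sub>R a" by (simp add: sgn_l2_def)
 show "dist a b = norm (a - b)" by (simp add: dist_l2_def)
 show "uniformity = (INF e\<in>{0 <..}. principal {(x::l2, y). dist x y < e})" by (rule uniformity_l2_def)
 show "open U = (\<forall>x\<in>U. \<forall>\<^sub>F (x', y) in uniformity. x' = x --> y \<in> U)" for U :: "l2 set"
  by (rule open_l2_def)
 show "a \<bullet> b = b \<bullet> a" by transfer (simp add: inner_commute)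
 show "(a + b) \<bullet> c = a \<bullet> c + b \<bullet> c"
 proof transfer
  fix a b c assume "l2rel a a" "l2rel b b" "l2rel c c"
  hence "integrable lborel (%x. a x \<bullet> c x)" "integrable lborel (%x. b x \<bullet> c x)"
   by (auto simp: l2rel_def sqi_inner_integrable)
  thus "(LINT x|lborel. (a x + b x) \<bullet> c x) = (LINT x|lborel. a x \<bullet> c x) + (LINT x|lborel. b x \<bullet> c x)"
   by (simp add: inner_add_left)
 qed
 show "(r *\<^sub>R a) \<bullet> b = r * (a \<bullet> b)" by transfer simp
 show "0 <= a \<bullet> a" by transfer (simp add: integral_nonneg_AE)
 show "(a \<bullet> a = 0) = (a = 0)"
 proof transfer
  fix a assume "l2rel a a"
  hence "integrable lborel (%x. a x \<bullet> a x)" "sqi a" by (auto simp: l2rel_def sqi_inner_integrable)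
  thus "((LINT x|lborel. a x \<bullet> a x) = 0) = l2rel a (%_. 0)"
   by (subst integral_nonneg_eq_0_iff_AE) (auto simp: l2rel_def sqi_zero)
 qed
 show "norm a = sqrt (a \<bullet> a)" by (rule norm_l2_def)
qed
end

lemma inner_l2_rep: "u \<bullet> v = (LINT x|lborel. rep_l2 u x \<bullet> rep_l2 v x)"
 by (simp add: inner_l2.rep_eq)

lemma norm_l2_sq: "(norm u)^2 = (LINT x|lborel. (cmod (rep_l2 u x))^2)"
 by (simp add: power2_norm_eq_inner inner_l2_rep)

lemma rep_add: "AE x in lborel. rep_l2 (u + v) x = rep_l2 u x + rep_l2 v x"
 using rep_abs_l2[OF sqi_add[OF rep_l2_sqi rep_l2_sqi], of u v] by (simp add: plus_l2_def map_fun_def)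
lemma rep_diff: "AE x in lborel. rep_l2 (u - v) x = rep_l2 u x - rep_l2 v x"
 using rep_abs_l2[OF sqi_diff[OF rep_l2_sqi rep_l2_sqi], of u v] by (simp add: minus_l2_def map_fun_def)
lemma rep_uminus: "AE x in lborel. rep_l2 (- u) x = - rep_l2 u x"
 using rep_abs_l2[OF sqi_uminus[OF rep_l2_sqi], of u] by (simp add: uminus_l2_def map_fun_def)
lemma rep_scaleR: "AE x in lborel. rep_l2 (r *\<^sub>R u) x = r *\<^sub>R rep_l2 u x"
 using rep_abs_l2[OF sqi_scaleR[OF rep_l2_sqi], of r u] by (simp add: scaleR_l2_def map_fun_def)
lemma rep_zero: "AE x in lborel. rep_l2 0 x = 0"
 using rep_abs_l2[OF sqi_zero] by (simp add: zero_l2_def)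

lemma norm_abs_l2: assumes "sqi f" shows "(norm (abs_l2 f))^2 = (LINT x|lborel. (cmod (f x))^2)"
 unfolding norm_l2_sq
 by (rule integral_cong_AE) (use rep_abs_l2[OF assms] sqi_measurable[OF assms] in auto)

text \<open>Nonnegative integrals are always defined, so one estimate yields both square
  integrability and the norm bound; this fits Fatou's lemma and Tonelli's theorem.\<close>

lemma norm_l2_le_nn:
 assumes [measurable]: "f \<in> borel_measurable borel" and "0 <= c"
  and le: "(\<integral>\<^sup>+x. ennreal ((cmod (f x))^2) \<partial>lborel) <= ennreal (c^2)"
 shows "sqi f" "norm (abs_l2 f) <= c"
proof -
 show s: "sqi f" unfolding sqi_def integrable_iff_bounded
  using le by (auto simp: le_less_trans)
 have "ennreal ((norm (abs_l2 f))^2) <= ennreal (c^2)"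
  using le by (simp add: norm_abs_l2[OF s] nn_integral_eq_integral[OF sqi_integrable[OF s], symmetric])
 thus "norm (abs_l2 f) <= c"
  using assms(2) by (simp add: power2_le_iff_abs_le)
qed

lemma nn_norm_l2: "(\<integral>\<^sup>+x. ennreal ((cmod (rep_l2 u x))^2) \<partial>lborel) = ennreal ((norm u)^2)"
 by (simp add: norm_l2_sq nn_integral_eq_integral[OF sqi_integrable[OF rep_l2_sqi]])

text \<open>A positive square integrable weight turns Cauchy sequences of L^2 into Cauchy sequences
  of L^1 on the whole line, where an a.e. convergent subsequence can be extracted; positivity allows
  the weight to be divided out again.\<close>

definition wgt :: "real => complex" where "wgt x = of_real (inverse (1 + x^2))"

lemma integrable_wgt: "integrable lborel (%x::real. inverse (1 + x^2))"
 using integrable_inverse_1_plus_square by (simp add: set_integrable_def)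

lemma wgt_sqi: "sqi wgt"
proof -
 have "integrable lborel (%x. (cmod (wgt x))^2)"
 proof (rule Bint_bound[OF integrable_wgt])
  have "inverse (1 + x^2) <= 1" for x :: real
   by (simp add: inverse_eq_divide divide_le_eq add_pos_nonneg)
  thus "AE x in lborel. norm ((cmod (wgt x))^2) <= norm (inverse (1 + x^2))"
   by (auto intro!: AE_I2 simp: wgt_def norm_inverse power2_eq_square[of "inverse _"] mult_left_le norm_power abs_mult
      simp del: power_inverse of_real_add of_real_inverse)
 qed (simp add: wgt_def)
 thus ?thesis unfolding sqi_def by (simp add: wgt_def[abs_def])
qed

text \<open>Cauchy-Schwarz is applied to the moduli, since the inner product of \<open>l2\<close>
  itself is a real part in which cancellation may occur.\<close>

lemma sqrt_l2_mult_le: "sqi f ==> sqi g ==> (LINT x|lborel. cmod (f x) * cmod (g x)) <= norm (abs_l2 f) * norm (abs_l2 g)"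
proof -
 assume f: "sqi f" and g: "sqi g"
 note [measurable] = sqi_measurable[OF f] sqi_measurable[OF g]
 have f': "sqi (%x. of_real (cmod (f x)))" and g': "sqi (%x. of_real (cmod (g x)))"
  using f g by (auto simp: sqi_def)
 have "(LINT x|lborel. cmod (f x) * cmod (g x)) = abs_l2 (%x. of_real (cmod (f x))) \<bullet> abs_l2 (%x. of_real (cmod (g x)))"
  unfolding inner_l2_rep
  by (rule integral_cong_AE) (use rep_abs_l2[OF f'] rep_abs_l2[OF g'] in "auto simp: inner_complex_def")
 also have "... <= norm (abs_l2 (%x. of_real (cmod (f x)))) * norm (abs_l2 (%x. of_real (cmod (g x))))"
  by (rule norm_cauchy_schwarz)
 also have "norm (abs_l2 (%x. of_real (cmod (f x)))) = norm (abs_l2 f)"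
  by (rule power2_eq_imp_eq) (simp_all add: norm_abs_l2[OF f] norm_abs_l2[OF f'])
 also have "norm (abs_l2 (%x. of_real (cmod (g x)))) = norm (abs_l2 g)"
  by (rule power2_eq_imp_eq) (simp_all add: norm_abs_l2[OF g] norm_abs_l2[OF g'])
 finally show ?thesis .
qed

lemma l2_cauchy_AE_subseq:
 assumes "Cauchy (X :: nat => l2)"
 obtains r where "strict_mono r" "AE x in lborel. Cauchy (%i. rep_l2 (X (r i)) x)"
proof -
 let ?s = "%n x. wgt x * rep_l2 (X n) x"
 have wpos: "wgt x ~= 0" for x
  by (simp add: wgt_def add_pos_nonneg del: of_real_add) (metis add_nonneg_eq_0_iff of_real_1 of_real_add of_real_eq_0_iff of_real_power zero_le_one zero_le_power2 zero_neq_one)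
 have 1: "integrable lborel (?s n)" for n
  by (rule sqi_mult_integrable[OF wgt_sqi rep_l2_sqi])
 have le: "(LINT x|lborel. norm (?s i x - ?s j x)) <= norm (abs_l2 wgt) * norm (X i - X j)" for i j
 proof -
  have "(LINT x|lborel. norm (?s i x - ?s j x)) = (LINT x|lborel. cmod (wgt x) * cmod (rep_l2 (X i - X j) x))"
   by (rule integral_cong_AE) (use rep_diff[of "X i" "X j"] sqi_measurable[OF wgt_sqi] in
     \<open>auto simp: norm_mult[symmetric] right_diff_distrib\<close>)
  also have "... <= norm (abs_l2 wgt) * norm (X i - X j)"
   using sqrt_l2_mult_le[OF wgt_sqi rep_l2_sqi[of "X i - X j"]] by simp
  finally show ?thesis .
 qed
 have 2: "\<exists>N. \<forall>i\<ge>N. \<forall>j\<ge>N. (LINT x|lborel. norm (?s i x - ?s j x)) < e" if "e > 0" for e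
 proof -
  let ?c = "norm (abs_l2 wgt) + 1"
  have c: "?c > 0" by (simp add: add_nonneg_pos)
  have "e / ?c > 0" using that c by simp
  then obtain N where N: "\<forall>i\<ge>N. \<forall>j\<ge>N. norm (X i - X j) < e / ?c"
   using assms unfolding Cauchy_iff by blast
  show ?thesis
  proof (intro exI[of _ N] allI impI)
   fix i j assume "N <= i" "N <= j"
   hence "norm (X i - X j) < e / ?c" using N by auto
   hence "?c * norm (X i - X j) < e" using c by (simp add: field_simps)
   thus "(LINT x|lborel. norm (?s i x - ?s j x)) < e"
    using le[of i j] by (simp add: algebra_simps) (smt (verit) norm_ge_zero)
  qed
 qed
 obtain r where r: "strict_mono r" "AE x in lborel. Cauchy (%i. ?s (r i) x)"
  using cauchy_L1_AE_cauchy_subseq[OF 1 2] by blast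
 have "AE x in lborel. Cauchy (%i. rep_l2 (X (r i)) x)"
 proof (rule AE_mp[OF r(2)], rule AE_I2, rule impI)
  fix x assume "Cauchy (%i. ?s (r i) x)"
  hence "convergent (%i. ?s (r i) x)" by (simp add: Cauchy_convergent)
  thus "Cauchy (%i. rep_l2 (X (r i)) x)"
   using convergent_mult_const_iff[OF wpos[of x]] by (simp add: Cauchy_convergent_iff)
 qed
 with r(1) show ?thesis by (rule that)
qed

text \<open>Riesz-Fischer: Fatou's lemma along an a.e. convergent subsequence bounds the distance
  from X n to the pointwise limit by the Cauchy modulus of X.\<close>

instance l2 :: complete_space
proof
 fix X :: "nat => l2" assume C: "Cauchy X"
 obtain r where r: "strict_mono r" "AE x in lborel. Cauchy (%i. rep_l2 (X (r i)) x)"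
  by (rule l2_cauchy_AE_subseq[OF C])
 define g where "g x = lim (%i. rep_l2 (X (r i)) x)" for x
 have g[measurable]: "g \<in> borel_measurable borel" unfolding g_def by measurable
 have lim: "AE x in lborel. (%i. rep_l2 (X (r i)) x) ----> g x"
  using r(2) by (rule AE_mp) (auto simp: g_def Cauchy_convergent_iff convergent_LIMSEQ_iff)
 have key: "(\<integral>\<^sup>+x. ennreal ((cmod (rep_l2 (X n) x - g x))^2) \<partial>lborel) <= ennreal (e^2)"
  if N: "!!i. i >= N ==> norm (X n - X i) <= e" and "e >= 0" for n N e
 proof -
  let ?h = "%i x. ennreal ((cmod (rep_l2 (X n) x - rep_l2 (X (r i)) x))^2)"
  have "(\<integral>\<^sup>+x. ennreal ((cmod (rep_l2 (X n) x - g x))^2) \<partial>lborel) = (\<integral>\<^sup>+x. liminf (%i. ?h i x) \<partial>lborel)"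
  proof (rule nn_integral_cong_AE, rule AE_mp[OF lim], rule AE_I2, rule impI)
   fix x assume "(%i. rep_l2 (X (r i)) x) ----> g x"
   hence "(%i. ?h i x) ----> ennreal ((cmod (rep_l2 (X n) x - g x))^2)"
    by (intro tendsto_ennrealI tendsto_intros)
   thus "ennreal ((cmod (rep_l2 (X n) x - g x))^2) = liminf (%i. ?h i x)"
    by (rule lim_imp_Liminf[symmetric, OF trivial_limit_sequentially])
  qed
  also have "... <= liminf (%i. \<integral>\<^sup>+x. ?h i x \<partial>lborel)"
   by (rule nn_integral_liminf) measurable
  also have "... <= ennreal (e^2)"
  proof (rule order_trans[OF Liminf_mono[where g = "%_. ennreal (e^2)"]], rule eventually_sequentiallyI[of N])
   fix i assume "N <= i"
   hence "N <= r i" using seq_suble[OF r(1), of i] by linarith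
   have "(\<integral>\<^sup>+x. ?h i x \<partial>lborel) = (\<integral>\<^sup>+x. ennreal ((cmod (rep_l2 (X n - X (r i)) x))^2) \<partial>lborel)"
    by (rule nn_integral_cong_AE) (use rep_diff[of "X n" "X (r i)"] in auto)
   also have "... <= ennreal (e^2)"
    unfolding nn_norm_l2 by (intro ennreal_leI power_mono N \<open>N <= r i\<close>) auto
   finally show "(\<integral>\<^sup>+x. ?h i x \<partial>lborel) <= ennreal (e^2)" .
  qed (simp add: Liminf_const)
  finally show ?thesis .
 qed
 have ex: "\<exists>N. \<forall>n\<ge>N. \<forall>i\<ge>N. norm (X n - X i) <= e" if "e > 0" for e
  using C that unfolding Cauchy_iff by (meson less_imp_le)
 obtain N1 where N1: "\<forall>n\<ge>N1. \<forall>i\<ge>N1. norm (X n - X i) <= 1" using ex[of 1] by auto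
 have "sqi (%x. rep_l2 (X N1) x - g x)"
  by (rule norm_l2_le_nn(1)[where c = 1]) (use key[of N1 N1 1] N1 in auto)
 from sqi_diff[OF rep_l2_sqi[of "X N1"] this] have sg: "sqi g" by simp
 have "X ----> abs_l2 g"
 proof (rule metric_LIMSEQ_I)
  fix e :: real assume "e > 0"
  then obtain N where N: "\<forall>n\<ge>N. \<forall>i\<ge>N. norm (X n - X i) <= e/2" using ex[of "e/2"] by auto
  have "dist (X n) (abs_l2 g) < e" if "n >= N" for n
  proof -
   have s: "sqi (%x. rep_l2 (X n) x - g x)" by (intro sqi_diff rep_l2_sqi sg)
   have "X n - abs_l2 g = abs_l2 (%x. rep_l2 (X n) x - g x)"
    by (rule abs_l2_eqI[OF s]) (use rep_diff[of "X n" "abs_l2 g"] rep_abs_l2[OF sg] in force)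
   moreover have "norm (abs_l2 (%x. rep_l2 (X n) x - g x)) <= e/2"
    by (rule norm_l2_le_nn(2)) (use key[of N n "e/2"] N that \<open>e > 0\<close> in auto)
   ultimately show ?thesis using \<open>e > 0\<close> by (simp add: dist_norm)
  qed
  thus "\<exists>N. \<forall>n\<ge>N. dist (X n) (abs_l2 g) < e" by blast
 qed
 thus "convergent X" by (auto simp: convergent_def)
qed

lemma l2_bounded_support:
 assumes [measurable]: "g \<in> borel_measurable borel" and e: "!!x. cmod (g x) <= e"
  and z: "!!x. x \<notin> {a..b} ==> g x = 0" and "a <= b"
 shows "sqi g" "norm (abs_l2 g) <= e * sqrt (b - a)"
proof -
 have e0: "0 <= e" using e[of 0] norm_ge_zero[of "g 0"] by linarith
 have le: "(\<integral>\<^sup>+x. ennreal ((cmod (g x))^2) \<partial>lborel) <= ennreal ((e * sqrt (b - a))^2)"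
 proof -
  have "(\<integral>\<^sup>+x. ennreal ((cmod (g x))^2) \<partial>lborel) <= (\<integral>\<^sup>+x. ennreal (e^2) * indicator {a..b} x \<partial>lborel)"
   by (rule nn_integral_mono) (use e z in "auto simp: indicator_def intro!: power_mono")
  also have "... = ennreal (e^2) * ennreal (b - a)"
   using \<open>a <= b\<close> by (simp add: nn_integral_cmult_indicator)
  also have "... = ennreal ((e * sqrt (b - a))^2)"
   using \<open>a <= b\<close> by (simp add: ennreal_mult power_mult_distrib)
  finally show ?thesis .
 qed
 have c: "0 <= e * sqrt (b - a)" using e0 \<open>a <= b\<close> by simp
 show "sqi g" "norm (abs_l2 g) <= e * sqrt (b - a)"
  using norm_l2_le_nn[OF _ c le] by auto
qed

section \<open>Multiplication operators, affine substitutions, conjugation and interval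
  integrals\<close>

definition mulf :: "(real => complex) => l2 => l2" where
 "mulf g u = abs_l2 (%x. g x * rep_l2 u x)"

definition bm :: "(real => complex) => real => bool" where
 "bm g C \<longleftrightarrow> g \<in> borel_measurable borel \<and> (\<forall>x. cmod (g x) <= C)"

lemma sqi_mulf: "bm g C ==> sqi (%x. g x * rep_l2 u x)"
 by (rule sqi_bound[where C = C and g = "rep_l2 u"])
   (auto simp: bm_def rep_l2_sqi norm_mult intro: mult_right_mono)

lemma rep_mulf: "bm g C ==> AE x in lborel. rep_l2 (mulf g u) x = g x * rep_l2 u x"
 unfolding mulf_def by (rule rep_abs_l2[OF sqi_mulf])

lemma norm_mulf: assumes "bm g C" shows "norm (mulf g u) <= C * norm u"
proof -
 have C: "0 <= C" using assms by (meson bm_def norm_ge_zero order_trans)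
 have [measurable]: "g \<in> borel_measurable borel" using assms by (simp add: bm_def)
 have "(\<integral>\<^sup>+x. ennreal ((cmod (g x * rep_l2 u x))^2) \<partial>lborel) <= (\<integral>\<^sup>+x. ennreal (C^2) * ennreal ((cmod (rep_l2 u x))^2) \<partial>lborel)"
  using assms by (auto simp: bm_def norm_mult power_mult_distrib simp flip: ennreal_mult
    intro!: nn_integral_mono ennreal_leI mult_right_mono power_mono)
 also have "... = ennreal ((C * norm u)^2)"
  by (subst nn_integral_cmult) (auto simp: nn_norm_l2 power_mult_distrib ennreal_mult)
 finally show ?thesis unfolding mulf_def
  by (intro norm_l2_le_nn(2)) (use C in auto)
qed

lemma mulf_add: assumes "bm g C" shows "mulf g (u + v) = mulf g u + mulf g v"
 by (rule l2_eqI) (use rep_mulf[OF assms, of "u + v"] rep_add[of u v] rep_add[of "mulf g u" "mulf g v"]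
  rep_mulf[OF assms, of u] rep_mulf[OF assms, of v] in "eventually_elim, simp add: algebra_simps")

lemma mulf_scaleR: assumes "bm g C" shows "mulf g (r *\<^sub>R u) = r *\<^sub>R mulf g u"
 by (rule l2_eqI) (use rep_mulf[OF assms, of "r *\<^sub>R u"] rep_scaleR[of r u] rep_scaleR[of r "mulf g u"]
  rep_mulf[OF assms, of u] in "eventually_elim, simp add: algebra_simps")

lemma lin_mulf: assumes "bm g C" shows "bounded_linear (mulf g)"
 by (rule bounded_linear_intro[where K = C])
   (use norm_mulf[OF assms] in "simp_all add: mulf_add[OF assms] mulf_scaleR[OF assms] mult.commute")

lemma mulf_mulf: assumes "bm g C" "bm h D" shows "mulf g (mulf h u) = mulf (%x. g x * h x) u"
proof -
 have b: "bm (%x. g x * h x) (C * D)"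
  using assms unfolding bm_def by (auto simp: norm_mult intro!: mult_mono intro: order_trans[OF norm_ge_zero])
 show ?thesis
  by (rule l2_eqI) (use rep_mulf[OF assms(1), of "mulf h u"] rep_mulf[OF assms(2), of u] rep_mulf[OF b, of u]
    in "eventually_elim, simp add: algebra_simps")
qed

lemma inner_mulf: assumes "bm g C" shows "mulf g u \<bullet> v = u \<bullet> mulf (%x. cnj (g x)) v"
proof -
 have b: "bm (%x. cnj (g x)) C" using assms by (auto simp: bm_def)
 have "mulf g u \<bullet> v = (LINT x|lborel. (g x * rep_l2 u x) \<bullet> rep_l2 v x)"
  unfolding inner_l2_rep using assms
  by (intro integral_cong_AE) (use rep_mulf[OF assms, of u] in "auto simp: bm_def")
 also have "... = (LINT x|lborel. rep_l2 u x \<bullet> (cnj (g x) * rep_l2 v x))"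
  by (simp add: inner_complex_Re algebra_simps)
 also have "... = u \<bullet> mulf (%x. cnj (g x)) v"
  unfolding inner_l2_rep using assms
  by (intro integral_cong_AE) (use rep_mulf[OF b, of v] in "auto simp: bm_def")
 finally show ?thesis .
qed

definition J :: "l2 => l2" where "J = mulf (%_. \<i>)"

lemma bm_i: "bm (%_. \<i>) 1" by (simp add: bm_def)
lemma lin_J: "bounded_linear J" unfolding J_def by (rule lin_mulf[OF bm_i])

lemma mulf_const_real: "mulf (%_. of_real r) u = r *\<^sub>R u"
 by (rule l2_eqI) (use rep_mulf[of "%_. of_real r" "\<bar>r\<bar>" u] rep_scaleR[of r u] in
   \<open>auto simp: bm_def scaleR_conv_of_real\<close>)

lemma J_J: "J (J u) = - u"
 unfolding J_def mulf_mulf[OF bm_i bm_i] using mulf_const_real[of "-1" u] by simp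

lemma inner_J: "J u \<bullet> v = - (u \<bullet> J v)"
proof -
 have "mulf (%_. - \<i>) v = - J v"
  using mulf_mulf[of "%_. of_real (-1)" 1 "%_. \<i>" 1 v] mulf_const_real[of "-1" "J v"] by (simp add: bm_def J_def)
 thus ?thesis unfolding J_def inner_mulf[OF bm_i] by simp
qed

lemma inner_J_self [simp]: "J u \<bullet> u = 0" "u \<bullet> J u = 0"
 using inner_J[of u u] by (auto simp: inner_commute)

lemma inner_J_J: "J u \<bullet> J v = u \<bullet> v"
 by (simp add: inner_J J_J)

lemma norm_J [simp]: "norm (J u) = norm u"
 by (simp add: norm_eq_sqrt_inner inner_J_J)

text \<open>One family covers the translations (c = 1) and the reflection (c = -1, h = 0). For |c| =
  1 these are isometries, and both kinds commute with the Schroedinger group constructed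
  below.\<close>

definition aff :: "real => real => l2 => l2" where
 "aff c h u = abs_l2 (%x. rep_l2 u (h + c * x))"

lemma sqi_aff: assumes "c ~= 0" "sqi f" shows "sqi (%x. f (h + c * x))"
proof -
 note [measurable] = sqi_measurable[OF assms(2)]
 have "(%x. f (h + c * x)) \<in> borel_measurable borel" by measurable
 thus ?thesis
  using assms lborel_integrable_real_affine[of "%x. (cmod (f x))^2" c h] by (simp add: sqi_def)
qed

lemma rep_aff: "c ~= 0 ==> AE x in lborel. rep_l2 (aff c h u) x = rep_l2 u (h + c * x)"
 unfolding aff_def by (rule rep_abs_l2[OF sqi_aff[OF _ rep_l2_sqi]])

lemma aff_abs: assumes "c ~= 0" "sqi f" shows "aff c h (abs_l2 f) = abs_l2 (%x. f (h + c * x))"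
proof (rule abs_l2_eqI[OF sqi_aff[OF assms]])
 note [measurable] = sqi_measurable[OF assms(2)]
 have "AE x in lborel. rep_l2 (abs_l2 f) (h + c * x) = f (h + c * x)"
  by (rule AE_borel_affine[OF assms(1) _ rep_abs_l2[OF assms(2)]]) measurable
 with rep_aff[OF assms(1), of h "abs_l2 f"]
 show "AE x in lborel. rep_l2 (aff c h (abs_l2 f)) x = f (h + c * x)" by eventually_elim simp
qed

lemma inner_aff: assumes "\<bar>c\<bar> = 1" shows "aff c h u \<bullet> aff c h v = u \<bullet> v"
proof -
 have c: "c ~= 0" using assms by auto
 have "aff c h u \<bullet> aff c h v = (LINT x|lborel. rep_l2 u (h + c * x) \<bullet> rep_l2 v (h + c * x))"
  unfolding inner_l2_rep using rep_aff[OF c, of h u] rep_aff[OF c, of h v]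
  by (intro integral_cong_AE) auto
 also have "... = u \<bullet> v"
  unfolding inner_l2_rep
  using lborel_integral_real_affine[OF c, of "%x. rep_l2 u x \<bullet> rep_l2 v x" h] assms by simp
 finally show ?thesis .
qed

lemma norm_aff: "\<bar>c\<bar> = 1 ==> norm (aff c h u) = norm u"
 by (simp add: norm_eq_sqrt_inner inner_aff)

lemma aff_add: assumes "c ~= 0" shows "aff c h (u + v) = aff c h u + aff c h v"
proof -
 have "AE x in lborel. rep_l2 (u + v) (h + c * x) = rep_l2 u (h + c * x) + rep_l2 v (h + c * x)"
  by (rule AE_borel_affine[OF assms _ rep_add]) measurable
 note ae = this rep_aff[OF assms, of h "u + v"] rep_aff[OF assms, of h u] rep_aff[OF assms, of h v]
  rep_add[of "aff c h u" "aff c h v"]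
 show ?thesis by (rule l2_eqI) (use ae in "eventually_elim, simp")
qed

lemma aff_scaleR: assumes "c ~= 0" shows "aff c h (r *\<^sub>R u) = r *\<^sub>R aff c h u"
proof -
 have "AE x in lborel. rep_l2 (r *\<^sub>R u) (h + c * x) = r *\<^sub>R rep_l2 u (h + c * x)"
  by (rule AE_borel_affine[OF assms _ rep_scaleR]) measurable
 note ae = this rep_aff[OF assms, of h "r *\<^sub>R u"] rep_aff[OF assms, of h u] rep_scaleR[of r "aff c h u"]
 show ?thesis by (rule l2_eqI) (use ae in "eventually_elim, simp")
qed

lemma lin_aff: "\<bar>c\<bar> = 1 ==> bounded_linear (aff c h)"
 by (rule bounded_linear_intro[where K = 1]) (auto simp: aff_add aff_scaleR norm_aff)

lemma aff_aff: assumes "c ~= 0" "d ~= 0" shows "aff c h (aff d k u) = aff (c * d) (k + d * h) u"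
 unfolding aff_def[of d] aff_abs[OF assms(1) sqi_aff[OF assms(2) rep_l2_sqi]] aff_def[of "c * d"]
 by (simp add: algebra_simps)

lemma aff_id [simp]: "aff 1 0 u = u"
 by (simp add: aff_def)

lemma aff_mulf: assumes "\<bar>c\<bar> = 1" "bm g C" shows "aff c h (mulf g u) = mulf (%x. g (h + c * x)) (aff c h u)"
proof -
 have c: "c ~= 0" using assms by auto
 have [measurable]: "g \<in> borel_measurable borel" using assms by (simp add: bm_def)
 have b: "bm (%x. g (h + c * x)) C" using assms by (auto simp: bm_def)
 have "AE x in lborel. rep_l2 (mulf g u) (h + c * x) = g (h + c * x) * rep_l2 u (h + c * x)"
  by (rule AE_borel_affine[OF c _ rep_mulf[OF assms(2)]]) measurable
 note ae = this rep_aff[OF c, of h "mulf g u"] rep_aff[OF c, of h u] rep_mulf[OF b, of "aff c h u"]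
 show ?thesis by (rule l2_eqI) (use ae in "eventually_elim, simp")
qed

abbreviation tr :: "real => l2 => l2" where "tr \<equiv> aff 1"
abbreviation rfl :: "l2 => l2" where "rfl \<equiv> aff (-1) 0"

lemma aff_J: "\<bar>c\<bar> = 1 ==> aff c h (J u) = J (aff c h u)"
 unfolding J_def by (simp add: aff_mulf[OF _ bm_i])

definition cj :: "l2 => l2" where "cj u = abs_l2 (%x. cnj (rep_l2 u x))"

lemma rep_cj: "AE x in lborel. rep_l2 (cj u) x = cnj (rep_l2 u x)"
 unfolding cj_def by (rule rep_abs_l2[OF sqi_cnj[OF rep_l2_sqi]])

lemma cj_add: "cj (u + v) = cj u + cj v"
 by (rule l2_eqI) (use rep_cj[of "u + v"] rep_cj[of u] rep_cj[of v] rep_add[of u v] rep_add[of "cj u" "cj v"]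
   in "eventually_elim, simp")
lemma cj_scaleR: "cj (r *\<^sub>R u) = r *\<^sub>R cj u"
 by (rule l2_eqI) (use rep_cj[of "r *\<^sub>R u"] rep_cj[of u] rep_scaleR[of r u] rep_scaleR[of r "cj u"]
   in "eventually_elim, simp")
lemma norm_cj [simp]: "norm (cj u) = norm u"
proof (rule power2_eq_imp_eq)
 show "(norm (cj u))^2 = (norm u)^2"
  unfolding cj_def norm_abs_l2[OF sqi_cnj[OF rep_l2_sqi]] by (simp add: norm_l2_sq)
qed auto
lemma lin_cj: "bounded_linear cj"
 by (rule bounded_linear_intro[where K = 1]) (auto simp: cj_add cj_scaleR)
lemma cj_cj [simp]: "cj (cj u) = u"
 by (rule l2_eqI) (use rep_cj[of "cj u"] rep_cj[of u] in "eventually_elim, simp")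
lemma cj_mulf: assumes "bm g C" shows "cj (mulf g u) = mulf (%x. cnj (g x)) (cj u)"
proof -
 have b: "bm (%x. cnj (g x)) C" using assms by (auto simp: bm_def)
 show ?thesis
 by (rule l2_eqI) (use rep_cj[of "mulf g u"] rep_cj[of u] rep_mulf[OF assms, of u] rep_mulf[OF b, of "cj u"]
   in "eventually_elim, simp")
qed

text \<open>These functionals separate the points of \<open>l2\<close>
  (\<open>I_zero_imp_zero\<close>) and express the fundamental theorem of calculus. For b < a the
  value is 0 and not minus the integral from b to a, so signed primitives need a case
  distinction.\<close>

definition I :: "real => real => l2 => complex" where
 "I a b u = (LINT x|lborel. indicator {a..b} x * rep_l2 u x)"

lemma sqi_indicator: "sqi (indicator {a..b} :: real => complex)"
 by (cases "a <= b", rule l2_bounded_support(1)[where e = 1 and a = a and b = b])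
   (auto simp: indicator_def sqi_def)

lemma norm_ind: "a <= b ==> norm (abs_l2 (indicator {a..b})) <= sqrt (b - a)"
 using l2_bounded_support(2)[of "indicator {a..b}" 1 a b] by (auto simp: indicator_def)

lemma I_integrable: "integrable lborel (%x. indicator {a..b} x * rep_l2 u x)"
 by (rule sqi_mult_integrable[OF sqi_indicator rep_l2_sqi])

lemma I_bound: assumes "a <= b" shows "cmod (I a b u) <= sqrt (b - a) * norm u"
proof -
 have "cmod (I a b u) <= (LINT x|lborel. cmod (indicator {a..b} x) * cmod (rep_l2 u x))"
  unfolding I_def norm_mult[symmetric] by (rule integral_norm_bound)
 also have "... <= norm (abs_l2 (indicator {a..b})) * norm (abs_l2 (rep_l2 u))"
  by (rule sqrt_l2_mult_le[OF sqi_indicator rep_l2_sqi])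
 also have "... <= sqrt (b - a) * norm u"
  using norm_ind[OF assms] by (simp add: mult_right_mono)
 finally show ?thesis .
qed

lemma I_cong: "sqi f ==> AE x in lborel. rep_l2 u x = f x ==> I a b u = (LINT x|lborel. indicator {a..b} x * f x)"
 unfolding I_def by (rule integral_cong_AE) (auto dest: sqi_measurable)

lemma I_add: "I a b (u + v) = I a b u + I a b v"
proof -
 have "I a b (u + v) = (LINT x|lborel. indicator {a..b} x * (rep_l2 u x + rep_l2 v x))"
  by (rule I_cong[OF sqi_add[OF rep_l2_sqi rep_l2_sqi] rep_add])
 also have "... = I a b u + I a b v"
  unfolding I_def using I_integrable by (simp add: algebra_simps)
 finally show ?thesis .
qed

lemma I_mulf_const: "I a b (mulf (%_. c) u) = c * I a b u"
proof -
 have b: "bm (%_. c) (cmod c)" by (simp add: bm_def)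
 have "I a b (mulf (%_. c) u) = (LINT x|lborel. indicator {a..b} x * (c * rep_l2 u x))"
  by (rule I_cong[OF sqi_mulf[OF b] rep_mulf[OF b]])
 also have "... = (LINT x|lborel. c * (indicator {a..b} x * rep_l2 u x))"
  by (simp add: algebra_simps)
 also have "... = c * I a b u"
  unfolding I_def using I_integrable by simp
 finally show ?thesis .
qed

lemma I_scaleR: "I a b (r *\<^sub>R u) = r *\<^sub>R I a b u"
 using I_mulf_const[of a b "of_real r" u] by (simp add: mulf_const_real scaleR_conv_of_real)

lemma lin_I: "bounded_linear (I a b)"
proof (cases "a <= b")
 case True
 thus ?thesis using I_bound[of a b]
  by (intro bounded_linear_intro[where K = "sqrt (b - a)"]) (auto simp: I_add I_scaleR mult.commute)
next
 case False
 hence "I a b = (%_. 0)" by (auto simp: I_def)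
 thus ?thesis by simp
qed

lemma I_cj: "I a b (cj u) = cnj (I a b u)"
proof -
 have "I a b (cj u) = (LINT x|lborel. indicator {a..b} x * cnj (rep_l2 u x))"
  by (rule I_cong[OF sqi_cnj[OF rep_l2_sqi] rep_cj])
 also have "... = (LINT x|lborel. cnj (indicator {a..b} x * rep_l2 u x))"
  by (auto simp: indicator_def intro!: Bint_cong)
 also have "... = cnj (I a b u)" unfolding I_def by (rule Bochner_Integration.integral_cnj)
 finally show ?thesis .
qed

lemma I_empty [simp]: "I a a u = 0"
 using I_bound[of a a u] by simp

lemma I_combine: assumes "a <= b" "b <= c" shows "I a b u + I b c u = I a c u"
proof -
 have "I a b u + I b c u = (LINT x|lborel. indicator {a..b} x * rep_l2 u x + indicator {b..c} x * rep_l2 u x)"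
  unfolding I_def using I_integrable by simp
 also have "... = I a c u" unfolding I_def
  by (rule integral_cong_AE) (use AE_lborel_singleton[of b] assms in
    \<open>auto simp: indicator_def elim!: eventually_mono\<close>)
 finally show ?thesis .
qed

lemma I_aff1: "I a b (tr h u) = I (a + h) (b + h) u"
proof -
 have "I a b (tr h u) = (LINT x|lborel. indicator {a..b} x * rep_l2 u (h + 1 * x))"
  by (rule I_cong[OF sqi_aff[OF _ rep_l2_sqi] rep_aff]) auto
 also have "... = (LINT x|lborel. indicator {a + h..b + h} (h + 1 * x) * rep_l2 u (h + 1 * x))"
  by (auto simp: indicator_def intro!: Bint_cong)
 also have "... = I (a + h) (b + h) u" unfolding I_def
  using lborel_integral_real_affine[of 1 "%x. indicator {a + h..b + h} x * rep_l2 u x" h] by simp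
 finally show ?thesis .
qed

lemma I_rfl: "I a b (rfl u) = I (- b) (- a) u"
proof -
 have "I a b (rfl u) = (LINT x|lborel. indicator {a..b} x * rep_l2 u (0 + (-1) * x))"
  by (rule I_cong[OF sqi_aff[OF _ rep_l2_sqi] rep_aff]) auto
 also have "... = (LINT x|lborel. indicator {-b..-a} (0 + (-1) * x) * rep_l2 u (0 + (-1) * x))"
  by (auto simp: indicator_def intro!: Bint_cong)
 also have "... = I (- b) (- a) u" unfolding I_def
  using lborel_integral_real_affine[of "-1" "%x. indicator {-b..-a} x * rep_l2 u x" 0] by simp
 finally show ?thesis .
qed

section \<open>Density of compactly supported continuous functions, continuity of
  translations\<close>

lemma tendsto_abs_l2_0:
 assumes s: "!!n. sqi (f n)" and g: "integrable lborel g"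
  and lim: "AE x in lborel. (%n. f n x) ----> 0"
  and bd: "!!n. AE x in lborel. (cmod (f n x))^2 <= g x"
 shows "(%n. norm (abs_l2 (f n))) ----> 0"
proof -
 note [measurable] = sqi_measurable[OF s] borel_measurable_integrable[OF g]
 have "(%n. LINT x|lborel. (cmod (f n x))^2) ----> (LINT x::real|lborel. (0::real))"
 proof (rule Bochner_Integration.integral_dominated_convergence[of "%_. 0" lborel "%n x. (cmod (f n x))^2" g])
  show "AE x in lborel. (%n. (cmod (f n x))^2) ----> 0"
   using lim
  proof eventually_elim
   fix x assume "(%n. f n x) ----> 0"
   hence "(%n. (cmod (f n x))^2) ----> (cmod 0)^2" by (intro tendsto_intros)
   thus "(%n. (cmod (f n x))^2) ----> 0" by simp
  qed
 qed (use g bd in auto)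
 hence "(%n. sqrt ((norm (abs_l2 (f n)))^2)) ----> sqrt 0"
  by (intro tendsto_real_sqrt) (simp add: norm_abs_l2[OF s])
 thus ?thesis by simp
qed

text \<open>After a cutoff in range and in size, a measurable function is an a.e. limit of
  continuous ones. Composing these with the radial retraction \<psi> onto a ball and multiplying by
  a tent function makes them bounded with common support, so that dominated convergence
  applies.\<close>

lemma Cc_dense:
 fixes u :: l2 assumes "e > 0"
 obtains f R where "continuous_on UNIV f" "R > 0" "!!x. \<bar>x\<bar> >= R ==> f x = 0" "sqi f" "norm (u - abs_l2 f) < e"
proof -
 let ?f = "rep_l2 u"
 define F where "F N x = (if \<bar>x\<bar> <= real N \<and> cmod (?f x) <= real N then ?f x else 0)" for N :: nat and x
 have [measurable]: "F N \<in> borel_measurable borel" for N unfolding F_def by measurable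
 have sF: "sqi (F N)" for N
  by (rule sqi_bound[where C = 1 and g = ?f]) (auto simp: F_def rep_l2_sqi)
 have "(%N. norm (abs_l2 (%x. ?f x - F N x))) ----> 0"
 proof (rule tendsto_abs_l2_0[OF _ sqi_integrable[OF rep_l2_sqi[of u]]])
  show "AE x in lborel. (%n. ?f x - F n x) ----> 0"
  proof (rule AE_I2)
   fix x
   obtain M :: nat where M: "max \<bar>x\<bar> (cmod (?f x)) <= real M" using real_arch_simple by blast
   show "(%n. ?f x - F n x) ----> 0"
    by (rule tendsto_eventually, rule eventually_sequentiallyI[of M]) (use M in "auto simp: F_def")
  qed
 qed (use sF in "auto simp: F_def[abs_def] intro: sqi_diff[OF rep_l2_sqi]")
 then obtain N where N: "norm (abs_l2 (%x. ?f x - F N x)) < e/2"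
  using assms by (auto dest!: order_tendstoD(2)[of _ _ _ "e/2"] simp: eventually_sequentially field_simps) blast
 have "F N \<in> borel_measurable lborel" by measurable
 hence "F N \<in> borel_measurable lebesgue" by (rule measurable_completion)
 hence "F N measurable_on UNIV"
  using lebesgue_measurable_imp_measurable_on[of "F N" UNIV] by (simp add: lebesgue_on_UNIV_eq)
 then obtain Z g where Z: "negligible Z" "!!n. continuous_on UNIV (g n)" "!!x. x \<notin> Z ==> (%n. g n x) ----> F N x"
  unfolding measurable_on_def by auto
 let ?M = "real N + 1"
 define \<psi> where "\<psi> z = (?M / max ?M (cmod z)) *\<^sub>R z" for z
 define cut where "cut x = max 0 (min 1 (?M - \<bar>x\<bar>))" for x :: real
 define h where "h n x = cut x *\<^sub>R \<psi> (g n x)" for n x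
 have c\<psi>: "continuous_on UNIV \<psi>" unfolding \<psi>_def by (intro continuous_intros) auto
 have ch: "continuous_on UNIV (h n)" for n unfolding h_def cut_def
  by (intro continuous_intros continuous_on_compose2[OF c\<psi> Z(2)]) auto
 hence [measurable]: "h n \<in> borel_measurable borel" for n by (rule borel_measurable_continuous_onI)
 have n\<psi>: "cmod (\<psi> z) <= ?M" for z
 proof -
  have "cmod z / max ?M (cmod z) <= 1" by (simp add: divide_le_eq_1 less_max_iff_disj)
  hence "?M * (cmod z / max ?M (cmod z)) <= ?M * 1" by (intro mult_left_mono) auto
  thus ?thesis by (simp add: \<psi>_def)
 qed
 have nh: "cmod (h n x) <= ?M" for n x
 proof -
  have "cut x * cmod (\<psi> (g n x)) <= 1 * ?M"
   by (rule mult_mono[OF _ n\<psi>]) (simp_all add: cut_def)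
  moreover have "cut x >= 0" by (simp add: cut_def)
  ultimately show ?thesis by (simp add: h_def)
 qed
 have hz: "h n x = 0" if "\<bar>x\<bar> >= ?M" for n x using that by (auto simp: h_def cut_def)
 have sh: "sqi (h n)" for n
  by (rule l2_bounded_support(1)[where e = ?M and a = "-?M" and b = ?M, OF _ nh]) (auto intro!: hz)
 have "(%n. norm (abs_l2 (%x. F N x - h n x))) ----> 0"
 proof (rule tendsto_abs_l2_0[where g = "%x. (2 * ?M)^2 * indicator {-?M..?M} x"])
  have "AE x in lebesgue. x \<notin> Z" using Z(1) by (simp add: AE_not_in negligible_iff_null_sets)
  hence "AE x in lborel. x \<notin> Z" by (simp add: AE_completion_iff)
  thus "AE x in lborel. (%n. F N x - h n x) ----> 0"
  proof eventually_elim
   fix x assume "x \<notin> Z"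
   hence "(%n. \<psi> (g n x)) ----> \<psi> (F N x)"
    by (intro continuous_on_tendsto_compose[OF c\<psi> Z(3)]) auto
   hence "(%n. F N x - h n x) ----> F N x - cut x *\<^sub>R \<psi> (F N x)"
    unfolding h_def by (intro tendsto_intros)
   moreover have "cut x *\<^sub>R \<psi> (F N x) = F N x"
   proof (cases "F N x = 0")
    case False
    hence "\<bar>x\<bar> <= real N" "cmod (F N x) <= real N" by (auto simp: F_def split: if_splits)
    hence "cut x = 1" "max ?M (cmod (F N x)) = ?M" by (auto simp: cut_def)
    moreover have "?M / ?M = 1" by simp
    ultimately show ?thesis unfolding \<psi>_def by simp
   qed (simp add: \<psi>_def)
   ultimately show "(%n. F N x - h n x) ----> 0" by simp
  qed
  show "AE x in lborel. (cmod (F N x - h n x))^2 <= (2 * ?M)^2 * indicator {-?M..?M} x" for n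
  proof (rule AE_I2)
   fix x
   have "cmod (F N x - h n x) <= cmod (F N x) + cmod (h n x)" by (rule norm_triangle_ineq4)
   also have "... <= 2 * ?M" using nh[of n x] by (auto simp: F_def)
   finally have "(cmod (F N x - h n x))^2 <= (2 * ?M)^2" by (intro power_mono) auto
   thus "(cmod (F N x - h n x))^2 <= (2 * ?M)^2 * indicator {-?M..?M} x"
   proof (cases "\<bar>x\<bar> <= ?M")
    case False
    hence "F N x = 0" "h n x = 0" using hz[of x n] by (auto simp: F_def)
    thus ?thesis by simp
   qed (simp add: indicator_def abs_le_iff)
  qed
 qed (auto simp: sF sh sqi_diff)
 then obtain n where n: "norm (abs_l2 (%x. F N x - h n x)) < e/2"
  using assms by (auto dest!: order_tendstoD(2)[of _ _ _ "e/2"] simp: eventually_sequentially field_simps) blast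
 have "u - abs_l2 (h n) = abs_l2 (%x. ?f x - F N x) + abs_l2 (%x. F N x - h n x)"
  by (rule l2_eqI) (use rep_diff[of u "abs_l2 (h n)"] rep_abs_l2[OF sh[of n]]
    rep_add[of "abs_l2 (%x. ?f x - F N x)" "abs_l2 (%x. F N x - h n x)"]
    rep_abs_l2[OF sqi_diff[OF rep_l2_sqi[of u] sF[of N]]] rep_abs_l2[OF sqi_diff[OF sF[of N] sh[of n]]] in
    \<open>eventually_elim, simp\<close>)
 hence "norm (u - abs_l2 (h n)) < e"
  using norm_triangle_ineq[of "abs_l2 (%x. ?f x - F N x)" "abs_l2 (%x. F N x - h n x)"] N n by simp
 thus ?thesis by (intro that[of "h n" ?M] ch sh hz) auto
qed

text \<open>Translations are isometries, so it suffices to treat a dense set of u; for continuous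
  functions of compact support the claim is uniform continuity.\<close>

lemma tr_tendsto: "((%h. tr h u) ---> u) (at 0)"
proof (rule metric_LIM_I)
 fix e :: real assume "e > 0"
 obtain f R where f: "continuous_on UNIV f" "R > 0" "!!x. \<bar>x\<bar> >= R ==> f x = 0" "sqi f" "norm (u - abs_l2 f) < e/3"
  using Cc_dense[of "e/3" u] \<open>e > 0\<close> by auto
 have "uniformly_continuous_on {-R-2..R+2} f"
  using f(1) by (intro compact_uniformly_continuous) (auto intro: continuous_on_subset)
 \<comment> \<open>For |h| < 1 the difference of f and its translate is supported in an interval of
   length 2 R + 2; a sup bound \<epsilon> therefore gives the norm bound e/4.\<close>
 define \<epsilon> where "\<epsilon> = e / (4 * sqrt (2 * R + 2))"
 have \<epsilon>: "\<epsilon> > 0" using \<open>e > 0\<close> f(2) by (simp add: \<epsilon>_def)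
 obtain d where d: "d > 0" "!!x y. x \<in> {-R-2..R+2} ==> y \<in> {-R-2..R+2} ==> dist y x < d ==> dist (f y) (f x) < \<epsilon>"
  using \<open>uniformly_continuous_on {-R-2..R+2} f\<close> \<epsilon> unfolding uniformly_continuous_on_def by metis
 have [measurable]: "f \<in> borel_measurable borel" using f(4) by (simp add: sqi_def)
 have "dist (tr h u) u < e" if h: "\<bar>h\<bar> < min d 1" for h
 proof -
  have s: "sqi (%x. f (h + 1 * x) - f x)" by (intro sqi_diff sqi_aff f(4)) auto
  have "norm (abs_l2 (%x. f (h + 1 * x) - f x)) <= \<epsilon> * sqrt ((R + 1) - (- R - 1))"
  proof (rule l2_bounded_support(2))
   show "cmod (f (h + 1 * x) - f x) <= \<epsilon>" for x
   proof (cases "\<bar>x\<bar> <= R + 1")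
    case True
    hence "x \<in> {-R-2..R+2}" "h + x \<in> {-R-2..R+2}" using h f(2) by auto
    from d(2)[OF this] show ?thesis using h by (simp add: dist_norm)
   next
    case False
    hence "f (h + x) = 0" "f x = 0" using h by (auto intro!: f(3))
    thus ?thesis using \<epsilon> by simp
   qed
   show "f (h + 1 * x) - f x = 0" if "x \<notin> {- R - 1..R + 1}" for x
   proof -
    have "f (h + x) = 0" "f x = 0" using h that by (auto intro!: f(3))
    thus ?thesis by simp
   qed
  qed (use f(2) in auto)
  also have "... = e / 4" using f(2) by (simp add: \<epsilon>_def field_simps)
  also have "abs_l2 (%x. f (h + 1 * x) - f x) = tr h (abs_l2 f) - abs_l2 f"
   unfolding aff_abs[OF one_neq_zero f(4)]
   by (rule sym, rule abs_l2_eqI[OF s]) (use rep_diff[of "abs_l2 (%x. f (h + 1 * x))" "abs_l2 f"]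
    rep_abs_l2[OF f(4)] rep_abs_l2[OF sqi_aff[OF one_neq_zero f(4), of h]] in "eventually_elim, simp")
  finally have 1: "norm (tr h (abs_l2 f) - abs_l2 f) <= e / 4" .
  have "tr h u - u = tr h (u - abs_l2 f) + (tr h (abs_l2 f) - abs_l2 f) - (u - abs_l2 f)"
   by (simp add: linear_diff[OF lin[OF lin_aff]])
  also have "norm ... <= norm (tr h (u - abs_l2 f)) + norm (tr h (abs_l2 f) - abs_l2 f) + norm (u - abs_l2 f)"
   by (meson norm_triangle_ineq4 norm_triangle_ineq add_mono order_trans order_refl)
  also have "... < e" using 1 f(5) \<open>e > 0\<close> by (simp add: norm_aff)
  finally show ?thesis by (simp add: dist_norm)
 qed
 thus "\<exists>s>0. \<forall>x. x ~= 0 \<and> dist x 0 < s --> dist (tr x u) u < e"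
  using d(1) by (intro exI[of _ "min d 1"]) auto
qed

section \<open>Weak derivatives\<close>

type_synonym cbf = "real \<Rightarrow>\<^sub>C complex"

lemma bcontfun_le: "norm (ev f x) <= norm f"
 by (rule norm_bounded)

lemma bcontfun_norm_le: "(!!x. norm (ev f x) <= c) ==> norm f <= c"
 by (rule norm_bound)

lemma bcontfun_measurable [measurable]: "ev (\<phi> :: cbf) \<in> borel_measurable borel"
 by (rule borel_measurable_continuous_onI) auto

lemma bm_bcontfun: "bm (ev \<phi>) (norm \<phi>)"
 by (simp add: bm_def bcontfun_le)

definition cmul :: "cbf => cbf => cbf" where
 "cmul f g = Bcontfun (%x. ev f x * ev g x)"
definition ccnj :: "cbf => cbf" where
 "ccnj f = Bcontfun (%x. cnj (ev f x))"
definition caff :: "real => real => cbf => cbf" where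
 "caff c h f = Bcontfun (%x. ev f (h + c * x))"

lemma apply_cmul [simp]: "ev (cmul f g) x = ev f x * ev g x"
proof -
 have "(%x. ev f x * ev g x) \<in> bcontfun"
  by (rule bcontfun_normI[where b = "norm f * norm g"])
    (auto intro!: continuous_intros mult_mono simp: norm_mult bcontfun_le)
 thus ?thesis by (simp add: cmul_def Bcontfun_inverse)
qed
lemma apply_ccnj [simp]: "ev (ccnj f) x = cnj (ev f x)"
proof -
 have "(%x. cnj (ev f x)) \<in> bcontfun"
  by (rule bcontfun_normI[where b = "norm f"]) (auto intro!: continuous_intros simp: bcontfun_le)
 thus ?thesis by (simp add: ccnj_def Bcontfun_inverse)
qed
lemma apply_caff [simp]: "ev (caff c h f) x = ev f (h + c * x)"
proof -
 have "continuous_on UNIV (%x. ev f (h + c * x))"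
  by (rule continuous_on_compose2[OF continuous_on_apply_bcontfun[of UNIV f]]) (auto intro!: continuous_intros)
 hence "(%x. ev f (h + c * x)) \<in> bcontfun"
  by (rule bcontfun_normI[where b = "norm f"]) (auto simp: bcontfun_le)
 thus ?thesis by (simp add: caff_def Bcontfun_inverse)
qed

lemma norm_cmul: "norm (cmul f g) <= norm f * norm g"
 by (rule bcontfun_norm_le) (simp add: norm_mult mult_mono bcontfun_le)

lemma bil_cmul: "bounded_bilinear cmul"
 by (rule bounded_bilinear.intro)
   (auto intro!: bcontfun_eqI exI[of _ 1] simp: algebra_simps norm_cmul)

lemma norm_ccnj [simp]: "norm (ccnj f) = norm f"
proof (rule antisym)
 show "norm (ccnj f) <= norm f" by (rule bcontfun_norm_le) (simp add: bcontfun_le)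
 show "norm f <= norm (ccnj f)" by (rule bcontfun_norm_le) (metis apply_ccnj bcontfun_le complex_mod_cnj)
qed

lemma lin_ccnj: "bounded_linear ccnj"
 by (rule bounded_linear_intro[where K = 1]) (auto intro!: bcontfun_eqI)

definition mul :: "cbf => l2 => l2" where "mul \<phi> = mulf (ev \<phi>)"

lemma rep_mul: "AE x in lborel. rep_l2 (mul \<phi> u) x = ev \<phi> x * rep_l2 u x"
 unfolding mul_def by (rule rep_mulf[OF bm_bcontfun])

lemma norm_mul: "norm (mul \<phi> u) <= norm \<phi> * norm u"
 unfolding mul_def by (rule norm_mulf[OF bm_bcontfun])

lemma mul_add_left: "mul (\<phi> + \<psi>) u = mul \<phi> u + mul \<psi> u"
 by (rule l2_eqI) (use rep_mul[of "\<phi> + \<psi>" u] rep_mul[of \<phi> u] rep_mul[of \<psi> u] rep_add[of "mul \<phi> u" "mul \<psi> u"] in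
   \<open>eventually_elim, simp add: algebra_simps\<close>)

lemma mul_scaleR_left: "mul (r *\<^sub>R \<phi>) u = r *\<^sub>R mul \<phi> u"
 by (rule l2_eqI) (use rep_mul[of "r *\<^sub>R \<phi>" u] rep_mul[of \<phi> u] rep_scaleR[of r "mul \<phi> u"] in
   \<open>eventually_elim, simp add: algebra_simps\<close>)

lemma bil_mul: "bounded_bilinear mul"
proof (rule bounded_bilinear.intro)
 show "\<exists>K. \<forall>a b. norm (mul a b) <= norm a * norm b * K" by (rule exI[of _ 1]) (simp add: norm_mul)
 show "mul a (b + b') = mul a b + mul a b'" "mul a (r *\<^sub>R b) = r *\<^sub>R mul a b" for a b b' r
  unfolding mul_def by (rule mulf_add[OF bm_bcontfun] mulf_scaleR[OF bm_bcontfun])+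
qed (simp_all add: mul_add_left mul_scaleR_left)

lemma mul_mul: "mul \<phi> (mul \<psi> u) = mul (cmul \<phi> \<psi>) u"
 unfolding mul_def mulf_mulf[OF bm_bcontfun bm_bcontfun] by (simp add: fun_eq_iff apply_cmul[abs_def])

lemma mul_commute: "mul \<phi> (mul \<psi> u) = mul \<psi> (mul \<phi> u)"
 unfolding mul_def mulf_mulf[OF bm_bcontfun bm_bcontfun] by (simp add: mult.commute)

lemma cj_mul: "cj (mul \<phi> u) = mul (ccnj \<phi>) (cj u)"
 unfolding mul_def cj_mulf[OF bm_bcontfun] by (simp add: fun_eq_iff apply_ccnj[abs_def])

lemma inner_mul: "mul \<phi> u \<bullet> v = u \<bullet> mul (ccnj \<phi>) v"
 unfolding mul_def inner_mulf[OF bm_bcontfun] by (simp add: fun_eq_iff apply_ccnj[abs_def])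

lemma J_mul: "J (mul \<phi> u) = mul \<phi> (J u)"
 unfolding mul_def J_def mulf_mulf[OF bm_bcontfun bm_i] mulf_mulf[OF bm_i bm_bcontfun] by (simp add: mult.commute)

lemma aff_mul: "\<bar>c\<bar> = 1 ==> aff c h (mul \<phi> u) = mul (caff c h \<phi>) (aff c h u)"
 unfolding mul_def by (simp add: aff_mulf[OF _ bm_bcontfun] apply_caff[abs_def])

text \<open>The derivative relation says that u lies in H^1 and has derivative w: the bounded continuous representative
 of u has increments given by integrals of w.\<close>

definition acb :: "cbf => l2 => bool" where
 "acb \<phi> w \<longleftrightarrow> (\<forall>a b. a <= b --> ev \<phi> b - ev \<phi> a = I a b w)"

definition isrep :: "cbf => l2 => bool" where
 "isrep \<phi> u \<longleftrightarrow> (AE x in lborel. rep_l2 u x = ev \<phi> x)"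

definition has_D :: "l2 => l2 => bool" where
 "has_D u w \<longleftrightarrow> (\<exists>\<phi>. isrep \<phi> u \<and> acb \<phi> w)"

lemma AE_continuous_eq:
 fixes f g :: "real => 'a::real_normed_vector"
 assumes "continuous_on S f" "continuous_on S g" "open S" and ae: "AE x in lborel. x \<in> S --> f x = g x" and "x \<in> S"
 shows "f x = g x"
proof (rule ccontr)
 assume "f x ~= g x"
 let ?A = "{x\<in>S. f x - g x \<in> - {0}}"
 have "open ?A"
  using continuous_open_preimage[OF continuous_on_diff[OF assms(1,2)] \<open>open S\<close> open_Compl[OF closed_singleton[of 0]]]
  by (simp add: vimage_def Int_def)
 moreover have "?A ~= {}" using \<open>f x ~= g x\<close> \<open>x \<in> S\<close> by auto
 ultimately have "\<not> negligible ?A" by (rule open_not_negligible)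
 moreover have "AE x in lebesgue. x \<notin> ?A" using ae by (auto simp: AE_completion_iff elim: eventually_mono)
 hence "negligible ?A"
  using \<open>open ?A\<close> by (subst negligible_iff_null_sets) (simp add: AE_iff_null_sets borel_open sets_completionI_sets)
 ultimately show False by simp
qed

lemma isrep_unique: "isrep \<phi> u ==> isrep \<psi> u ==> \<phi> = \<psi>"
 by (rule bcontfun_eqI, rule AE_continuous_eq[of UNIV]) (auto simp: isrep_def elim: AE_mp)

definition cb :: "l2 => cbf" where "cb u = (THE \<phi>. isrep \<phi> u)"

lemma isrep_cb: "isrep \<phi> u ==> cb u = \<phi>"
 unfolding cb_def by (rule the_equality) (auto intro: isrep_unique)

lemma isrep_inj: "isrep \<phi> u ==> isrep \<phi> v ==> u = v"
 unfolding isrep_def by (rule l2_eqI) (auto elim: AE_mp)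

lemma has_D_cb: assumes "has_D u w" shows "isrep (cb u) u" "acb (cb u) w"
 using assms isrep_cb unfolding has_D_def by auto

lemma isrep_add: "isrep \<phi> u ==> isrep \<psi> v ==> isrep (\<phi> + \<psi>) (u + v)"
 unfolding isrep_def using rep_add[of u v] by (auto elim: AE_mp)
lemma isrep_scaleR: "isrep \<phi> u ==> isrep (r *\<^sub>R \<phi>) (r *\<^sub>R u)"
 unfolding isrep_def using rep_scaleR[of r u] by (auto elim: AE_mp)
lemma isrep_mul: "isrep \<psi> u ==> isrep (cmul \<phi> \<psi>) (mul \<phi> u)"
 unfolding isrep_def using rep_mul[of \<phi> u] by (auto elim: AE_mp)
lemma isrep_cj: "isrep \<phi> u ==> isrep (ccnj \<phi>) (cj u)"
 unfolding isrep_def using rep_cj[of u] by (auto elim: AE_mp)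
lemma isrep_aff: assumes "isrep \<phi> u" "c ~= 0" shows "isrep (caff c h \<phi>) (aff c h u)"
proof -
 have "AE x in lborel. rep_l2 u (h + c * x) = ev \<phi> (h + c * x)"
  by (rule AE_borel_affine[OF assms(2)]) (use assms(1) in "auto simp: isrep_def")
 with rep_aff[OF assms(2), of h u] show ?thesis unfolding isrep_def by eventually_elim simp
qed
lemma isrep_zero: "isrep 0 0"
 unfolding isrep_def using rep_zero by simp

lemma mul_cb_commute: "isrep \<phi> u ==> isrep \<psi> v ==> mul \<phi> v = mul \<psi> u"
 by (rule isrep_inj[OF isrep_mul[of \<psi> v \<phi>]])
   (use isrep_mul[of \<phi> u \<psi>] in "auto simp: isrep_def mult.commute")

text \<open>An a.e. statement is turned into equations whose two sides are continuous in u and in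
  \<phi>; this makes \<open>isrep\<close> stable under limits.\<close>

lemma isrep_iff_ind:
 "isrep \<phi> u \<longleftrightarrow> (\<forall>N::nat. mulf (indicator {-real N..real N}) u = mul \<phi> (abs_l2 (indicator {-real N..real N})))"
proof -
 have b: "bm (indicator {-real N..real N}) 1" for N by (auto simp: bm_def indicator_def)
 have ae: "AE x in lborel. rep_l2 (mulf (indicator {-real N..real N}) u) x = indicator {-real N..real N} x * rep_l2 u x \<and>
   rep_l2 (mul \<phi> (abs_l2 (indicator {-real N..real N}))) x = ev \<phi> x * indicator {-real N..real N} x" for N
  using rep_mulf[OF b, of N u] rep_mul[of \<phi> "abs_l2 (indicator {-real N..real N})"] rep_abs_l2[OF sqi_indicator, of "-real N" "real N"]
  by eventually_elim simp
 show ?thesis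
 proof
  assume "isrep \<phi> u"
  thus "\<forall>N::nat. mulf (indicator {-real N..real N}) u = mul \<phi> (abs_l2 (indicator {-real N..real N}))"
  proof (intro allI l2_eqI)
   fix N
   show "AE x in lborel. rep_l2 (mulf (indicator {-real N..real N}) u) x = rep_l2 (mul \<phi> (abs_l2 (indicator {-real N..real N}))) x"
    using ae[of N] \<open>isrep \<phi> u\<close> unfolding isrep_def by eventually_elim simp
  qed
 next
  assume eq: "\<forall>N::nat. mulf (indicator {-real N..real N}) u = mul \<phi> (abs_l2 (indicator {-real N..real N}))"
  have "AE x in lborel. \<forall>N. indicator {-real N..real N} x * rep_l2 u x = ev \<phi> x * indicator {-real N..real N} x"
   unfolding AE_all_countable
  proof
   fix N show "AE x in lborel. indicator {-real N..real N} x * rep_l2 u x = ev \<phi> x * indicator {-real N..real N} x"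
    using ae[of N] by eventually_elim (use eq in auto)
  qed
  thus "isrep \<phi> u" unfolding isrep_def
  proof eventually_elim
   fix x :: real assume *: "\<forall>N. indicator {-real N..real N} x * rep_l2 u x = ev \<phi> x * indicator {-real N..real N} x"
   obtain N :: nat where "\<bar>x\<bar> <= real N" using real_arch_simple by blast
   hence "x \<in> {-real N..real N}" by auto
   with *[rule_format, of N] show "rep_l2 u x = ev \<phi> x" by simp
  qed
 qed
qed

lemma isrep_closed:
 assumes "!!n. isrep (\<phi> n) (u n)" "\<phi> ----> \<psi>" "u ----> v"
 shows "isrep \<psi> v"
 unfolding isrep_iff_ind
proof
 fix N :: nat
 let ?i = "indicator {-real N..real N} :: real => complex"
 have b: "bm ?i 1" by (auto simp: bm_def indicator_def)
 have "(%n. mulf ?i (u n)) ----> mulf ?i v"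
  by (rule bounded_linear.tendsto[OF lin_mulf[OF b] assms(3)])
 moreover have "(%n. mul (\<phi> n) (abs_l2 ?i)) ----> mul \<psi> (abs_l2 ?i)"
  by (rule bounded_bilinear.tendsto[OF bil_mul assms(2) tendsto_const])
 moreover have "mulf ?i (u n) = mul (\<phi> n) (abs_l2 ?i)" for n
  using assms(1) isrep_iff_ind by blast
 ultimately show "mulf ?i v = mul \<psi> (abs_l2 ?i)" using LIMSEQ_unique by simp
qed

text \<open>The mean of f over [x, x + l] is controlled by u, and the oscillation on that interval
  by w. The free length l matters twice: a small l absorbs the quartic term of the energy, and l to
  infinity shows that a square integrable function with derivative 0 vanishes.\<close>

lemma ac_sup_bound:
 assumes rep: "AE x in lborel. rep_l2 u x = f x" and ac: "!!a b. a <= b ==> f b - f a = I a b w" and l: "0 < l"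
 shows "cmod (f x) <= norm u / sqrt l + sqrt l * norm w"
proof -
 let ?i = "indicator {x..x + l} :: real => complex"
 have i: "complex_of_real l * f x = (LINT y|lborel. ?i y * f x)"
 proof -
  have "(LINT y|lborel. ?i y * f x) = (LINT y|lborel. indicator {x..x+l} y *\<^sub>R f x)"
   by (rule Bint_cong) (auto simp: indicator_def)
  thus ?thesis using l by (auto simp: scaleR_conv_of_real)
 qed
 have int1: "integrable lborel (%y. ?i y * f x)"
 proof -
  have "integrable lborel (%y. indicator {x..x+l} y *\<^sub>R f x)" using l by simp
  moreover have "(%y. indicator {x..x+l} y *\<^sub>R f x) = (%y. ?i y * f x)" by (auto simp: indicator_def)
  ultimately show ?thesis by simp
 qed
 have "complex_of_real l * f x - I x (x + l) u = (LINT y|lborel. ?i y * f x - ?i y * rep_l2 u y)"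
  unfolding i I_def using I_integrable int1 by simp
 also have "cmod ... <= (LINT y|lborel. indicator {x..x+l} y * (sqrt l * norm w))"
 proof (rule order_trans[OF Bochner_Integration.integral_norm_bound], rule integral_mono_AE)
  show "integrable lborel (%y. cmod (?i y * f x - ?i y * rep_l2 u y))"
   using I_integrable int1 by simp
  show "integrable lborel (%y. indicator {x..x+l} y * (sqrt l * norm w))"
   using integrable_real_indicator[of "{x..x+l}" lborel] l by simp
 next
  have *: "cmod (f x - f y) <= sqrt l * norm w" if "y \<in> {x..x+l}" for y
  proof -
   have "cmod (f y - f x) <= sqrt (y - x) * norm w" using ac[of x y] I_bound[of x y w] that by simp
   also have "... <= sqrt l * norm w" using that by (intro mult_right_mono) auto
   finally show ?thesis by (simp add: norm_minus_commute)
  qed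
  show "AE y in lborel. cmod (?i y * f x - ?i y * rep_l2 u y) <= indicator {x..x+l} y * (sqrt l * norm w)"
   using rep by eventually_elim (use * in "auto simp: indicator_def")
 qed
 also have "... = l * (sqrt l * norm w)" using l by simp
 finally have "cmod (complex_of_real l * f x - I x (x + l) u) <= l * (sqrt l * norm w)" .
 moreover have "cmod (I x (x + l) u) <= sqrt l * norm u" using I_bound[of x "x + l" u] l by simp
 ultimately have "cmod (complex_of_real l * f x) <= sqrt l * norm u + l * (sqrt l * norm w)"
  using norm_triangle_sub[of "complex_of_real l * f x" "I x (x + l) u"] by linarith
 hence "l * cmod (f x) <= sqrt l * norm u + l * (sqrt l * norm w)"
  using l by (simp add: norm_mult)
 also have "... = l * (norm u / sqrt l + sqrt l * norm w)"
  using l by (simp add: field_simps)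
 finally show ?thesis using l by simp
qed

lemma ac_continuous:
 assumes ac: "!!a b. a <= b ==> f b - f a = I a b w"
 shows "continuous_on UNIV f"
proof -
 have le: "cmod (f y - f x) <= sqrt \<bar>y - x\<bar> * norm w" for x y
 proof (cases "x <= y")
  case True thus ?thesis using ac[of x y] I_bound[of x y w] by simp
 next
  case False thus ?thesis using ac[of y x] I_bound[of y x w] by (simp add: norm_minus_commute)
 qed
 show ?thesis unfolding continuous_on_def
 proof
  fix x
  have "((%y. f y - f x) ---> 0) (at x)"
  proof (rule Lim_null_comparison[where g = "%y. sqrt \<bar>y - x\<bar> * norm w"])
   have "((%y. sqrt \<bar>y - x\<bar> * norm w) ---> sqrt \<bar>x - x\<bar> * norm w) (at x)" by (intro tendsto_intros)
   thus "((%y. sqrt \<bar>y - x\<bar> * norm w) ---> 0) (at x)" by simp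
  qed (use le in simp)
  thus "(f ---> f x) (at x)" by (simp add: LIM_zero_iff)
 qed
qed

lemma has_DI:
 assumes rep: "AE x in lborel. rep_l2 u x = f x" and ac: "!!a b. a <= b ==> f b - f a = I a b w"
 shows "has_D u w" "ev (cb u) = f"
proof -
 have c: "continuous_on UNIV f" by (rule ac_continuous[OF ac])
 have "f \<in> bcontfun"
  by (rule bcontfun_normI[OF c, where b = "norm u / sqrt 1 + sqrt 1 * norm w"]) (rule ac_sup_bound[OF rep ac], auto)
 then obtain \<phi> where \<phi>: "f = ev \<phi>" by (rule bcontfunE)
 have r: "isrep \<phi> u" using rep \<phi> by (simp add: isrep_def)
 thus "has_D u w" using ac \<phi> unfolding has_D_def acb_def by auto
 show "ev (cb u) = f" using isrep_cb[OF r] \<phi> by simp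
qed

lemma norm_cb_le: assumes "has_D u w" "0 < l" shows "norm (cb u) <= norm u / sqrt l + sqrt l * norm w"
 by (rule bcontfun_norm_le, rule ac_sup_bound) (use has_D_cb[OF assms(1)] assms(2) in "auto simp: isrep_def acb_def")

lemma norm_cb: "has_D u w ==> norm (cb u) <= norm u + norm w"
 using norm_cb_le[of u w 1] by simp

lemma acb_add: "acb \<phi> u ==> acb \<psi> v ==> acb (\<phi> + \<psi>) (u + v)"
 by (auto simp: acb_def I_add algebra_simps)
lemma acb_scaleR: "acb \<phi> u ==> acb (r *\<^sub>R \<phi>) (r *\<^sub>R u)"
 by (auto simp: acb_def I_scaleR simp flip: scaleR_diff_right)
lemma acb_cj: "acb \<phi> u ==> acb (ccnj \<phi>) (cj u)"
 by (auto simp: acb_def I_cj simp flip: complex_cnj_diff)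

lemma has_D_add: "has_D u w ==> has_D v z ==> has_D (u + v) (w + z)"
 unfolding has_D_def using isrep_add acb_add by blast
lemma has_D_scaleR: "has_D u w ==> has_D (r *\<^sub>R u) (r *\<^sub>R w)"
 unfolding has_D_def using isrep_scaleR acb_scaleR by blast
lemma has_D_uminus: "has_D u w ==> has_D (- u) (- w)"
 using has_D_scaleR[of u w "-1"] by simp
lemma has_D_diff: "has_D u w ==> has_D v z ==> has_D (u - v) (w - z)"
 using has_D_add[OF _ has_D_uminus, of u w v z] by simp
lemma has_D_cj: "has_D u w ==> has_D (cj u) (cj w)"
 unfolding has_D_def using isrep_cj acb_cj by blast
lemma has_D_zero: "has_D 0 0"
 unfolding has_D_def by (rule exI[of _ 0]) (simp add: isrep_zero acb_def bounded_linear.linear[OF lin_I, THEN linear_0])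

lemma isrep_J: "isrep \<phi> u ==> isrep (cmul (const_bcontfun \<i>) \<phi>) (J u)"
 using isrep_mul[of \<phi> u "const_bcontfun \<i>"] by (simp add: mul_def J_def const_bcontfun.rep_eq)

lemma has_D_J: assumes "has_D u w" shows "has_D (J u) (J w)"
proof -
 obtain \<phi> where "isrep \<phi> u" "acb \<phi> w" using assms by (auto simp: has_D_def)
 thus ?thesis unfolding has_D_def
  by (intro exI[of _ "cmul (const_bcontfun \<i>) \<phi>"] conjI isrep_J)
    (auto simp: acb_def J_def I_mulf_const const_bcontfun.rep_eq simp flip: right_diff_distrib)
qed

lemma has_D_tr: assumes "has_D u w" shows "has_D (tr h u) (tr h w)"
proof -
 obtain \<phi> where "isrep \<phi> u" "acb \<phi> w" using assms by (auto simp: has_D_def)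
 thus ?thesis unfolding has_D_def
  by (intro exI[of _ "caff 1 h \<phi>"] conjI isrep_aff) (auto simp: acb_def I_aff1 add.commute)
qed

lemma has_D_rfl: assumes "has_D u w" shows "has_D (rfl u) (- rfl w)"
proof -
 obtain \<phi> where \<phi>: "isrep \<phi> u" "acb \<phi> w" using assms by (auto simp: has_D_def)
 have "acb (caff (-1) 0 \<phi>) (- rfl w)" unfolding acb_def
 proof (intro allI impI)
  fix a b :: real assume "a <= b"
  hence "ev \<phi> (- a) - ev \<phi> (- b) = I (- b) (- a) w"
   using \<phi>(2) by (auto simp: acb_def)
  moreover have "I a b (- rfl w) = - I (- b) (- a) w"
   using I_scaleR[of a b "-1" "rfl w"] by (simp add: I_rfl)
  ultimately show "ev (caff (-1) 0 \<phi>) b - ev (caff (-1) 0 \<phi>) a = I a b (- rfl w)"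
   by (simp add: algebra_simps)
 qed
 moreover have "isrep (caff (-1) 0 \<phi>) (rfl u)" by (rule isrep_aff[OF \<phi>(1)]) simp
 ultimately show ?thesis unfolding has_D_def by blast
qed

lemma cb_add: "has_D u w ==> has_D v z ==> cb (u + v) = cb u + cb v"
 by (intro isrep_cb isrep_add has_D_cb)
lemma cb_scaleR: "has_D u w ==> cb (r *\<^sub>R u) = r *\<^sub>R cb u"
 by (intro isrep_cb isrep_scaleR has_D_cb)
lemma cb_diff: "has_D u w ==> has_D v z ==> cb (u - v) = cb u - cb v"
 using cb_add[of u w "-1 *\<^sub>R v" "-1 *\<^sub>R z"] cb_scaleR[of v z "-1"] has_D_scaleR[of v z "-1"] by simp
lemma cb_cj: "has_D u w ==> cb (cj u) = ccnj (cb u)"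
 by (intro isrep_cb isrep_cj has_D_cb)

section \<open>Averages over short intervals, difference quotients, closedness of the
  derivative\<close>

definition avg :: "real => l2 => l2" where
 "avg h u = abs_l2 (%x. I x (x + h) u / of_real h)"

lemma I_diff: "I a b (u - v) = I a b u - I a b v"
 by (rule linear_diff[OF lin[OF lin_I]])

lemma I_shift_diff:
 assumes "0 < h" "a <= b" shows "I b (b + h) u - I a (a + h) u = I a b (tr h u - u)"
 using I_combine[of a b "b + h" u] I_combine[of a "a + h" "b + h" u] assms
 by (simp add: I_diff I_aff1 algebra_simps)

text \<open>Up to the factor 1/h, the deviation at x is the integral of u (x + y) - \<kappa> u x
  over y in [0, h]. Cauchy-Schwarz in y and Tonelli reduce its norm to norms of translates. The
  value \<kappa> = 1 serves for convergence to u, and \<kappa> = 0 for the contraction bound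
  \<open>norm_avg\<close>.\<close>

lemma avg_core:
 assumes h: "0 < h" and e: "0 <= \<epsilon>" and le: "!!y. y \<in> {0..h} ==> norm (tr y u - \<kappa> *\<^sub>R u) <= \<epsilon>"
 shows "sqi (%x. I x (x + h) u / of_real h)" "norm (avg h u - \<kappa> *\<^sub>R u) <= \<epsilon>"
proof -
 let ?U = "rep_l2 u"
 have "continuous_on UNIV (%x. I x (x + h) u)"
  by (rule ac_continuous[where w = "tr h u - u"]) (simp add: I_shift_diff h)
 hence [measurable]: "(%x. I x (x + h) u) \<in> borel_measurable borel"
  by (rule borel_measurable_continuous_onI)
 define G where "G x y = indicator {0..h} y * (?U (x + 1 * y) - \<kappa> *\<^sub>R ?U x)" for x y
 define d where "d x = I x (x + h) u / of_real h - \<kappa> *\<^sub>R ?U x" for x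
 have [measurable]: "d \<in> borel_measurable borel" unfolding d_def by measurable
 have sG: "sqi (G x)" for x
 proof -
  have "sqi (%y. indicator {0..h} y * ?U (x + 1 * y))"
   by (rule sqi_bound[OF _ sqi_aff[OF one_neq_zero rep_l2_sqi, of u x], where C = 1]) (auto simp: indicator_def)
  moreover have "sqi (%y. (\<kappa> *\<^sub>R ?U x) * indicator {0..h} y)"
   by (rule sqi_cmult[OF sqi_indicator])
  ultimately have "sqi (%y. indicator {0..h} y * ?U (x + 1 * y) - (\<kappa> *\<^sub>R ?U x) * indicator {0..h} y)"
   by (rule sqi_diff)
  thus ?thesis unfolding G_def by (simp add: algebra_simps)
 qed
 have dG: "of_real h * d x = (LINT y|lborel. G x y)" for x
 proof -
  have "I x (x + h) u = (LINT y|lborel. indicator {x..x + h} (x + 1 * y) * ?U (x + 1 * y))"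
   unfolding I_def using lborel_integral_real_affine[of 1 "%y. indicator {x..x + h} y * ?U y" x] by simp
  also have "... = (LINT y|lborel. indicator {0..h} y * ?U (x + 1 * y))"
   by (rule Bint_cong) (auto simp: indicator_def)
  finally have 1: "I x (x + h) u = (LINT y|lborel. indicator {0..h} y * ?U (x + 1 * y))" .
  have "integrable lborel (%y. indicator {0..h} y * ?U (x + 1 * y))"
   by (rule sqi_mult_integrable[OF sqi_indicator sqi_aff[OF one_neq_zero rep_l2_sqi]])
  moreover have i2: "integrable lborel (%y. indicator {0..h} y *\<^sub>R (\<kappa> *\<^sub>R ?U x))" using h by simp
  ultimately have "(LINT y|lborel. indicator {0..h} y * ?U (x + 1 * y) - indicator {0..h} y *\<^sub>R (\<kappa> *\<^sub>R ?U x))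
    = I x (x + h) u - (LINT y|lborel. indicator {0..h} y *\<^sub>R (\<kappa> *\<^sub>R ?U x))"
   unfolding 1 by (rule Bochner_Integration.integral_diff)
  also have "... = I x (x + h) u - h *\<^sub>R \<kappa> *\<^sub>R ?U x" using h by simp
  also have "... = of_real h * d x" using h by (simp add: d_def field_simps scaleR_conv_of_real)
  also have "(%y. indicator {0..h} y * ?U (x + 1 * y) - indicator {0..h} y *\<^sub>R (\<kappa> *\<^sub>R ?U x)) = G x"
   by (auto simp: G_def indicator_def)
  finally show ?thesis by simp
 qed
 have dle: "(cmod (d x))^2 <= (LINT y|lborel. (cmod (G x y))^2) / h" for x
 proof -
  have "h * cmod (d x) = cmod (LINT y|lborel. G x y)" using dG[of x] h by (metis abs_of_pos norm_mult norm_of_real)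
  also have "... <= (LINT y|lborel. cmod (indicator {0..h} y) * cmod (G x y))"
   by (rule order_trans[OF Bochner_Integration.integral_norm_bound], rule eq_refl)
     (auto simp: G_def indicator_def intro!: Bint_cong)
  also have "... <= norm (abs_l2 (indicator {0..h})) * norm (abs_l2 (G x))"
   by (rule sqrt_l2_mult_le[OF sqi_indicator sG])
  also have "... <= sqrt h * norm (abs_l2 (G x))"
   using norm_ind[of 0 h] h by (intro mult_right_mono) auto
  finally have "(h * cmod (d x))^2 <= (sqrt h * norm (abs_l2 (G x)))^2" using h by (intro power_mono) auto
  hence "h * (h * (cmod (d x))^2) <= h * (LINT y|lborel. (cmod (G x y))^2)"
   using h unfolding power_mult_distrib norm_abs_l2[OF sG] by (simp add: power2_eq_square[of h])
  thus ?thesis using h by (simp add: field_simps)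
 qed
 have "(\<integral>\<^sup>+x. ennreal ((cmod (d x))^2) \<partial>lborel) <= (\<integral>\<^sup>+x. ennreal (1/h) * (\<integral>\<^sup>+y. ennreal ((cmod (G x y))^2) \<partial>lborel) \<partial>lborel)"
 proof (rule nn_integral_mono)
  fix x
  have "ennreal ((cmod (d x))^2) <= ennreal ((1/h) * (LINT y|lborel. (cmod (G x y))^2))"
   using dle[of x] by (intro ennreal_leI) simp
  also have "... = ennreal (1/h) * ennreal (LINT y|lborel. (cmod (G x y))^2)"
   using h by (intro ennreal_mult) (auto intro: integral_nonneg_AE)
  also have "ennreal (LINT y|lborel. (cmod (G x y))^2) = (\<integral>\<^sup>+y. ennreal ((cmod (G x y))^2) \<partial>lborel)"
   by (rule nn_integral_eq_integral[symmetric, OF sqi_integrable[OF sG]]) auto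
  finally show "ennreal ((cmod (d x))^2) <= ennreal (1/h) * (\<integral>\<^sup>+y. ennreal ((cmod (G x y))^2) \<partial>lborel)" .
 qed
 also have "... = ennreal (1/h) * (\<integral>\<^sup>+x. (\<integral>\<^sup>+y. ennreal ((cmod (G x y))^2) \<partial>lborel) \<partial>lborel)"
  unfolding G_def by (rule nn_integral_cmult) measurable
 also have "(\<integral>\<^sup>+x. (\<integral>\<^sup>+y. ennreal ((cmod (G x y))^2) \<partial>lborel) \<partial>lborel) = (\<integral>\<^sup>+y. (\<integral>\<^sup>+x. ennreal ((cmod (G x y))^2) \<partial>lborel) \<partial>lborel)"
  unfolding G_def by (rule lborel_pair.Fubini') measurable
 also have "... <= (\<integral>\<^sup>+y. ennreal (\<epsilon>^2) * indicator {0..h} y \<partial>lborel)"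
 proof (rule nn_integral_mono)
  fix y :: real
  show "(\<integral>\<^sup>+x. ennreal ((cmod (G x y))^2) \<partial>lborel) <= ennreal (\<epsilon>^2) * indicator {0..h} y"
  proof (cases "y \<in> {0..h}")
   case True
   have "(\<integral>\<^sup>+x. ennreal ((cmod (G x y))^2) \<partial>lborel) = (\<integral>\<^sup>+x. ennreal ((cmod (rep_l2 (tr y u - \<kappa> *\<^sub>R u) x))^2) \<partial>lborel)"
    by (rule nn_integral_cong_AE) (use rep_diff[of "tr y u" "\<kappa> *\<^sub>R u"] rep_scaleR[of \<kappa> u] rep_aff[OF one_neq_zero, of y u] in
      \<open>eventually_elim, insert True, simp add: G_def add.commute\<close>)
   also have "... <= ennreal (\<epsilon>^2)" unfolding nn_norm_l2 using le[OF True] by (intro ennreal_leI power_mono) auto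
   finally show ?thesis using True by simp
  qed (simp add: G_def)
 qed
 also have "(\<integral>\<^sup>+y. ennreal (\<epsilon>^2) * indicator {0..h} y \<partial>lborel) = ennreal (\<epsilon>^2) * ennreal h"
  using h by (simp add: nn_integral_cmult_indicator)
 also have "ennreal (1/h) * (ennreal (\<epsilon>^2) * ennreal h) = ennreal (\<epsilon>^2)"
  using h by (simp flip: ennreal_mult)
 finally have fin: "(\<integral>\<^sup>+x. ennreal ((cmod (d x))^2) \<partial>lborel) <= ennreal (\<epsilon>^2)"
  by (simp add: mult_left_mono)
 have sd: "sqi d" and nd: "norm (abs_l2 d) <= \<epsilon>"
  using norm_l2_le_nn[OF _ e fin] by auto
 show s: "sqi (%x. I x (x + h) u / of_real h)"
  using sqi_add[OF sd sqi_scaleR[OF rep_l2_sqi[of u], of \<kappa>]] by (simp add: d_def)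
 have "avg h u - \<kappa> *\<^sub>R u = abs_l2 d"
  by (rule abs_l2_eqI[OF sd]) (use rep_diff[of "avg h u" "\<kappa> *\<^sub>R u"] rep_scaleR[of \<kappa> u] rep_abs_l2[OF s] in
    \<open>eventually_elim, simp add: d_def avg_def\<close>)
 with nd show "norm (avg h u - \<kappa> *\<^sub>R u) <= \<epsilon>" by simp
qed

lemma norm_avg: "0 < h ==> norm (avg h u) <= norm u"
 using avg_core(2)[of h "norm u" u 0] by (simp add: norm_aff)

lemma rep_avg: "0 < h ==> AE x in lborel. rep_l2 (avg h u) x = I x (x + h) u / of_real h"
 unfolding avg_def by (rule rep_abs_l2[OF avg_core(1)[where \<kappa> = 0 and \<epsilon> = "norm u"]]) (auto simp: norm_aff)

lemma avg_diff: assumes "0 < h" shows "avg h (u - v) = avg h u - avg h v"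
 by (rule l2_eqI) (use rep_avg[OF assms, of "u - v"] rep_avg[OF assms, of u] rep_avg[OF assms, of v]
   rep_diff[of "avg h u" "avg h v"] in "eventually_elim, simp add: I_diff diff_divide_distrib")

lemma avg_tendsto: "((%h. avg h u) ---> u) (at_right 0)"
proof (rule tendstoI)
 fix e :: real assume "e > 0"
 then obtain d where d: "d > 0" "!!h. h ~= 0 ==> \<bar>h\<bar> < d ==> norm (tr h u - u) < e / 2"
  using LIM_D[OF tr_tendsto[of u], of "e/2"] by auto
 have "dist (avg h u) u < e" if "0 < h" "h < d" for h
 proof -
  have "norm (tr y u - 1 *\<^sub>R u) <= e/2" if "y \<in> {0..h}" for y
   using d(2)[of y] that \<open>h < d\<close> \<open>e > 0\<close> by (cases "y = 0") auto
  from avg_core(2)[OF \<open>0 < h\<close> _ this] show ?thesis using \<open>e > 0\<close> by (simp add: dist_norm)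
 qed
 thus "\<forall>\<^sub>F h in at_right 0. dist (avg h u) u < e"
  using d(1) by (auto simp: eventually_at_right_field)
qed

lemma has_D_avg: assumes "0 < h" shows "has_D (avg h u) ((tr h u - u) /\<^sub>R h)"
proof (rule has_DI(1)[OF rep_avg[OF assms]])
 fix a b :: real assume "a <= b"
 thus "I b (b + h) u / complex_of_real h - I a (a + h) u / complex_of_real h = I a b ((tr h u - u) /\<^sub>R h)"
  unfolding diff_divide_distrib[symmetric] I_shift_diff[OF assms \<open>a <= b\<close>] I_scaleR
  by (simp add: scaleR_conv_of_real divide_inverse)
qed

text \<open>All averages of u are 0, yet they converge to u.\<close>

lemma I_zero_imp_zero: assumes "!!a b. a <= b ==> I a b u = 0" shows "u = 0"
proof -
 have "avg h u = 0" if "0 < h" for h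
  by (rule l2_eqI) (use rep_avg[OF that, of u] rep_zero assms that in "auto elim: AE_mp")
 hence "((%h. avg h u) ---> 0) (at_right 0)"
  by (intro tendsto_eventually) (auto simp: eventually_at_right_field intro: exI[of _ 1])
 with avg_tendsto[of u] show ?thesis by (rule tendsto_unique[rotated]) simp
qed

lemma acb_unique: "acb \<phi> w ==> acb \<phi> z ==> w = z"
 using I_zero_imp_zero[of "w - z"] by (auto simp: acb_def I_diff)

lemma has_D_unique: "has_D u w ==> has_D u z ==> w = z"
 using acb_unique isrep_unique unfolding has_D_def by blast

definition D :: "l2 => l2" where "D u = (THE w. has_D u w)"

lemma D_eq: "has_D u w ==> D u = w"
 unfolding D_def by (rule the_equality) (auto intro: has_D_unique)

text \<open>The bridge between the integrated notion \<open>has_D\<close> and the translation group: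
  whatever is continuous and commutes with translations, such as U t, preserves derivatives.\<close>

lemma tr_diff_avg: assumes "has_D u w" "0 < h" shows "(tr h u - u) /\<^sub>R h = avg h w"
proof (rule l2_eqI)
 have r: "isrep (cb u) u" and a: "acb (cb u) w" by (rule has_D_cb[OF assms(1)])+
 have "isrep (caff 1 h (cb u)) (tr h u)" by (rule isrep_aff[OF r]) simp
 thus "AE x in lborel. rep_l2 ((tr h u - u) /\<^sub>R h) x = rep_l2 (avg h w) x"
  using r rep_avg[OF assms(2), of w] rep_scaleR[of "inverse h" "tr h u - u"] rep_diff[of "tr h u" u]
  unfolding isrep_def
 proof eventually_elim
  fix x assume *: "rep_l2 (tr h u) x = ev (caff 1 h (cb u)) x" "rep_l2 u x = ev (cb u) x"
   "rep_l2 (avg h w) x = I x (x + h) w / complex_of_real h"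
   "rep_l2 ((tr h u - u) /\<^sub>R h) x = rep_l2 (tr h u - u) x /\<^sub>R h" "rep_l2 (tr h u - u) x = rep_l2 (tr h u) x - rep_l2 u x"
  have "ev (cb u) (x + h) - ev (cb u) x = I x (x + h) w"
   using a assms(2) by (simp add: acb_def)
  thus "rep_l2 ((tr h u - u) /\<^sub>R h) x = rep_l2 (avg h w) x"
   using * by (simp add: add.commute scaleR_conv_of_real divide_inverse)
 qed
qed

lemma has_D_avg': "has_D u w ==> 0 < h ==> has_D (avg h u) (avg h w)"
 using has_D_avg[of h u] tr_diff_avg[of u w h] by simp

text \<open>By \<open>norm_cb\<close> the continuous representatives form a Cauchy sequence in the
  sup norm, and their uniform limit represents v.\<close>

lemma has_D_closed:
 assumes d: "!!n. has_D (u n) (w n)" and u: "u ----> v" and w: "w ----> z"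
 shows "has_D v z" "(%n. cb (u n)) ----> cb v"
proof -
 have "Cauchy (%n. cb (u n))"
 proof (rule CauchyI)
  fix e :: real assume "e > 0"
  obtain M where M: "!!m n. m >= M ==> n >= M ==> norm (u m - u n) < e/2"
   using CauchyD[OF LIMSEQ_imp_Cauchy[OF u], of "e/2"] \<open>e > 0\<close> by auto
  obtain N where N: "!!m n. m >= N ==> n >= N ==> norm (w m - w n) < e/2"
   using CauchyD[OF LIMSEQ_imp_Cauchy[OF w], of "e/2"] \<open>e > 0\<close> by auto
  show "\<exists>M. \<forall>m\<ge>M. \<forall>n\<ge>M. norm (cb (u m) - cb (u n)) < e"
  proof (intro exI[of _ "max M N"] allI impI)
   fix m n assume "max M N <= m" "max M N <= n"
   thus "norm (cb (u m) - cb (u n)) < e"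
    using norm_cb[OF has_D_diff[OF d d], of m n] M[of m n] N[of m n] by (simp add: cb_diff[OF d d])
  qed
 qed
 then obtain \<psi> where \<psi>: "(%n. cb (u n)) ----> \<psi>" by (auto simp: Cauchy_convergent_iff convergent_def)
 have r: "isrep \<psi> v" by (rule isrep_closed[OF _ \<psi> u]) (rule has_D_cb[OF d])
 have pt: "(%n. ev (cb (u n)) x) ----> ev \<psi> x" for x
  using tendsto_bcontfun_uniform_limit[OF \<psi>] by (rule tendsto_uniform_limitI) simp
 have "acb \<psi> z" unfolding acb_def
 proof (intro allI impI)
  fix a b :: real assume "a <= b"
  hence "ev (cb (u n)) b - ev (cb (u n)) a = I a b (w n)" for n
   using has_D_cb(2)[OF d] by (simp add: acb_def)
  moreover have "(%n. I a b (w n)) ----> I a b z" by (rule bounded_linear.tendsto[OF lin_I w])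
  ultimately show "ev \<psi> b - ev \<psi> a = I a b z"
   using LIMSEQ_unique[OF tendsto_diff[OF pt pt]] by simp
 qed
 with r show "has_D v z" by (auto simp: has_D_def)
 show "(%n. cb (u n)) ----> cb v" using \<psi> isrep_cb[OF r] by simp
qed

section \<open>Integration by parts and the product rule\<close>

lemma I_signed_continuous: "continuous_on UNIV (%x. if x < a then - I x a u else I a x u)"
proof (rule ac_continuous[where w = u])
 fix c d :: real assume "c <= d"
 thus "(if d < a then - I d a u else I a d u) - (if c < a then - I c a u else I a c u) = I c d u"
  using I_combine[of c d a u] I_combine[of c a d u] I_combine[of a c d u]
  by (cases "d < a"; cases "c < a") (simp_all add: algebra_simps)
qed

text \<open>Fubini: the product of the two integrals is an integral over the square, which the
  diagonal splits into two triangles. The hypotheses concern [a, b] only, because functions on a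
  half line and frames with a defect satisfy them only there.\<close>

lemma ibp:
 assumes ab: "a <= b" and f: "!!x. x \<in> {a..b} ==> f x = f a + I a x w" and g: "!!x. x \<in> {a..b} ==> g x = g a + I a x k"
 shows "f b * g b - f a * g a = (LINT x|lborel. indicator {a..b} x * (f x * rep_l2 k x + g x * rep_l2 w x))"
proof -
 let ?i = "indicator {a..b} :: real => complex"
 let ?W = "%x. ?i x * rep_l2 w x" and ?K = "%x. ?i x * rep_l2 k x"
 note iW = I_integrable[of a b w] and iK = I_integrable[of a b k]
 have P: "integrable (lborel \<Otimes>\<^sub>M lborel) (%(x, y). ?W x * ?K y)"
 proof (rule lborel_pair.Fubini_integrable)
  show "(%(x, y). ?W x * ?K y) \<in> borel_measurable (lborel \<Otimes>\<^sub>M lborel)" by measurable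
  show "integrable lborel (%x. LINT y|lborel. cmod (case (x, y) of (x, y) => ?W x * ?K y))"
   using integrable_norm[OF iW] by (simp add: norm_mult)
  show "AE x in lborel. integrable lborel (%y. case (x, y) of (x, y) => ?W x * ?K y)" using iK by simp
 qed
 let ?t = "%x y. if y <= x then ?W x * ?K y else 0" and ?s = "%x y. if x < y then ?W x * ?K y else 0"
 have Pt: "integrable (lborel \<Otimes>\<^sub>M lborel) (%(x, y). ?t x y)" and Ps: "integrable (lborel \<Otimes>\<^sub>M lborel) (%(x, y). ?s x y)"
  by (rule Bint_bound[OF P], measurable, auto)+
 have 1: "I a b w * I a b k = (LINT x|lborel. LINT y|lborel. ?W x * ?K y)"
  unfolding I_def using iK iW by simp
 also have "... = (\<integral>z. (case z of (x, y) => ?W x * ?K y) \<partial>(lborel \<Otimes>\<^sub>M lborel))"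
  using lborel_pair.integral_fst'[OF P] by simp
 also have "... = (\<integral>z. (case z of (x, y) => ?t x y) + (case z of (x, y) => ?s x y) \<partial>(lborel \<Otimes>\<^sub>M lborel))"
  by (rule Bint_cong) auto
 also have "... = (\<integral>z. (case z of (x, y) => ?t x y) \<partial>(lborel \<Otimes>\<^sub>M lborel)) + (\<integral>z. (case z of (x, y) => ?s x y) \<partial>(lborel \<Otimes>\<^sub>M lborel))"
  by (rule Bochner_Integration.integral_add[OF Pt Ps])
 also have "(\<integral>z. (case z of (x, y) => ?t x y) \<partial>(lborel \<Otimes>\<^sub>M lborel)) = (LINT x|lborel. LINT y|lborel. ?t x y)"
  using lborel_pair.integral_fst'[OF Pt] by simp
 also have "... = (LINT x|lborel. ?W x * I a x k)"
 proof (rule Bint_cong[OF refl])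
  fix x
  show "(LINT y|lborel. ?t x y) = ?W x * I a x k"
  proof (cases "x \<in> {a..b}")
   case True
   have "(LINT y|lborel. ?t x y) = (LINT y|lborel. ?W x * (indicator {a..x} y * rep_l2 k y))"
    by (rule Bint_cong) (use True in "auto simp: indicator_def")
   thus ?thesis unfolding I_def using I_integrable[of a x k] by simp
  next
   case False
   hence i0: "?i x = 0" by (rule indicator_simps(2))
   show ?thesis unfolding i0 by (simp cong: if_cong)
  qed
 qed
 also have "(\<integral>z. (case z of (x, y) => ?s x y) \<partial>(lborel \<Otimes>\<^sub>M lborel)) = (LINT y|lborel. LINT x|lborel. ?s x y)"
  using lborel_pair.integral_snd[OF Ps] by simp
 also have "... = (LINT y|lborel. ?K y * I a y w)"
 proof (rule Bint_cong[OF refl])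
  fix y
  show "(LINT x|lborel. ?s x y) = ?K y * I a y w"
  proof (cases "y \<in> {a..b}")
   case True
   have "(LINT x|lborel. ?s x y) = (LINT x|lborel. ?K y * (indicator {a..y} x * rep_l2 w x))"
    by (rule integral_cong_AE) (use True AE_lborel_singleton[of y] in "auto simp: indicator_def elim!: eventually_mono")
   thus ?thesis unfolding I_def using I_integrable[of a y w] by simp
  next
   case False
   hence i0: "?i y = 0" by (rule indicator_simps(2))
   show ?thesis unfolding i0 by (simp cong: if_cong)
  qed
 qed
 finally have eq: "I a b w * I a b k = (LINT x|lborel. ?W x * I a x k) + (LINT x|lborel. ?K x * I a x w)" .
 have aux: "integrable lborel (%x. (?i x * rep_l2 z x) * I a x k)" for z k
 proof -
  have c: "continuous_on {a..b} (%x. I a x k)"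
   by (rule continuous_on_eq[OF continuous_on_subset[OF I_signed_continuous[of a k]]]) auto
  have [measurable]: "(%x. ?i x * I a x k) \<in> borel_measurable borel"
  proof -
   have "(%x. indicator {a..b} x *\<^sub>R I a x k) \<in> borel_measurable borel"
    by (rule borel_measurable_continuous_on_indicator[OF _ c]) simp
   moreover have "(%x. indicator {a..b} x *\<^sub>R I a x k) = (%x. ?i x * I a x k)" by (auto simp: indicator_def)
   ultimately show ?thesis by simp
  qed
  have "integrable lborel (%x. (?i x * I a x k) * (?i x * rep_l2 z x))"
  proof (rule Bint_bound[of _ "%x. (sqrt (b - a) * norm k) *\<^sub>R (?i x * rep_l2 z x)"])
   show "integrable lborel (%x. (sqrt (b - a) * norm k) *\<^sub>R (?i x * rep_l2 z x))" using I_integrable by simp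
   show "AE x in lborel. norm ((?i x * I a x k) * (?i x * rep_l2 z x)) <= norm ((sqrt (b - a) * norm k) *\<^sub>R (?i x * rep_l2 z x))"
   proof (rule AE_I2)
    fix x
    have "cmod (?i x * I a x k) <= sqrt (b - a) * norm k"
    proof (cases "x \<in> {a..b}")
     case True
     hence "cmod (I a x k) <= sqrt (x - a) * norm k" by (intro I_bound) auto
     also have "... <= sqrt (b - a) * norm k" using True by (intro mult_right_mono) auto
     finally show ?thesis using True by simp
    qed (use ab in simp)
    thus "norm ((?i x * I a x k) * (?i x * rep_l2 z x)) <= norm ((sqrt (b - a) * norm k) *\<^sub>R (?i x * rep_l2 z x))"
     unfolding norm_mult[of "?i x * I a x k"] norm_scaleR using ab by (intro mult_right_mono) auto
   qed
  qed measurable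
  moreover have "(%x. (?i x * I a x k) * (?i x * rep_l2 z x)) = (%x. (?i x * rep_l2 z x) * I a x k)" by (auto simp: indicator_def)
  ultimately show ?thesis by simp
 qed
 have "(LINT x|lborel. ?i x * (f x * rep_l2 k x + g x * rep_l2 w x)) =
   (LINT x|lborel. f a * ?K x + ?K x * I a x w + (g a * ?W x + ?W x * I a x k))"
 proof (rule Bint_cong[OF refl])
  fix x
  show "?i x * (f x * rep_l2 k x + g x * rep_l2 w x) = f a * ?K x + ?K x * I a x w + (g a * ?W x + ?W x * I a x k)"
  proof (cases "x \<in> {a..b}")
   case True
   thus ?thesis unfolding f[OF True] g[OF True] by (simp add: algebra_simps)
  qed simp
 qed
 also have "... = f a * I a b k + (LINT x|lborel. ?K x * I a x w) + (g a * I a b w + (LINT x|lborel. ?W x * I a x k))"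
 proof -
  have "I a b k = (LINT x|lborel. ?K x)" "I a b w = (LINT x|lborel. ?W x)" by (simp_all add: I_def)
  thus ?thesis using iW iK aux by simp
 qed
 also have "... = f b * g b - f a * g a"
 proof -
  have "b \<in> {a..b}" using ab by simp
  show ?thesis unfolding f[OF \<open>b \<in> {a..b}\<close>] g[OF \<open>b \<in> {a..b}\<close>] using eq by (simp add: algebra_simps)
 qed
 finally show ?thesis by simp
qed

lemma I_mul: "I a b (mul \<phi> u) = (LINT x|lborel. indicator {a..b} x * (ev \<phi> x * rep_l2 u x))"
 by (rule I_cong[OF sqi_mulf[OF bm_bcontfun, of \<phi> u] rep_mul])

lemma acb_cmul:
 assumes "acb \<phi> g" "acb \<psi> w" shows "acb (cmul \<phi> \<psi>) (mul \<phi> w + mul \<psi> g)"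
 unfolding acb_def
proof (intro allI impI)
 fix a b :: real assume ab: "a <= b"
 have "ev \<phi> b * ev \<psi> b - ev \<phi> a * ev \<psi> a =
   (LINT x|lborel. indicator {a..b} x * (ev \<phi> x * rep_l2 w x + ev \<psi> x * rep_l2 g x))"
  by (rule ibp[OF ab]) (use assms in "auto simp: acb_def algebra_simps")
 also have "... = (LINT x|lborel. indicator {a..b} x * (ev \<phi> x * rep_l2 w x) + indicator {a..b} x * (ev \<psi> x * rep_l2 g x))"
  by (simp add: algebra_simps)
 also have "... = I a b (mul \<phi> w) + I a b (mul \<psi> g)"
  unfolding I_mul
  by (rule Bochner_Integration.integral_add)
    (rule sqi_mult_integrable[OF sqi_indicator sqi_mulf[OF bm_bcontfun]])+
 finally show "ev (cmul \<phi> \<psi>) b - ev (cmul \<phi> \<psi>) a = I a b (mul \<phi> w + mul \<psi> g)"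
  by (simp add: I_add)
qed

text \<open>The factor \<phi> need only be bounded with derivative in L^2. This is essential for the
  components of the frame, which do not decay.\<close>

lemma has_D_mul:
 assumes "acb \<phi> g" "has_D u w" shows "has_D (mul \<phi> u) (mul \<phi> w + mul (cb u) g)"
 unfolding has_D_def
 by (intro exI[of _ "cmul \<phi> (cb u)"] conjI isrep_mul acb_cmul assms(1) has_D_cb[OF assms(2)])

section \<open>Gronwall's inequality and Picard iteration in Banach spaces\<close>

lemma integral_in_subspace:
 fixes f :: "real => 'a::real_normed_vector"
 assumes S: "closed S" "subspace S" and f: "f integrable_on {a..b}" "!!x. x \<in> {a..b} ==> f x \<in> S"
 shows "integral {a..b} f \<in> S"
proof -
 have "(f has_integral integral {a..b} f) (cbox a b)" using f(1) by (simp add: integrable_integral)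
 note hi = this[unfolded has_integral]
 have "integral {a..b} f \<in> closure S"
  unfolding closure_approachable
 proof (intro allI impI)
  fix e :: real assume "e > 0"
  then obtain \<gamma> where \<gamma>: "gauge \<gamma>" "!!P. P tagged_division_of cbox a b ==> \<gamma> fine P ==>
    norm ((\<Sum>(x, k)\<in>P. measure lborel k *\<^sub>R f x) - integral {a..b} f) < e" using hi by meson
  obtain P where P: "P tagged_division_of cbox a b" "\<gamma> fine P" using fine_division_exists[OF \<gamma>(1)] by blast
  have "(\<Sum>(x, k)\<in>P. measure lborel k *\<^sub>R f x) \<in> S"
   by (rule subspace_sum[OF S(2)]) (use tag_in_interval[OF P(1)] f(2) in "auto intro!: subspace_scale[OF S(2)]")
  thus "\<exists>y\<in>S. dist y (integral {a..b} f) < e" using \<gamma>(2)[OF P] by (auto simp: dist_norm)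
 qed
 thus ?thesis using S(1) by (simp add: closure_closed)
qed

lemma vector_derivative_within_Ici:
 assumes "!!T. 0 < T ==> (y hvd y') (at t within {0..t + T})" "0 <= t"
 shows "(y hvd y') (at0 t)"
proof -
 have "at0 t = at t within {0..t + 1}"
  by (rule at_within_nhd[of _ "{..<t + 1}"]) auto
 thus ?thesis using assms(1)[of 1] by simp
qed

lemma integral_has_vector_derivative_Ici:
 fixes g :: "real => 'a::banach"
 assumes "cont0 g" "0 <= t"
 shows "((%t. x0 + integral {0..t} g) hvd g t) (at0 t)"
proof (rule vector_derivative_within_Ici[OF _ assms(2)])
 fix T :: real assume "0 < T"
 have "continuous_on {0..t+T} g" using assms(1) by (rule continuous_on_subset) auto
 from integral_has_vector_derivative[OF this, of t]
 show "((%t. x0 + integral {0..t} g) hvd g t) (at t within {0..t + T})"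
  using \<open>0 < T\<close> assms(2) by (auto intro!: derivative_eq_intros)
qed

lemma FTC_Ici:
 fixes y :: "real => 'a::banach"
 assumes "!!t. 0 <= t ==> (y hvd y' t) (at0 t)" "0 <= a" "a <= b"
 shows "(y' has_integral y b - y a) {a..b}"
 by (rule fundamental_theorem_of_calculus[OF assms(3)])
   (use assms(2) in "auto intro!: has_vector_derivative_within_subset[OF assms(1)]")

lemma gronwall_integral:
 fixes f :: "real => real"
 assumes c: "continuous_on {0..T} f" and C: "0 <= C"
  and le: "!!t. t \<in> {0..T} ==> f t <= a + C * integral {0..t} f" and t: "t \<in> {0..T}"
 shows "f t <= a * exp (C * t)"
proof -
 define v where "v t = a + C * integral {0..t} f" for t
 define g where "g t = v t * exp (- C * t)" for t
 have dv: "(v has_real_derivative C * f s) (at s within {0..T})" if "s \<in> {0..T}" for s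
  unfolding v_def using integral_has_vector_derivative[OF c that]
  by (auto intro!: derivative_eq_intros simp: hrd_iff[symmetric])
 have dg: "(g has_real_derivative (C * f s - C * v s) * exp (- C * s)) (at s within {0..T})" if "s \<in> {0..T}" for s
  unfolding g_def using dv[OF that] by (auto intro!: derivative_eq_intros simp: algebra_simps)
 have "g t <= g 0"
 proof (cases "t = 0")
  case False
  hence "0 < t" using t by simp
  have "\<exists>\<xi>\<in>{0<..<t}. g t - g 0 = (C * f \<xi> - C * v \<xi>) * exp (- C * \<xi>) * (t - 0)"
  proof (rule mvt_simple[OF \<open>0 < t\<close>, where f' = "%s h. (C * f s - C * v s) * exp (- C * s) * h"])
   fix x assume "0 <= x" "x <= t"
   hence "(g has_real_derivative (C * f x - C * v x) * exp (- C * x)) (at x within {0..t})"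
    using dg[of x] t by (auto intro: DERIV_subset)
   thus "(g has_derivative (%h. (C * f x - C * v x) * exp (- C * x) * h)) (at x within {0..t})"
    by (simp add: has_field_derivative_def)
  qed
  then obtain \<xi> where \<xi>: "\<xi> \<in> {0<..<t}" "g t - g 0 = (C * f \<xi> - C * v \<xi>) * exp (- C * \<xi>) * (t - 0)" by blast
  have "f \<xi> <= v \<xi>" using le[of \<xi>] \<xi>(1) t by (auto simp: v_def)
  hence "C * f \<xi> - C * v \<xi> <= 0" using C by (simp add: mult_left_mono)
  hence "(C * f \<xi> - C * v \<xi>) * (exp (- C * \<xi>) * (t - 0)) <= 0" using \<open>0 < t\<close> by (intro mult_nonpos_nonneg) auto
  thus ?thesis using \<xi>(2) by (simp add: mult.assoc)
 qed simp
 hence "v t * exp (- C * t) <= a" by (simp add: g_def v_def)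
 hence "v t <= a * exp (C * t)" by (simp add: exp_minus field_simps)
 thus ?thesis using le[OF t] by (simp add: v_def)
qed

lemma gronwall:
 fixes y :: "real => 'a::banach"
 assumes d: "!!t. t \<in> {0..T} ==> (y hvd y' t) (at t within {0..T})" and C: "0 <= C"
  and le: "!!t. t \<in> {0..T} ==> norm (y' t) <= C * norm (y t)" and t: "t \<in> {0..T}"
 shows "norm (y t) <= norm (y 0) * exp (C * t)"
proof (rule gronwall_integral[OF _ C _ t])
 have cy: "continuous_on {0..T} y"
  using d by (rule continuous_on_vector_derivative)
 thus "continuous_on {0..T} (%t. norm (y t))" by (intro continuous_intros)
 fix t assume t: "t \<in> {0..T}"
 have ftc: "(y' has_integral y t - y 0) {0..t}"
  by (rule fundamental_theorem_of_calculus) (use t in "auto intro!: has_vector_derivative_within_subset[OF d]")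
 have "norm (integral {0..t} y') <= integral {0..t} (%s. C * norm (y s))"
 proof (rule Henstock_Kurzweil_Integration.integral_norm_bound_integral)
  show "y' integrable_on {0..t}" using ftc by blast
  have "continuous_on {0..t} y" using cy t by (auto intro: continuous_on_subset)
  thus "(%s. C * norm (y s)) integrable_on {0..t}"
   by (intro integrable_continuous_real continuous_intros)
 qed (use le t in auto)
 moreover have "integral {0..t} y' = y t - y 0" using ftc by (rule integral_unique)
 ultimately show "norm (y t) <= norm (y 0) + C * integral {0..t} (%s. norm (y s))"
  using norm_triangle_sub[of "y t" "y 0"] by simp
qed

text \<open>Division by the weight E = exp (2 * integral of |L|) makes the integral operator a
  contraction with factor 1/2 on the whole half line, so one use of Banach's fixed point theorem
  gives the global solution. Since f vanishes at 0, the growth of f is bounded by L, and weighted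
  bounded functions are mapped to such functions.\<close>

lemma picard:
 fixes f :: "real => 'a::banach => 'a"
 assumes S: "closed S" "subspace S" "x0 \<in> S" and fS: "!!t x. 0 <= t ==> x \<in> S ==> f t x \<in> S"
  and f0: "!!t. 0 <= t ==> f t 0 = 0" and L: "cont0 L"
  and lip: "!!t x y. 0 <= t ==> x \<in> S ==> y \<in> S ==> norm (f t x - f t y) <= L t * norm (x - y)"
  and cont: "!!y. cont0 y ==> (!!t. 0 <= t ==> y t \<in> S) ==> cont0 (%t. f t (y t))"
 obtains y where "cont0 y" "y 0 = x0" "!!t. 0 <= t ==> y t \<in> S"
  "!!t. 0 <= t ==> (y hvd f t (y t)) (at0 t)"
proof -
 define E where "E t = exp (2 * integral {0..t} (%s. \<bar>L s\<bar>))" for t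
 have dE: "(E hvd 2 * \<bar>L t\<bar> * E t) (at0 t)" if "0 <= t" for t
 proof -
  have "((%t. integral {0..t} (%s. \<bar>L s\<bar>)) has_real_derivative \<bar>L t\<bar>) (at0 t)"
   using integral_has_vector_derivative_Ici[OF continuous_on_rabs[OF L] that, of 0] by (simp add: hrd_iff)
  thus ?thesis unfolding E_def hrd_iff[symmetric] by (auto intro!: derivative_eq_intros)
 qed
 have cE: "cont0 E" by (rule continuous_on_vector_derivative[of _ _ "%t. 2 * \<bar>L t\<bar> * E t"]) (use dE in auto)
 have E0: "0 < E t" and iE: "\<bar>inverse (E t)\<bar> = inverse (E t)" for t by (simp_all add: E_def)
 have int: "g integrable_on {0..t}" if "cont0 g" for g :: "real => 'b::banach" and t
  by (rule integrable_continuous_real[OF continuous_on_subset[OF that]]) auto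
 have E1: "1 <= E t" for t
  using Henstock_Kurzweil_Integration.integral_nonneg[OF int[OF continuous_on_rabs[OF L]]] by (simp add: E_def)
 \<comment> \<open>As E' = 2 |L| E, the integral of |L| E B is at most B/2 times E; this is where
   the contraction factor comes from.\<close>
 have bound: "norm (integral {0..t} g) <= B / 2 * E t"
  if g: "cont0 g" "!!s. 0 <= s ==> norm (g s) <= \<bar>L s\<bar> * (E s * B)" and "0 <= t" "0 <= B" for g :: "real => 'a" and t B
 proof -
  have i: "((%s. \<bar>L s\<bar> * (E s * B)) has_integral B / 2 * E t - B / 2 * E 0) {0..t}"
   by (rule FTC_Ici[of "%t. B / 2 * E t"]) (use has_vector_derivative_mult_right[OF dE, of _ "B / 2"] that in "simp_all add: mult_ac")
  have "norm (integral {0..t} g) <= integral {0..t} (%s. \<bar>L s\<bar> * (E s * B))"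
   by (rule Henstock_Kurzweil_Integration.integral_norm_bound_integral[OF int[OF g(1)]]) (use i g(2) in auto)
  also have "... <= B / 2 * E t" using integral_unique[OF i] E0[of 0] \<open>0 <= B\<close> by simp
  finally show ?thesis .
 qed
 let ?C = "{u :: real \<Rightarrow>\<^sub>C 'a. \<forall>t. apply_bcontfun u t \<in> S}"
 define F where "F u s = f s (E s *\<^sub>R apply_bcontfun u s)" for u s
 \<comment> \<open>\<open>max 0 t\<close> extends the function to negative times as a constant,
   since the bounded continuous functions used here live on the whole line.\<close>
 define P where "P u t = (x0 + integral {0..max 0 t} (F u)) /\<^sub>R E (max 0 t)" for u t
 have cF: "cont0 (F u)" if "u \<in> ?C" for u
  unfolding F_def using that by (intro cont continuous_on_scaleR cE continuous_on_apply_bcontfun subspace_scale[OF S(2)]) auto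
 have F: "norm (F u s - F v s) <= \<bar>L s\<bar> * (E s * norm (u - v))" if "u \<in> ?C" "v \<in> ?C" "0 <= s" for u v s
 proof -
  have "norm (F u s - F v s) <= L s * norm (E s *\<^sub>R apply_bcontfun u s - E s *\<^sub>R apply_bcontfun v s)"
   unfolding F_def by (rule lip) (use that in "auto intro: subspace_scale[OF S(2)]")
  also have "... = L s * (E s * norm (apply_bcontfun (u - v) s))" using E0[of s] by (simp flip: scaleR_diff_right)
  also have "... <= \<bar>L s\<bar> * (E s * norm (u - v))"
   using E0[of s] norm_bounded[of "u - v" s] by (intro mult_mono mult_nonneg_nonneg) auto
  finally show ?thesis .
 qed
 have PB: "apply_bcontfun (Bcontfun (P u)) = P u" if u: "u \<in> ?C" for u
 proof (rule Bcontfun_inverse, rule bcontfun_normI)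
  have "cont0 (%t. (x0 + integral {0..t} (F u)) /\<^sub>R E t)"
   using E0 by (intro continuous_intros cE continuous_on_vector_derivative[OF integral_has_vector_derivative_Ici[OF cF[OF u], of _ 0, simplified]])
    (auto simp: less_imp_neq[symmetric])
  thus "continuous_on UNIV (P u)" unfolding P_def
   by (rule continuous_on_compose2[where g = "%t. (x0 + integral {0..t} (F u)) /\<^sub>R E t"]) (auto intro!: continuous_intros)
  fix t
  have "norm (x0 + integral {0..max 0 t} (F u)) <= norm x0 + norm u / 2 * E (max 0 t)"
   using F[OF u, of 0] S(2) f0
   by (intro order_trans[OF norm_triangle_ineq] add_left_mono bound cF[OF u]) (auto simp: F_def subspace_0)
  also have "... <= (norm x0 + norm u / 2) * E (max 0 t)" using E1[of "max 0 t"] by (simp add: distrib_right mult_le_cancel_left1)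
  finally have "norm (x0 + integral {0..max 0 t} (F u)) / E (max 0 t) <= norm x0 + norm u / 2"
   by (simp only: pos_divide_le_eq[OF E0])
  thus "norm (P u t) <= norm x0 + norm u / 2" unfolding P_def norm_scaleR iE by (simp only: divide_inverse mult.commute)
 qed
 have "\<exists>!u\<in>?C. Bcontfun (P u) = u"
 proof (rule Banach_fix[where c = "1/2"])
  show "complete ?C" unfolding complete_eq_closed closed_sequential_limits
  proof (intro allI impI)
   fix w l assume a: "(\<forall>n. w n \<in> ?C) \<and> w ----> l"
   have "apply_bcontfun l t \<in> S" for t
    by (rule closed_sequentially[OF S(1) _ tendsto_uniform_limitI[OF tendsto_bcontfun_uniform_limit[OF conjunct2[OF a]] UNIV_I]]) (use a in auto)
   thus "l \<in> ?C" by blast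
  qed
  show "?C ~= {}" using subspace_0[OF S(2)] by (auto intro: exI[of _ 0])
  show "(%u. Bcontfun (P u)) ` ?C \<subseteq> ?C"
  proof (clarsimp simp: PB)
   fix u :: "real \<Rightarrow>\<^sub>C 'a" and t assume u: "\<forall>t. apply_bcontfun u t \<in> S"
   have "integral {0..max 0 t} (F u) \<in> S"
    by (rule integral_in_subspace[OF S(1,2) int[OF cF]]) (use u in "auto simp: F_def intro!: fS subspace_scale[OF S(2)]")
   thus "P u t \<in> S" unfolding P_def by (intro subspace_scale[OF S(2)] subspace_add[OF S(2,3)])
  qed
  fix u v assume u: "u \<in> ?C" and v: "v \<in> ?C"
  show "dist (Bcontfun (P u)) (Bcontfun (P v)) <= 1 / 2 * dist u v" unfolding dist_norm
  proof (rule norm_bound)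
   fix t
   have "norm (integral {0..max 0 t} (%s. F u s - F v s)) <= norm (u - v) / 2 * E (max 0 t)"
    by (intro bound continuous_on_diff cF u v F) auto
   hence "norm (integral {0..max 0 t} (F u) - integral {0..max 0 t} (F v)) / E (max 0 t) <= norm (u - v) / 2"
    using E0[of "max 0 t"] by (simp add: Henstock_Kurzweil_Integration.integral_diff[OF int[OF cF[OF u]] int[OF cF[OF v]]] field_simps)
   thus "norm (apply_bcontfun (Bcontfun (P u) - Bcontfun (P v)) t) <= 1 / 2 * norm (u - v)"
    unfolding minus_bcontfun.rep_eq PB[OF u] PB[OF v] P_def scaleR_diff_right[symmetric] norm_scaleR iE
    by (simp only: add_diff_cancel_left divide_inverse mult_1 mult.commute)
  qed
 qed simp_all
 then obtain u where u: "u \<in> ?C" "Bcontfun (P u) = u" by auto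
 define y where "y t = E t *\<^sub>R apply_bcontfun u t" for t
 have y: "y t = x0 + integral {0..t} (F u)" if "0 <= t" for t
 proof -
  have "apply_bcontfun u t = (x0 + integral {0..t} (F u)) /\<^sub>R E t"
   using PB[OF u(1), unfolded u(2)] that by (simp add: P_def max_absorb2)
  thus ?thesis using E0[of t] by (simp add: y_def)
 qed
 show ?thesis
 proof
  show "cont0 y" unfolding y_def by (intro continuous_intros cE continuous_on_apply_bcontfun)
  show "y 0 = x0" by (simp add: y)
  show "y t \<in> S" for t using u(1) by (auto simp: y_def intro: subspace_scale[OF S(2)])
  show "(y hvd f t (y t)) (at0 t)" if "0 <= t" for t
   using has_vector_derivative_transform[OF _ y integral_has_vector_derivative_Ici[OF cF[OF u(1)] that, of x0]] that by (simp add: F_def y_def[abs_def])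
 qed
qed

section \<open>Sobolev norms and tame product estimates\<close>

primrec Hs :: "nat => l2 => bool" where
 "Hs 0 u = True"
| "Hs (Suc k) u = ((\<exists>w. has_D u w) \<and> Hs k (D u))"

primrec nk :: "nat => l2 => real" where
 "nk 0 u = norm u"
| "nk (Suc k) u = norm u + nk k (D u)"

declare Hs.simps(2) [simp del] nk.simps(2) [simp del]

lemma Hs_SucI: "has_D u w ==> Hs k w ==> Hs (Suc k) u"
 using D_eq by (auto simp: Hs.simps(2))

lemma nk_Suc: "has_D u w ==> nk (Suc k) u = norm u + nk k w"
 by (simp add: D_eq nk.simps(2))

lemma Hs_SucE: assumes "Hs (Suc k) u" obtains w where "has_D u w" "Hs k w" "D u = w"
 using assms D_eq by (auto simp: Hs.simps(2))

lemma Hs_pred: "Hs (Suc k) u ==> Hs k u"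
 by (induction k arbitrary: u) (auto simp: Hs.simps(2))

lemma Hs_mono: "j <= k ==> Hs k u ==> Hs j u"
 by (induction k) (auto simp: le_Suc_eq dest: Hs_pred)

lemma nk_nonneg [simp]: "0 <= nk k u"
 by (induction k arbitrary: u) (auto simp: nk.simps(2))

lemma norm_le_nk: "norm u <= nk k u"
 by (cases k) (auto simp: nk.simps(2))

lemma nk_pred: "nk k u <= nk (Suc k) u"
 by (induction k arbitrary: u) (auto simp: nk.simps(2))

lemma Hs_add: "Hs k u ==> Hs k v ==> Hs k (u + v)"
proof (induction k arbitrary: u v)
 case (Suc k)
 obtain w z where "has_D u w" "Hs k w" "has_D v z" "Hs k z" using Suc.prems by (elim Hs_SucE) blast
 with Suc.IH show ?case by (intro Hs_SucI[OF has_D_add]) auto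
qed simp

lemma nk_triangle: "Hs k u ==> Hs k v ==> nk k (u + v) <= nk k u + nk k v"
proof (induction k arbitrary: u v)
 case (Suc k)
 obtain w z where *: "has_D u w" "Hs k w" "has_D v z" "Hs k z" using Suc.prems by (elim Hs_SucE) blast
 show ?case unfolding nk_Suc[OF has_D_add[OF *(1,3)]] nk_Suc[OF *(1)] nk_Suc[OF *(3)]
  using Suc.IH[OF *(2,4)] norm_triangle_ineq[of u v] by simp
qed (simp add: norm_triangle_ineq)

lemma Hs_scaleR: "Hs k u ==> Hs k (r *\<^sub>R u)"
proof (induction k arbitrary: u)
 case (Suc k)
 obtain w where "has_D u w" "Hs k w" using Suc.prems by (elim Hs_SucE) blast
 with Suc.IH show ?case by (intro Hs_SucI[OF has_D_scaleR]) auto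
qed simp

lemma nk_scaleR: "Hs k u ==> nk k (r *\<^sub>R u) = \<bar>r\<bar> * nk k u"
proof (induction k arbitrary: u)
 case (Suc k)
 obtain w where *: "has_D u w" "Hs k w" using Suc.prems by (elim Hs_SucE) blast
 show ?case unfolding nk_Suc[OF has_D_scaleR[OF *(1)]] nk_Suc[OF *(1)]
  using Suc.IH[OF *(2)] by (simp add: algebra_simps)
qed simp

lemma Hs_uminus: "Hs k u ==> Hs k (- u)" using Hs_scaleR[of k u "-1"] by simp
lemma Hs_diff: "Hs k u ==> Hs k v ==> Hs k (u - v)"
 using Hs_add[of k u "- v"] Hs_uminus[of k v] by simp

lemma Hs_J: "Hs k u ==> Hs k (J u) \<and> nk k (J u) = nk k u"
proof (induction k arbitrary: u)
 case (Suc k)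
 obtain w where *: "has_D u w" "Hs k w" using Suc.prems by (elim Hs_SucE) blast
 show ?case using Hs_SucI[OF has_D_J[OF *(1)]] Suc.IH[OF *(2)]
  by (simp only: nk_Suc[OF has_D_J[OF *(1)]] nk_Suc[OF *(1)] norm_J)
qed simp

lemma Hs_cj: "Hs k u ==> Hs k (cj u) \<and> nk k (cj u) = nk k u"
proof (induction k arbitrary: u)
 case (Suc k)
 obtain w where *: "has_D u w" "Hs k w" using Suc.prems by (elim Hs_SucE) blast
 show ?case using Hs_SucI[OF has_D_cj[OF *(1)]] Suc.IH[OF *(2)]
  by (simp only: nk_Suc[OF has_D_cj[OF *(1)]] nk_Suc[OF *(1)] norm_cj)
qed simp

text \<open>Only the first factor enters through its continuous representative, so the second may be
  a mere L^2 element.\<close>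

definition pr :: "l2 => l2 => l2" where "pr u v = mul (cb u) v"

lemma has_D_pr: "has_D u w ==> has_D v z ==> has_D (pr u v) (pr u z + pr v w)"
 unfolding pr_def by (rule has_D_mul) (rule has_D_cb)

lemma norm_pr: "has_D u w ==> norm (pr u v) <= (norm u + norm w) * norm v"
 unfolding pr_def by (rule order_trans[OF norm_mul]) (intro mult_right_mono norm_cb, auto)

lemma norm_pr_nk: "Hs (Suc k) u ==> norm (pr u v) <= nk (Suc k) u * norm v"
proof (elim Hs_SucE)
 fix w assume *: "has_D u w" "Hs k w"
 have "norm (pr u v) <= (norm u + norm w) * norm v" by (rule norm_pr[OF *(1)])
 also have "... <= (norm u + nk k w) * norm v" using norm_le_nk[of w k] by (intro mult_right_mono) auto
 finally show ?thesis unfolding nk_Suc[OF *(1)] .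
qed

lemma nk_pr_step:
 assumes u: "has_D u w" and v: "has_D v z" and H: "Hs k (pr u z)" "Hs k (pr v w)"
 shows "Hs (Suc k) (pr u v)" "nk (Suc k) (pr u v) <= norm (pr u v) + nk k (pr u z) + nk k (pr v w)"
 using Hs_SucI[OF has_D_pr[OF u v] Hs_add[OF H]] nk_Suc[OF has_D_pr[OF u v], of k] nk_triangle[OF H] by auto

text \<open>One derivative of u v leaves three terms: the norm of the product and the two products
  with a differentiated factor. Hence the constant is multiplied by 3 at each order.\<close>

lemma pr_algebra:
 "Hs (Suc k) u ==> Hs (Suc k) v ==> Hs (Suc k) (pr u v) \<and> nk (Suc k) (pr u v) <= 3 ^ Suc k * nk (Suc k) u * nk (Suc k) v"
proof (induction k arbitrary: u v)
 case 0
 obtain w z where *: "has_D u w" "has_D v z" using "0.prems" by (elim Hs_SucE) blast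
 have "nk 1 (pr u v) <= norm (pr u v) + norm (pr u z) + norm (pr v w)"
  using nk_pr_step(2)[OF *, of 0] by simp
 also have "... <= (norm u + norm w) * norm v + (norm u + norm w) * norm z + (norm v + norm z) * norm w"
  using norm_pr[OF *(1), of v] norm_pr[OF *(1), of z] norm_pr[OF *(2), of w] by simp
 also have "... <= 3 * ((norm u + norm w) * (norm v + norm z))"
  by (simp add: algebra_simps)
 also have "... = 3 * nk 1 u * nk 1 v" using nk_Suc[OF *(1), of 0] nk_Suc[OF *(2), of 0] by simp
 finally show ?case using nk_pr_step(1)[OF *, of 0] by simp
next
 case (Suc k)
 obtain w z where *: "has_D u w" "Hs (Suc k) w" "has_D v z" "Hs (Suc k) z"
  using Suc.prems by (elim Hs_SucE[of "Suc k"]) blast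
 have H: "Hs (Suc k) u" "Hs (Suc k) v" using Suc.prems Hs_pred by blast+
 note ih1 = Suc.IH[OF H(1) *(4)] and ih2 = Suc.IH[OF H(2) *(2)]
 let ?C = "3 ^ Suc k :: real" and ?U = "nk (Suc (Suc k)) u" and ?V = "nk (Suc (Suc k)) v"
 have le: "nk (Suc k) u <= ?U" "nk (Suc k) v <= ?V" "nk (Suc k) w <= ?U" "nk (Suc k) z <= ?V" "norm v <= ?V"
  using nk_Suc[OF *(1), of "Suc k"] nk_Suc[OF *(3), of "Suc k"] nk_pred[of "Suc k" u] nk_pred[of "Suc k" v]
   norm_le_nk[of v "Suc (Suc k)"] by auto
 have "nk (Suc (Suc k)) (pr u v) <= norm (pr u v) + nk (Suc k) (pr u z) + nk (Suc k) (pr v w)"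
  by (rule nk_pr_step(2)[OF *(1,3)]) (use ih1 ih2 in auto)
 also have "... <= ?U * ?V + ?C * ?U * ?V + ?C * ?V * ?U"
 proof (intro add_mono)
  show "norm (pr u v) <= ?U * ?V"
   by (rule order_trans[OF norm_pr_nk[OF Suc.prems(1)]]) (use le in "intro mult_left_mono, auto")
  show "nk (Suc k) (pr u z) <= ?C * ?U * ?V"
   by (rule order_trans[OF conjunct2[OF ih1]]) (use le in "intro mult_mono, auto")
  show "nk (Suc k) (pr v w) <= ?C * ?V * ?U"
   by (rule order_trans[OF conjunct2[OF ih2]]) (use le in "intro mult_mono, auto")
 qed
 also have "... <= ?C * (?U * ?V) + ?C * (?U * ?V) + ?C * (?U * ?V)"
 proof -
  have "1 <= ?C" by (rule one_le_power) simp
  hence "1 * (?U * ?V) <= ?C * (?U * ?V)" by (intro mult_right_mono) auto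
  thus ?thesis by (simp add: mult_ac)
 qed
 also have "... = 3 ^ Suc (Suc k) * ?U * ?V" by simp
 finally show ?case using nk_pr_step(1)[OF *(1,3)] ih1 ih2 by simp
qed

lemmas pr_Hs = pr_algebra[THEN conjunct1] and nk_pr = pr_algebra[THEN conjunct2]

text \<open>Each summand contains only one norm of top order. Once the lower norms are under
  control, the estimate is linear in the top norm, which is what Gronwall's inequality
  needs.\<close>

lemma nk_pr_tame:
 assumes "Hs (Suc (Suc k)) u" "Hs (Suc (Suc k)) v"
 shows "nk (Suc (Suc k)) (pr u v) <= 3 ^ Suc (Suc k) * (nk (Suc k) u * nk (Suc (Suc k)) v + nk (Suc (Suc k)) u * nk (Suc k) v)"
proof -
 obtain w z where *: "has_D u w" "Hs (Suc k) w" "has_D v z" "Hs (Suc k) z"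
  using assms by (elim Hs_SucE[of "Suc k"]) blast
 have H: "Hs (Suc k) u" "Hs (Suc k) v" using assms Hs_pred by blast+
 let ?C = "3 ^ Suc k :: real" and ?U = "nk (Suc (Suc k)) u" and ?V = "nk (Suc (Suc k)) v"
  and ?u = "nk (Suc k) u" and ?v = "nk (Suc k) v"
 have le: "nk (Suc k) w <= ?U" "nk (Suc k) z <= ?V" "norm v <= ?V"
  using nk_Suc[OF *(1), of "Suc k"] nk_Suc[OF *(3), of "Suc k"] norm_le_nk[of v "Suc (Suc k)"] by auto
 have "nk (Suc (Suc k)) (pr u v) <= norm (pr u v) + nk (Suc k) (pr u z) + nk (Suc k) (pr v w)"
  by (rule nk_pr_step(2)[OF *(1,3)]) (use pr_Hs H * in auto)
 also have "... <= ?u * ?V + ?C * ?u * ?V + ?C * ?v * ?U"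
 proof (intro add_mono)
  show "norm (pr u v) <= ?u * ?V"
   by (rule order_trans[OF norm_pr_nk[OF H(1)]]) (use le in "intro mult_left_mono, auto")
  show "nk (Suc k) (pr u z) <= ?C * ?u * ?V"
   by (rule order_trans[OF nk_pr[OF H(1) *(4)]]) (use le in "intro mult_left_mono, auto")
  show "nk (Suc k) (pr v w) <= ?C * ?v * ?U"
   by (rule order_trans[OF nk_pr[OF H(2) *(2)]]) (use le in "intro mult_left_mono, auto")
 qed
 also have "... <= 3 * ?C * (?u * ?V + ?U * ?v)"
 proof -
  have "1 <= ?C" by (rule one_le_power) simp
  hence 1: "1 * (?u * ?V) <= ?C * (?u * ?V)" by (intro mult_right_mono) auto
  have "0 <= ?C * (?u * ?V)" "0 <= ?C * (?U * ?v)" by auto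
  thus ?thesis using 1 by (simp only: distrib_left mult_ac)
 qed
 finally show ?thesis by simp
qed

text \<open>The polarised form of |u|^2 u, with the conjugate in the middle slot: a difference of
  two values on the diagonal telescopes into three terms, each linear in u - v.\<close>

definition cub :: "l2 => l2 => l2 => l2" where "cub u v w = pr u (pr (cj v) w)"
definition NL :: "l2 => l2" where "NL u = (1/2) *\<^sub>R cub u u u"

lemma cub_Hs:
 assumes "Hs (Suc k) u" "Hs (Suc k) v" "Hs (Suc k) w"
 shows "Hs (Suc k) (cub u v w)" "nk (Suc k) (cub u v w) <= (3 ^ Suc k)^2 * (nk (Suc k) u * nk (Suc k) v * nk (Suc k) w)"
proof -
 have v: "Hs (Suc k) (cj v)" "nk (Suc k) (cj v) = nk (Suc k) v" using Hs_cj[OF assms(2)] by blast+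
 have p: "Hs (Suc k) (pr (cj v) w)" by (rule pr_Hs[OF v(1) assms(3)])
 thus "Hs (Suc k) (cub u v w)" unfolding cub_def by (rule pr_Hs[OF assms(1)])
 have "nk (Suc k) (cub u v w) <= 3 ^ Suc k * nk (Suc k) u * nk (Suc k) (pr (cj v) w)"
  unfolding cub_def by (rule nk_pr[OF assms(1) p])
 also have "... <= 3 ^ Suc k * nk (Suc k) u * (3 ^ Suc k * nk (Suc k) v * nk (Suc k) w)"
  using nk_pr[OF v(1) assms(3)] unfolding v(2) by (rule mult_left_mono) simp
 finally show "nk (Suc k) (cub u v w) <= (3 ^ Suc k)^2 * (nk (Suc k) u * nk (Suc k) v * nk (Suc k) w)"
  by (simp only: power2_eq_square mult_ac)
qed

lemma NL_Hs: "Hs (Suc k) u ==> Hs (Suc k) (NL u)"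
 unfolding NL_def by (intro Hs_scaleR cub_Hs)

lemma pr_diff_left: "has_D u w ==> has_D v z ==> pr (u - v) x = pr u x - pr v x"
 unfolding pr_def by (simp add: cb_diff bounded_bilinear.diff_left[OF bil_mul])
lemma pr_diff_right: "pr u (x - y) = pr u x - pr u y"
 unfolding pr_def by (simp add: bounded_bilinear.diff_right[OF bil_mul])

lemma cj_diff: "cj (u - v) = cj u - cj v"
 by (rule linear_diff[OF lin[OF lin_cj]])

lemma NL_lip:
 assumes u: "Hs (Suc k) u" and v: "Hs (Suc k) v" and R: "nk (Suc k) u <= R" "nk (Suc k) v <= R"
 shows "nk (Suc k) (NL u - NL v) <= (3 ^ Suc k)^2 * (3 * R^2) * nk (Suc k) (u - v)"
proof -
 obtain w z where *: "has_D u w" "has_D v z" using u v by (elim Hs_SucE) blast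
 have d: "Hs (Suc k) (u - v)" by (rule Hs_diff[OF u v])
 let ?C = "(3 ^ Suc k)^2 :: real" and ?d = "nk (Suc k) (u - v)"
 have R0: "0 <= R" using order_trans[OF nk_nonneg R(1)] .
 have eq: "cub u u u - cub v v v = cub (u - v) u u + cub v (u - v) u + cub v v (u - v)"
  unfolding cub_def cj_diff pr_diff_left[OF *] pr_diff_left[OF has_D_cj[OF *(1)] has_D_cj[OF *(2)]] pr_diff_right by simp
 have b: "nk (Suc k) (cub a b c) <= ?C * (A * B * E)"
  if "Hs (Suc k) a" "Hs (Suc k) b" "Hs (Suc k) c" "nk (Suc k) a <= A" "nk (Suc k) b <= B" "nk (Suc k) c <= E" for a b c A B E
 proof -
  have A: "0 <= A" "0 <= B" "0 <= E" using that(4-6) nk_nonneg order_trans by blast+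
  show ?thesis
   by (rule order_trans[OF cub_Hs(2)[OF that(1-3)]]) (intro mult_left_mono mult_mono that(4-6) A mult_nonneg_nonneg nk_nonneg zero_le_power2)
 qed
 have "nk (Suc k) (cub u u u - cub v v v) <= nk (Suc k) (cub (u - v) u u) + nk (Suc k) (cub v (u - v) u) + nk (Suc k) (cub v v (u - v))"
  unfolding eq using nk_triangle[OF Hs_add[OF cub_Hs(1)[OF d u u] cub_Hs(1)[OF v d u]] cub_Hs(1)[OF v v d]]
   nk_triangle[OF cub_Hs(1)[OF d u u] cub_Hs(1)[OF v d u]] by linarith
 also have "... <= ?C * (?d * R * R) + ?C * (R * ?d * R) + ?C * (R * R * ?d)"
  by (intro add_mono b d u v R order_refl)
 also have "... = ?C * (3 * R^2) * ?d" by (simp add: power2_eq_square algebra_simps)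
 finally have 1: "nk (Suc k) (cub u u u - cub v v v) <= ?C * (3 * R^2) * ?d" .
 have "nk (Suc k) (NL u - NL v) = (1/2) * nk (Suc k) (cub u u u - cub v v v)"
  unfolding NL_def scaleR_diff_right[symmetric]
  using nk_scaleR[OF Hs_diff[OF cub_Hs(1)[OF u u u] cub_Hs(1)[OF v v v]], of "1/2"] by simp
 also have "... <= nk (Suc k) (cub u u u - cub v v v)" by simp
 finally show ?thesis using 1 by linarith
qed

lemma NL_tame:
 assumes u: "Hs (Suc (Suc k)) u"
 shows "nk (Suc (Suc k)) (NL u) <= 3 * (3 ^ Suc (Suc k))^2 * (nk (Suc k) u)^2 * nk (Suc (Suc k)) u"
proof -
 let ?C = "3 ^ Suc (Suc k) :: real" and ?a = "nk (Suc k) u" and ?b = "nk (Suc (Suc k)) u"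
 note cu = Hs_cj[OF u] Hs_cj[OF Hs_pred[OF u]]
 have p: "Hs (Suc (Suc k)) (pr (cj u) u)" using cu pr_Hs u by blast
 have p1: "nk (Suc (Suc k)) (pr (cj u) u) <= ?C * (2 * (?a * ?b))"
  using nk_pr_tame[of k "cj u" u] cu u by (simp add: algebra_simps)
 have "nk (Suc k) (pr (cj u) u) <= 3 ^ Suc k * nk (Suc k) (cj u) * nk (Suc k) u"
  using cu Hs_pred[OF u] by (intro nk_pr) auto
 also have "... <= ?C * (?a * ?a)" using cu
  by (simp only: mult.assoc) (intro mult_right_mono, auto)
 finally have p2: "nk (Suc k) (pr (cj u) u) <= ?C * (?a * ?a)" .
 have "nk (Suc (Suc k)) (cub u u u) <= ?C * (?a * nk (Suc (Suc k)) (pr (cj u) u) + ?b * nk (Suc k) (pr (cj u) u))"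
  unfolding cub_def by (rule nk_pr_tame[OF u p])
 also have "... <= ?C * (?a * (?C * (2 * (?a * ?b))) + ?b * (?C * (?a * ?a)))"
  by (intro mult_left_mono add_mono p1 p2) auto
 also have "... = 3 * ?C^2 * ?a^2 * ?b" by (simp only: power2_eq_square) (simp add: algebra_simps)
 finally have 1: "nk (Suc (Suc k)) (cub u u u) <= 3 * ?C^2 * ?a^2 * ?b" .
 have "nk (Suc (Suc k)) (NL u) = (1/2) * nk (Suc (Suc k)) (cub u u u)"
  unfolding NL_def using nk_scaleR[OF cub_Hs(1)[OF u u u], of "1/2"] by simp
 also have "... <= nk (Suc (Suc k)) (cub u u u)" by simp
 finally show ?thesis using 1 by linarith
qed

section \<open>Continuous curves in Sobolev spaces\<close>

primrec CH :: "nat => (real => l2) => bool" where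
 "CH 0 u = cont0 u"
| "CH (Suc k) u = (cont0 u \<and> (\<forall>t\<ge>0. \<exists>w. has_D (u t) w) \<and> CH k (%t. D (u t)))"

declare CH.simps(2) [simp del]

lemma CH_cong: "(!!t. 0 <= t ==> u t = v t) ==> CH k u = CH k v"
proof (induction k arbitrary: u v)
 case 0
 have "cont0 u = cont0 v" by (rule continuous_on_cong) (auto simp: 0)
 thus ?case by simp
next
 case (Suc k)
 have "cont0 u = cont0 v" by (rule continuous_on_cong) (auto simp: Suc.prems)
 moreover have "CH k (%t. D (u t)) = CH k (%t. D (v t))" by (rule Suc.IH) (simp add: Suc.prems)
 ultimately show ?case using Suc.prems by (simp add: CH.simps(2))
qed

lemma CH_SucI: assumes "cont0 u" "!!t. 0 <= t ==> has_D (u t) (w t)" "CH k w" shows "CH (Suc k) u"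
proof -
 have "CH k (%t. D (u t)) = CH k w" by (rule CH_cong) (simp add: D_eq assms(2))
 thus ?thesis using assms by (auto simp: CH.simps(2))
qed

lemma CH_SucE: assumes "CH (Suc k) u"
 obtains w where "cont0 u" "!!t. 0 <= t ==> has_D (u t) (w t)" "CH k w"
proof (rule that[of "%t. D (u t)"])
 show "has_D (u t) (D (u t))" if "0 <= t" for t using assms that D_eq by (auto simp: CH.simps(2))
qed (use assms in "auto simp: CH.simps(2)")

lemma CH_continuous: "CH k u ==> cont0 u" by (cases k) (auto simp: CH.simps(2))
lemma CH_pred: "CH (Suc k) u ==> CH k u" by (induction k arbitrary: u) (auto simp: CH.simps(2))
lemma CH_mono: "j <= k ==> CH k u ==> CH j u"
 by (induction k) (auto simp: le_Suc_eq dest: CH_pred)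

lemma CH_bounded_linear:
 assumes T: "bounded_linear T" and c: "!!u w. has_D u w ==> has_D (T u) (T w)"
 shows "CH k u ==> CH k (%t. T (u t))"
proof (induction k arbitrary: u)
 case 0 thus ?case using lin_cont[OF T] by simp
next
 case (Suc k)
 obtain w where "cont0 u" "!!t. 0 <= t ==> has_D (u t) (w t)" "CH k w" using Suc.prems by (elim CH_SucE) (rule that, assumption+)
 thus ?case using lin_cont[OF T] Suc.IH c by (intro CH_SucI[where w = "%t. T (w t)"]) auto
qed

lemma CH_add: "CH k u ==> CH k v ==> CH k (%t. u t + v t)"
proof (induction k arbitrary: u v)
 case 0 thus ?case by (auto intro: continuous_on_add)
next
 case (Suc k)
 obtain w z where "cont0 u" "!!t. 0 <= t ==> has_D (u t) (w t)" "CH k w"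
  "cont0 v" "!!t. 0 <= t ==> has_D (v t) (z t)" "CH k z" using Suc.prems by (elim CH_SucE) (rule that, assumption+)
 thus ?case using Suc.IH
  by (intro CH_SucI[where w = "%t. w t + z t"]) (auto intro: continuous_on_add has_D_add)
qed

lemma CH_scaleR: "CH k u ==> CH k (%t. r *\<^sub>R u t)"
 by (rule CH_bounded_linear[OF bounded_linear_scaleR_right has_D_scaleR])
lemma CH_diff: "CH k u ==> CH k v ==> CH k (%t. u t - v t)"
 using CH_add[of k u "%t. (-1) *\<^sub>R v t"] CH_scaleR[of k v "-1"] by simp
lemma CH_J: "CH k u ==> CH k (%t. J (u t))" by (rule CH_bounded_linear[OF lin_J has_D_J])
lemma CH_cj: "CH k u ==> CH k (%t. cj (u t))" by (rule CH_bounded_linear[OF lin_cj has_D_cj])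

lemma CH_cb: assumes "CH (Suc k) u" shows "cont0 (%t. cb (u t))"
proof -
 obtain w where w: "cont0 u" "!!t. 0 <= t ==> has_D (u t) (w t)" "CH k w" using assms by (elim CH_SucE) (rule that, assumption+)
 have cw: "cont0 w" by (rule CH_continuous[OF w(3)])
 show ?thesis unfolding continuous_on_def
 proof
  fix s :: real assume s: "s \<in> {0..}"
  have "((%t. norm (u t - u s) + norm (w t - w s)) ---> norm (u s - u s) + norm (w s - w s)) (at0 s)"
   using w(1) cw s by (intro tendsto_intros) (auto simp: continuous_on_def)
  hence lim: "((%t. norm (u t - u s) + norm (w t - w s)) ---> 0) (at0 s)" by simp
  have "((%t. cb (u t) - cb (u s)) ---> 0) (at0 s)"
  proof (rule Lim_null_comparison[OF _ lim])
   have "norm (cb (u t) - cb (u s)) <= norm (u t - u s) + norm (w t - w s)" if "t \<in> {0..}" for t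
    using norm_cb[OF has_D_diff[OF w(2)[of t] w(2)[of s]]] cb_diff[OF w(2)[of t] w(2)[of s]] that s by simp
   thus "\<forall>\<^sub>F t in at0 s. norm (cb (u t) - cb (u s)) <= norm (u t - u s) + norm (w t - w s)"
    by (auto simp: eventually_at intro: exI[of _ 1])
  qed
  thus "((%t. cb (u t)) ---> cb (u s)) (at0 s)" by (simp add: LIM_zero_iff)
 qed
qed

lemma CH_pr: "CH (Suc k) u ==> CH (Suc k) v ==> CH (Suc k) (%t. pr (u t) (v t))"
proof (induction k arbitrary: u v)
 case 0
 obtain w z where *: "cont0 u" "!!t. 0 <= t ==> has_D (u t) (w t)" "CH 0 w"
  "cont0 v" "!!t. 0 <= t ==> has_D (v t) (z t)" "CH 0 z" using "0.prems" by (elim CH_SucE) (rule that, assumption+)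
 note c = bil_cont[OF bil_mul] CH_cb[OF "0.prems"(1)] CH_cb[OF "0.prems"(2)]
 show ?case
  by (rule CH_SucI[where w = "%t. pr (u t) (z t) + pr (v t) (w t)"])
    (use * in "auto simp: pr_def intro!: c continuous_on_add has_D_pr[unfolded pr_def]")
next
 case (Suc k)
 obtain w z where *: "cont0 u" "!!t. 0 <= t ==> has_D (u t) (w t)" "CH (Suc k) w"
  "cont0 v" "!!t. 0 <= t ==> has_D (v t) (z t)" "CH (Suc k) z"
  using Suc.prems by (elim CH_SucE[of "Suc k"]) (rule that, assumption+)
 note P = Suc.prems[THEN CH_pred]
 show ?case
 proof (rule CH_SucI[where w = "%t. pr (u t) (z t) + pr (v t) (w t)"])
  show "cont0 (%t. pr (u t) (v t))" by (rule CH_continuous[OF Suc.IH[OF P]])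
  show "CH (Suc k) (%t. pr (u t) (z t) + pr (v t) (w t))"
   by (intro CH_add Suc.IH P *(3,6))
 qed (use * has_D_pr in auto)
qed

instance l2 :: banach ..

section \<open>The free Schroedinger group\<close>

text \<open>A copy of the bounded operators: the exponential series needs a Banach algebra as a type class
 instance. The group is the limit of the exponentials of i times difference quotients.\<close>

typedef op = "UNIV :: (l2 \<Rightarrow>\<^sub>L l2) set" morphisms blop Op ..

lemmas blop_simps [simp] = Op_inverse[OF UNIV_I] blop_inverse
lemma op_eqI: "(!!u. blinfun_apply (blop a) u = blinfun_apply (blop b) u) ==> a = b"
 by (metis blinfun_eqI blop_inject)

text \<open>The exponential series needs an algebra with norm 1 = 1, hence a nonzero element of
  \<open>l2\<close>; the indicator of [0, 1] is one.\<close>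

lemma norm_id_blinfun_l2: "norm (id_blinfun :: l2 \<Rightarrow>\<^sub>L l2) = 1"
proof (rule antisym[OF norm_blinfun_id_le])
 let ?u = "abs_l2 (indicator {0..1::real})"
 have "I 0 1 ?u = (LINT x::real|lborel. indicator {0..1} x * indicator {0..1} x)"
  by (rule I_cong[OF sqi_indicator rep_abs_l2[OF sqi_indicator]])
 also have "... = (LINT x|lborel. indicator {0..1::real} x *\<^sub>R (1::complex))"
  by (rule Bint_cong) (auto simp: indicator_def)
 also have "... = 1" by simp
 finally have "?u ~= 0" by (auto simp: linear_0[OF lin[OF lin_I]])
 moreover have "norm (blinfun_apply id_blinfun ?u) <= norm (id_blinfun :: l2 \<Rightarrow>\<^sub>L l2) * norm ?u" by (rule norm_blinfun)
 ultimately show "1 <= norm (id_blinfun :: l2 \<Rightarrow>\<^sub>L l2)" by simp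
qed

instantiation op :: real_normed_algebra_1
begin
definition "0 = Op 0"
definition "1 = Op id_blinfun"
definition "a + b = Op (blop a + blop b)"
definition "a - b = Op (blop a - blop b)"
definition "- a = Op (- blop a)"
definition "a * b = Op (blop a o\<^sub>L blop b)"
definition "r *\<^sub>R a = Op (r *\<^sub>R blop a)"
definition norm_op :: "op => real" where "norm_op a = norm (blop a)"
definition sgn_op :: "op => op" where "sgn_op a = scaleR (inverse (norm a)) a"
definition dist_op :: "op => op => real" where "dist_op a b = norm (a - b)"
definition uniformity_op :: "(op \<times> op) filter"
 where "uniformity_op = (INF e\<in>{0 <..}. principal {(x, y). dist x y < e})"
definition open_op :: "op set => bool"
 where "open_op S = (\<forall>x\<in>S. \<forall>\<^sub>F (x', y) in uniformity. x' = x --> y \<in> S)"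

lemmas op_defs = zero_op_def one_op_def plus_op_def minus_op_def uminus_op_def times_op_def scaleR_op_def norm_op_def

instance
proof
 fix a b c :: op and r s :: real
 show "a + b + c = a + (b + c)" "a + b = b + a" "0 + a = a" "- a + a = 0" "a - b = a + - b"
  "r *\<^sub>R (a + b) = r *\<^sub>R a + r *\<^sub>R b" "(r + s) *\<^sub>R a = r *\<^sub>R a + s *\<^sub>R a"
  "r *\<^sub>R s *\<^sub>R a = (r * s) *\<^sub>R a" "1 *\<^sub>R a = a"
  by (simp_all add: op_defs algebra_simps)
 show "a * b * c = a * (b * c)" "1 * a = a" "a * 1 = a" "(a + b) * c = a * c + b * c" "a * (b + c) = a * b + a * c"
  "(r *\<^sub>R a) * b = r *\<^sub>R (a * b)" "a * (r *\<^sub>R b) = r *\<^sub>R (a * b)"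
  by (auto intro!: op_eqI simp: op_defs blinfun.bilinear_simps)
 show "(0::op) ~= 1" using norm_id_blinfun_l2 by (auto simp: op_defs Op_inject)
 show "sgn a = inverse (norm a) *\<^sub>R a" by (simp add: sgn_op_def)
 show "dist a b = norm (a - b)" by (simp add: dist_op_def)
 show "uniformity = (INF e\<in>{0 <..}. principal {(x::op, y). dist x y < e})" by (rule uniformity_op_def)
 show "open S = (\<forall>x\<in>S. \<forall>\<^sub>F (x', y) in uniformity. x' = x --> y \<in> S)" for S :: "op set" by (rule open_op_def)
 show "(norm a = 0) = (a = 0)" unfolding op_defs by (metis Op_inverse UNIV_I blop_inverse norm_eq_zero)
 show "norm (a + b) <= norm a + norm b" by (simp add: op_defs norm_triangle_ineq)
 show "norm (r *\<^sub>R a) = \<bar>r\<bar> * norm a" by (simp add: op_defs)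
 show "norm (a * b) <= norm a * norm b" by (simp add: op_defs norm_blinfun_compose)
 show "norm (1::op) = 1" by (simp add: op_defs norm_id_blinfun_l2)
qed
end

instance op :: banach
proof
 fix X :: "nat => op" assume "Cauchy X"
 hence "Cauchy (%n. blop (X n))"
  unfolding Cauchy_def dist_norm by (simp add: norm_op_def minus_op_def)
 then obtain B where "(%n. blop (X n)) ----> B" by (auto simp: Cauchy_convergent_iff convergent_def)
 hence "X ----> Op B"
  unfolding tendsto_iff dist_norm by (simp add: norm_op_def minus_op_def)
 thus "convergent X" by (auto simp: convergent_def)
qed

definition ap :: "op => l2 => l2" where "ap a u = blinfun_apply (blop a) u"

lemma bil_ap: "bounded_bilinear ap"
 by (rule bounded_bilinear.intro)
   (auto simp: ap_def op_defs blinfun.bilinear_simps intro!: exI[of _ 1] norm_blinfun)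

lemma ap_mult: "ap (a * b) u = ap a (ap b u)" by (simp add: ap_def times_op_def)
lemma ap_one [simp]: "ap 1 u = u" by (simp add: ap_def one_op_def)
lemma ap_Op: "bounded_linear f ==> ap (Op (Blinfun f)) u = f u"
 by (simp add: ap_def bounded_linear_Blinfun_apply)
lemmas ap_bilinear = bounded_bilinear.add_left[OF bil_ap] bounded_bilinear.add_right[OF bil_ap]
 bounded_bilinear.diff_left[OF bil_ap] bounded_bilinear.diff_right[OF bil_ap]
 bounded_bilinear.scaleR_left[OF bil_ap] bounded_bilinear.scaleR_right[OF bil_ap]
lemma op_eq_apI: "(!!u. ap a u = ap b u) ==> a = b" unfolding ap_def by (rule op_eqI)

section \<open>Exponentials of skew operators and their limit\<close>

lemma ap_exp_deriv: "((%t. ap (exp (t *\<^sub>R A)) u) hvd ap (exp (t *\<^sub>R A)) (ap A u)) (at t within S)"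
proof -
 have "((%t. exp (t *\<^sub>R A)) hvd exp (t *\<^sub>R A) * A) (at t within S)"
  by (rule exp_scaleR_has_vector_derivative_right)
 hence "((%t. ap (exp (t *\<^sub>R A)) u) hvd ap (exp (t *\<^sub>R A) * A) u) (at t within S)"
  by (rule lin_hvd[OF bounded_bilinear.bounded_linear_left[OF bil_ap]])
 thus ?thesis by (simp add: ap_mult)
qed

lemma exp_commute: fixes A B :: "'a::{real_normed_algebra_1,banach}" assumes "A * B = B * A" shows "exp A * B = B * exp A"
proof -
 have s: "summable (%n. A ^ n /\<^sub>R fact n)" by (rule summable_exp_generic)
 have "exp A * B = (\<Sum>n. (A ^ n /\<^sub>R fact n) * B)" unfolding exp_def by (rule suminf_mult2[OF s])
 also have "... = (\<Sum>n. B * (A ^ n /\<^sub>R fact n))" using power_commuting_commutes[OF assms] by simp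
 also have "... = B * exp A" unfolding exp_def by (rule suminf_mult[OF s])
 finally show ?thesis .
qed

lemma ap_exp_commute:
 assumes S: "bounded_linear S" and c: "!!u. ap A (S u) = S (ap A u)"
 shows "ap (exp (t *\<^sub>R A)) (S u) = S (ap (exp (t *\<^sub>R A)) u)"
proof -
 let ?B = "Op (Blinfun S)"
 have "(t *\<^sub>R A) * ?B = ?B * (t *\<^sub>R A)"
  by (rule op_eq_apI) (simp add: ap_mult ap_bilinear ap_Op[OF S] c linear_cmul[OF bounded_linear.linear[OF S]])
 from arg_cong[OF exp_commute[OF this], of "%a. ap a u"] show ?thesis by (simp add: ap_mult ap_Op[OF S])
qed

definition skew :: "op => bool" where "skew A \<longleftrightarrow> (\<forall>u. ap A u \<bullet> u = 0)"

lemma norm_skew_exp: assumes "skew A" shows "norm (ap (exp (t *\<^sub>R A)) u) = norm u"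
proof -
 let ?p = "%t. ap (exp (t *\<^sub>R A)) u"
 have d: "((%t. ?p t \<bullet> ?p t) has_real_derivative 0) (at t)" for t
 proof -
  have "exp (t *\<^sub>R A) * A = A * exp (t *\<^sub>R A)" by (rule exp_commute) simp
  hence "ap (exp (t *\<^sub>R A)) (ap A u) = ap A (?p t)" by (metis ap_mult)
  hence "(?p hvd ap A (?p t)) (at t)" using ap_exp_deriv[where S = UNIV] by metis
  hence "((%t. ?p t \<bullet> ?p t) hvd (?p t \<bullet> ap A (?p t) + ap A (?p t) \<bullet> ?p t)) (at t)"
   by (intro bil_hvd[OF bounded_bilinear_inner])
  thus ?thesis using assms by (simp add: skew_def inner_commute hrd_iff)
 qed
 have "?p t \<bullet> ?p t = ?p 0 \<bullet> ?p 0" by (rule DERIV_isconst_all) (use d in blast)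
 thus ?thesis by (simp add: norm_eq_sqrt_inner)
qed

lemma vector_mean_bound:
 fixes f :: "real => 'a::real_normed_vector"
 assumes d: "!!s. (f hvd f' s) (at s)" and b: "!!s. norm (f' s) <= B"
 shows "norm (f t - f s) <= B * \<bar>t - s\<bar>"
proof -
 have "norm (f t - f s) <= B * norm (t - s)"
 proof (rule differentiable_bound[of UNIV f "%s h. h *\<^sub>R f' s"])
  show "(f has_derivative (%h. h *\<^sub>R f' x)) (at x within UNIV)" for x
   using d[of x] by (simp add: has_vector_derivative_def)
  show "onorm (%h. h *\<^sub>R f' x) <= B" for x
  proof (rule onorm_le)
   show "norm (h *\<^sub>R f' x) <= B * norm h" for h
    using mult_right_mono[OF b[of x], of "\<bar>h\<bar>"] by (simp add: mult.commute)
  qed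
 qed auto
 thus ?thesis by simp
qed

lemma skew_exp_diff: assumes "skew A" shows "norm (ap (exp (t *\<^sub>R A)) u - ap (exp (s *\<^sub>R A)) u) <= norm (ap A u) * \<bar>t - s\<bar>"
 by (rule vector_mean_bound[OF ap_exp_deriv]) (simp add: norm_skew_exp[OF assms])

text \<open>A bounded approximation of the second derivative. The central difference is chosen
  because it is symmetric, so that i times it is skew, and because it commutes with the reflection
  as well as with translations.\<close>

definition Lh :: "real => l2 => l2" where
 "Lh h u = (tr h u - 2 *\<^sub>R u + tr (- h) u) /\<^sub>R h^2"

lemma lin_Lh: "bounded_linear (Lh h)"
 unfolding Lh_def
 by (intro bounded_linear_intros bounded_linear_add bounded_linear_sub lin_aff
    bounded_linear_const_scaleR bounded_linear_ident) auto

lemma lin_JLh: "bounded_linear (%u. J (Lh h u))"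
 by (rule bounded_linear_compose[OF lin_J lin_Lh])

definition G :: "real => op" where "G h = Op (Blinfun (%u. J (Lh h u)))"

lemma ap_G: "ap (G h) u = J (Lh h u)"
 unfolding G_def by (rule ap_Op[OF lin_JLh])

lemma inner_tr: "tr h u \<bullet> v = u \<bullet> tr (- h) v"
 using inner_aff[of 1 "-h" "tr h u" v] by (simp add: aff_aff)

lemma Lh_commute_linear:
 assumes S: "linear S" and c: "!!h u. tr h (S u) = S (tr (c * h) u)" "c = 1 \<or> c = -1" shows "Lh h (S u) = S (Lh h u)"
 using c(2) unfolding Lh_def
 by (auto simp: c(1) linear_add[OF S] linear_diff[OF S] linear_cmul[OF S])

lemma Lh_J: "Lh h (J u) = J (Lh h u)"
 by (rule Lh_commute_linear[of _ 1]) (auto simp: aff_J bounded_linear.linear[OF lin_J])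
lemma Lh_tr: "Lh h (tr k u) = tr k (Lh h u)"
 by (rule Lh_commute_linear[of _ 1]) (auto simp: aff_aff bounded_linear.linear[OF lin_aff] add.commute)
lemma Lh_rfl: "Lh h (rfl u) = rfl (Lh h u)"
 by (rule Lh_commute_linear[of _ "-1"]) (auto simp: aff_aff bounded_linear.linear[OF lin_aff])
lemma Lh_Lh: "Lh h (Lh k u) = Lh k (Lh h u)"
 by (rule Lh_commute_linear[of _ 1]) (auto simp: Lh_tr bounded_linear.linear[OF lin_Lh])

lemma Lh_sym: "Lh h u \<bullet> v = u \<bullet> Lh h v"
 unfolding Lh_def by (simp add: inner_left_distrib inner_right_distrib inner_diff_left inner_diff_right inner_tr)

lemma inner_J_Lh: "J (Lh h u) \<bullet> u = 0"
proof -
 have "J (Lh h u) \<bullet> u = - (Lh h u \<bullet> J u)" by (rule inner_J)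
 also have "Lh h u \<bullet> J u = u \<bullet> J (Lh h u)" by (simp add: Lh_sym Lh_J)
 finally show ?thesis by (simp add: inner_commute)
qed

lemma skew_G: "skew (G h)" by (simp add: skew_def ap_G inner_J_Lh)
lemma skew_diff: "skew A ==> skew B ==> skew (A - B)" by (simp add: skew_def ap_bilinear inner_diff_left)

lemma G_commute: "G h * G k = G k * G h"
 by (rule op_eq_apI) (simp add: ap_mult ap_G Lh_J Lh_Lh[of h k])

text \<open>The second difference quotient equals the translate by -h of the double average of z,
  and averages as well as translates converge strongly.\<close>

lemma Lh_tendsto: assumes "has_D u w" "has_D w z" shows "((%h. Lh h u) ---> z) (at_right 0)"
proof -
 have eq: "Lh h u = tr (- h) (avg h (avg h z))" if h: "0 < h" for h
 proof -
  have "avg h (avg h z) = (tr h (avg h w) - avg h w) /\<^sub>R h"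
   using tr_diff_avg[OF has_D_avg'[OF assms(2) h] h] by simp
  also have "avg h w = (tr h u - u) /\<^sub>R h" using tr_diff_avg[OF assms(1) h] by simp
  finally have "tr (- h) (avg h (avg h z)) = tr (- h) ((tr h ((tr h u - u) /\<^sub>R h) - (tr h u - u) /\<^sub>R h) /\<^sub>R h)" by simp
  also have "... = Lh h u"
   unfolding Lh_def
   by (simp add: linear_add[OF lin[OF lin_aff]] linear_diff[OF lin[OF lin_aff]] linear_cmul[OF lin[OF lin_aff]]
     aff_aff power2_eq_square algebra_simps scaleR_2)
  finally show ?thesis by simp
 qed
 have "((%h. norm (avg h z - z) + norm (avg h z - z) + norm (tr (-h) z - z)) ---> norm (z - z) + norm (z - z) + norm (z - z)) (at_right 0)"
 proof (intro tendsto_intros avg_tendsto)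
  have "((%h. tr h z) ---> z) (at 0)" by (rule tr_tendsto)
  moreover have "filterlim (%h::real. - h) (at 0) (at_right 0)"
   by (rule filterlim_atI) (auto intro!: tendsto_eq_intros simp: eventually_at_right_field intro: exI[of _ 1])
  ultimately show "((%h. tr (- h) z) ---> z) (at_right 0)" by (rule filterlim_compose)
 qed
 hence lim: "((%h. norm (avg h z - z) + norm (avg h z - z) + norm (tr (-h) z - z)) ---> 0) (at_right 0)" by simp
 have "norm (Lh h u - z) <= norm (avg h z - z) + norm (avg h z - z) + norm (tr (-h) z - z)" if h: "0 < h" for h
 proof -
  have "Lh h u - z = tr (- h) (avg h (avg h z - z) + (avg h z - z)) + (tr (- h) z - z)"
   by (simp add: eq[OF h] avg_diff[OF h] linear_diff[OF lin[OF lin_aff]]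
    linear_add[OF lin[OF lin_aff]])
  also have "norm ... <= norm (avg h (avg h z - z)) + norm (avg h z - z) + norm (tr (- h) z - z)"
   by (rule order_trans[OF norm_triangle_ineq]) (simp add: norm_aff norm_triangle_ineq)
  also have "norm (avg h (avg h z - z)) <= norm (avg h z - z)" by (rule norm_avg[OF h])
  finally show ?thesis by simp
 qed
 hence "((%h. Lh h u - z) ---> 0) (at_right 0)"
  by (intro Lim_null_comparison[OF _ lim]) (auto simp: eventually_at_right_field intro: exI[of _ 1])
 thus ?thesis by (simp add: LIM_zero_iff)
qed

abbreviation eps :: "nat => real" where "eps n \<equiv> inverse (real (Suc n))"

lemma eps_at_right: "filterlim eps (at_right 0) sequentially"
 by (rule tendsto_imp_filterlim_at_right[OF LIMSEQ_inverse_real_of_nat]) simp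

text \<open>The averages of u have the difference quotients as exact derivatives, so closedness of
  the derivative gives the claim.\<close>

lemma has_D_limI: assumes "((%h. (tr h u - u) /\<^sub>R h) ---> w) (at_right 0)" shows "has_D u w"
proof (rule has_D_closed(1))
 show "has_D (avg (eps n) u) ((tr (eps n) u - u) /\<^sub>R eps n)" for n by (rule has_D_avg) simp
 show "(%n. avg (eps n) u) ----> u" by (rule filterlim_compose[OF avg_tendsto eps_at_right])
 show "(%n. (tr (eps n) u - u) /\<^sub>R eps n) ----> w" by (rule filterlim_compose[OF assms eps_at_right])
qed

lemma H2_dense: assumes "0 < e" obtains v w z where "has_D v w" "has_D w z" "norm (u - v) < e"
proof -
 have "((%h. norm (avg h u - u) + norm (avg h u - u)) ---> norm (u - u) + norm (u - u)) (at_right 0)"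
  by (intro tendsto_intros avg_tendsto)
 hence "\<forall>\<^sub>F h in at_right 0. norm (avg h u - u) + norm (avg h u - u) < e"
  using assms by (intro order_tendstoD(2)[of _ "norm (u - u) + norm (u - u)"]) auto
 then obtain h where h: "0 < h" "norm (avg h u - u) + norm (avg h u - u) < e"
  unfolding eventually_at_right_field by (metis dense less_eq_real_def)
 have "norm (u - avg h (avg h u)) <= norm (u - avg h u) + norm (avg h (u - avg h u))"
  using norm_triangle_ineq[of "u - avg h u" "avg h (u - avg h u)"] by (simp add: avg_diff[OF h(1)])
 also have "... < e" using norm_avg[OF h(1), of "u - avg h u"] h(2) by (simp add: norm_minus_commute)
 finally have "norm (u - avg h (avg h u)) < e" .
 moreover have "has_D ((tr h (avg h u) - avg h u) /\<^sub>R h) ((tr h ((tr h u - u) /\<^sub>R h) - (tr h u - u) /\<^sub>R h) /\<^sub>R h)"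
  by (intro has_D_scaleR has_D_diff has_D_tr has_D_avg h(1))
 ultimately show ?thesis using that[OF has_D_avg[OF h(1)]] by blast
qed

definition En :: "nat => real => l2 => l2" where "En n t u = ap (exp (t *\<^sub>R G (eps n))) u"

lemma norm_En [simp]: "norm (En n t u) = norm u"
 by (simp add: En_def norm_skew_exp[OF skew_G])
lemma lin_En: "bounded_linear (En n t)"
 unfolding En_def by (rule bounded_bilinear.bounded_linear_right[OF bil_ap])
lemma En_diff: "En n t (u - v) = En n t u - En n t v"
 by (rule linear_diff[OF lin[OF lin_En]])

text \<open>The generators A, B commute, so exp (t A) - exp (t B) is the isometry exp (t B) applied
  to exp (t (A - B)) - 1; and A - B is again skew, so its orbit through u moves with constant
  speed.\<close>

lemma En_compare: "norm (En m t u - En n t u) <= \<bar>t\<bar> * norm (Lh (eps m) u - Lh (eps n) u)"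
proof -
 let ?A = "G (eps m)" and ?B = "G (eps n)"
 have "exp (t *\<^sub>R ?A) = exp (t *\<^sub>R ?B + t *\<^sub>R (?A - ?B))" by (simp add: algebra_simps)
 also have "... = exp (t *\<^sub>R ?B) * exp (t *\<^sub>R (?A - ?B))"
  by (rule exp_add_commuting) (simp add: algebra_simps G_commute)
 finally have "En m t u - En n t u = En n t (ap (exp (t *\<^sub>R (?A - ?B))) u - ap (exp (0 *\<^sub>R (?A - ?B))) u)"
  by (simp add: En_def ap_mult ap_bilinear)
 hence "norm (En m t u - En n t u) = norm (ap (exp (t *\<^sub>R (?A - ?B))) u - ap (exp (0 *\<^sub>R (?A - ?B))) u)" by simp
 also have "... <= norm (ap (?A - ?B) u) * \<bar>t - 0\<bar>" by (rule skew_exp_diff[OF skew_diff[OF skew_G skew_G]])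
 also have "ap (?A - ?B) u = J (Lh (eps m) u - Lh (eps n) u)"
  by (simp add: ap_bilinear ap_G linear_diff[OF lin[OF lin_J]])
 finally show ?thesis by (simp add: mult.commute)
qed

text \<open>On H^2 the generators converge; the isometry of all \<open>En n t\<close> carries the
  convergence over to the closure of H^2, uniformly for bounded t.\<close>

lemma En_Cauchy_uniform: assumes "0 < e" "0 <= T"
 obtains N where "!!m n t. m >= N ==> n >= N ==> \<bar>t\<bar> <= T ==> norm (En m t u - En n t u) < e"
proof -
 obtain v w z where v: "has_D v w" "has_D w z" "norm (u - v) < e / 3" using H2_dense[of "e/3" u] assms by auto
 have "Cauchy (%n. Lh (eps n) v)"
  by (rule LIMSEQ_imp_Cauchy[OF filterlim_compose[OF Lh_tendsto[OF v(1,2)] eps_at_right]])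
 moreover have "0 < e / (3 * (T + 1))" using assms by simp
 ultimately obtain N where N: "!!m n. m >= N ==> n >= N ==> norm (Lh (eps m) v - Lh (eps n) v) < e / (3 * (T + 1))"
  using CauchyD by blast
 show ?thesis
 proof (rule that[of N])
  fix m n t assume *: "m >= N" "n >= N" "\<bar>t\<bar> <= T"
  have "norm (En m t v - En n t v) <= \<bar>t\<bar> * norm (Lh (eps m) v - Lh (eps n) v)" by (rule En_compare)
  also have "... <= (T + 1) * (e / (3 * (T + 1)))" using N[OF *(1,2)] *(3) assms by (intro mult_mono) auto
  also have "... = e / 3" using assms(2) by (simp add: divide_simps)
  finally have 1: "norm (En m t v - En n t v) <= e / 3" .
  have "En m t u - En n t u = En m t (u - v) + (En m t v - En n t v) - En n t (u - v)" by (simp add: En_diff)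
  also have "norm ... <= norm (En m t (u - v)) + norm (En m t v - En n t v) + norm (En n t (u - v))"
   by (rule order_trans[OF norm_triangle_ineq4 add_right_mono[OF norm_triangle_ineq]])
  also have "... < e" using 1 v(3) by simp
  finally show "norm (En m t u - En n t u) < e" .
 qed
qed

definition U :: "real => l2 => l2" where "U t u = lim (%n. En n t u)"

lemma En_tendsto: "(%n. En n t u) ----> U t u"
proof -
 have "Cauchy (%n. En n t u)"
 proof (rule CauchyI)
  fix e :: real assume "0 < e"
  then obtain N where "!!m n s. m >= N ==> n >= N ==> \<bar>s\<bar> <= \<bar>t\<bar> ==> norm (En m s u - En n s u) < e"
   using En_Cauchy_uniform[of e "\<bar>t\<bar>" u] by auto
  thus "\<exists>M. \<forall>m\<ge>M. \<forall>n\<ge>M. norm (En m t u - En n t u) < e" by blast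
 qed
 thus ?thesis unfolding U_def by (simp add: Cauchy_convergent_iff convergent_LIMSEQ_iff)
qed

lemma En_uniform: assumes "0 < e" "0 <= T"
 obtains N where "!!n t. n >= N ==> \<bar>t\<bar> <= T ==> norm (En n t u - U t u) <= e"
proof -
 obtain N where N: "!!m n t. m >= N ==> n >= N ==> \<bar>t\<bar> <= T ==> norm (En m t u - En n t u) < e"
  using En_Cauchy_uniform[OF assms, of u] by auto
 show ?thesis
 proof (rule that[of N])
  fix n t assume *: "n >= N" "\<bar>t\<bar> <= T"
  have "(%m. norm (En n t u - En m t u)) ----> norm (En n t u - U t u)"
   by (intro tendsto_intros En_tendsto)
  thus "norm (En n t u - U t u) <= e"
   by (rule LIMSEQ_le_const2) (use N[OF *(1) _ *(2)] in "auto intro!: exI[of _ N] less_imp_le")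
 qed
qed

lemma norm_U [simp]: "norm (U t u) = norm u"
 using LIMSEQ_unique[OF tendsto_norm[OF En_tendsto[of t u]]] by simp

lemma U_add: "U t (u + v) = U t u + U t v"
 using LIMSEQ_unique[OF En_tendsto[of t "u + v"] tendsto_add[OF En_tendsto En_tendsto, of t u t v,
   folded linear_add[OF lin[OF lin_En]]]] by simp
lemma U_commute: assumes "bounded_linear S" "!!h u. Lh h (S u) = S (Lh h u)" "!!u. J (S u) = S (J u)"
 shows "U t (S u) = S (U t u)"
proof -
 have "En n t (S u) = S (En n t u)" for n
  unfolding En_def by (rule ap_exp_commute[OF assms(1)]) (simp add: ap_G assms)
 hence "(%n. S (En n t u)) ----> U t (S u)" using En_tendsto[of t "S u"] by simp
 thus ?thesis using bounded_linear.tendsto[OF assms(1) En_tendsto[of t u]] LIMSEQ_unique by blast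
qed
lemma U_scaleR: "U t (r *\<^sub>R u) = r *\<^sub>R U t u"
 by (rule U_commute[OF bounded_linear_scaleR_right])
   (auto simp: linear_cmul[OF lin[OF lin_Lh]] linear_cmul[OF lin[OF lin_J]])
lemma lin_U: "bounded_linear (U t)"
 by (rule bounded_linear_intro[where K = 1]) (auto simp: U_add U_scaleR)
lemma U_diff: "U t (u - v) = U t u - U t v"
 by (rule linear_diff[OF lin[OF lin_U]])
lemma U_J: "U t (J u) = J (U t u)" by (rule U_commute[OF lin_J]) (auto simp: Lh_J)
lemma U_tr: "U t (tr h u) = tr h (U t u)" by (rule U_commute[OF lin_aff]) (auto simp: Lh_tr aff_J)
lemma U_rfl: "U t (rfl u) = rfl (U t u)" by (rule U_commute[OF lin_aff]) (auto simp: Lh_rfl aff_J)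
lemma U_0 [simp]: "U 0 u = u"
 using LIMSEQ_unique[OF En_tendsto[of 0 u]] by (simp add: En_def)

lemma U_U: "U s (U t u) = U (s + t) u"
proof -
 have "(%n. En n s (En n t u)) ----> U s (U t u)"
 proof (rule Lim_transform)
  show "(%n. En n s (U t u)) ----> U s (U t u)" by (rule En_tendsto)
  have "(%n. norm (En n t u - U t u)) ----> norm (U t u - U t u)" by (intro tendsto_intros En_tendsto)
  hence "(%n. norm (En n s (En n t u) - En n s (U t u))) ----> 0" by (simp add: En_diff[symmetric])
  thus "(%n. En n s (En n t u) - En n s (U t u)) ----> 0" by (rule tendsto_norm_zero_cancel)
 qed
 moreover have "En n s (En n t u) = En n (s + t) u" for n
  unfolding En_def ap_mult[symmetric] scaleR_add_left by (subst exp_add_commuting) auto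
 ultimately show ?thesis using LIMSEQ_unique[OF En_tendsto[of "s + t" u]] by simp
qed

lemma U_inverse [simp]: "U (- t) (U t u) = u" "U t (U (- t) u) = u" by (simp_all add: U_U)

text \<open>U t commutes with translations, hence with difference quotients.\<close>

lemma has_D_U: assumes "has_D u w" shows "has_D (U t u) (U t w)"
proof (rule has_D_limI)
 have "((%h. U t (avg h w)) ---> U t w) (at_right 0)"
  by (rule bounded_linear.tendsto[OF lin_U avg_tendsto])
 moreover have "U t (avg h w) = (tr h (U t u) - U t u) /\<^sub>R h" if "0 < h" for h
  unfolding tr_diff_avg[OF assms that, symmetric] by (simp add: U_diff U_tr U_scaleR)
 hence "\<forall>\<^sub>F h in at_right 0. U t (avg h w) = (tr h (U t u) - U t u) /\<^sub>R h"
  by (auto simp: eventually_at_right_field intro: exI[of _ 1])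
 ultimately show "((%h. (tr h (U t u) - U t u) /\<^sub>R h) ---> U t w) (at_right 0)"
  by (rule Lim_transform_eventually)
qed

text \<open>The derivatives of the approximations are the approximate groups applied to J (Lh u),
  and these converge uniformly on bounded time intervals, so limit and derivative may be
  interchanged.\<close>

lemma U_deriv: assumes "has_D u w" "has_D w z" shows "((%t. U t u) hvd U t (J z)) (at t)"
proof -
 define T where "T = \<bar>t\<bar> + 1"
 have T: "0 <= T" by (simp add: T_def)
 have lim: "(%n. ap (G (eps n)) u) ----> J z" unfolding ap_G
  by (rule bounded_linear.tendsto[OF lin_J filterlim_compose[OF Lh_tendsto[OF assms] eps_at_right]])
 have "\<exists>g. \<forall>x\<in>{-T<..<T}. (%n. En n x u) ----> g x \<and> (g has_derivative (%h. h *\<^sub>R U x (J z))) (at x within {-T<..<T})"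
 proof (rule has_derivative_sequence)
  show "convex {-T<..<T}" by simp
  show "((%x. En n x u) has_derivative (%h. h *\<^sub>R En n x (ap (G (eps n)) u))) (at x within {-T<..<T})" for n x
   using ap_exp_deriv[of "G (eps n)" u x "{-T<..<T}"] by (simp add: En_def has_vector_derivative_def)
  show "(0::real) \<in> {-T<..<T}" using abs_ge_zero[of t] unfolding T_def by auto
  show "(%n. En n 0 u) ----> U 0 u" by (rule En_tendsto)
  fix e :: real assume "0 < e"
  obtain N1 where N1: "!!n t. n >= N1 ==> \<bar>t\<bar> <= T ==> norm (En n t (J z) - U t (J z)) <= e/2"
   using En_uniform[of "e/2" T "J z"] \<open>0 < e\<close> T by auto
  obtain N2 where N2: "!!n. n >= N2 ==> norm (ap (G (eps n)) u - J z) < e/2"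
   using LIMSEQ_D[OF lim, of "e/2"] \<open>0 < e\<close> by auto
  have "norm (h *\<^sub>R En n x (ap (G (eps n)) u) - h *\<^sub>R U x (J z)) <= e * norm h"
   if "n >= max N1 N2" "x \<in> {-T<..<T}" for n x h
  proof -
   have "En n x (ap (G (eps n)) u) - U x (J z) = En n x (ap (G (eps n)) u - J z) + (En n x (J z) - U x (J z))" by (simp add: En_diff)
   also have "norm ... <= norm (ap (G (eps n)) u - J z) + norm (En n x (J z) - U x (J z))"
    by (rule order_trans[OF norm_triangle_ineq]) simp
   also have "... <= e"
   proof -
    have "\<bar>x\<bar> <= T" "n >= N1" "n >= N2" using that by auto
    from N1[OF this(2,1)] N2[OF this(3)] show ?thesis by linarith
   qed
   finally have "norm (En n x (ap (G (eps n)) u) - U x (J z)) * \<bar>h\<bar> <= e * \<bar>h\<bar>" by (intro mult_right_mono) auto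
   thus ?thesis by (simp add: scaleR_diff_right[symmetric] mult.commute)
  qed
  thus "\<forall>\<^sub>F n in sequentially. \<forall>x\<in>{-T<..<T}. \<forall>h. norm (h *\<^sub>R En n x (ap (G (eps n)) u) - h *\<^sub>R U x (J z)) <= e * norm h"
   unfolding eventually_sequentially by blast
 qed
 then obtain g where g: "!!x. x \<in> {-T<..<T} ==> (%n. En n x u) ----> g x"
   "!!x. x \<in> {-T<..<T} ==> (g has_derivative (%h. h *\<^sub>R U x (J z))) (at x within {-T<..<T})" by blast
 have t: "t \<in> {-T<..<T}" by (auto simp: T_def)
 have geq: "g x = U x u" if "x \<in> {-T<..<T}" for x using LIMSEQ_unique[OF g(1)[OF that] En_tendsto] .
 have "((%t. U t u) has_derivative (%h. h *\<^sub>R U t (J z))) (at t within {-T<..<T})"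
  by (rule has_derivative_transform[OF t geq[symmetric] g(2)[OF t]])
 thus ?thesis using t by (simp add: has_vector_derivative_def at_within_open[OF t])
qed

lemma U_continuous: "continuous_on UNIV (%t. U t u)"
 unfolding continuous_on_iff
proof (intro ballI allI impI)
 fix t e :: real assume "0 < e"
 obtain v w z where v: "has_D v w" "has_D w z" "norm (u - v) < e / 3" using H2_dense[of "e/3" u] \<open>0 < e\<close> by auto
 have "((%t. U t v) hvd U t (J z)) (at t)" by (rule U_deriv[OF v(1,2)])
 hence "continuous (at t) (%t. U t v)" by (rule has_vector_derivative_continuous)
 then obtain d where d: "d > 0" "!!s. dist s t < d ==> dist (U s v) (U t v) < e / 3"
  unfolding continuous_at_eps_delta using \<open>0 < e\<close> by (meson divide_pos_pos zero_less_numeral)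
 have "dist (U s u) (U t u) < e" if "dist s t < d" for s
 proof -
  have "U s u - U t u = U s (u - v) + (U s v - U t v) - U t (u - v)" by (simp add: U_diff)
  also have "norm ... <= norm (U s (u - v)) + norm (U s v - U t v) + norm (U t (u - v))"
   by (rule order_trans[OF norm_triangle_ineq4 add_right_mono[OF norm_triangle_ineq]])
  also have "... < e" using v(3) d(2)[OF that] by (simp add: dist_norm)
  finally show ?thesis by (simp add: dist_norm)
 qed
 thus "\<exists>d>0. \<forall>s\<in>UNIV. dist s t < d --> dist (U s u) (U t u) < e" using d(1) by blast
qed

section \<open>Calculus along the group, symmetries of the nonlinearity\<close>

lemma hvd_iff:
 "(f hvd f') (at t within S) \<longleftrightarrow> ((%s. (f s - f t) /\<^sub>R (s - t)) ---> f') (at t within S)"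
proof -
 have "(f hvd f') (at t within S) \<longleftrightarrow> ((%s. norm ((f s - f t) - (s - t) *\<^sub>R f') / norm (s - t)) ---> 0) (at t within S)"
  unfolding has_vector_derivative_def has_derivative_iff_norm by (simp add: bounded_linear_scaleR_left)
 also have "... \<longleftrightarrow> ((%s. norm ((f s - f t) /\<^sub>R (s - t) - f')) ---> 0) (at t within S)"
 proof (rule tendsto_cong)
  show "\<forall>\<^sub>F s in at t within S. norm ((f s - f t) - (s - t) *\<^sub>R f') / norm (s - t) = norm ((f s - f t) /\<^sub>R (s - t) - f')"
   unfolding eventually_at
  proof (intro exI[of _ 1] conjI ballI impI)
   fix s assume "s ~= t \<and> dist s t < 1"
   hence "(f s - f t) /\<^sub>R (s - t) - f' = ((f s - f t) - (s - t) *\<^sub>R f') /\<^sub>R (s - t)"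
    by (simp add: scaleR_diff_right)
   thus "norm ((f s - f t) - (s - t) *\<^sub>R f') / norm (s - t) = norm ((f s - f t) /\<^sub>R (s - t) - f')"
    by (simp add: divide_inverse mult.commute)
  qed simp
 qed
 also have "... \<longleftrightarrow> ((%s. (f s - f t) /\<^sub>R (s - t)) ---> f') (at t within S)"
  by (simp add: tendsto_norm_zero_iff LIM_zero_iff)
 finally show ?thesis .
qed

lemma norm_le_integral:
 fixes y :: "real => 'a::banach"
 assumes d: "!!t. t \<in> {0..T} ==> (y hvd y' t) (at t within {0..T})"
  and g: "continuous_on {0..T} g" and le: "!!t. t \<in> {0..T} ==> norm (y' t) <= g t" and t: "t \<in> {0..T}"
 shows "norm (y t) <= norm (y 0) + integral {0..t} g"
proof -
 have ftc: "(y' has_integral y t - y 0) {0..t}"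
  by (rule fundamental_theorem_of_calculus) (use t in "auto intro!: has_vector_derivative_within_subset[OF d]")
 have "norm (integral {0..t} y') <= integral {0..t} g"
 proof (rule Henstock_Kurzweil_Integration.integral_norm_bound_integral)
  show "y' integrable_on {0..t}" using ftc by blast
  show "g integrable_on {0..t}"
   by (rule integrable_continuous_real[OF continuous_on_subset[OF g]]) (use t in auto)
 qed (use le t in auto)
 moreover have "integral {0..t} y' = y t - y 0" using ftc by (rule integral_unique)
 ultimately show ?thesis using norm_triangle_sub[of "y t" "y 0"] by simp
qed

lemma zero_deriv_const:
 fixes f :: "real => 'a::real_normed_vector"
 assumes "!!t. t \<in> {0..\<tau>} ==> (f hvd 0) (at t within {0..\<tau>})" and t: "t \<in> {0..\<tau>}"
 shows "f t = f 0"
proof -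
 from has_vector_derivative_zero_constant[OF convex_real_interval(5) assms(1)]
 obtain c where c: "!!x. x \<in> {0..\<tau>} ==> f x = c" by blast
 show ?thesis using c[OF t] c[of 0] t by simp
qed

lemma U_tendsto: assumes "(y ---> y0) F" "(f ---> t0) F" shows "((%s. U (f s) (y s)) ---> U t0 y0) F"
proof -
 have "((%s. U (f s) y0) ---> U t0 y0) F"
  by (rule continuous_on_tendsto_compose[OF U_continuous assms(2)]) auto
 moreover have "((%s. norm (y s - y0)) ---> norm (y0 - y0)) F" by (intro tendsto_intros assms)
 hence "((%s. U (f s) (y s) - U (f s) y0) ---> 0) F"
  by - (rule tendsto_norm_zero_cancel, simp add: U_diff[symmetric])
 ultimately have "((%s. U (f s) y0 + (U (f s) (y s) - U (f s) y0)) ---> U t0 y0 + 0) F"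
  by (rule tendsto_add)
 thus ?thesis by simp
qed

text \<open>The group is only strongly continuous, so no product rule for operators is at hand. The
  difference quotient is split into U s applied to the quotient of y, and the quotient of U on the
  fixed vector y t, which lies in the domain of the generator.\<close>

lemma U_hvd:
 assumes y: "(y hvd y') (at t within S)" and D: "has_D (y t) w" "has_D w z"
 shows "((%t. U t (y t)) hvd J (U t z) + U t y') (at t within S)"
 unfolding hvd_iff
proof -
 have a: "((%s. U s ((y s - y t) /\<^sub>R (s - t))) ---> U t y') (at t within S)"
  by (rule U_tendsto[OF y[unfolded hvd_iff] tendsto_ident_at])
 have "((%t'. U t' (y t)) hvd U t (J z)) (at t within S)"
  by (rule has_vector_derivative_at_within[OF U_deriv[OF D]])
 hence b: "((%s. (U s (y t) - U t (y t)) /\<^sub>R (s - t)) ---> J (U t z)) (at t within S)"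
  unfolding hvd_iff U_J .
 have "(%s. (U s (y s) - U t (y t)) /\<^sub>R (s - t)) = (%s. (U s (y t) - U t (y t)) /\<^sub>R (s - t) + U s ((y s - y t) /\<^sub>R (s - t)))"
  by (rule ext) (simp add: U_scaleR U_diff algebra_simps)
 thus "((%s. (U s (y s) - U t (y t)) /\<^sub>R (s - t)) ---> J (U t z) + U t y') (at t within S)"
  using tendsto_add[OF b a] by simp
qed

lemma cb_tendsto:
 assumes "!!s. s \<in> S ==> has_D (q s) (w s)" "t \<in> S" "(q ---> q t) (at t within S)" "(w ---> w t) (at t within S)"
 shows "((%s. cb (q s)) ---> cb (q t)) (at t within S)"
proof -
 have "((%s. norm (q s - q t) + norm (w s - w t)) ---> norm (q t - q t) + norm (w t - w t)) (at t within S)"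
  by (intro tendsto_intros assms)
 hence lim: "((%s. norm (q s - q t) + norm (w s - w t)) ---> 0) (at t within S)" by simp
 have "((%s. cb (q s) - cb (q t)) ---> 0) (at t within S)"
 proof (rule Lim_null_comparison[OF _ lim])
  have "norm (cb (q s) - cb (q t)) <= norm (q s - q t) + norm (w s - w t)" if "s \<in> S" for s
   using norm_cb[OF has_D_diff[OF assms(1)[OF that] assms(1)[OF assms(2)]]]
    cb_diff[OF assms(1)[OF that] assms(1)[OF assms(2)]] by simp
  thus "\<forall>\<^sub>F s in at t within S. norm (cb (q s) - cb (q t)) <= norm (q s - q t) + norm (w s - w t)"
   by (simp add: eventually_at_filter)
 qed
 thus ?thesis by (simp add: LIM_zero_iff)
qed

text \<open>Translation invariance of the inner product gives the identity for difference quotients,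
  without boundary terms at infinity to be discussed.\<close>

lemma inner_D: assumes "has_D u w" "has_D v z" shows "w \<bullet> v = - (u \<bullet> z)"
proof -
 have a: "((%h. avg h w \<bullet> v) ---> w \<bullet> v) (at_right 0)" by (intro tendsto_intros avg_tendsto)
 have b: "((%h. - (tr h u \<bullet> avg h z)) ---> - (u \<bullet> z)) (at_right 0)"
  by (intro tendsto_intros avg_tendsto tendsto_mono[OF _ tr_tendsto] at_le) auto
 have "avg h w \<bullet> v = - (tr h u \<bullet> avg h z)" if h: "0 < h" for h
 proof -
  have "tr h u \<bullet> tr h v = u \<bullet> v" by (rule inner_aff) simp
  thus ?thesis unfolding tr_diff_avg[OF assms(1) h, symmetric] tr_diff_avg[OF assms(2) h, symmetric]
   by (simp add: inner_diff_left inner_diff_right algebra_simps)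
 qed
 hence "\<forall>\<^sub>F h in at_right 0. avg h w \<bullet> v = - (tr h u \<bullet> avg h z)"
  by (auto simp: eventually_at_right_field intro: exI[of _ 1])
 hence ev: "\<forall>\<^sub>F h in at_right 0. - (tr h u \<bullet> avg h z) = avg h w \<bullet> v" by (rule eventually_mono) simp
 have "((%h. avg h w \<bullet> v) ---> - (u \<bullet> z)) (at_right 0)" by (rule Lim_transform_eventually[OF b ev])
 thus ?thesis using tendsto_unique[OF trivial_limit_at_right_real a] by blast
qed

lemma inner_cj: "cj u \<bullet> cj v = u \<bullet> v"
proof -
 have "cj u \<bullet> cj v = (LINT x|lborel. rep_l2 u x \<bullet> rep_l2 v x)"
  unfolding inner_l2_rep
  by (rule integral_cong_AE) (use rep_cj[of u] rep_cj[of v] in "auto simp: inner_complex_def")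
 thus ?thesis by (simp add: inner_l2_rep)
qed

lemma pr_commute: "has_D u w ==> has_D v z ==> pr u v = pr v u"
 unfolding pr_def by (rule mul_cb_commute) (rule has_D_cb, assumption)+

lemma NL_eq: "has_D u w ==> NL u = (1/2) *\<^sub>R mul (cmul (cb u) (ccnj (cb u))) u"
 unfolding NL_def cub_def pr_def by (simp add: cb_cj mul_mul)

text \<open>The nonlinearity multiplies u by a real function, which commutes with i and is
  symmetric; the skewness of i then forces the inner product to vanish. This is the gauge invariance
  behind conservation of mass.\<close>

lemma inner_J_NL: assumes "has_D u w" shows "J (NL u) \<bullet> u = 0"
proof -
 let ?t = "cmul (cb u) (ccnj (cb u))"
 have r: "ccnj ?t = ?t" by (rule bcontfun_eqI) (simp add: mult.commute)
 have "J (mul ?t u) \<bullet> u = mul ?t (J u) \<bullet> u" by (simp add: J_mul)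
 also have "... = J u \<bullet> mul ?t u" by (simp add: inner_mul r)
 also have "... = - (u \<bullet> J (mul ?t u))" by (rule inner_J)
 finally have "J (mul ?t u) \<bullet> u = 0" by (simp add: inner_commute)
 thus ?thesis unfolding NL_eq[OF assms]
  by (simp add: linear_cmul[OF lin[OF lin_J]])
qed

section \<open>Global solutions of the cubic Schroedinger equation\<close>

text \<open>A solution with H^2 regularity on a bounded time interval, enough for both conservation
  laws. They are thus available for every mild solution before its global existence is
  known.\<close>

locale nls_reg =
 fixes q w z :: "real => l2" and \<tau> :: real
 assumes qw: "!!t. t \<in> {0..\<tau>} ==> has_D (q t) (w t)" and wz: "!!t. t \<in> {0..\<tau>} ==> has_D (w t) (z t)"
  and cw: "continuous_on {0..\<tau>} w" and cz: "continuous_on {0..\<tau>} z"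
  and eq: "!!t. t \<in> {0..\<tau>} ==> (q hvd J (z t + NL (q t))) (at t within {0..\<tau>})"
begin

lemma cq: "continuous_on {0..\<tau>} q"
 using eq by (rule continuous_on_vector_derivative)

lemma mass: assumes t: "t \<in> {0..\<tau>}" shows "norm (q t) = norm (q 0)"
proof -
 have "((%t. q t \<bullet> q t) hvd 0) (at t within {0..\<tau>})" if t: "t \<in> {0..\<tau>}" for t
 proof -
  have "((%t. q t \<bullet> q t) hvd q t \<bullet> J (z t + NL (q t)) + J (z t + NL (q t)) \<bullet> q t) (at t within {0..\<tau>})"
   by (rule bil_hvd[OF bounded_bilinear_inner eq[OF t] eq[OF t]])
  moreover have "J (z t + NL (q t)) \<bullet> q t = 0"
  proof -
   have "J (z t) \<bullet> q t = - (J (w t) \<bullet> w t)"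
    using inner_D[OF has_D_J[OF wz[OF t]] qw[OF t]] by simp
   thus ?thesis using inner_J_NL[OF qw[OF t]]
    by (simp add: linear_add[OF lin[OF lin_J]] inner_add_left)
  qed
  ultimately show "((%t. q t \<bullet> q t) hvd 0) (at t within {0..\<tau>})"
   by (simp add: inner_commute)
 qed
 from zero_deriv_const[OF this t] show ?thesis by (simp add: norm_eq_sqrt_inner)
qed

definition H :: "real => real" where
 "H t = w t \<bullet> w t - (1/4) * (pr (q t) (cj (q t)) \<bullet> pr (q t) (cj (q t)))"

text \<open>The flow is Hamiltonian: the derivative of H is a multiple of the inner product of p = J
  (z + NL q) with z + NL q, which is 0 because J is skew.\<close>

lemma energy: assumes t: "t \<in> {0..\<tau>}" shows "H t = H 0"
proof -
 have "(H hvd 0) (at t within {0..\<tau>})" if t: "t \<in> {0..\<tau>}" for t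
 proof -
  let ?F = "at t within {0..\<tau>}"
  define p where "p = J (z t + NL (q t))"
  have lq: "(q ---> q t) ?F" "(w ---> w t) ?F" "(z ---> z t) ?F"
   using cq cw cz t by (auto simp: continuous_on_def)
  have dq: "((%s. (q s - q t) /\<^sub>R (s - t)) ---> p) ?F" using eq[OF t] unfolding hvd_iff p_def .
  have lcb: "((%s. cb (q s)) ---> cb (q t)) ?F" by (rule cb_tendsto[OF qw t lq(1,2)])
  have ev: "\<forall>\<^sub>F s in ?F. s \<in> {0..\<tau>}" by (simp add: eventually_at_filter)
  \<comment> \<open>As q_t lies only in L^2, w need not be differentiable in t. Integration by parts
    in space rewrites the increment of the square of w as minus the inner product of q s - q t with
    z s + z t, and here only q has to be differentiated.\<close>
  have 1: "((%s. w s \<bullet> w s) hvd (- (p \<bullet> (z t + z t)))) ?F" unfolding hvd_iff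
  proof (rule Lim_transform_eventually)
   show "((%s. - (((q s - q t) /\<^sub>R (s - t)) \<bullet> (z s + z t))) ---> - (p \<bullet> (z t + z t))) ?F"
    by (intro tendsto_intros dq lq)
   show "\<forall>\<^sub>F s in ?F. - (((q s - q t) /\<^sub>R (s - t)) \<bullet> (z s + z t)) = (w s \<bullet> w s - w t \<bullet> w t) /\<^sub>R (s - t)"
    using ev
   proof eventually_elim
    fix s assume s: "s \<in> {0..\<tau>}"
    have "w s \<bullet> w s = - (q s \<bullet> z s)" "w t \<bullet> w t = - (q t \<bullet> z t)" "w s \<bullet> w t = - (q s \<bullet> z t)" "w t \<bullet> w s = - (q t \<bullet> z s)"
     using inner_D[OF qw wz] s t by blast+
    thus "- (((q s - q t) /\<^sub>R (s - t)) \<bullet> (z s + z t)) = (w s \<bullet> w s - w t \<bullet> w t) /\<^sub>R (s - t)"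
     by (simp add: inner_diff_left inner_add_right inner_commute[of "w t" "w s"] algebra_simps)
   qed
  qed
  let ?\<phi> = "cb (q t)"
  have 2: "((%s. pr (q s) (cj (q s))) hvd (mul ?\<phi> (cj p) + mul (ccnj ?\<phi>) p)) ?F" unfolding hvd_iff
  proof (rule Lim_transform_eventually)
   show "((%s. mul (cb (q s)) (cj ((q s - q t) /\<^sub>R (s - t))) + mul (ccnj ?\<phi>) ((q s - q t) /\<^sub>R (s - t))) ---> mul ?\<phi> (cj p) + mul (ccnj ?\<phi>) p) ?F"
    by (intro tendsto_add bounded_bilinear.tendsto[OF bil_mul] lcb tendsto_const dq
      bounded_linear.tendsto[OF lin_cj])
   show "\<forall>\<^sub>F s in ?F. mul (cb (q s)) (cj ((q s - q t) /\<^sub>R (s - t))) + mul (ccnj ?\<phi>) ((q s - q t) /\<^sub>R (s - t))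
     = (pr (q s) (cj (q s)) - pr (q t) (cj (q t))) /\<^sub>R (s - t)"
    using ev
   proof eventually_elim
    fix s assume s: "s \<in> {0..\<tau>}"
    have "mul (ccnj ?\<phi>) (q s - q t) = pr (cj (q t)) (q s - q t)"
     unfolding pr_def cb_cj[OF qw[OF t]] ..
    also have "... = pr (q s - q t) (cj (q t))"
     by (rule pr_commute[OF has_D_cj[OF qw[OF t]] has_D_diff[OF qw[OF s] qw[OF t]]])
    also have "... = pr (q s) (cj (q t)) - pr (q t) (cj (q t))"
     by (rule pr_diff_left[OF qw[OF s] qw[OF t]])
    finally have a: "mul (ccnj ?\<phi>) (q s - q t) = pr (q s) (cj (q t)) - pr (q t) (cj (q t))" .
    have b: "mul (cb (q s)) (cj (q s - q t)) = pr (q s) (cj (q s)) - pr (q s) (cj (q t))"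
     unfolding pr_def cj_diff by (rule bounded_bilinear.diff_right[OF bil_mul])
    show "mul (cb (q s)) (cj ((q s - q t) /\<^sub>R (s - t))) + mul (ccnj ?\<phi>) ((q s - q t) /\<^sub>R (s - t))
     = (pr (q s) (cj (q s)) - pr (q t) (cj (q t))) /\<^sub>R (s - t)"
     unfolding cj_scaleR bounded_bilinear.scaleR_right[OF bil_mul] scaleR_add_right[symmetric] a b by simp
   qed
  qed
  let ?s = "pr (q t) (cj (q t))"
  have cs: "cj ?s = ?s"
   unfolding pr_def cj_mul cj_cj cb_cj[OF qw[OF t], symmetric]
   using pr_commute[OF has_D_cj[OF qw[OF t]] qw[OF t]] by (simp add: pr_def)
  have ms: "mul ?\<phi> ?s = 2 *\<^sub>R NL (q t)"
   unfolding NL_def cub_def using pr_commute[OF has_D_cj[OF qw[OF t]] qw[OF t]] by (simp add: pr_def)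
  have "?s \<bullet> mul (ccnj ?\<phi>) p = mul ?\<phi> ?s \<bullet> p" by (simp add: inner_mul)
  moreover have "?s \<bullet> mul ?\<phi> (cj p) = mul ?\<phi> ?s \<bullet> p"
  proof -
   have "?s \<bullet> mul ?\<phi> (cj p) = cj ?s \<bullet> mul ?\<phi> (cj p)" by (simp add: cs)
   also have "... = ?s \<bullet> cj (mul ?\<phi> (cj p))" using inner_cj[of ?s "cj (mul ?\<phi> (cj p))"] by simp
   also have "... = ?s \<bullet> mul (ccnj ?\<phi>) p" by (simp add: cj_mul)
   finally show ?thesis by (simp add: inner_mul)
  qed
  ultimately have 3: "?s \<bullet> (mul ?\<phi> (cj p) + mul (ccnj ?\<phi>) p) = 4 * (NL (q t) \<bullet> p)"
   by (simp add: inner_add_right ms)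
  have 4: "((%s. pr (q s) (cj (q s)) \<bullet> pr (q s) (cj (q s))) hvd 8 * (NL (q t) \<bullet> p)) ?F"
   by (rule has_vector_derivative_eq_rhs[OF bil_hvd[OF bounded_bilinear_inner 2 2]])
     (use 3 in "simp add: inner_commute")
  have 5: "((%s. (1/4) * (pr (q s) (cj (q s)) \<bullet> pr (q s) (cj (q s)))) hvd (1/4) * (8 * (NL (q t) \<bullet> p))) ?F"
   by (rule has_vector_derivative_mult_right[OF 4])
  have "(H hvd (- (p \<bullet> (z t + z t)) - (1/4) * (8 * (NL (q t) \<bullet> p)))) ?F"
   unfolding H_def[abs_def] by (rule has_vector_derivative_diff[OF 1 5])
  also have "- (p \<bullet> (z t + z t)) - (1/4) * (8 * (NL (q t) \<bullet> p)) = - 2 * (p \<bullet> (z t + NL (q t)))"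
   by (simp add: inner_add_right inner_commute[of "NL (q t)"])
  also have "p \<bullet> (z t + NL (q t)) = 0" unfolding p_def by simp
  finally show "(H hvd 0) ?F" by simp
 qed
 from zero_deriv_const[OF this t] show ?thesis .
qed

text \<open>The equation is focusing, so the quartic term of H has the wrong sign. In the sup bound
  for q the length l = 1 / (m^2 + 1) is taken, where m is the conserved norm of q: then l m^2 <= 1,
  the quartic term costs at most half of the square of w, and it can be absorbed.\<close>

lemma H1_bound: assumes t: "t \<in> {0..\<tau>}"
 shows "(norm (w t))^2 <= 2 * \<bar>H 0\<bar> + (norm (q 0)) ^ 4 * ((norm (q 0))^2 + 1)"
proof -
 define m where "m = norm (q 0)"
 have m: "norm (q t) = m" using mass[OF t] by (simp add: m_def)
 have m0: "0 <= m" by (simp add: m_def)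
 define l where "l = 1 / (m^2 + 1)"
 have l: "0 < l" by (simp add: l_def add_nonneg_pos)
 have lm: "l * m^2 <= 1" "1 / l = m^2 + 1" by (auto simp: l_def divide_le_eq add_nonneg_pos)
 let ?W = "norm (w t)"
 let ?s = "pr (q t) (cj (q t))"
 have "norm ?s <= norm (cb (q t)) * m" unfolding pr_def using norm_mul[of "cb (q t)" "cj (q t)"] m by simp
 also have "... <= (m / sqrt l + sqrt l * ?W) * m"
  using norm_cb_le[OF qw[OF t] l] m m0 by (intro mult_right_mono) auto
 finally have "(norm ?s)^2 <= ((m / sqrt l + sqrt l * ?W) * m)^2" by (intro power_mono) auto
 also have "... = (m / sqrt l + sqrt l * ?W)^2 * m^2" by (simp add: power_mult_distrib)
 also have "... <= (2 * (m / sqrt l)^2 + 2 * (sqrt l * ?W)^2) * m^2"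
  using sum_squares_bound[of "m / sqrt l" "sqrt l * ?W"] by (intro mult_right_mono) (auto simp: power2_sum)
 also have "... = 2 * m ^ 4 * (1 / l) + 2 * (l * m^2) * ?W^2"
  using l by (simp add: power_divide power_mult_distrib algebra_simps power4_eq_xxxx power2_eq_square)
 also have "... <= 2 * m ^ 4 * (m^2 + 1) + 2 * 1 * ?W^2"
  unfolding lm(2) by (intro add_left_mono mult_right_mono mult_left_mono lm(1)) auto
 finally have s: "(norm ?s)^2 <= 2 * m ^ 4 * (m^2 + 1) + 2 * ?W^2" by simp
 have "?W^2 = H 0 + (1/4) * (norm ?s)^2"
  using energy[OF t] by (simp add: H_def power2_norm_eq_inner)
 thus ?thesis using s unfolding m_def[symmetric] by (simp add: algebra_simps)
qed

end

text \<open>With a metric on the natural numbers, bounded sequences in a Banach space are bounded continuous functions,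
 hence form a Banach space.\<close>

instantiation nat :: metric_space
begin
definition dist_nat :: "nat => nat => real" where "dist_nat m n = \<bar>real m - real n\<bar>"
definition uniformity_nat :: "(nat \<times> nat) filter"
 where "uniformity_nat = (INF e\<in>{0 <..}. principal {(x, y). dist x y < e})"
instance
proof
 show "uniformity = (INF e\<in>{0 <..}. principal {(x::nat, y). dist x y < e})" by (rule uniformity_nat_def)
 have eq: "b = x" if "\<bar>real x - real b\<bar> < 1" for x b :: nat
 proof -
  have "real_of_int \<bar>int x - int b\<bar> < 1" using that by simp
  hence "\<bar>int x - int b\<bar> < 1" by linarith
  thus ?thesis by simp
 qed
 fix S :: "nat set"
 have "\<forall>\<^sub>F (x', y) in uniformity. x' = x --> y \<in> S" if "x \<in> S" for x
  unfolding uniformity_nat_def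
  by (rule eventually_INF1[of 1]) (use that in "auto simp: eventually_principal dist_nat_def dest!: eq")
 thus "open S = (\<forall>x\<in>S. \<forall>\<^sub>F (x', y) in uniformity. x' = x --> y \<in> S)"
  by (auto simp: open_discrete)
qed (auto simp: dist_nat_def)
end

instance bcontfun :: (metric_space, banach) banach ..

type_synonym seq = "nat \<Rightarrow>\<^sub>C l2"
abbreviation sq :: "seq => nat => l2" where "sq == apply_bcontfun"

definition mk :: "nat => (nat => l2) => seq" where "mk k f = Bcontfun (%j. if j <= k then f j else 0)"

lemma sq_mk [simp]: "sq (mk k f) j = (if j <= k then f j else 0)"
proof -
 have "(%j. if j <= k then f j else 0) \<in> bcontfun"
 proof (rule bcontfun_normI)
  show "continuous_on UNIV (%j. if j <= k then f j else 0)" by simp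
  show "norm (if j <= k then f j else 0) <= (\<Sum>i\<le>k. norm (f i))" for j
   by (auto intro!: member_le_sum[of j "{..k}" "%i. norm (f i)"] sum_nonneg)
 qed
 thus ?thesis by (simp add: mk_def Bcontfun_inverse)
qed

lemma sq_tendsto: "(P ---> Q) F ==> ((%x. sq (P x) j) ---> sq Q j) F"
 by (rule metric_tendsto_imp_tendsto) (auto intro!: always_eventually dist_bounded)

definition supp :: "nat => seq => bool" where "supp k P \<longleftrightarrow> (\<forall>j>k. sq P j = 0)"

lemma norm_seq_le_sum: "supp k P ==> norm P <= (\<Sum>j\<le>k. norm (sq P j))"
proof (rule norm_bound)
 fix j assume "supp k P"
 thus "norm (sq P j) <= (\<Sum>j\<le>k. norm (sq P j))"
  by (cases "j <= k") (auto simp: supp_def intro: member_le_sum[of j "{..k}" "%i. norm (sq P i)"] sum_nonneg)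
qed

lemma sum_le_norm_seq: "(\<Sum>j\<le>k. norm (sq P j)) <= real (Suc k) * norm P"
 using sum_bounded_above[of "{..k}" "%j. norm (sq P j)" "norm P"] by (simp add: norm_bounded)

lemma seq_tendstoI:
 assumes "!!x. supp k (P x)" "supp k Q" "!!j. ((%x. sq (P x) j) ---> sq Q j) F"
 shows "(P ---> Q) F"
proof -
 have "((%x. \<Sum>j\<le>k. norm (sq (P x) j - sq Q j)) ---> (\<Sum>j\<le>k. norm (sq Q j - sq Q j))) F"
  by (intro tendsto_intros assms)
 hence lim: "((%x. \<Sum>j\<le>k. norm (sq (P x) j - sq Q j)) ---> 0) F" by simp
 have "((%x. P x - Q) ---> 0) F"
 proof (rule Lim_null_comparison[OF _ lim], rule always_eventually, rule allI)
  fix x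
  have "supp k (P x - Q)" using assms(1)[of x] assms(2) by (simp add: supp_def)
  from norm_seq_le_sum[OF this] show "norm (P x - Q) <= (\<Sum>j\<le>k. norm (sq (P x) j - sq Q j))" by simp
 qed
 thus ?thesis by (simp add: LIM_zero_iff)
qed

text \<open>The even functions of H^k, as the closed subspace of sequences u, Du, ..., D^k u, 0, 0, ...\<close>

definition Xk :: "nat => seq set" where
 "Xk k = {P. (\<forall>j<k. has_D (sq P j) (sq P (Suc j))) \<and> supp k P \<and> rfl (sq P 0) = sq P 0}"

lemma XkD: "P \<in> Xk k ==> j < k ==> has_D (sq P j) (sq P (Suc j))" "P \<in> Xk k ==> supp k P"
 "P \<in> Xk k ==> rfl (sq P 0) = sq P 0"
 by (auto simp: Xk_def)

lemma Xk_closed: "closed (Xk k)"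
 unfolding closed_sequential_limits
proof (intro allI impI, elim conjE)
 fix P Q assume P: "\<forall>n. P n \<in> Xk k" and lim: "P ----> Q"
 note l = sq_tendsto[OF lim]
 show "Q \<in> Xk k" unfolding Xk_def supp_def
 proof (intro CollectI conjI allI impI)
  fix j assume "j < k"
  thus "has_D (sq Q j) (sq Q (Suc j))" using has_D_closed(1)[OF _ l l] P XkD(1) by blast
 next
  fix j assume "k < j"
  hence "sq (P n) j = 0" for n using P by (auto simp: Xk_def supp_def)
  thus "sq Q j = 0" using LIMSEQ_unique[OF l[of j]] by simp
 next
  have "(%n. rfl (sq (P n) 0)) ----> rfl (sq Q 0)" by (rule bounded_linear.tendsto[OF lin_aff l]) simp
  moreover have "(%n. rfl (sq (P n) 0)) = (%n. sq (P n) 0)" using P by (auto simp: Xk_def)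
  ultimately have "(%n. sq (P n) 0) ----> rfl (sq Q 0)" by (simp only:)
  thus "rfl (sq Q 0) = sq Q 0" by (rule LIMSEQ_unique[OF _ l[of 0]])
 qed
qed

lemma Xk_subspace: "subspace (Xk k)"
proof -
 have a: "linear rfl" by (rule bounded_linear.linear[OF lin_aff]) simp
 show ?thesis unfolding subspace_def Xk_def supp_def
  by (auto simp: linear_0[OF a] linear_add[OF a] linear_cmul[OF a] has_D_zero has_D_add has_D_scaleR)
qed

lemma Hs_iff_seq: "(\<forall>j<k. has_D (f j) (f (Suc j))) ==> Hs k (f 0) \<and> nk k (f 0) = (\<Sum>j\<le>k. norm (f j))"
proof (induction k arbitrary: f)
 case (Suc k)
 have "Hs k (f (Suc 0)) \<and> nk k (f (Suc 0)) = (\<Sum>j\<le>k. norm (f (Suc j)))"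
  using Suc.IH[of "%j. f (Suc j)"] Suc.prems by auto
 moreover have "has_D (f 0) (f (Suc 0))" using Suc.prems by auto
 ultimately show ?case using Hs_SucI nk_Suc by (simp only: sum.atMost_Suc_shift)
qed simp

lemma Xk_Hs: assumes "P \<in> Xk k" "m <= k" shows "Hs m (sq P 0)" "nk m (sq P 0) = (\<Sum>j\<le>m. norm (sq P j))"
 using Hs_iff_seq[of m "sq P"] XkD(1)[OF assms(1)] assms(2) by auto

lemma nk_le_norm: "P \<in> Xk k ==> m <= k ==> nk m (sq P 0) <= real (Suc m) * norm P"
 using Xk_Hs(2) sum_le_norm_seq by metis

definition emb :: "nat => l2 => seq" where "emb k u = mk k (%j. (D ^^ j) u)"

lemma Hs_has_D: "Hs k u ==> j < k ==> has_D ((D ^^ j) u) ((D ^^ Suc j) u)"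
proof (induction j arbitrary: k u)
 case 0
 then obtain k' where "k = Suc k'" by (cases k) auto
 thus ?case using 0 by (auto elim: Hs_SucE)
next
 case (Suc j)
 then obtain k' where "k = Suc k'" by (cases k) auto
 then obtain w where "has_D u w" "Hs k' w" "D u = w" using Suc.prems by (auto elim: Hs_SucE)
 thus ?case using Suc.IH[of k' w] Suc.prems \<open>k = Suc k'\<close> by (simp add: funpow_swap1)
qed

lemma emb_0 [simp]: "sq (emb k u) 0 = u" by (simp add: emb_def)

lemma emb_Xk: "Hs k u ==> rfl u = u ==> emb k u \<in> Xk k"
 unfolding Xk_def supp_def using Hs_has_D[of k u] by (auto simp: emb_def simp del: funpow.simps)

lemma norm_Xk_le_nk: "P \<in> Xk k ==> norm P <= nk k (sq P 0)"
 using norm_seq_le_sum XkD(2) Xk_Hs(2) by fastforce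

definition UU :: "nat => real => seq => seq" where "UU k t P = mk k (%j. U t (sq P j))"

lemma U_zero [simp]: "U t 0 = 0" using U_scaleR[of t 0 0] by simp

lemma sq_UU: "supp k P ==> sq (UU k t P) j = U t (sq P j)"
 by (auto simp: UU_def supp_def)

lemma UU_Xk: "P \<in> Xk k ==> UU k t P \<in> Xk k"
 using XkD(2)[of P k] unfolding Xk_def
 by (auto simp: sq_UU has_D_U supp_def) (metis U_rfl)

lemma supp_UU: "supp k (UU k t P)" by (simp add: UU_def supp_def)

lemma norm_UU: assumes "supp k P" shows "norm (UU k t P) = norm P"
proof (rule antisym)
 show "norm (UU k t P) <= norm P" by (rule norm_bound) (simp add: sq_UU[OF assms] norm_bounded)
 show "norm P <= norm (UU k t P)" by (rule norm_bound) (metis sq_UU[OF assms] norm_bounded norm_U)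
qed

lemma UU_diff: "UU k t (P - Q) = UU k t P - UU k t Q"
 by (rule bcontfun_eqI) (simp add: UU_def U_diff)

lemma UU_tendsto: assumes "(P ---> Q) F" "(f ---> t) F" shows "((%x. UU k (f x) (P x)) ---> UU k t Q) F"
 by (rule seq_tendstoI[where k = k, OF supp_UU supp_UU])
   (auto simp: UU_def intro!: U_tendsto sq_tendsto assms)

lemma UU_continuous: "continuous_on S P ==> continuous_on S f ==> continuous_on S (%x. UU k (f x) (P x))"
 unfolding continuous_on_def by (auto intro!: UU_tendsto)

definition NN :: "nat => seq => seq" where "NN k P = emb k (J (NL (sq P 0)))"

lemma rfl_cb: "has_D u w ==> cb (rfl u) = caff (-1) 0 (cb u)"
 by (rule isrep_cb, rule isrep_aff) (auto dest: has_D_cb)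

lemma rfl_NL: assumes "has_D u w" "rfl u = u" shows "rfl (NL u) = NL u"
proof -
 have a: "linear rfl" by (rule bounded_linear.linear[OF lin_aff]) simp
 have c: "caff (-1) 0 (cb u) = cb u" using rfl_cb[OF assms(1)] assms(2) by simp
 have "caff (-1) 0 (cmul (cb u) (ccnj (cb u))) = cmul (caff (-1) 0 (cb u)) (ccnj (caff (-1) 0 (cb u)))"
  by (rule bcontfun_eqI) simp
 thus ?thesis unfolding NL_eq[OF assms(1)] by (simp add: linear_cmul[OF a] aff_mul c assms(2))
qed

lemma NN_Xk: assumes "P \<in> Xk (Suc k)" shows "NN (Suc k) P \<in> Xk (Suc k)"
 unfolding NN_def
proof (rule emb_Xk)
 have "Hs (Suc k) (sq P 0)" by (rule Xk_Hs(1)[OF assms]) simp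
 thus "Hs (Suc k) (J (NL (sq P 0)))" using Hs_J NL_Hs by blast
 show "rfl (J (NL (sq P 0))) = J (NL (sq P 0))"
  using rfl_NL[OF XkD(1)[OF assms] XkD(3)[OF assms]] by (simp add: aff_J)
qed

text \<open>The factors \<open>real (Suc (Suc k))\<close> come from passing between the sup norm of
  sequences and the sum of norms in \<open>nk\<close>.\<close>

lemma NN_lip: assumes P: "P \<in> Xk (Suc k)" "norm P <= R" and Q: "Q \<in> Xk (Suc k)" "norm Q <= R"
 shows "norm (NN (Suc k) P - NN (Suc k) Q) <= (3 ^ Suc k)^2 * (3 * (real (Suc (Suc k)) * R)^2) * real (Suc (Suc k)) * norm (P - Q)"
proof -
 let ?u = "sq P 0" and ?v = "sq Q 0" and ?c = "real (Suc (Suc k))"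
 have X: "P - Q \<in> Xk (Suc k)" "NN (Suc k) P - NN (Suc k) Q \<in> Xk (Suc k)"
  by (intro subspace_diff[OF Xk_subspace] P Q NN_Xk)+
 have h: "Hs (Suc k) ?u" "Hs (Suc k) ?v" by (rule Xk_Hs(1)[OF P(1)] Xk_Hs(1)[OF Q(1)], simp)+
 have n: "nk (Suc k) ?u <= ?c * R" "nk (Suc k) ?v <= ?c * R"
  by (rule order_trans[OF nk_le_norm[OF P(1)]], simp, intro mult_left_mono P(2), simp,
    rule order_trans[OF nk_le_norm[OF Q(1)]], simp, intro mult_left_mono Q(2), simp)
 have "norm (NN (Suc k) P - NN (Suc k) Q) <= nk (Suc k) (sq (NN (Suc k) P - NN (Suc k) Q) 0)"
  by (rule norm_Xk_le_nk[OF X(2)])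
 also have "sq (NN (Suc k) P - NN (Suc k) Q) 0 = J (NL ?u - NL ?v)"
  by (simp add: NN_def linear_diff[OF lin[OF lin_J]])
 also have "nk (Suc k) (J (NL ?u - NL ?v)) = nk (Suc k) (NL ?u - NL ?v)"
  using Hs_J[OF Hs_diff[OF NL_Hs[OF h(1)] NL_Hs[OF h(2)]]] by blast
 also have "... <= (3 ^ Suc k)^2 * (3 * (?c * R)^2) * nk (Suc k) (?u - ?v)"
  by (rule NL_lip[OF h n])
 also have "... <= (3 ^ Suc k)^2 * (3 * (?c * R)^2) * (?c * norm (P - Q))"
  using nk_le_norm[OF X(1), of "Suc k"] by (intro mult_left_mono) auto
 finally show ?thesis by (simp only: mult.assoc)
qed

section \<open>Truncation, a priori bounds and global existence\<close>

definition retr :: "real => 'a::real_normed_vector => 'a" where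
 "retr R x = (R / max R (norm x)) *\<^sub>R x"

lemma retr_id: "0 < R ==> norm x <= R ==> retr R x = x"
 by (simp add: retr_def max_def)

lemma norm_retr: assumes "0 < R" shows "norm (retr R x) <= R"
proof -
 have "norm x / max R (norm x) <= 1" using assms by (simp add: divide_le_eq_1 less_max_iff_disj)
 hence "R * (norm x / max R (norm x)) <= R * 1" using assms by (intro mult_left_mono) auto
 thus ?thesis using assms by (simp add: retr_def)
qed

text \<open>One unit of the constant is due to the change of the vector, the other to the change of
  the scaling factor. The sup norm of sequences is not a Hilbert norm, for which the constant would
  be 1.\<close>

lemma retr_lip: assumes R: "0 < R" shows "norm (retr R x - retr R y) <= 2 * norm (x - y)"
proof -
 let ?a = "max R (norm x)" and ?b = "max R (norm y)"
 have a: "0 < ?a" "0 < ?b" "R <= ?a" "R <= ?b" "norm y <= ?b" using R by auto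
 have ab: "\<bar>?b - ?a\<bar> <= norm (x - y)" using norm_triangle_ineq3[of x y] by (auto simp: max_def)
 have "retr R x - retr R y = (R / ?a) *\<^sub>R (x - y) + (R * (?b - ?a) / (?a * ?b)) *\<^sub>R y"
 proof -
  have "R / ?a - R / ?b = R * (?b - ?a) / (?a * ?b)" using a by (simp add: field_simps)
  hence "(R * (?b - ?a) / (?a * ?b)) *\<^sub>R y = (R / ?a) *\<^sub>R y - (R / ?b) *\<^sub>R y" by (metis scaleR_left_diff_distrib)
  thus ?thesis by (simp add: retr_def scaleR_diff_right)
 qed
 also have "norm ... <= (R / ?a) * norm (x - y) + \<bar>R * (?b - ?a) / (?a * ?b)\<bar> * norm y"
  using R a by (intro order_trans[OF norm_triangle_ineq]) simp
 also have "(R / ?a) * norm (x - y) <= 1 * norm (x - y)"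
  using a by (intro mult_right_mono) (auto simp: divide_le_eq_1)
 also have "\<bar>R * (?b - ?a) / (?a * ?b)\<bar> * norm y = (R / ?a) * (norm y / ?b) * \<bar>?b - ?a\<bar>"
  using a R by (simp add: abs_mult)
 also have "... <= 1 * 1 * norm (x - y)"
  using a R by (intro mult_mono ab) (auto simp: divide_le_eq_1)
 finally show ?thesis by simp
qed

lemma retr_Xk: "P \<in> Xk k ==> retr R P \<in> Xk k"
 unfolding retr_def by (rule subspace_scale[OF Xk_subspace])

lemma NN_zero: "NN k 0 = 0"
proof -
 have "NL 0 = 0" unfolding NL_def cub_def pr_def by (simp add: bounded_bilinear.zero_right[OF bil_mul])
 moreover have "(D ^^ j) 0 = 0" for j by (induction j) (simp_all add: D_eq[OF has_D_zero])
 ultimately show ?thesis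
  unfolding NN_def emb_def by (intro bcontfun_eqI) (simp add: linear_0[OF lin[OF lin_J]])
qed

lemma NN_continuous:
 fixes a :: "real => seq"
 assumes c: "cont0 a" and X: "!!t. 0 <= t ==> a t \<in> Xk (Suc k)"
 shows "cont0 (%t. NN (Suc k) (a t))"
 unfolding continuous_on_def
proof
 fix t :: real assume t: "t \<in> {0..}"
 let ?K = "(3 ^ Suc k)^2 * (3 * (real (Suc (Suc k)) * (norm (a t) + 1))^2) * real (Suc (Suc k))"
 have lim: "(a ---> a t) (at0 t)" using c t by (auto simp: continuous_on_def)
 have "((%s. ?K * norm (a s - a t)) ---> ?K * norm (a t - a t)) (at0 t)" by (intro tendsto_intros lim)
 hence l0: "((%s. ?K * norm (a s - a t)) ---> 0) (at0 t)" by simp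
 have "\<forall>\<^sub>F s in at0 t. norm (a s) < norm (a t) + 1" by (rule order_tendstoD(2)[OF tendsto_norm[OF lim]]) simp
 moreover have "\<forall>\<^sub>F s in at0 t. 0 <= s" by (auto simp: eventually_at_filter)
 ultimately have "\<forall>\<^sub>F s in at0 t. norm (NN (Suc k) (a s) - NN (Suc k) (a t)) <= ?K * norm (a s - a t)"
  by eventually_elim (rule NN_lip, use t X in auto)
 from Lim_null_comparison[OF this l0]
 show "((%s. NN (Suc k) (a s)) ---> NN (Suc k) (a t)) (at0 t)" by (simp add: LIM_zero_iff)
qed

text \<open>The equation in the interaction picture, p = U(-t) q, where the right hand side is Lipschitz on bounded sets.\<close>

definition NF :: "nat => real => seq => seq" where "NF k t P = UU k (- t) (NN k (UU k t P))"

definition mild :: "nat => seq => real => (real => seq) => bool" where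
 "mild k P0 \<tau> p \<longleftrightarrow> p 0 = P0 \<and> (\<forall>t\<in>{0..\<tau>}. p t \<in> Xk k \<and> (p hvd NF k t (p t)) (at t within {0..\<tau>}))"

text \<open>The radius of the truncation may grow in time, so that one global solution of the truncated
 equation stays inside it as soon as the radius exceeds the a priori bound.\<close>

lemma truncated_solution:
 assumes P0: "P0 \<in> Xk (Suc k)" and R: "cont0 R" "!!t. 0 < R t"
 obtains p where "cont0 p" "p 0 = P0" "!!t. 0 <= t ==> p t \<in> Xk (Suc k)"
  "!!t. 0 <= t ==> (p hvd UU (Suc k) (- t) (NN (Suc k) (retr (R t) (UU (Suc k) t (p t))))) (at0 t)"
proof -
 let ?K = "%t. (3 ^ Suc k)^2 * (3 * (real (Suc (Suc k)) * R t)^2) * real (Suc (Suc k))"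
 let ?U = "UU (Suc k)" and ?N = "NN (Suc k)" and ?X = "Xk (Suc k)"
 show ?thesis
 proof (rule picard[of ?X P0 "%t P. ?U (- t) (?N (retr (R t) (?U t P)))" "%t. ?K t * 2", OF Xk_closed Xk_subspace P0])
  fix t :: real and P assume "P \<in> ?X"
  thus "?U (- t) (?N (retr (R t) (?U t P))) \<in> ?X" by (intro UU_Xk NN_Xk retr_Xk)
 next
  fix t :: real
  have z: "?U t 0 = 0" for t using UU_diff[of "Suc k" t 0 0] by simp
  show "?U (- t) (?N (retr (R t) (?U t 0))) = 0" by (simp add: z retr_def NN_zero)
 next
  show "cont0 (%t. ?K t * 2)" by (intro continuous_intros R)
 next
  fix t P Q assume PQ: "P \<in> ?X" "Q \<in> ?X"
  have X: "?U t P \<in> ?X" "?U t Q \<in> ?X" "P - Q \<in> ?X" using PQ by (auto intro: UU_Xk subspace_diff[OF Xk_subspace])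
  have "?N (retr (R t) (?U t P)) - ?N (retr (R t) (?U t Q)) \<in> ?X"
   by (intro subspace_diff[OF Xk_subspace] NN_Xk retr_Xk X)
  hence "norm (?U (- t) (?N (retr (R t) (?U t P))) - ?U (- t) (?N (retr (R t) (?U t Q)))) = norm (?N (retr (R t) (?U t P)) - ?N (retr (R t) (?U t Q)))"
   unfolding UU_diff[symmetric] by (intro norm_UU XkD(2))
  also have "... <= ?K t * (2 * norm (?U t P - ?U t Q))"
   by (rule order_trans[OF NN_lip[OF retr_Xk[OF X(1)] norm_retr[OF R(2)] retr_Xk[OF X(2)] norm_retr[OF R(2)]]])
    (intro mult_left_mono retr_lip R, simp)
  also have "norm (?U t P - ?U t Q) = norm (P - Q)"
   unfolding UU_diff[symmetric] by (rule norm_UU[OF XkD(2)[OF X(3)]])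
  finally show "norm (?U (- t) (?N (retr (R t) (?U t P))) - ?U (- t) (?N (retr (R t) (?U t Q)))) <= ?K t * 2 * norm (P - Q)"
   by (simp only: mult.assoc)
 next
  fix y :: "real => seq" assume y: "cont0 y" "!!t. 0 <= t ==> y t \<in> ?X"
  have "cont0 (%t. retr (R t) (?U t (y t)))" unfolding retr_def
   by (intro continuous_intros UU_continuous y(1) R) (metis R(2) max.strict_coboundedI1 less_irrefl)
  hence "cont0 (%t. ?N (retr (R t) (?U t (y t))))"
   by (rule NN_continuous) (intro retr_Xk UU_Xk y(2))
  thus "cont0 (%t. ?U (- t) (?N (retr (R t) (?U t (y t)))))" by (intro UU_continuous continuous_intros)
 qed (use that in blast)+
qed

lemma mild_continuous: "mild k P0 \<tau> p ==> continuous_on {0..\<tau>} p"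
 unfolding mild_def by (rule continuous_on_vector_derivative) blast

lemma lin_sq: "bounded_linear (%P. sq P j)"
 by (rule bounded_linear_intro[where K = 1]) (auto simp: norm_bounded)

text \<open>Since 2 <= k, the values of p lie in the domain of the generator, so U t (p t) is
  differentiable and the interaction picture can be undone.\<close>

lemma mild_nls_reg:
 assumes m: "mild k P0 \<tau> p" and k: "2 <= k"
 shows "nls_reg (%t. sq (UU k t (p t)) 0) (%t. sq (UU k t (p t)) 1) (%t. sq (UU k t (p t)) 2) \<tau>"
proof
 have X: "UU k t (p t) \<in> Xk k" "p t \<in> Xk k" if "t \<in> {0..\<tau>}" for t using m that by (auto simp: mild_def intro: UU_Xk)
 show "has_D (sq (UU k t (p t)) 0) (sq (UU k t (p t)) 1)" if "t \<in> {0..\<tau>}" for t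
  using XkD(1)[OF X(1)[OF that], of 0] k by simp
 show "has_D (sq (UU k t (p t)) 1) (sq (UU k t (p t)) 2)" if "t \<in> {0..\<tau>}" for t
  using XkD(1)[OF X(1)[OF that], of 1] k by (simp add: numeral_2_eq_2)
 have "continuous_on {0..\<tau>} (%t. sq (UU k t (p t)) j)" for j
  by (rule lin_cont[OF lin_sq UU_continuous[OF mild_continuous[OF m] continuous_on_id]])
 thus "continuous_on {0..\<tau>} (%t. sq (UU k t (p t)) 1)" "continuous_on {0..\<tau>} (%t. sq (UU k t (p t)) 2)" by blast+
 show "((%t. sq (UU k t (p t)) 0) hvd J (sq (UU k t (p t)) 2 + NL (sq (UU k t (p t)) 0))) (at t within {0..\<tau>})"
  if t: "t \<in> {0..\<tau>}" for t
 proof -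
  have s: "supp k (p s)" if "s \<in> {0..\<tau>}" for s using X(2)[OF that] XkD(2) by blast
  have "(p hvd NF k t (p t)) (at t within {0..\<tau>})" using m t by (simp add: mild_def)
  hence d: "((%t. sq (p t) 0) hvd sq (NF k t (p t)) 0) (at t within {0..\<tau>})"
   by (rule lin_hvd[OF lin_sq])
  have "((%t. U t (sq (p t) 0)) hvd J (U t (sq (p t) 2)) + U t (sq (NF k t (p t)) 0)) (at t within {0..\<tau>})"
   by (rule U_hvd[OF d, of "sq (p t) 1"]) (use XkD(1)[OF X(2)[OF t], of 0] XkD(1)[OF X(2)[OF t], of 1] k in "simp_all add: numeral_2_eq_2")
  also have "U t (sq (NF k t (p t)) 0) = J (NL (sq (UU k t (p t)) 0))"
   by (simp add: NF_def UU_def NN_def)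
  also have "J (U t (sq (p t) 2)) + J (NL (sq (UU k t (p t)) 0)) = J (sq (UU k t (p t)) 2 + NL (sq (UU k t (p t)) 0))"
   by (simp add: sq_UU[OF s[OF t]] linear_add[OF lin[OF lin_J]])
  finally show ?thesis
   by (rule has_vector_derivative_transform[OF t, rotated]) (simp add: sq_UU[OF s])
 qed
qed

lemma nk_UU: assumes "P \<in> Xk k" "m <= k" shows "nk m (sq (UU k t P) 0) = nk m (sq P 0)"
 using Xk_Hs(2)[OF UU_Xk[OF assms(1)] assms(2), of t] Xk_Hs(2)[OF assms] by (simp add: sq_UU[OF XkD(2)[OF assms(1)]])

lemma mild_subset: "mild k P0 \<tau> p ==> \<sigma> <= \<tau> ==> mild k P0 \<sigma> p"
 unfolding mild_def by (auto intro!: has_vector_derivative_within_subset[where S = "{0..\<tau>}" and T = "{0..\<sigma>}"])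

text \<open>The bound B must not depend on the solution, because it is going to fix the radius of
  the truncation before a solution is known; continuity of B serves the same purpose. Monotonicity
  lets B t bound the lower norm at all earlier times. Order 1 comes from mass and energy, each
  further order from the tame estimate and Gronwall's inequality.\<close>

lemma mild_apriori:
 assumes P0: "P0 \<in> Xk k" and k: "2 <= k" and m: "1 <= m" "m <= k"
 shows "\<exists>B. cont0 B \<and> (\<forall>s\<ge>0. 0 <= B s \<and> (\<forall>t\<ge>s. B s <= B t)) \<and>
  (\<forall>p t. 0 <= t --> mild k P0 t p --> nk m (sq (p t) 0) <= B t)"
 using m
proof (induction m rule: nat_induct_at_least)
 case base
 define M where "M = norm (sq P0 0)"
 define H0 where "H0 = sq P0 1 \<bullet> sq P0 1 - (1/4) * (pr (sq P0 0) (cj (sq P0 0)) \<bullet> pr (sq P0 0) (cj (sq P0 0)))"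
 show ?case
 proof (intro exI[of _ "%_. M + sqrt (2 * \<bar>H0\<bar> + M ^ 4 * (M^2 + 1))"] conjI allI impI)
  fix p and t :: real assume t0: "0 <= t" and ml: "mild k P0 t p"
  have t: "t \<in> {0..t}" using t0 by simp
  interpret nls_reg "%t. sq (UU k t (p t)) 0" "%t. sq (UU k t (p t)) 1" "%t. sq (UU k t (p t)) 2" t
   by (rule mild_nls_reg[OF ml k])
  have p0: "p 0 = P0" using ml by (simp add: mild_def)
  have z: "sq (UU k 0 (p 0)) j = sq P0 j" for j by (simp add: p0 sq_UU[OF XkD(2)[OF P0]])
  have X: "p t \<in> Xk k" using ml t by (simp add: mild_def)
  have "H 0 = H0" unfolding H_def H0_def by (simp only: z)
  hence "(norm (sq (UU k t (p t)) 1))^2 <= 2 * \<bar>H0\<bar> + M ^ 4 * (M^2 + 1)"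
   using H1_bound[OF t] by (simp add: z M_def)
  hence "norm (sq (UU k t (p t)) 1) <= sqrt (2 * \<bar>H0\<bar> + M ^ 4 * (M^2 + 1))" by (rule real_le_rsqrt)
  moreover have "norm (sq (UU k t (p t)) 0) = M" using mass[OF t] by (simp add: z M_def)
  ultimately show "nk 1 (sq (p t) 0) <= M + sqrt (2 * \<bar>H0\<bar> + M ^ 4 * (M^2 + 1))"
   using nk_UU[OF X, of 1 t] Xk_Hs(2)[OF UU_Xk[OF X], of 1 t] k by simp
 qed (simp_all add: M_def)
next
 case (Suc m)
 then obtain B where cB: "cont0 B" and B0: "!!s. 0 <= s ==> 0 <= B s" and mono: "!!s t. 0 <= s ==> s <= t ==> B s <= B t"
  and B: "!!p t. 0 <= t ==> mild k P0 t p ==> nk m (sq (p t) 0) <= B t" by auto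
 obtain m' where m': "m = Suc m'" using Suc by (cases m) auto
 \<comment> \<open>This is the constant of \<open>NL_tame\<close> with B t in place of the lower
   norm; the factor \<open>real (Suc (Suc m))\<close> in the exponent counts the derivatives of
   order at most Suc m.\<close>
 let ?c = "%t. 3 * (3 ^ Suc m)^2 * (B t)^2 :: real"
 show ?case
 proof (intro exI[of _ "%t. nk (Suc m) (sq P0 0) * exp (real (Suc (Suc m)) * ?c t * t)"] conjI allI impI)
  show "cont0 (%t. nk (Suc m) (sq P0 0) * exp (real (Suc (Suc m)) * ?c t * t))" by (intro continuous_intros cB)
  show "0 <= nk (Suc m) (sq P0 0) * exp (real (Suc (Suc m)) * ?c t * t)" for t by simp
  show "nk (Suc m) (sq P0 0) * exp (real (Suc (Suc m)) * ?c s * s) <= nk (Suc m) (sq P0 0) * exp (real (Suc (Suc m)) * ?c t * t)"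
   if "0 <= s" "s <= t" for s t
   unfolding mult.assoc using that mono[of s t] B0[of s] by (intro mult_left_mono iffD2[OF exp_le_cancel_iff] mult_mono power_mono) auto
  fix p and t :: real assume t0: "0 <= t" and ml: "mild k P0 t p"
  have t: "t \<in> {0..t}" using t0 by simp
  have X: "p s \<in> Xk k" if "s \<in> {0..t}" for s using ml that by (simp add: mild_def)
  define f where "f s = (\<Sum>i\<le>Suc m. norm (sq (p s) i))" for s
  have fnk: "f s = nk (Suc m) (sq (p s) 0)" if "s \<in> {0..t}" for s
   unfolding f_def using Xk_Hs(2)[OF X[OF that] Suc.prems] by simp
  have p0: "p 0 = P0" using ml by (simp add: mild_def)
  have cf: "continuous_on {0..t} f" unfolding f_def
   by (intro continuous_intros lin_cont[OF lin_sq mild_continuous[OF ml]])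
  have d: "norm (sq (NF k s (p s)) i) <= ?c t * f s" if s: "s \<in> {0..t}" and i: "i <= Suc m" for s i
  proof -
   let ?Q = "UU k s (p s)"
   have XQ: "?Q \<in> Xk k" by (rule UU_Xk[OF X[OF s]])
   obtain k' where k': "k = Suc k'" using k by (cases k) auto
   have XN: "NN k ?Q \<in> Xk k" using NN_Xk XQ k' by blast
   have hQ: "Hs (Suc m) (sq ?Q 0)" by (rule Xk_Hs(1)[OF XQ Suc.prems])
   have nB: "nk m (sq (p s) 0) <= B t" using B[OF _ mild_subset[OF ml], of s] mono[of s t] s by force
   have "norm (sq (NF k s (p s)) i) = norm (sq (NN k ?Q) i)"
    unfolding NF_def sq_UU[OF XkD(2)[OF XN]] by simp
   also have "... <= (\<Sum>i\<le>Suc m. norm (sq (NN k ?Q) i))"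
    using i by (intro member_le_sum[of i "{..Suc m}" "%i. norm (sq (NN k ?Q) i)"]) auto
   also have "... = nk (Suc m) (sq (NN k ?Q) 0)" using Xk_Hs(2)[OF XN Suc.prems] by simp
   also have "... = nk (Suc m) (NL (sq ?Q 0))" using Hs_J NL_Hs[OF hQ] by (simp add: NN_def)
   also have "... <= 3 * (3 ^ Suc m)^2 * (nk m (sq ?Q 0))^2 * nk (Suc m) (sq ?Q 0)"
    using NL_tame[of m' "sq ?Q 0"] hQ m' by simp
   also have "nk m (sq ?Q 0) = nk m (sq (p s) 0)" using nk_UU[OF X[OF s]] Suc.prems by simp
   also have "nk (Suc m) (sq ?Q 0) = f s" using nk_UU[OF X[OF s] Suc.prems] fnk[OF s] by simp
   also have "3 * (3 ^ Suc m)^2 * (nk m (sq (p s) 0))^2 * f s <= ?c t * f s"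
    using nB by (intro mult_right_mono mult_left_mono power_mono) (auto simp: f_def intro!: sum_nonneg add_nonneg_nonneg)
   finally show ?thesis .
  qed
  have "f t <= f 0 * exp (real (Suc (Suc m)) * ?c t * t)"
  proof (rule gronwall_integral[OF cf _ _ t])
   fix s assume s: "s \<in> {0..t}"
   have "norm (sq (p s) i) <= norm (sq (p 0) i) + integral {0..s} (%r. ?c t * f r)" if i: "i <= Suc m" for i
   proof (rule norm_le_integral[OF _ _ d[OF _ i] s])
    show "((%t. sq (p t) i) hvd sq (NF k r (p r)) i) (at r within {0..t})" if "r \<in> {0..t}" for r
     using ml that by (intro lin_hvd[OF lin_sq]) (simp add: mild_def)
    show "continuous_on {0..t} (%r. ?c t * f r)" by (intro continuous_intros cf)
   qed
   hence "f s <= (\<Sum>i\<le>Suc m. norm (sq (p 0) i) + integral {0..s} (%r. ?c t * f r))"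
    unfolding f_def[of s] by (intro sum_mono) simp
   also have "... = f 0 + real (Suc (Suc m)) * ?c t * integral {0..s} f"
    unfolding sum.distrib f_def[of 0, symmetric] by simp
   finally show "f s <= f 0 + real (Suc (Suc m)) * ?c t * integral {0..s} f" .
  qed simp
  thus "nk (Suc m) (sq (p t) 0) <= nk (Suc m) (sq P0 0) * exp (real (Suc (Suc m)) * ?c t * t)"
   using fnk[OF t] fnk[of 0] t0 p0 by simp
 qed
qed

text \<open>Bootstrap: as long as p stays within the radius R, the truncation is inactive, p solves
  the true equation, and the a priori bound keeps it at distance at least 1 inside. By continuity it
  can never reach the radius.\<close>

lemma mild_global:
 assumes P0: "P0 \<in> Xk k" and k: "2 <= k"
 obtains p where "cont0 p" "!!t. 0 <= t ==> mild k P0 t p"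
proof -
 obtain k' where k': "k = Suc k'" using k by (cases k) auto
 obtain B where cB: "cont0 B" and B0: "!!s. 0 <= s ==> 0 <= B s"
  and B: "!!p t. 0 <= t ==> mild k P0 t p ==> nk k (sq (p t) 0) <= B t"
  using mild_apriori[OF P0 k, of k] k by auto
 \<comment> \<open>The summand 1 is the gap between bound and radius, and \<open>norm P0\<close>
   places the initial value inside the ball.\<close>
 define R where "R t = B (max 0 t) + norm P0 + 1" for t
 have cR: "cont0 R" unfolding R_def by (intro continuous_intros continuous_on_compose2[OF cB]) auto
 have R: "0 < R t" for t using B0[of "max 0 t"] by (simp add: R_def add_nonneg_pos)
 obtain p where p: "cont0 p" "p 0 = P0" "!!t. 0 <= t ==> p t \<in> Xk k"
  "!!t. 0 <= t ==> (p hvd UU k (- t) (NN k (retr (R t) (UU k t (p t))))) (at0 t)"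
  using truncated_solution[of P0 k' R] P0 cR R unfolding k' by blast
 have ml: "mild k P0 \<tau> p" if "!!t. t \<in> {0..\<tau>} ==> norm (p t) <= R t" for \<tau>
  unfolding mild_def
 proof (intro conjI ballI p(2))
  fix t assume t: "t \<in> {0..\<tau>}"
  hence t0: "0 <= t" by simp
  show "p t \<in> Xk k" by (rule p(3)[OF t0])
  have "retr (R t) (UU k t (p t)) = UU k t (p t)"
   by (rule retr_id[OF R]) (simp add: norm_UU[OF XkD(2)[OF p(3)[OF t0]]] that[OF t])
  hence "(p hvd NF k t (p t)) (at0 t)" using p(4)[OF t0] by (simp add: NF_def)
  thus "(p hvd NF k t (p t)) (at t within {0..\<tau>})"
   by (rule has_vector_derivative_within_subset) auto
 qed
 define g where "g t = norm (p t) - R t" for t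
 have bd: "g t <= -1" if t: "0 <= t" and g: "!!s. s \<in> {0..t} ==> g s <= 0" for t
 proof -
  have "nk k (sq (p t) 0) <= B t" by (rule B[OF t ml]) (use g in "simp add: g_def")
  thus ?thesis unfolding g_def R_def max_absorb2[OF t] using norm_Xk_le_nk[OF p(3)[OF t]] norm_ge_zero[of P0] by linarith
 qed
 have "g t <= 0" if t: "0 <= t" for t
 proof (rule ccontr)
  assume neg: "\<not> g t <= 0"
  have cg: "continuous_on {0..t} g" unfolding g_def
   by (intro continuous_intros continuous_on_subset[OF p(1)] continuous_on_subset[OF cR]) auto
  define A where "A = {s \<in> {0..t}. g s \<in> {0..}}"
  have "A = {0..t} \<inter> g -` {0..}" by (auto simp: A_def)
  hence "closed A" using continuous_closed_preimage[OF cg closed_atLeastAtMost closed_atLeast] by simp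
  moreover have "bounded A" by (rule bounded_subset[of "{0..t}"]) (auto simp: A_def)
  ultimately have "compact A" by (simp add: compact_eq_bounded_closed)
  moreover have "A ~= {}" using neg t by (auto simp: A_def)
  ultimately obtain s where s: "s \<in> A" "!!r. r \<in> A ==> s <= r" using compact_attains_inf by metis
  have sT: "0 <= s" "s <= t" "0 <= g s" using s(1) by (auto simp: A_def)
  have "g 0 <= -1/2" using B0[of 0] by (simp add: g_def R_def p(2))
  moreover have "continuous_on {0..s} g" by (rule continuous_on_subset[OF cg]) (use sT in auto)
  \<comment> \<open>Before the first time with g >= 0 the continuous function g would have to pass
    through -1/2, a value excluded by \<open>bd\<close>.\<close>
  ultimately obtain x where x: "0 <= x" "x <= s" "g x = -1/2"
   using IVT'[of g 0 "-1/2" s] sT by auto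
  have "g r <= 0" if "r \<in> {0..x}" for r
  proof (rule ccontr)
   assume "\<not> g r <= 0"
   hence "r \<in> A" using that x sT by (auto simp: A_def)
   with s(2)[OF this] that x have "x = s" by auto
   thus False using x(3) sT(3) by simp
  qed
  from bd[OF x(1) this] show False using x(3) by simp
 qed
 hence "mild k P0 t p" for t by (intro ml) (simp add: g_def)
 with p(1) show ?thesis by (rule that)
qed

lemma CH_of_seq:
 assumes "cont0 p" "!!t. 0 <= t ==> p t \<in> Xk k"
 shows "CH k (%t. sq (p t) 0)"
proof -
 have "j + m = k ==> CH m (%t. sq (p t) j)" for j m
 proof (induction m arbitrary: j)
  case 0 thus ?case using lin_cont[OF lin_sq assms(1)] by simp
 next
  case (Suc m)
  show ?case
  proof (rule CH_SucI[where w = "%t. sq (p t) (Suc j)"])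
   show "cont0 (%t. sq (p t) j)" by (rule lin_cont[OF lin_sq assms(1)])
   show "has_D (sq (p t) j) (sq (p t) (Suc j))" if "0 <= t" for t using XkD(1)[OF assms(2)[OF that]] Suc.prems by simp
   show "CH m (%t. sq (p t) (Suc j))" using Suc by simp
  qed
 qed
 from this[of 0 k] show ?thesis by simp
qed

theorem nls_global:
 assumes "Hs k q0" "rfl q0 = q0" and k: "2 <= k"
 obtains q where "q 0 = q0" "CH k q" "!!t. 0 <= t ==> rfl (q t) = q t"
  "!!t. 0 <= t ==> (q hvd J (D (D (q t)) + NL (q t))) (at0 t)"
proof -
 let ?P0 = "emb k q0"
 have P0: "?P0 \<in> Xk k" by (rule emb_Xk[OF assms(1,2)])
 obtain p where cp: "cont0 p" and mp: "!!t. 0 <= t ==> mild k ?P0 t p" using mild_global[OF P0 k] by blast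
 let ?q = "%t. UU k t (p t)"
 have qX: "?q t \<in> Xk k" if "0 <= t" for t using mp[OF that] that by (intro UU_Xk) (simp add: mild_def)
 have cq: "cont0 ?q" by (intro UU_continuous cp continuous_intros)
 show ?thesis
 proof (rule that[of "%t. sq (?q t) 0"])
  have "p 0 = ?P0" using mp[of 0] by (simp add: mild_def)
  thus "sq (?q 0) 0 = q0" by (simp add: sq_UU[OF XkD(2)[OF P0]])
  show "CH k (%t. sq (?q t) 0)" by (rule CH_of_seq[OF cq qX])
  fix t :: real assume t: "0 <= t"
  show "rfl (sq (?q t) 0) = sq (?q t) 0" by (rule XkD(3)[OF qX[OF t]])
  show "((%t. sq (?q t) 0) hvd J (D (D (sq (?q t) 0)) + NL (sq (?q t) 0))) (at0 t)"
  proof (rule vector_derivative_within_Ici[OF _ t])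
   fix T :: real assume "0 < T"
   hence T: "t \<in> {0..t + T}" "0 <= t + T" using t by auto
   interpret nls_reg "%t. sq (UU k t (p t)) 0" "%t. sq (UU k t (p t)) 1" "%t. sq (UU k t (p t)) 2" "t + T"
    by (rule mild_nls_reg[OF mp[OF T(2)] k])
   show "((%t. sq (?q t) 0) hvd J (D (D (sq (?q t) 0)) + NL (sq (?q t) 0))) (at t within {0..t + T})"
    using eq[OF T(1)] D_eq[OF qw[OF T(1)]] D_eq[OF wz[OF T(1)]] by simp
  qed
 qed
qed

section \<open>Real parts and the integration by parts used for the frame\<close>

definition cre :: "cbf => cbf" where "cre \<phi> = (1/2) *\<^sub>R (\<phi> + ccnj \<phi>)"
definition rel :: "l2 => l2" where "rel u = (1/2) *\<^sub>R (u + cj u)"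
definition ci :: "cbf => cbf" where "ci \<phi> = cmul (const_bcontfun \<i>) \<phi>"

lemma Re_half: "(1/2) *\<^sub>R (z + cnj z) = of_real (Re z)"
 by (simp add: complex_eq_iff)

lemma apply_cre [simp]: "ev (cre \<phi>) x = of_real (Re (ev \<phi> x))"
 using Re_half by (simp add: cre_def)
lemma apply_ci [simp]: "ev (ci \<phi>) x = \<i> * ev \<phi> x"
 by (simp add: ci_def const_bcontfun.rep_eq)

lemma lin_cre: "bounded_linear cre"
 unfolding cre_def by (intro bounded_linear_const_scaleR bounded_linear_add bounded_linear_ident lin_ccnj)
lemma lin_ci: "bounded_linear ci"
 unfolding ci_def by (rule bounded_bilinear.bounded_linear_right[OF bil_cmul])
lemma lin_rel: "bounded_linear rel"
 unfolding rel_def by (intro bounded_linear_const_scaleR bounded_linear_add bounded_linear_ident lin_cj)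

lemma rep_rel: "AE x in lborel. rep_l2 (rel u) x = of_real (Re (rep_l2 u x))"
 using rep_scaleR[of "1/2" "u + cj u"] rep_add[of u "cj u"] rep_cj[of u] unfolding rel_def
 by eventually_elim (simp only: Re_half)

lemma rep_J: "AE x in lborel. rep_l2 (J u) x = \<i> * rep_l2 u x"
 unfolding J_def by (rule rep_mulf[OF bm_i])

lemma I_rel: "I a b (rel u) = of_real (Re (I a b u))"
 unfolding rel_def by (simp only: I_scaleR I_add I_cj Re_half)

lemma norm_cre: "norm (cre \<phi>) <= norm \<phi>"
 by (rule bcontfun_norm_le) (simp add: order_trans[OF abs_Re_le_cmod bcontfun_le])

lemma has_D_rel: "has_D u w ==> has_D (rel u) (rel w)"
 unfolding rel_def by (intro has_D_scaleR has_D_add has_D_cj)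

text \<open>K is required to be a primitive only on [a, s], not on the line: it will be a component
  of the frame minus its defect.\<close>

lemma ibp_acb:
 assumes "a <= s" "acb \<beta> g" and K: "!!x. x \<in> {a..s} ==> ev K x = ev K a + I a x k"
 shows "ev \<beta> s * ev K s - ev \<beta> a * ev K a = I a s (mul \<beta> k + mul K g)"
proof -
 have "ev \<beta> s * ev K s - ev \<beta> a * ev K a =
  (LINT x|lborel. indicator {a..s} x * (ev \<beta> x * rep_l2 k x + ev K x * rep_l2 g x))"
  by (rule ibp[OF assms(1) _ K]) (use assms(2) in "auto simp: acb_def algebra_simps")
 also have "... = (LINT x|lborel. indicator {a..s} x * (ev \<beta> x * rep_l2 k x) + indicator {a..s} x * (ev K x * rep_l2 g x))"
  by (simp add: algebra_simps)
 also have "... = I a s (mul \<beta> k) + I a s (mul K g)"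
  unfolding I_mul
  by (rule Bochner_Integration.integral_add)
    (rule sqi_mult_integrable[OF sqi_indicator sqi_mulf[OF bm_bcontfun]])+
 finally show ?thesis by (simp add: I_add)
qed

definition dens :: "l2 => cbf" where "dens q = (1/2) *\<^sub>R cmul (cb q) (ccnj (cb q))"

lemma apply_dens: "ev (dens q) x = of_real ((cmod (ev (cb q) x))^2 / 2)"
 by (simp add: dens_def complex_norm_square[symmetric] scaleR_conv_of_real)

lemma NL_dens: "has_D q w ==> NL q = mul (dens q) q"
 unfolding NL_eq dens_def by (simp add: mul_scaleR_left)

lemma acb_dens: assumes "has_D q w" shows "acb (dens q) (rel (mul (ccnj (cb q)) w))"
proof -
 have a: "acb (cb q) w" by (rule has_D_cb[OF assms])
 have "acb (dens q) ((1/2) *\<^sub>R (mul (cb q) (cj w) + mul (ccnj (cb q)) w))"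
  unfolding dens_def by (intro acb_scaleR acb_cmul a acb_cj)
 moreover have "ccnj (ccnj (cb q)) = cb q" by (rule bcontfun_eqI) simp
 hence "mul (cb q) (cj w) + mul (ccnj (cb q)) w = mul (ccnj (cb q)) w + cj (mul (ccnj (cb q)) w)"
  by (simp add: cj_mul add.commute)
 ultimately show ?thesis by (simp add: rel_def)
qed

lemma acb_ci: "acb \<phi> g ==> acb (ci \<phi>) (J g)"
 by (auto simp: acb_def J_def I_mulf_const simp flip: right_diff_distrib)

section \<open>Transport of the frame\<close>

text \<open>The defects dv, dm measure the failure of the frame equations in s at a fixed time.\<close>

locale frame_point =
 fixes v m dv dm :: cbf and q w z :: l2 and a s :: real
 assumes as: "a <= s" and vreal: "!!x. Im (ev v x) = 0"
  and qw: "has_D q w" and wz: "has_D w z"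
  and Kv: "!!x. x \<in> {a..s} ==> ev v x - ev dv x = ev v a + I a x (rel (mul m (cj q)))"
  and Km: "!!x. x \<in> {a..s} ==> ev m x - ev dm x = ev m a - I a x (mul v q)"
begin

text \<open>b stands for i q_s and ith for i |q|^2/2, as continuous functions; vt and mt are the
  prescribed t-derivatives of the frame, p is q_t, and g is the s-derivative of ith.\<close>

definition "b = cb (J w)"
definition "ith = ci (dens q)"
definition "vt = cre (cmul (ccnj b) m)"
definition "mt = cmul ith m - cmul b v"
definition "p = J (z + NL q)"
definition "g = J (rel (mul (ccnj (cb q)) w))"

lemma acb_b: "acb b (J z)" unfolding b_def by (rule has_D_cb[OF has_D_J[OF wz]])
lemma isrep_b: "isrep b (J w)" unfolding b_def by (rule has_D_cb[OF has_D_J[OF wz]])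
lemma isrep_q: "isrep (cb q) q" by (rule has_D_cb[OF qw])

lemma d0: "ev dv a = 0" "ev dm a = 0"
 using Kv[of a] Km[of a] as by auto

lemma Kv': "ev (v - dv) x = ev (v - dv) a + I a x (rel (mul m (cj q)))" if "x \<in> {a..s}"
 using Kv[OF that] d0 by simp
lemma Km': "ev (m - dm) x = ev (m - dm) a + I a x (- mul v q)" if "x \<in> {a..s}"
 using Km[OF that] d0 I_scaleR[of a x "-1" "mul v q"] by simp

lemma p_eq: "p = J z + J (mul (dens q) q)"
 unfolding p_def NL_dens[OF qw] by (rule linear_add[OF lin[OF lin_J]])

lemmas I_lin = I_add I_diff

lemma mul_diff_left: "mul (\<phi> - \<psi>) u = mul \<phi> u - mul \<psi> u"
 by (rule bounded_bilinear.diff_left[OF bil_mul])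

text \<open>The left side is the t-derivative of the defect of v. It is found by integrating conj b
  times m - dm by parts; all contributions of an exact frame cancel, and what is left is linear in
  the defect dm with only q_ss in L^2 as coefficient.\<close>

lemma vt_eq:
 "ev vt s - ev vt a - I a s (rel (mul mt (cj q) + mul m (cj p)))
  = of_real (Re (cnj (ev b s) * ev dm s - I a s (mul dm (cj (J z)))))"
proof -
 have "ev (ccnj b) s * ev (m - dm) s - ev (ccnj b) a * ev (m - dm) a
   = I a s (mul (ccnj b) (- mul v q) + mul (m - dm) (cj (J z)))"
  by (rule ibp_acb[OF as acb_cj[OF acb_b] Km'])
 hence 1: "cnj (ev b s) * ev m s - cnj (ev b a) * ev m a
  = cnj (ev b s) * ev dm s + I a s (mul (ccnj b) (- mul v q) + mul m (cj (J z))) - I a s (mul dm (cj (J z)))"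
  using d0 by (simp add: algebra_simps mul_diff_left I_lin)
 \<comment> \<open>The integrands cancel pointwise. This is the zero curvature condition: the linear
   systems in s and in t are compatible exactly when q solves the Schroedinger equation.\<close>
 have z: "rel (mul (ccnj b) (- mul v q) + mul m (cj (J z)) - (mul mt (cj q) + mul m (cj p))) = 0"
 proof (rule l2_eqI)
  let ?A = "mul (ccnj b) (- mul v q)" and ?B = "mul m (cj (J z))" and ?C = "mul mt (cj q)" and ?E = "mul m (cj p)"
  show "AE x in lborel. rep_l2 (rel (?A + ?B - (?C + ?E))) x = rep_l2 0 x"
   using rep_rel[of "?A + ?B - (?C + ?E)"] rep_diff[of "?A + ?B" "?C + ?E"] rep_add[of ?A ?B] rep_add[of ?C ?E]
    rep_mul[of "ccnj b" "- mul v q"] rep_uminus[of "mul v q"] rep_mul[of v q] rep_mul[of m "cj (J z)"] rep_cj[of "J z"]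
    rep_mul[of mt "cj q"] rep_cj[of q] rep_mul[of m "cj p"] rep_cj[of p]
    rep_add[of "J z" "J (mul (dens q) q)", folded p_eq] rep_J[of "mul (dens q) q"] rep_mul[of "dens q" q] rep_zero
  proof eventually_elim
   case (elim x)
   show ?case unfolding elim
    by (simp add: mt_def ith_def apply_dens vreal algebra_simps)
  qed
 qed
 have "ev vt s - ev vt a = of_real (Re (cnj (ev b s) * ev m s - cnj (ev b a) * ev m a))"
  by (simp add: vt_def)
 also have "... = of_real (Re (cnj (ev b s) * ev dm s - I a s (mul dm (cj (J z)))))
   + I a s (rel (mul (ccnj b) (- mul v q) + mul m (cj (J z))))"
  unfolding 1 I_rel by simp
 also have "rel (mul (ccnj b) (- mul v q) + mul m (cj (J z))) = rel (mul mt (cj q) + mul m (cj p))"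
  using z unfolding linear_diff[OF lin[OF lin_rel]] by simp
 finally show ?thesis by simp
qed

text \<open>As for v, but with two integrations by parts, one for b v and one for ith m; the
  derivatives J z of b and g of ith lie in L^2.\<close>

lemma mt_eq:
 "ev mt s - ev mt a + I a s (mul vt q + mul v p)
  = ev ith s * ev dm s - I a s (mul dm g) - ev b s * ev dv s + I a s (mul dv (J z))"
proof -
 have "ev b s * ev (v - dv) s - ev b a * ev (v - dv) a
   = I a s (mul b (rel (mul m (cj q))) + mul (v - dv) (J z))"
  by (rule ibp_acb[OF as acb_b Kv'])
 hence 1: "ev b s * ev v s - ev b a * ev v a
  = ev b s * ev dv s + I a s (mul b (rel (mul m (cj q))) + mul v (J z)) - I a s (mul dv (J z))"
  using d0 by (simp add: algebra_simps mul_diff_left I_lin)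
 have ag: "acb ith g" unfolding ith_def g_def by (rule acb_ci[OF acb_dens[OF qw]])
 have "ev ith s * ev (m - dm) s - ev ith a * ev (m - dm) a
   = I a s (mul ith (- mul v q) + mul (m - dm) g)"
  by (rule ibp_acb[OF as ag Km'])
 hence 2: "ev ith s * ev m s - ev ith a * ev m a
  = ev ith s * ev dm s + I a s (mul ith (- mul v q) + mul m g) - I a s (mul dm g)"
  using d0 by (simp add: algebra_simps mul_diff_left I_lin)
 let ?A = "mul ith (- mul v q)" and ?B = "mul m g" and ?C = "mul b (rel (mul m (cj q)))" and ?E = "mul v (J z)"
  and ?F = "mul vt q" and ?P = "mul v p"
 have z: "(?A + ?B) - (?C + ?E) + (?F + ?P) = 0"
 proof (rule l2_eqI)
  show "AE x in lborel. rep_l2 ((?A + ?B) - (?C + ?E) + (?F + ?P)) x = rep_l2 0 x"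
   using rep_add[of "(?A + ?B) - (?C + ?E)" "?F + ?P"] rep_diff[of "?A + ?B" "?C + ?E"] rep_add[of ?A ?B] rep_add[of ?C ?E] rep_add[of ?F ?P]
    rep_mul[of ith "- mul v q"] rep_uminus[of "mul v q"] rep_mul[of v q] rep_mul[of m g]
    rep_J[of "rel (mul (ccnj (cb q)) w)", folded g_def] rep_rel[of "mul (ccnj (cb q)) w"] rep_mul[of "ccnj (cb q)" w]
    rep_mul[of b "rel (mul m (cj q))"] rep_rel[of "mul m (cj q)"] rep_mul[of m "cj q"] rep_cj[of q]
    rep_mul[of v "J z"] rep_mul[of vt q] rep_mul[of v p]
    rep_add[of "J z" "J (mul (dens q) q)", folded p_eq] rep_J[of "mul (dens q) q"] rep_mul[of "dens q" q] rep_zero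
    isrep_b[unfolded isrep_def] isrep_q[unfolded isrep_def] rep_J[of w]
  proof eventually_elim
   case (elim x)
   have bw: "ev b x = \<i> * rep_l2 w x" using elim by simp
   show ?case unfolding elim
    by (simp add: vt_def mt_def ith_def apply_dens bw vreal complex_eq_iff algebra_simps)
  qed
 qed
 have "ev mt s - ev mt a + I a s (?F + ?P) =
   (ev ith s * ev dm s - I a s (mul dm g)) - (ev b s * ev dv s - I a s (mul dv (J z)))
   + I a s ((?A + ?B) - (?C + ?E) + (?F + ?P))"
 proof -
  have "ev mt s - ev mt a = (ev ith s * ev m s - ev ith a * ev m a)
    - (ev b s * ev v s - ev b a * ev v a)"
   by (simp add: mt_def)
  thus ?thesis unfolding 1 2 by (simp add: I_lin algebra_simps)
 qed
 also have "I a s ((?A + ?B) - (?C + ?E) + (?F + ?P)) = 0"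
  unfolding z by (rule linear_0[OF lin[OF lin_I]])
 finally show ?thesis by simp
qed

end

text \<open>Clamping the argument to [a, S] makes the defects on a bounded interval elements of the
  Banach space of bounded continuous functions on the line; the primitive of an L^2 function need
  not be bounded globally.\<close>

definition cl :: "real => real => cbf => cbf" where
 "cl a S \<phi> = Bcontfun (%x. ev \<phi> (max a (min S x)))"
definition IA :: "real => real => l2 => cbf" where
 "IA a S u = Bcontfun (%x. I a (max a (min S x)) u)"

lemma apply_cl [simp]: "ev (cl a S \<phi>) x = ev \<phi> (max a (min S x))"
proof -
 have "continuous_on UNIV (%x. ev \<phi> (max a (min S x)))"
  by (rule continuous_on_compose2[OF continuous_on_apply_bcontfun[of UNIV \<phi>]]) (auto intro!: continuous_intros)
 hence "(%x. ev \<phi> (max a (min S x))) \<in> bcontfun"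
  by (rule bcontfun_normI[where b = "norm \<phi>"]) (auto simp: bcontfun_le)
 thus ?thesis by (simp add: cl_def Bcontfun_inverse)
qed

lemma I_le: "a <= x ==> x <= S ==> cmod (I a x u) <= sqrt (S - a) * norm u"
 by (rule order_trans[OF I_bound]) (auto intro!: mult_right_mono)

lemma apply_IA [simp]: assumes "a <= S" shows "ev (IA a S u) x = I a (max a (min S x)) u"
proof -
 have "continuous_on UNIV (%x. (%y. if y < a then - I y a u else I a y u) (max a (min S x)))"
  by (rule continuous_on_compose2[OF I_signed_continuous[of a u]]) (auto intro!: continuous_intros)
 hence "continuous_on UNIV (%x. I a (max a (min S x)) u)" by (simp add: not_less[symmetric] cong: if_cong)
 hence "(%x. I a (max a (min S x)) u) \<in> bcontfun"
  by (rule bcontfun_normI[where b = "sqrt (S - a) * norm u"]) (use assms in "auto intro!: I_le")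
 thus ?thesis by (simp add: IA_def Bcontfun_inverse)
qed

lemma lin_cl: "bounded_linear (cl a S)"
 by (rule bounded_linear_intro[where K = 1]) (auto intro!: bcontfun_eqI bcontfun_norm_le simp: bcontfun_le)

lemma lin_IA: assumes "a <= S" shows "bounded_linear (IA a S)"
 by (rule bounded_linear_intro[where K = "sqrt (S - a)"])
   (use assms in \<open>auto intro!: bcontfun_eqI bcontfun_norm_le I_le simp: I_add I_scaleR mult.commute[of "norm _"]\<close>)

lemma lin_const_at: "bounded_linear (%\<phi>::cbf. const_bcontfun (ev \<phi> a) :: cbf)"
 by (rule bounded_linear_intro[where K = 1])
   (auto intro!: bcontfun_eqI bcontfun_norm_le simp: bcontfun_le const_bcontfun.rep_eq)

lemma continuous_Ici_bounded:
 fixes f :: "real => 'a::real_normed_vector"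
 assumes "cont0 f" obtains B where "0 <= B" "!!t. t \<in> {0..T} ==> norm (f t) <= B"
proof -
 have "continuous_on {0..T} f" by (rule continuous_on_subset[OF assms]) auto
 hence "bounded (f ` {0..T})" by (intro compact_imp_bounded compact_continuous_image) auto
 then obtain B where B: "\<forall>x\<in>f ` {0..T}. norm x <= B" unfolding bounded_iff ..
 show ?thesis by (rule that[of "max 0 B"]) (use B in "auto simp: le_max_iff_disj")
qed

locale nls_sol =
 fixes q w z :: "real => l2"
 assumes qw: "!!t. 0 <= t ==> has_D (q t) (w t)" and wz: "!!t. 0 <= t ==> has_D (w t) (z t)"
  and cq: "cont0 q" and cw: "cont0 w" and cz: "cont0 z"
  and eq: "!!t. 0 <= t ==> (q hvd J (z t + NL (q t))) (at0 t)"
begin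

definition b :: "real => cbf" where "b t = cb (J (w t))"
definition ith :: "real => cbf" where "ith t = ci (dens (q t))"

lemma CHq: "CH (Suc 0) q" by (rule CH_SucI[OF cq qw]) (use cw in auto)
lemma CHw: "CH (Suc 0) w" by (rule CH_SucI[OF cw wz]) (use cz in auto)

lemma cb_continuous: "cont0 (%t. cb (q t))" by (rule CH_cb[OF CHq])
lemma b_continuous: "cont0 b" unfolding b_def[abs_def] by (rule CH_cb[OF CH_J[OF CHw]])
lemma ith_continuous: "cont0 ith"
 unfolding ith_def[abs_def] dens_def
 by (intro lin_cont[OF lin_ci] continuous_on_scaleR continuous_on_const
   bil_cont[OF bil_cmul] cb_continuous lin_cont[OF lin_ccnj])

definition FF :: "real => cbf \<times> cbf => cbf \<times> cbf" where
 "FF t Y = (cre (cmul (ccnj (b t)) (snd Y)), cmul (ith t) (snd Y) - cmul (b t) (fst Y))"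

lemma FF_diff: "FF t X - FF t Y = FF t (X - Y)"
 unfolding FF_def
 by (simp add: linear_diff[OF lin[OF lin_cre]] bounded_bilinear.diff_right[OF bil_cmul])

lemma norm_FF: "norm (FF t Y) <= (norm (b t) + norm (ith t) + norm (b t)) * norm Y"
proof -
 have f: "norm (fst Y) <= norm Y" "norm (snd Y) <= norm Y" by (metis norm_fst_le norm_snd_le prod.collapse)+
 have "norm (FF t Y) <= norm (fst (FF t Y)) + norm (snd (FF t Y))" by (metis norm_Pair_le prod.collapse)
 also have "... <= norm (b t) * norm Y + (norm (ith t) * norm Y + norm (b t) * norm Y)"
 proof (intro add_mono)
  show "norm (fst (FF t Y)) <= norm (b t) * norm Y" unfolding FF_def fst_conv
   by (rule order_trans[OF norm_cre], rule order_trans[OF norm_cmul]) (simp add: mult_left_mono f)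
  show "norm (snd (FF t Y)) <= norm (ith t) * norm Y + norm (b t) * norm Y" unfolding FF_def snd_conv
   by (rule order_trans[OF norm_triangle_ineq4], intro add_mono order_trans[OF norm_cmul]) (simp_all add: mult_left_mono f)
 qed
 finally show ?thesis by (simp add: algebra_simps)
qed

lemma frame_ode:
 obtains Y where "cont0 Y" "Y 0 = Y0" "!!t. 0 <= t ==> (Y hvd FF t (Y t)) (at0 t)"
proof (rule picard[of UNIV Y0 FF "%t. norm (b t) + norm (ith t) + norm (b t)"])
 show "cont0 (%t. norm (b t) + norm (ith t) + norm (b t))" by (intro continuous_intros b_continuous ith_continuous)
 show "norm (FF t X - FF t Y) <= (norm (b t) + norm (ith t) + norm (b t)) * norm (X - Y)" for t X Y
  unfolding FF_diff by (rule norm_FF)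
 show "FF t 0 = 0" for t using FF_diff[of t 0 0] by simp
 fix y :: "real => cbf \<times> cbf" assume "cont0 y"
 thus "cont0 (%t. FF t (y t))" unfolding FF_def
  by (intro continuous_on_Pair continuous_on_diff lin_cont[OF lin_cre]
    bil_cont[OF bil_cmul] lin_cont[OF lin_ccnj]
    b_continuous ith_continuous continuous_on_fst continuous_on_snd)
qed (use that in auto)

definition frame :: "(real => cbf) => (real => cbf) => bool" where
 "frame v m \<longleftrightarrow> cont0 v \<and> cont0 m \<and>
  (\<forall>t\<ge>0. (v hvd cre (cmul (ccnj (b t)) (m t))) (at0 t)) \<and>
  (\<forall>t\<ge>0. (m hvd cmul (ith t) (m t) - cmul (b t) (v t)) (at0 t)) \<and> (\<forall>t\<ge>0. \<forall>x. Im (ev (v t) x) = 0) \<and>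
  (\<forall>t\<ge>0. acb (v t) (rel (mul (m t) (cj (q t))))) \<and> (\<forall>t\<ge>0. acb (m t) (- mul (v t) (q t)))"

lemma frame_exists:
 assumes V0: "!!x. Im (ev V0 x) = 0" "acb V0 (rel (mul M0 (cj (q 0))))" "acb M0 (- mul V0 (q 0))"
 obtains v m where "v 0 = V0" "m 0 = M0" "frame v m"
proof -
 obtain Y where Y: "cont0 Y" "Y 0 = (V0, M0)" "!!t. 0 <= t ==> (Y hvd FF t (Y t)) (at0 t)"
  using frame_ode[of "(V0, M0)"] by blast
 define v where "v t = fst (Y t)" for t
 define m where "m t = snd (Y t)" for t
 let ?vt = "%t. cre (cmul (ccnj (b t)) (m t))" and ?mt = "%t. cmul (ith t) (m t) - cmul (b t) (v t)"
 let ?p = "%t. J (z t + NL (q t))"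
 have cv: "cont0 v" and cm: "cont0 m" unfolding v_def m_def
  by (intro continuous_on_fst continuous_on_snd Y(1))+
 have dv: "(v hvd ?vt t) (at0 t)" if "0 <= t" for t
  using lin_hvd[OF bounded_linear_fst Y(3)[OF that]] by (simp add: v_def[abs_def] m_def FF_def)
 have dm: "(m hvd ?mt t) (at0 t)" if "0 <= t" for t
  using lin_hvd[OF bounded_linear_snd Y(3)[OF that]] by (simp add: v_def m_def[abs_def] FF_def)
 have vreal: "Im (ev (v t) x) = 0" if t: "0 <= t" for t x
 proof -
  \<comment> \<open>The equation for v has a real right hand side whatever v and m are, so the
    imaginary part of v is constant in t.\<close>
  have "v t - cre (v t) = v 0 - cre (v 0)"
  proof (rule zero_deriv_const[of t])
   fix s assume "s \<in> {0..t}"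
   hence "((%t. v t - cre (v t)) hvd ?vt s - cre (?vt s)) (at0 s)"
    by (intro has_vector_derivative_diff lin_hvd[OF lin_cre] dv) auto
   moreover have "?vt s - cre (?vt s) = 0" by (rule bcontfun_eqI) simp
   ultimately show "((%t. v t - cre (v t)) hvd 0) (at s within {0..t})"
    by (auto intro: has_vector_derivative_within_subset)
  qed (use t in auto)
  moreover have "v 0 - cre (v 0) = 0" by (rule bcontfun_eqI) (simp add: v_def Y(2) complex_eq_iff V0(1))
  ultimately have "v t = cre (v t)" by simp
  thus ?thesis by (metis Im_complex_of_real apply_cre)
 qed
 have key: "ev (v T) S - ev (v T) a = I a S (rel (mul (m T) (cj (q T)))) \<and>
   ev (m T) S - ev (m T) a = - I a S (mul (v T) (q T))"
  if aS: "a <= S" and T: "0 <= T" for a S T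
 proof -
  \<comment> \<open>The defects of the two s-equations on [a, S]. They vanish at t = 0, and their
    t-derivatives are bounded linearly by the defects themselves.\<close>
  define DV where "DV t = cl a S (v t) - const_bcontfun (ev (v t) a) - IA a S (rel (mul (m t) (cj (q t))))" for t
  define DM where "DM t = cl a S (m t) - const_bcontfun (ev (m t) a) + IA a S (mul (v t) (q t))" for t
  define DV' where "DV' t = cl a S (?vt t) - const_bcontfun (ev (?vt t) a) - IA a S (rel (mul (?mt t) (cj (q t)) + mul (m t) (cj (?p t))))" for t
  define DM' where "DM' t = cl a S (?mt t) - const_bcontfun (ev (?mt t) a) + IA a S (mul (?vt t) (q t) + mul (v t) (?p t))" for t
  have p1: "((%t. mul (m t) (cj (q t))) hvd mul (?mt t) (cj (q t)) + mul (m t) (cj (?p t))) (at0 t)" if "0 <= t" for t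
   using bil_hvd[OF bil_mul dm[OF that] lin_hvd[OF lin_cj eq[OF that]]]
   by (simp only: add.commute)
  have p2: "((%t. mul (v t) (q t)) hvd mul (?vt t) (q t) + mul (v t) (?p t)) (at0 t)" if "0 <= t" for t
   using bil_hvd[OF bil_mul dv[OF that] eq[OF that]] by (simp only: add.commute)
  have dDV: "(DV hvd DV' t) (at0 t)" if "0 <= t" for t
   unfolding DV_def[abs_def] DV'_def
   by (intro has_vector_derivative_diff lin_hvd[OF lin_cl dv[OF that]]
     lin_hvd[OF lin_const_at dv[OF that]]
     lin_hvd[OF lin_IA[OF aS] lin_hvd[OF lin_rel p1[OF that]]])
  have dDM: "(DM hvd DM' t) (at0 t)" if "0 <= t" for t
   unfolding DM_def[abs_def] DM'_def
   by (intro has_vector_derivative_diff has_vector_derivative_add lin_hvd[OF lin_cl dm[OF that]]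
     lin_hvd[OF lin_const_at dm[OF that]]
     lin_hvd[OF lin_IA[OF aS] p2[OF that]])
  obtain B1 where B1: "0 <= B1" "!!t. t \<in> {0..T} ==> norm (b t) <= B1" using continuous_Ici_bounded[OF b_continuous, where T = T] by blast
  obtain B2 where B2: "0 <= B2" "!!t. t \<in> {0..T} ==> norm (ith t) <= B2" using continuous_Ici_bounded[OF ith_continuous, where T = T] by blast
  obtain B3 where B3: "0 <= B3" "!!t. t \<in> {0..T} ==> norm (z t) <= B3" using continuous_Ici_bounded[OF cz, where T = T] by blast
  let ?g = "%t. J (rel (mul (ccnj (cb (q t))) (w t)))"
  have "cont0 ?g"
   by (intro lin_cont[OF lin_J] lin_cont[OF lin_rel]
    bil_cont[OF bil_mul] lin_cont[OF lin_ccnj] cb_continuous cw)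
  from continuous_Ici_bounded[OF this, where T = T]
  obtain B4 where B4: "0 <= B4" "!!t. t \<in> {0..T} ==> norm (?g t) <= B4" by blast
  let ?r = "sqrt (S - a)"
  \<comment> \<open>B1 to B4 bound the coefficients b, ith, q_ss and the derivative of ith on
    [0, T]. The last two are only square integrable in s and enter under an integral, which costs
    the factor sqrt (S - a).\<close>
  let ?C = "(B1 + ?r * B3) + (B2 + ?r * B4) + (B1 + ?r * B3)"
  have r0: "0 <= ?r" using aS by simp
  have bd: "norm (DV' t, DM' t) <= ?C * norm (DV t, DM t)" if t: "t \<in> {0..T}" for t
  proof -
   have t0: "0 <= t" using t by simp
   let ?N = "norm (DV t, DM t)"
   have N: "norm (DV t) <= ?N" "norm (DM t) <= ?N" by (rule norm_fst_le norm_snd_le)+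
   have fp: "frame_point (v t) (m t) (DV t) (DM t) (q t) (w t) (z t) a s" if s: "a <= s" "s <= S" for s
   proof
    fix x assume "x \<in> {a..s}"
    hence "max a (min S x) = x" using s by auto
    thus "ev (v t) x - ev (DV t) x = ev (v t) a + I a x (rel (mul (m t) (cj (q t))))"
     "ev (m t) x - ev (DM t) x = ev (m t) a - I a x (mul (v t) (q t))"
     by (simp_all add: DV_def DM_def aS const_bcontfun.rep_eq)
   qed (use s vreal[OF t0] qw[OF t0] wz[OF t0] in auto)
   have Ib: "cmod (I a s (mul \<phi> u)) <= ?r * (?N * B)" if "a <= s" "s <= S" "norm \<phi> <= ?N" "norm u <= B" for s \<phi> u B
   proof (rule order_trans[OF I_le[OF that(1,2)]], rule mult_left_mono[OF _ r0], rule order_trans[OF norm_mul])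
    show "norm \<phi> * norm u <= ?N * B" by (rule mult_mono[OF that(3,4)]) auto
   qed
   have pb: "cmod (ev \<beta> s * ev \<phi> s) <= B * ?N" if "norm \<beta> <= B" "norm \<phi> <= ?N" for \<beta> \<phi> :: cbf and B s
    unfolding norm_mult by (rule mult_mono) (use that bcontfun_le order_trans norm_ge_zero in blast)+
   have z': "norm (J (z t)) <= B3" "norm (cj (J (z t))) <= B3" using B3(2)[OF t] by simp_all
   have V: "norm (DV' t) <= (B1 + ?r * B3) * ?N"
   proof (rule bcontfun_norm_le)
    fix x
    define s where "s = max a (min S x)"
    have s: "a <= s" "s <= S" using aS by (auto simp: s_def)
    interpret fp: frame_point "v t" "m t" "DV t" "DM t" "q t" "w t" "z t" a s by (rule fp[OF s])
    have "ev (DV' t) x = of_real (Re (cnj (ev (b t) s) * ev (DM t) s - I a s (mul (DM t) (cj (J (z t))))))"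
     using fp.vt_eq unfolding fp.vt_def fp.mt_def fp.p_def fp.ith_def fp.b_def DV'_def b_def ith_def
     by (simp add: aS const_bcontfun.rep_eq s_def)
    also have "cmod ... <= cmod (ev (b t) s * ev (DM t) s) + cmod (I a s (mul (DM t) (cj (J (z t)))))"
    proof -
     have "cmod (of_real (Re X)) <= cmod X" for X by (simp only: norm_of_real abs_Re_le_cmod)
     also have "cmod (cnj X * Y - Z) <= cmod (X * Y) + cmod Z" for X Y Z
      using norm_triangle_ineq4[of "cnj X * Y" Z] by (simp add: norm_mult)
     finally show ?thesis .
    qed
    also have "... <= B1 * ?N + ?r * (?N * B3)"
     by (intro add_mono pb Ib s B1(2)[OF t] N z')
    finally show "cmod (ev (DV' t) x) <= (B1 + ?r * B3) * ?N" by (simp add: algebra_simps)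
   qed
   have M: "norm (DM' t) <= ((B2 + ?r * B4) + (B1 + ?r * B3)) * ?N"
   proof (rule bcontfun_norm_le)
    fix x
    define s where "s = max a (min S x)"
    have s: "a <= s" "s <= S" using aS by (auto simp: s_def)
    interpret fp: frame_point "v t" "m t" "DV t" "DM t" "q t" "w t" "z t" a s by (rule fp[OF s])
    have "ev (DM' t) x = ev (ith t) s * ev (DM t) s - I a s (mul (DM t) (?g t)) - ev (b t) s * ev (DV t) s + I a s (mul (DV t) (J (z t)))"
     using fp.mt_eq unfolding fp.vt_def fp.mt_def fp.p_def fp.ith_def fp.b_def fp.g_def DM'_def b_def ith_def
     by (simp add: aS const_bcontfun.rep_eq s_def)
    also have "cmod ... <= cmod (ev (ith t) s * ev (DM t) s) + cmod (I a s (mul (DM t) (?g t)))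
      + cmod (ev (b t) s * ev (DV t) s) + cmod (I a s (mul (DV t) (J (z t))))"
     by (intro order_trans[OF norm_triangle_ineq] order_trans[OF norm_triangle_ineq4] add_mono order_refl)
    also have "... <= B2 * ?N + ?r * (?N * B4) + B1 * ?N + ?r * (?N * B3)"
     by (intro add_mono pb Ib s B1(2)[OF t] B2(2)[OF t] B4(2)[OF t] N z')
    finally show "cmod (ev (DM' t) x) <= ((B2 + ?r * B4) + (B1 + ?r * B3)) * ?N" by (simp add: algebra_simps)
   qed
   have "norm (DV' t, DM' t) <= norm (DV' t) + norm (DM' t)" by (rule norm_Pair_le)
   also have "... <= ?C * ?N" using V M by (simp add: algebra_simps)
   finally show ?thesis .
  qed
  have "norm (DV T, DM T) <= norm (DV 0, DM 0) * exp (?C * T)"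
  proof (rule gronwall[of T "%t. (DV t, DM t)" "%t. (DV' t, DM' t)" ?C T])
   show "((%t. (DV t, DM t)) hvd (DV' t, DM' t)) (at t within {0..T})" if "t \<in> {0..T}" for t
   proof -
    have "t >= 0" using that by simp
    show ?thesis
     by (rule has_vector_derivative_Pair)
       (rule has_vector_derivative_within_subset[OF dDV[OF \<open>t >= 0\<close>]] has_vector_derivative_within_subset[OF dDM[OF \<open>t >= 0\<close>]], simp)+
   qed
   show "0 <= ?C" using B1(1) B2(1) B3(1) B4(1) r0 by simp
  qed (use bd T in auto)
  moreover have "DV 0 = 0" "DM 0 = 0"
   using V0(2,3) aS I_scaleR[of _ _ "-1" "mul V0 (q 0)"]
   by (auto intro!: bcontfun_eqI simp: DV_def DM_def v_def m_def Y(2) acb_def const_bcontfun.rep_eq)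
  ultimately have "(DV T, DM T) = 0" by simp
  hence "DV T = 0" "DM T = 0" by (simp_all add: zero_prod_def)
  hence "ev (DV T) S = 0" "ev (DM T) S = 0" by simp_all
  thus ?thesis by (simp add: DV_def DM_def aS const_bcontfun.rep_eq algebra_simps)
 qed
 show ?thesis
 proof (rule that[of v m])
  show "v 0 = V0" "m 0 = M0" by (simp_all add: v_def m_def Y(2))
  have "acb (v t) (rel (mul (m t) (cj (q t))))" "acb (m t) (- mul (v t) (q t))" if "0 <= t" for t
   using key[OF _ that] I_scaleR[of _ _ "-1" "mul (v t) (q t)"] by (simp_all add: acb_def)
  thus "frame v m" unfolding frame_def using cv cm dv dm vreal by blast
 qed
qed

end

section \<open>Functions on the half line\<close>

text \<open>Smooth bump functions are built from exp (-e/x) times polynomials in 1/x, a class closed under derivatives.\<close>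

definition ef :: "real => real poly => real => real" where
 "ef e p x = (if 0 < x then poly p (1 / x) * exp (- (e / x)) else 0)"

text \<open>With y = 1/x one has d/dx = - y^2 d/dy, and p(y) exp (- e y) is taken to y^2 (e p(y) -
  p'(y)) exp (- e y).\<close>

definition efd :: "real => real poly => real poly" where
 "efd e p = [:0, 0, 1:] * (smult e p - pderiv p)"

lemma poly_exp_tendsto_0:
 fixes p :: "real poly" assumes "0 < e"
 shows "((%y. y ^ n * poly p y * exp (- (e * y))) ---> 0) at_top"
proof (induction p arbitrary: n)
 case (pCons a p)
 have "((%y. a * (y ^ n * exp (- (e * y))) + y ^ Suc n * poly p y * exp (- (e * y))) ---> a * 0 + 0) at_top"
  by (intro tendsto_add tendsto_mult tendsto_const pCons.IH) (use assms in real_asymp)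
 thus ?case by (simp add: algebra_simps)
qed simp

lemma ef_tendsto_0: assumes "0 < e" shows "((ef e p) ---> 0) (at_right 0)"
proof (rule Lim_transform_eventually)
 show "((%x. (inverse x) ^ 0 * poly p (inverse x) * exp (- (e * inverse x))) ---> 0) (at_right 0)"
  by (rule filterlim_compose[OF poly_exp_tendsto_0[OF assms] filterlim_inverse_at_top_right])
 show "\<forall>\<^sub>F x in at_right 0. (inverse x) ^ 0 * poly p (inverse x) * exp (- (e * inverse x)) = ef e p x"
  unfolding eventually_at_filter by (intro always_eventually) (simp add: ef_def divide_inverse)
qed

lemma ef_deriv: assumes e: "0 < e" shows "(ef e p has_real_derivative ef e (efd e p) x) (at x)"
proof -
 consider "0 < x" | "x < 0" | "x = 0" by linarith
 thus ?thesis
 proof cases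
  case 1
  have "((%x. poly p (1 / x) * exp (- (e / x))) has_real_derivative
    (poly (pderiv p) (1 / x) * (- (1 / x^2)) * exp (- (e / x)) + exp (- (e / x)) * (e / x^2) * poly p (1 / x))) (at x)"
   using 1 by (auto intro!: derivative_eq_intros DERIV_chain'[OF _ poly_DERIV] simp: power2_eq_square)
  moreover have "poly (pderiv p) (1 / x) * (- (1 / x^2)) * exp (- (e / x)) + exp (- (e / x)) * (e / x^2) * poly p (1 / x) = ef e (efd e p) x"
   using 1 by (simp add: ef_def efd_def power2_eq_square algebra_simps)
  ultimately have "((%x. poly p (1 / x) * exp (- (e / x))) has_real_derivative ef e (efd e p) x) (at x)" by simp
  thus ?thesis
   by (rule has_field_derivative_transform_within_open[where S = "{0<..}"]) (use 1 in "auto simp: ef_def")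
 next
  case 2
  have "((%x. 0) has_real_derivative ef e (efd e p) x) (at x)" using 2 by (simp add: ef_def)
  thus ?thesis
   by (rule has_field_derivative_transform_within_open[where S = "{..<0}"]) (use 2 in "auto simp: ef_def")
 next
  case 3
  have "((%h. (ef e p h - ef e p 0) / (h - 0)) ---> 0) (at 0)"
  proof (rule filterlim_split_at)
   show "((%h. (ef e p h - ef e p 0) / (h - 0)) ---> 0) (at_left 0)"
    by (rule tendsto_eventually) (auto simp: eventually_at_filter ef_def intro!: always_eventually)
   show "((%h. (ef e p h - ef e p 0) / (h - 0)) ---> 0) (at_right 0)"
   \<comment> \<open>Dividing by h multiplies the polynomial by 1/h, so the quotient is again of the
     form \<open>ef\<close> and tends to 0.\<close>
   proof (rule Lim_transform_eventually[OF ef_tendsto_0[OF e, of "pCons 0 p"]])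
    show "\<forall>\<^sub>F h in at_right 0. ef e (pCons 0 p) h = (ef e p h - ef e p 0) / (h - 0)"
     unfolding eventually_at_filter by (intro always_eventually) (simp add: ef_def)
   qed
  qed
  thus ?thesis using 3 by (simp add: has_field_derivative_iff ef_def)
 qed
qed

definition smooth :: "(real => real) => bool" where
 "smooth f \<longleftrightarrow> (\<exists>F. F 0 = f \<and> (\<forall>n x. (F n has_real_derivative F (Suc n) x) (at x)))"

lemma smooth_deriv_pow: assumes "smooth f" shows "(deriv ^^ n) f differentiable (at x)"
proof -
 obtain F where F: "F 0 = f" "!!n x. (F n has_real_derivative F (Suc n) x) (at x)" using assms by (auto simp: smooth_def)
 have "(deriv ^^ n) f = F n" for n
  by (induction n) (auto simp: F(1) intro!: ext DERIV_imp_deriv F(2))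
 thus ?thesis using F(2)[of n x] by (auto simp: real_differentiable_def)
qed

lemma smooth_diff: assumes "smooth f" "smooth g" shows "smooth (%x. c * f x - d * g x)"
proof -
 obtain F where F: "F 0 = f" "!!n x. (F n has_real_derivative F (Suc n) x) (at x)" using assms by (auto simp: smooth_def)
 obtain G where G: "G 0 = g" "!!n x. (G n has_real_derivative G (Suc n) x) (at x)" using assms by (auto simp: smooth_def)
 show ?thesis unfolding smooth_def
  by (intro exI[of _ "%n x. c * F n x - d * G n x"]) (auto simp: F(1) G(1) intro!: derivative_eq_intros F(2) G(2))
qed

lemma smooth_primitive: assumes "smooth f" "!!x. (g has_real_derivative f x) (at x)" shows "smooth g"
proof -
 obtain F where F: "F 0 = f" "!!n x. (F n has_real_derivative F (Suc n) x) (at x)" using assms by (auto simp: smooth_def)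
 show ?thesis unfolding smooth_def
 proof (intro exI[of _ "%n. case n of 0 => g | Suc m => F m"] conjI allI)
  show "((case n of 0 => g | Suc m => F m) has_real_derivative (case Suc n of 0 => g | Suc m => F m) x) (at x)" for n x
   using assms(2) F by (cases n) auto
 qed simp
qed

lemma smooth_continuous: "smooth f ==> continuous_on S f"
 unfolding smooth_def by (metis DERIV_isCont continuous_at_imp_continuous_on)

text \<open>Each summand has one factor flat at a and one flat at b. Finite sums of such products
  are closed under derivatives; \<open>bfd\<close> is the product rule on the coefficient lists,
  where -p records the sign coming from b - x.\<close>

definition bf :: "real => real => real => (real poly \<times> real poly) list => real => real" where
 "bf e a b ps x = (\<Sum>(p, r)\<leftarrow>ps. ef e p (x - a) * ef e r (b - x))"
definition bfd :: "real => (real poly \<times> real poly) list => (real poly \<times> real poly) list" where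
 "bfd e ps = concat (map (%(p, r). [(efd e p, r), (- p, efd e r)]) ps)"

lemma bf_deriv: assumes "0 < e" shows "(bf e a b ps has_real_derivative bf e a b (bfd e ps) x) (at x)"
proof (induction ps)
 case Nil thus ?case by (simp add: bf_def[abs_def] bfd_def)
next
 case (Cons pr ps)
 obtain p r where pr: "pr = (p, r)" by (cases pr)
 have 1: "((%x. ef e p (x - a)) has_real_derivative ef e (efd e p) (x - a)) (at x)"
 proof -
  have "((%x. x - a) has_real_derivative 1) (at x)" by (auto intro!: derivative_eq_intros)
  from DERIV_chain2[where f = "ef e p", OF ef_deriv[OF assms] this] show ?thesis by simp
 qed
 have 2: "((%x. ef e r (b - x)) has_real_derivative ef e (efd e r) (b - x) * (- 1)) (at x)"
  by (rule DERIV_chain2[where f = "ef e r" and g = "%x. b - x", OF ef_deriv[OF assms]]) (auto intro!: derivative_eq_intros)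
 have "bf e a b (pr # ps) = (%x. ef e p (x - a) * ef e r (b - x) + bf e a b ps x)" by (simp add: bf_def[abs_def] pr)
 moreover have "bf e a b (bfd e (pr # ps)) x = (ef e p (x - a) * (ef e (efd e r) (b - x) * (- 1)) + ef e (efd e p) (x - a) * ef e r (b - x)) + bf e a b (bfd e ps) x"
  by (simp add: bf_def bfd_def pr) (simp add: ef_def)
 ultimately show ?case by (simp only:) (rule DERIV_add[OF DERIV_mult'[OF 1 2] Cons.IH])
qed

lemma smooth_bf: "0 < e ==> smooth (bf e a b ps)"
 unfolding smooth_def by (intro exI[of _ "%n. bf e a b ((bfd e ^^ n) ps)"]) (auto intro: bf_deriv)

text \<open>As the exponent \<open>eps n\<close> tends to 0, the bumps tend pointwise to the
  indicator of the open interval while staying between 0 and 1.\<close>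

definition bump :: "nat => real => real => real => real" where
 "bump n a b = bf (eps n) a b [(1, 1)]"

lemma bump_eq: "bump n a b x = (if a < x \<and> x < b then exp (- (eps n / (x - a))) * exp (- (eps n / (b - x))) else 0)"
 by (simp add: bump_def bf_def ef_def)

lemma smooth_bump: "smooth (bump n a b)" unfolding bump_def by (rule smooth_bf) simp

lemma bump_bounds: "0 <= bump n a b x" "bump n a b x <= 1" "x \<notin> {a..b} ==> bump n a b x = 0"
 by (auto simp: bump_eq intro!: mult_le_one)

lemma bump_lim: "(%n. bump n a b x) ----> indicator {a<..<b} x"
proof (cases "a < x \<and> x < b")
 case True
 have "(%n. exp (- (eps n / (x - a))) * exp (- (eps n / (b - x)))) ----> exp (- (0 / (x - a))) * exp (- (0 / (b - x)))"
  by (intro tendsto_intros LIMSEQ_inverse_real_of_nat) (use True in auto)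
 thus ?thesis using True by (simp add: bump_eq)
qed (auto simp: bump_eq)

text \<open>The half line is embedded in the line: u is the extension of f by zero. The junk values of f at s <= 0 do not matter.\<close>

definition zx :: "(real => real) => l2 => bool" where
 "zx f u \<longleftrightarrow> f \<in> borel_measurable (Lpos) \<and> (AE x in lborel. rep_l2 u x = (if 0 < x then of_real (f x) else 0))"

lemma lebesgue_on_AE_iff: "(AE x in Lpos. P x) \<longleftrightarrow> (AE x in lborel. (0::real) < x --> P x)"
 by (subst AE_restrict_space_iff) (auto simp: AE_completion_iff)

text \<open>The Sobolev spaces of the statement use completed Lebesgue measure on the half line,
  \<open>l2\<close> uses Borel functions on the line. The lemma passes from F to a Borel function B
  equal a.e. to the extension of F by zero.\<close>

lemma lebesgue_on_conv:
 fixes F B :: "real => real"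
 assumes F: "F \<in> borel_measurable (Lpos)" and [measurable]: "B \<in> borel_measurable borel"
  and ae: "AE x in lborel. (if 0 < x then F x else 0) = B x"
 shows "integrable (Lpos) F \<longleftrightarrow> integrable lborel B"
  "(LINT x|Lpos. F x) = (LINT x|lborel. B x)"
proof -
 let ?F = "%x. indicat_real {0<..} x *\<^sub>R F x"
 have mF: "?F \<in> borel_measurable lebesgue"
  using F by (subst (asm) borel_measurable_restrict_space_iff) auto
 have B': "B \<in> borel_measurable lborel" by measurable
 hence mB: "B \<in> borel_measurable lebesgue" by (rule measurable_completion)
 have "AE x in lebesgue. (if 0 < x then F x else 0) = B x" using ae by (simp add: AE_completion_iff)
 hence ae': "AE x in lebesgue. ?F x = B x" by eventually_elim (auto simp: indicator_def split: if_splits)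
 have "integrable (Lpos) F \<longleftrightarrow> integrable lebesgue ?F" by (subst integrable_restrict_space) auto
 also have "... \<longleftrightarrow> integrable lebesgue B" by (rule integrable_cong_AE[OF mF mB ae'])
 also have "... \<longleftrightarrow> integrable lborel B" by (rule integrable_completion[OF B'])
 finally show "integrable (Lpos) F \<longleftrightarrow> integrable lborel B" .
 have "(LINT x|Lpos. F x) = (LINT x|lebesgue. ?F x)" by (subst integral_restrict_space) auto
 also have "... = (LINT x|lebesgue. B x)" by (rule integral_cong_AE[OF mF mB ae'])
 also have "... = (LINT x|lborel. B x)" by (rule integral_completion[OF B'])
 finally show "(LINT x|Lpos. F x) = (LINT x|lborel. B x)" .
qed

lemma zx_L2: assumes "zx f u" shows "L2_pos f" "(LINT x|Lpos. (f x)^2) = (norm u)^2"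
proof -
 have m: "f \<in> borel_measurable (Lpos)" using assms by (simp add: zx_def)
 have ae: "AE x in lborel. rep_l2 u x = (if 0 < x then of_real (f x) else 0)" using assms by (simp add: zx_def)
 have ae2: "AE x in lborel. (if 0 < x then (f x)^2 else 0) = (cmod (rep_l2 u x))^2"
  using ae by eventually_elim auto
 have m2: "(%x. (f x)^2) \<in> borel_measurable (Lpos)" using m by measurable
 have mr: "(%x. (cmod (rep_l2 u x))^2) \<in> borel_measurable borel" by measurable
 note c = lebesgue_on_conv[OF m2 mr ae2]
 show "L2_pos f" unfolding L2_pos_def using m c(1) sqi_integrable[OF rep_l2_sqi] by simp
 show "(LINT x|Lpos. (f x)^2) = (norm u)^2" using c(2) by (simp add: norm_l2_sq)
qed

text \<open>The extension by zero is Lebesgue measurable and agrees a.e. with a Borel function,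
  whose class in \<open>l2\<close> is taken.\<close>

lemma L2_zx: assumes "L2_pos f" obtains u where "zx f u"
proof -
 have m: "f \<in> borel_measurable (Lpos)" and i: "integrable (Lpos) (%x. (f x)^2)"
  using assms by (auto simp: L2_pos_def)
 have "(%x. indicat_real {0<..} x *\<^sub>R f x) \<in> borel_measurable lebesgue"
  using m by (subst (asm) borel_measurable_restrict_space_iff) auto
 from completion_ex_borel_measurable_real[OF this]
 obtain B where B: "B \<in> borel_measurable lborel" "AE x in lborel. indicat_real {0<..} x *\<^sub>R f x = B x" by blast
 hence [measurable]: "B \<in> borel_measurable borel" by simp
 have ae: "AE x in lborel. (if 0 < x then (f x)^2 else 0) = (B x)^2" using B(2) by eventually_elim (auto simp: indicator_def split: if_splits)
 have m2: "(%x. (f x)^2) \<in> borel_measurable (Lpos)" using m by measurable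
 have "integrable lborel (%x. (B x)^2)" using lebesgue_on_conv(1)[OF m2 _ ae] i by simp
 hence s: "sqi (%x. of_real (B x))" by (simp add: sqi_def)
 have "zx f (abs_l2 (%x. of_real (B x)))" unfolding zx_def
  using m rep_abs_l2[OF s] B(2) by (auto elim!: AE_mp simp: indicator_def split: if_splits)
 thus ?thesis by (rule that)
qed

lemma zx_unique: "zx f u ==> zx f v ==> u = v"
 unfolding zx_def by (intro l2_eqI) (auto elim: AE_mp)

lemma zx_cong: assumes "zx f u" "g \<in> borel_measurable (Lpos)" "AE x in lborel. 0 < x --> f x = g x" shows "zx g u"
proof -
 have "AE x in lborel. rep_l2 u x = (if 0 < x then of_real (f x) else 0)" using assms(1) by (simp add: zx_def)
 hence "AE x in lborel. rep_l2 u x = (if 0 < x then of_real (g x) else 0)"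
  using assms(3) by eventually_elim auto
 thus ?thesis using assms(2) by (simp add: zx_def)
qed

lemma zx_AE_eq: assumes "zx f u" "zx g u" shows "AE x in lborel. 0 < x --> f x = g x"
proof -
 have "AE x in lborel. rep_l2 u x = (if 0 < x then of_real (f x) else 0)" "AE x in lborel. rep_l2 u x = (if 0 < x then of_real (g x) else 0)"
  using assms by (auto simp: zx_def)
 thus ?thesis by eventually_elim (auto simp: of_real_eq_iff)
qed

lemma zx_lin: assumes "zx f u" "zx g v" shows "zx (%x. a * f x + b * g x) (a *\<^sub>R u + b *\<^sub>R v)"
proof -
 have "(%x. a * f x + b * g x) \<in> borel_measurable (Lpos)" using assms by (auto simp: zx_def)
 moreover have "AE x in lborel. rep_l2 u x = (if 0 < x then of_real (f x) else 0)" "AE x in lborel. rep_l2 v x = (if 0 < x then of_real (g x) else 0)"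
  using assms by (auto simp: zx_def)
 hence "AE x in lborel. rep_l2 (a *\<^sub>R u + b *\<^sub>R v) x = (if 0 < x then of_real (a * f x + b * g x) else 0)"
  using rep_add[of "a *\<^sub>R u" "b *\<^sub>R v"] rep_scaleR[of a u] rep_scaleR[of b v]
  by eventually_elim (auto simp: scaleR_conv_of_real)
 ultimately show ?thesis by (simp add: zx_def)
qed

text \<open>h is absolutely continuous on the closed half line with derivative w.\<close>

definition hac :: "(real => real) => l2 => bool" where
 "hac h w \<longleftrightarrow> (\<forall>a b. 0 <= a --> a <= b --> of_real (h b - h a) = I a b w)"

lemma test_funD:
 assumes "test_fun \<phi>"
 shows "!!x. (\<phi> has_real_derivative deriv \<phi> x) (at x)" "continuous_on UNIV \<phi>" "continuous_on UNIV (deriv \<phi>)"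
  "\<exists>B>0. (\<forall>x. x \<notin> {0..B} --> \<phi> x = 0 \<and> deriv \<phi> x = 0) \<and> \<phi> 0 = 0 \<and> \<phi> B = 0"
proof -
 have d: "(deriv ^^ n) \<phi> differentiable (at x)" for n x using assms by (simp add: test_fun_def)
 show d1: "(\<phi> has_real_derivative deriv \<phi> x) (at x)" for x
  using d[of 0 x] by (simp add: DERIV_deriv_iff_real_differentiable)
 thus "continuous_on UNIV \<phi>" by (auto intro!: continuous_at_imp_continuous_on DERIV_isCont)
 have "(deriv \<phi> has_real_derivative deriv (deriv \<phi>) x) (at x)" for x
  using d[of 1 x] by (simp add: DERIV_deriv_iff_real_differentiable)
 thus "continuous_on UNIV (deriv \<phi>)" by (auto intro!: continuous_at_imp_continuous_on DERIV_isCont)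
 let ?S = "closure {x. \<phi> x ~= 0}"
 have S: "compact ?S" "?S \<subseteq> {0<..}" using assms by (auto simp: test_fun_def)
 then obtain B where B: "B > 0" "!!x. x \<in> ?S ==> norm x < B" using compact_imp_bounded bounded_pos_less by metis
 have z: "\<phi> x = 0 \<and> deriv \<phi> x = 0" if "x \<notin> ?S" for x
 proof -
  have o: "open (- ?S)" by (rule open_Compl[OF closed_closure])
  have "((%x. 0) has_real_derivative deriv \<phi> x) (at x)"
   by (rule has_field_derivative_transform_within_open[OF d1 o]) (use that closure_subset[of "{x. \<phi> x ~= 0}"] in auto)
  from DERIV_unique[OF this DERIV_const] show ?thesis using that closure_subset[of "{x. \<phi> x ~= 0}"] by auto
 qed
 show "\<exists>B>0. (\<forall>x. x \<notin> {0..B} --> \<phi> x = 0 \<and> deriv \<phi> x = 0) \<and> \<phi> 0 = 0 \<and> \<phi> B = 0"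
 proof (intro exI[of _ B] conjI allI impI B(1))
  fix x assume "x \<notin> {0..B}"
  hence "x \<notin> ?S" using S(2) B(2)[of x] by force
  from z[OF this] show "\<phi> x = 0" "deriv \<phi> x = 0" by blast+
 next
  have "0 \<notin> ?S" using S(2) by force
  from z[OF this] show "\<phi> 0 = 0" by blast
  have "B \<notin> ?S" using B(2)[of B] B(1) by force
  from z[OF this] show "\<phi> B = 0" by blast
 qed
qed

lemma sqi_supported: assumes "continuous_on UNIV \<psi>" "!!x. x \<notin> {0..B} ==> \<psi> x = (0::real)" "0 <= B" shows "sqi (%x. of_real (\<psi> x))"
proof -
 have "compact (\<psi> ` {0..B})" using assms(1) by (intro compact_continuous_image) (auto intro: continuous_on_subset)
 hence "bounded (\<psi> ` {0..B})" by (rule compact_imp_bounded)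
 then obtain e where e: "\<forall>x\<in>\<psi> ` {0..B}. norm x <= e" unfolding bounded_iff ..
 have "cmod (of_real (\<psi> x)) <= max 0 e" for x using e assms(2)[of x] by (cases "x \<in> {0..B}") (auto simp: le_max_iff_disj)
 moreover have "\<psi> \<in> borel_measurable borel" by (rule borel_measurable_continuous_onI[OF assms(1)])
 ultimately show ?thesis using assms(2,3) by (intro l2_bounded_support(1)[where e = "max 0 e" and a = 0 and b = B]) auto
qed

lemma test_pairing:
 assumes u: "zx f u" and \<psi>: "continuous_on UNIV \<psi>" "sqi (%x. of_real (\<psi> x))"
 shows "integrable (Lpos) (%x. f x * \<psi> x)"
  "of_real (LINT x|Lpos. f x * \<psi> x) = (LINT x|lborel. rep_l2 u x * of_real (\<psi> x))"
proof -
 have [measurable]: "\<psi> \<in> borel_measurable borel" by (rule borel_measurable_continuous_onI[OF \<psi>(1)])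
 have m: "f \<in> borel_measurable (Lpos)" and ae: "AE x in lborel. rep_l2 u x = (if 0 < x then of_real (f x) else 0)"
  using u by (auto simp: zx_def)
 have "\<psi> \<in> borel_measurable lebesgue" by (rule measurable_completion) measurable
 hence "\<psi> \<in> borel_measurable (Lpos)" by (rule measurable_restrict_space1)
 hence m2: "(%x. f x * \<psi> x) \<in> borel_measurable (Lpos)" using m by measurable
 have i: "integrable lborel (%x. rep_l2 u x * of_real (\<psi> x))" by (rule sqi_mult_integrable[OF rep_l2_sqi \<psi>(2)])
 have ae2: "AE x in lborel. (if 0 < x then f x * \<psi> x else 0) = Re (rep_l2 u x) * \<psi> x"
  using ae by eventually_elim auto
 note c = lebesgue_on_conv[OF m2 _ ae2]
 have "integrable lborel (%x. Re (rep_l2 u x) * \<psi> x)" using integrable_Re[OF i] by simp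
 thus "integrable (Lpos) (%x. f x * \<psi> x)" using c(1) by simp
 have "(LINT x|lborel. rep_l2 u x * of_real (\<psi> x)) = (LINT x|lborel. of_real (Re (rep_l2 u x) * \<psi> x))"
 proof (rule integral_cong_AE)
  show "AE x in lborel. rep_l2 u x * of_real (\<psi> x) = of_real (Re (rep_l2 u x) * \<psi> x)"
   using ae by eventually_elim simp
 qed measurable
 also have "... = of_real (LINT x|lborel. Re (rep_l2 u x) * \<psi> x)" by (rule integral_complex_of_real)
 finally show "of_real (LINT x|Lpos. f x * \<psi> x) = (LINT x|lborel. rep_l2 u x * of_real (\<psi> x))"
  using c(2) by simp
qed

lemma test_primitive:
 assumes "!!x. (\<phi> has_real_derivative \<phi>' x) (at x)" "continuous_on UNIV \<phi>'" "sqi (%x. of_real (\<phi>' x))" "a <= x"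
 shows "of_real (\<phi> x) = of_real (\<phi> a) + I a x (abs_l2 (%x. of_real (\<phi>' x)))"
proof -
 have "I a x (abs_l2 (%x. of_real (\<phi>' x))) = (LINT y|lborel. indicator {a..x} y * of_real (\<phi>' y))"
  by (rule I_cong[OF assms(3) rep_abs_l2[OF assms(3)]])
 also have "... = (LINT y|lborel. of_real (indicator {a..x} y *\<^sub>R \<phi>' y))"
  by (rule Bint_cong) (auto simp: indicator_def)
 also have "... = of_real (LINT y|lborel. indicator {a..x} y *\<^sub>R \<phi>' y)" by (rule integral_complex_of_real)
 also have "(LINT y|lborel. indicator {a..x} y *\<^sub>R \<phi>' y) = \<phi> x - \<phi> a"
 proof (rule integral_FTC_atLeastAtMost[OF assms(4)])
  show "(\<phi> hvd \<phi>' y) (at y within {a..x})" for y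
   using assms(1)[of y] by (auto intro: has_vector_derivative_at_within simp: hrd_iff)
  show "continuous_on {a..x} \<phi>'" by (rule continuous_on_subset[OF assms(2)]) simp
 qed
 finally show ?thesis by simp
qed

text \<open>\<open>ibp\<close> on [0, B], where B lies beyond the support of the test function; both
  boundary terms vanish, as the support is a compact subset of the open half line.\<close>

lemma hac_ibp:
 assumes h: "hac h w" and \<phi>: "test_fun \<phi>"
 shows "(LINT x|lborel. of_real (h x) * of_real (deriv \<phi> x)) = - (LINT x|lborel. rep_l2 w x * of_real (\<phi> x))"
  "integrable lborel (%x. complex_of_real (h x) * of_real (deriv \<phi> x))"
proof -
 note t = test_funD[OF \<phi>]
 obtain B where B: "B > 0" "!!x. x \<notin> {0..B} ==> \<phi> x = 0 \<and> deriv \<phi> x = 0" "\<phi> 0 = 0" "\<phi> B = 0" using t(4) by blast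
 have s: "sqi (%x. of_real (\<phi> x))" "sqi (%x. of_real (deriv \<phi> x))"
  by (rule sqi_supported[OF t(2), of B] sqi_supported[OF t(3), of B], use B in auto)+
 let ?d = "abs_l2 (%x. of_real (deriv \<phi> x))"
 have "of_real (h B) * of_real (\<phi> B) - of_real (h 0) * of_real (\<phi> 0) =
   (LINT x|lborel. indicator {0..B} x * (of_real (h x) * rep_l2 ?d x + of_real (\<phi> x) * rep_l2 w x))"
 proof (rule ibp)
  show "0 <= B" using B by simp
  fix x assume x: "x \<in> {0..B}"
  have "complex_of_real (h x - h 0) = I 0 x w" using h x unfolding hac_def by auto
  thus "of_real (h x) = of_real (h 0) + I 0 x w" by (simp add: diff_eq_eq add.commute)
  show "of_real (\<phi> x) = of_real (\<phi> 0) + I 0 x ?d" by (rule test_primitive[OF t(1,3) s(2)]) (use x in auto)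
 qed
 hence 0: "(LINT x|lborel. indicator {0..B} x * (of_real (h x) * rep_l2 ?d x + of_real (\<phi> x) * rep_l2 w x)) = 0"
  using B by simp
 \<comment> \<open>Nothing is known of h at negative arguments. The continuous function used here
   agrees with h for x >= 0 and supplies measurability and integrability.\<close>
 have ch: "continuous_on UNIV (%x. if x < 0 then of_real (h 0) - I x 0 w else of_real (h 0) + I 0 x w)"
 proof -
  have "continuous_on UNIV (%x. of_real (h 0) + (if x < 0 then - I x 0 w else I 0 x w))"
   by (intro continuous_intros I_signed_continuous)
  thus ?thesis by (rule continuous_on_eq) auto
 qed
 have heq: "of_real (h x) = (if x < 0 then of_real (h 0) - I x 0 w else of_real (h 0) + I 0 x w)" if "0 <= x" for x
 proof -
  have "complex_of_real (h x - h 0) = I 0 x w" using h that unfolding hac_def by blast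
  hence "of_real (h x) = of_real (h 0) + I 0 x w" by (simp add: diff_eq_eq add.commute)
  thus ?thesis using that by simp
 qed
 let ?H = "%x. if x < 0 then of_real (h 0) - I x 0 w else of_real (h 0) + I 0 x w"
 have "integrable lborel (%x. indicator {0..B} x *\<^sub>R (?H x * of_real (deriv \<phi> x)))"
  by (rule borel_integrable_compact) (auto intro!: continuous_intros continuous_on_subset[OF ch] continuous_on_subset[OF t(3)])
 moreover have "(%x. indicator {0..B} x *\<^sub>R (?H x * of_real (deriv \<phi> x))) = (%x. of_real (h x) * of_real (deriv \<phi> x))"
 proof
  fix x show "indicator {0..B} x *\<^sub>R (?H x * of_real (deriv \<phi> x)) = of_real (h x) * of_real (deriv \<phi> x)"
   using heq[of x] B(2)[of x] by (cases "x \<in> {0..B}") auto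
 qed
 ultimately show ih: "integrable lborel (%x. complex_of_real (h x) * of_real (deriv \<phi> x))" by simp
 have iw: "integrable lborel (%x. rep_l2 w x * of_real (\<phi> x))" by (rule sqi_mult_integrable[OF rep_l2_sqi s(1)])
 note [measurable] = borel_measurable_integrable[OF ih] borel_measurable_integrable[OF iw]
 have "(LINT x|lborel. indicator {0..B} x * (of_real (h x) * rep_l2 ?d x + of_real (\<phi> x) * rep_l2 w x))
   = (LINT x|lborel. of_real (h x) * of_real (deriv \<phi> x) + rep_l2 w x * of_real (\<phi> x))"
 proof (rule integral_cong_AE)
  have aeq: "AE x in lborel. indicator {0..B} x * (of_real (h x) * rep_l2 ?d x + of_real (\<phi> x) * rep_l2 w x) = of_real (h x) * of_real (deriv \<phi> x) + rep_l2 w x * of_real (\<phi> x)"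
   using rep_abs_l2[OF s(2)]
  proof eventually_elim
   case (elim x)
   thus ?case using B(2)[of x] by (cases "x \<in> {0..B}") (auto simp: algebra_simps)
  qed
  thus "AE x in lborel. indicator {0..B} x * (of_real (h x) * rep_l2 ?d x + of_real (\<phi> x) * rep_l2 w x) = of_real (h x) * of_real (deriv \<phi> x) + rep_l2 w x * of_real (\<phi> x)" .
  have [measurable]: "(%x. indicator {0..B} x * ?H x) \<in> borel_measurable borel"
   using borel_measurable_continuous_onI[OF ch] by (intro borel_measurable_times) auto
  have [measurable]: "(%x. complex_of_real (\<phi> x)) \<in> borel_measurable borel" by (rule sqi_measurable[OF s(1)])
  have "(%x. indicator {0..B} x * (of_real (h x) * rep_l2 ?d x + of_real (\<phi> x) * rep_l2 w x))
    = (%x. (indicator {0..B} x * ?H x) * rep_l2 ?d x + indicator {0..B} x * of_real (\<phi> x) * rep_l2 w x)"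
  proof
   fix x show "indicator {0..B} x * (of_real (h x) * rep_l2 ?d x + of_real (\<phi> x) * rep_l2 w x)
    = (indicator {0..B} x * ?H x) * rep_l2 ?d x + indicator {0..B} x * of_real (\<phi> x) * rep_l2 w x"
    using heq[of x] by (cases "x \<in> {0..B}") (auto simp: algebra_simps)
  qed
  thus "(%x. indicator {0..B} x * (of_real (h x) * rep_l2 ?d x + of_real (\<phi> x) * rep_l2 w x)) \<in> borel_measurable lborel"
   by simp
 qed measurable
 thus "(LINT x|lborel. of_real (h x) * of_real (deriv \<phi> x)) = - (LINT x|lborel. rep_l2 w x * of_real (\<phi> x))"
  using 0 ih iw by (simp add: add_eq_0_iff)
qed

lemma weak_derivI:
 assumes u: "zx f u" and w: "zx g w" and h: "hac h w" "AE x in lborel. 0 < x --> f x = h x"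
 shows "weak_deriv f g"
 unfolding weak_deriv_def
proof (intro allI impI)
 fix \<phi> assume \<phi>: "test_fun \<phi>"
 note t = test_funD[OF \<phi>]
 obtain B where B: "B > 0" "!!x. x \<notin> {0..B} ==> \<phi> x = 0 \<and> deriv \<phi> x = 0" "\<phi> 0 = 0" "\<phi> B = 0" using t(4) by blast
 have s: "sqi (%x. of_real (\<phi> x))" "sqi (%x. of_real (deriv \<phi> x))"
  by (rule sqi_supported[OF t(2), of B] sqi_supported[OF t(3), of B], use B in auto)+
 note p1 = test_pairing[OF u t(3) s(2)] and p2 = test_pairing[OF w t(2) s(1)]
 note ib = hac_ibp[OF h(1) \<phi>]
 have "(LINT x|lborel. rep_l2 u x * of_real (deriv \<phi> x)) = (LINT x|lborel. of_real (h x) * of_real (deriv \<phi> x))"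
 proof (rule integral_cong_AE)
  show "(%x. complex_of_real (h x) * complex_of_real (deriv \<phi> x)) \<in> borel_measurable lborel"
   using borel_measurable_integrable[OF ib(2)] .
  show "(%x. rep_l2 u x * complex_of_real (deriv \<phi> x)) \<in> borel_measurable lborel"
   using sqi_measurable[OF s(2)] by measurable
  have "AE x in lborel. rep_l2 u x = (if 0 < x then of_real (f x) else 0)" using u by (simp add: zx_def)
  thus "AE x in lborel. rep_l2 u x * of_real (deriv \<phi> x) = of_real (h x) * of_real (deriv \<phi> x)"
   using h(2) AE_lborel_singleton[of 0]
  proof eventually_elim
   case (elim x)
   thus ?case using B(2)[of x] by (cases "0 < x") auto
  qed
 qed
 hence "complex_of_real (LINT x|Lpos. f x * deriv \<phi> x) = of_real (- (LINT x|Lpos. g x * \<phi> x))"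
  using p1(2) p2(2) ib(1) by simp
 thus "integrable (Lpos) (%x. f x * deriv \<phi> x) \<and> integrable (Lpos) (%x. g x * \<phi> x) \<and>
   (LINT x|Lpos. f x * deriv \<phi> x) = - (LINT x|Lpos. g x * \<phi> x)"
  using p1(1) p2(1) by (simp only: of_real_eq_iff)
qed

section \<open>Primitives on the half line and the lemma of Du Bois-Reymond\<close>

definition rp :: "l2 => bool" where "rp u \<longleftrightarrow> (\<exists>g. zx g u)"

text \<open>The primitive of w from 0. Through \<open>max 0 x\<close> it is constant for x <= 0,
  hence continuous on the whole line.\<close>

definition hI :: "l2 => real => real" where "hI w x = Re (I 0 (max 0 x) w)"

lemma rp_cj: assumes "rp u" shows "cj u = u"
proof (rule l2_eqI)
 obtain g where "AE x in lborel. rep_l2 u x = (if 0 < x then of_real (g x) else 0)"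
  using assms unfolding rp_def zx_def by blast
 thus "AE x in lborel. rep_l2 (cj u) x = rep_l2 u x" using rep_cj[of u] by eventually_elim auto
qed

lemma rp_I: assumes "rp u" shows "of_real (Re (I a b u)) = I a b u"
 using I_cj[of a b u] rp_cj[OF assms] by (simp add: complex_eq_iff)

lemma hI_continuous: "continuous_on UNIV (hI w)"
proof -
 have "continuous_on UNIV (%x. (%x. if x < 0 then - I x 0 w else I 0 x w) (max 0 x))"
  by (rule continuous_on_compose2[OF I_signed_continuous]) (auto intro!: continuous_intros)
 hence "continuous_on UNIV (%x. I 0 (max 0 x) w)" by simp
 thus ?thesis unfolding hI_def[abs_def] by (intro continuous_intros)
qed

lemma hI_hac: assumes "rp w" shows "hac (%x. c + hI w x) w"
 unfolding hac_def
proof (intro allI impI)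
 fix a b :: real assume ab: "0 <= a" "a <= b"
 have "I 0 a w + I a b w = I 0 b w" by (rule I_combine[OF ab])
 hence "I a b w = I 0 b w - I 0 a w" by (simp add: eq_diff_eq add.commute)
 moreover have "complex_of_real (c + hI w b - (c + hI w a)) = of_real (Re (I 0 b w)) - of_real (Re (I 0 a w))"
  unfolding hI_def using ab by simp
 ultimately show "complex_of_real (c + hI w b - (c + hI w a)) = I a b w"
  unfolding rp_I[OF assms] by simp
qed

lemma hac_hI: assumes "hac h w" "0 <= x" shows "h x = h 0 + hI w x"
proof -
 have "complex_of_real (h x - h 0) = I 0 x w" using assms unfolding hac_def by blast
 from arg_cong[OF this, of Re] show ?thesis using assms(2) by (simp add: hI_def)
qed

lemma hac_continuous: assumes "hac h w" shows "cont0 h"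
proof (rule continuous_on_eq)
 show "cont0 (%x. h 0 + hI w x)"
  by (intro continuous_intros continuous_on_subset[OF hI_continuous]) auto
 show "h 0 + hI w x = h x" if "x \<in> {0..}" for x using hac_hI[OF assms, of x] that by simp
qed

text \<open>Because the mean is zero, the primitive vanishes again to the right of r and so has
  compact support; p > 0 keeps that support away from 0.\<close>

lemma antiderivative_test_fun:
 assumes s: "smooth \<psi>" and z: "!!x. x \<notin> {p..r} ==> \<psi> x = 0" and pr: "0 < p" "p <= r" and i: "(LINT x|lborel. \<psi> x) = 0"
 obtains \<phi> where "test_fun \<phi>" "deriv \<phi> = \<psi>"
proof -
 define \<phi> where "\<phi> x = integral {0..x} \<psi>" for x
 have c: "continuous_on S \<psi>" for S by (rule smooth_continuous[OF s])
 have lo: "\<phi> x = 0" if "x < p" for x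
 proof -
  have "\<phi> x = integral {0..x} (%x. 0)" unfolding \<phi>_def
   by (rule Henstock_Kurzweil_Integration.integral_cong) (use z that in auto)
  thus ?thesis by simp
 qed
 have d: "(\<phi> has_real_derivative \<psi> x) (at x)" for x
 proof (cases "x < p")
  case True
  have "((%x. 0) has_real_derivative \<psi> x) (at x)" using z[of x] True by simp
  thus ?thesis
   by (rule has_field_derivative_transform_within_open[where S = "{..<p}"]) (use True lo in auto)
 next
  case False
  hence x: "0 < x" using pr by simp
  have "(\<phi> hvd \<psi> x) (at x within {0..x+1})" unfolding \<phi>_def[abs_def]
   by (rule integral_has_vector_derivative[OF c]) (use x in auto)
  moreover have "at x within {0..x+1} = at x" by (rule at_within_interior) (use x in auto)
  ultimately show ?thesis by (simp add: hrd_iff)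
 qed
 have hi: "\<phi> x = 0" if "r < x" for x
 proof -
  have "integrable lborel (%x. indicator {p..r} x *\<^sub>R \<psi> x)" by (rule borel_integrable_compact[OF _ c]) simp
  moreover have "(%x. indicator {p..r} x *\<^sub>R \<psi> x) = \<psi>" using z by (intro ext) (auto simp: indicator_def)
  ultimately have "integral UNIV \<psi> = (LINT x|lborel. \<psi> x)" by (intro integral_lborel) simp
  moreover have "integral UNIV (%y. if y \<in> {0..x} then \<psi> y else 0) = \<phi> x" unfolding \<phi>_def by (rule integral_restrict_UNIV)
  moreover have "(%y. if y \<in> {0..x} then \<psi> y else 0) = \<psi>" using z pr that by (intro ext) auto
  ultimately show ?thesis using i by simp
 qed
 have sm: "smooth \<phi>" by (rule smooth_primitive[OF s d])
 have "{x. \<phi> x ~= 0} \<subseteq> {p..r}" using lo hi by force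
 hence cl: "closure {x. \<phi> x ~= 0} \<subseteq> {p..r}" by (rule closure_minimal) simp
 hence "compact (closure {x. \<phi> x ~= 0})" using bounded_subset[OF compact_imp_bounded[OF compact_Icc] cl] closed_closure compact_eq_bounded_closed by blast
 hence "test_fun \<phi>" unfolding test_fun_def using smooth_deriv_pow[OF sm] cl pr by force
 moreover have "deriv \<phi> = \<psi>" by (intro ext DERIV_imp_deriv d)
 ultimately show ?thesis by (rule that)
qed

text \<open>A combination of a bump over [a, b] and one over [1, 2] with total integral 0 is the
  derivative of a test function and thus orthogonal to K. Letting the bumps tend to indicators shows
  that K has the same mean over [a, b] as over the reference interval [1, 2] of length 1.\<close>

lemma du_bois_reymond_mean:
 fixes K :: "real => complex"
 assumes [measurable]: "K \<in> borel_measurable borel" and iK: "!!R. integrable lborel (%x. indicator {0..R} x * K x)"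
  and orth: "!!\<phi>. test_fun \<phi> ==> (LINT x|lborel. K x * of_real (deriv \<phi> x)) = 0" and ab: "0 < a" "a <= b"
 shows "(LINT x|lborel. indicator {a..b} x * K x) = (LINT x|lborel. indicator {1..2} x * K x) * of_real (b - a)"
proof -
 define R where "R = max b 2"
 let ?G = "%x. cmod (indicator {0..R} x * K x)"
 have iG: "integrable lborel ?G" using iK[of R] by (rule integrable_norm)
 have bm[measurable]: "bump n p r \<in> borel_measurable borel" for n p r
  by (rule borel_measurable_continuous_onI[OF smooth_continuous[OF smooth_bump]])
 have dom: "cmod (K x * of_real (bump n p r x)) <= ?G x" if "0 < p" "r <= R" for n :: nat and p r x :: real
  using bump_bounds(1,2)[of n p r x] bump_bounds(3)[of x p r n] that by (cases "x \<in> {p..r}") (auto simp: norm_mult indicator_def intro!: mult_left_le)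
 have ib: "integrable lborel (%x. K x * of_real (bump n p r x))" if "0 < p" "r <= R" for n :: nat and p r :: real
  by (rule Bint_bound[OF iG]) (use dom[OF that] in auto)
 have lim: "(%n. LINT x|lborel. K x * of_real (bump n p r x)) ----> (LINT x|lborel. K x * of_real (indicator {p<..<r} x))"
  if "0 < p" "r <= R" for p r :: real
  by (rule integral_dominated_convergence[OF _ _ iG])
    (use dom[OF that] in "auto intro!: tendsto_intros bump_lim")
 have iI: "integrable lborel (%x. indicator {0..R} x :: real)" by (rule integrable_real_indicator) (auto simp: emeasure_lborel_Icc_eq)
 have dom1: "\<bar>bump n p r x\<bar> <= indicator {0..R} x" if "0 < p" "r <= R" for n :: nat and p r x :: real
  using bump_bounds(1,2)[of n p r x] bump_bounds(3)[of x p r n] that by (cases "x \<in> {p..r}") (auto simp: indicator_def)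
 have ib1: "integrable lborel (bump n p r)" if "0 < p" "r <= R" for n :: nat and p r :: real
  by (rule Bint_bound[OF iI]) (use dom1[OF that] in auto)
 have lim1: "(%n. LINT x|lborel. bump n p r x) ----> (LINT x|lborel. indicator {p<..<r} x)"
  if "0 < p" "r <= R" for p r :: real
  by (rule integral_dominated_convergence[OF _ _ iI])
    (use dom1[OF that] in "auto intro!: bump_lim")
 have A: "0 < a" "b <= R" and C: "0 < (1::real)" "2 <= R" using ab by (auto simp: R_def)
 have "of_real (LINT x|lborel. bump n 1 2 x) * (LINT x|lborel. K x * of_real (bump n a b x))
   = of_real (LINT x|lborel. bump n a b x) * (LINT x|lborel. K x * of_real (bump n 1 2 x))" for n
 proof -
  let ?c = "LINT x|lborel. bump n 1 2 x" and ?d = "LINT x|lborel. bump n a b x"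
  define \<psi> where "\<psi> x = ?c * bump n a b x - ?d * bump n 1 2 x" for x
  have sm: "smooth \<psi>" unfolding \<psi>_def[abs_def] by (intro smooth_diff smooth_bump)
  have z: "\<psi> x = 0" if "x \<notin> {min a 1..R}" for x
  proof -
   have x: "x \<notin> {a..b}" "x \<notin> {1..2}" using that A C by auto
   show ?thesis unfolding \<psi>_def bump_bounds(3)[OF x(1)] bump_bounds(3)[OF x(2)] by simp
  qed
  have i: "(LINT x|lborel. \<psi> x) = 0" unfolding \<psi>_def using ib1[OF A] ib1[OF C] by simp
  have p: "0 < min a 1" "min a 1 <= R" using A C by auto
  obtain \<phi> where "test_fun \<phi>" "deriv \<phi> = \<psi>"
   using antiderivative_test_fun[OF sm z p i] by blast
  with orth have "(LINT x|lborel. K x * of_real (\<psi> x)) = 0" by metis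
  moreover have "(%x. K x * of_real (\<psi> x)) = (%x. of_real ?c * (K x * of_real (bump n a b x)) - of_real ?d * (K x * of_real (bump n 1 2 x)))"
   by (simp add: \<psi>_def fun_eq_iff algebra_simps)
  moreover have "(LINT x|lborel. of_real ?c * (K x * of_real (bump n a b x)) - of_real ?d * (K x * of_real (bump n 1 2 x)))
    = of_real ?c * (LINT x|lborel. K x * of_real (bump n a b x)) - of_real ?d * (LINT x|lborel. K x * of_real (bump n 1 2 x))"
   by (subst Bochner_Integration.integral_diff) (use ib[OF A, of n] ib[OF C, of n] in "auto simp del: of_real_mult")
  ultimately show ?thesis by simp
 qed
 hence seq: "(%n. of_real (LINT x|lborel. bump n 1 2 x) * (LINT x|lborel. K x * of_real (bump n a b x)))
   = (%n. of_real (LINT x|lborel. bump n a b x) * (LINT x|lborel. K x * of_real (bump n 1 2 x)))" by blast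
 have "(%n. of_real (LINT x|lborel. bump n 1 2 x) * (LINT x|lborel. K x * of_real (bump n a b x)))
  ----> of_real (LINT x|lborel. indicator {1<..<2::real} x) * (LINT x|lborel. K x * of_real (indicator {a<..<b} x))"
  by (intro tendsto_mult tendsto_of_real lim[OF A] lim1[OF C])
 moreover have "(%n. of_real (LINT x|lborel. bump n a b x) * (LINT x|lborel. K x * of_real (bump n 1 2 x)))
  ----> of_real (LINT x|lborel. indicator {a<..<b} x) * (LINT x|lborel. K x * of_real (indicator {1<..<2} x))"
  by (intro tendsto_mult tendsto_of_real lim[OF C] lim1[OF A])
 ultimately have "of_real (LINT x|lborel. indicator {1<..<2::real} x) * (LINT x|lborel. K x * of_real (indicator {a<..<b} x))
  = of_real (LINT x|lborel. indicator {a<..<b} x) * (LINT x|lborel. K x * of_real (indicator {1<..<2} x))"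
  unfolding seq by (rule LIMSEQ_unique)
 moreover have "(LINT x|lborel. K x * of_real (indicator {p<..<r} x)) = (LINT x|lborel. indicator {p..r} x * K x)" for p r :: real
  by (rule integral_cong_AE) (use AE_lborel_singleton[of p] AE_lborel_singleton[of r] in "auto simp: indicator_def elim!: AE_mp")
 ultimately show ?thesis using ab by (simp add: mult.commute)
qed

text \<open>The half line analogue of \<open>has_D\<close>. Nothing is required across 0: h 0 may be
  nonzero although u is an extension by zero.\<close>

definition hd1 :: "l2 => l2 => bool" where
 "hd1 u w \<longleftrightarrow> rp w \<and> (\<exists>h. zx h u \<and> hac h w)"

lemma hac_measurable: assumes "hac h w" shows "h \<in> borel_measurable (Lpos)"
proof -
 have "(%x. h 0 + hI w x) \<in> borel_measurable lebesgue"
  by (rule measurable_completion) (use borel_measurable_continuous_onI[OF hI_continuous] in measurable)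
 hence "(%x. h 0 + hI w x) \<in> borel_measurable (Lpos)" by (rule measurable_restrict_space1)
 moreover have "(%x. h 0 + hI w x) \<in> borel_measurable (Lpos) \<longleftrightarrow> h \<in> borel_measurable (Lpos)"
  by (rule measurable_cong) (metis hac_hI[OF assms] greaterThan_iff less_imp_le space_restrict_space2 sets_completionI_sets sets_lborel space_lebesgue_on)
 ultimately show ?thesis by blast
qed

lemma hd1_weak_deriv: assumes "zx f u" "zx g w" "hd1 u w" shows "weak_deriv f g"
proof -
 obtain h where h: "zx h u" "hac h w" using assms(3) unfolding hd1_def by blast
 show ?thesis by (rule weak_derivI[OF assms(1,2) h(2) zx_AE_eq[OF assms(1) h(1)]])
qed

text \<open>The difference K of u and the primitive of w is orthogonal to the derivatives of all
  test functions, has therefore the same mean over every interval, and is a.e. a constant c on the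
  half line; primitive plus c is the representative sought.\<close>

lemma weak_deriv_hd1: assumes f: "zx f u" and g: "zx g w" and wd: "weak_deriv f g" shows "hd1 u w"
proof -
 have rw: "rp w" using g by (auto simp: rp_def)
 have hh: "hac (%x. 0 + hI w x) w" by (rule hI_hac[OF rw])
 define K where "K x = rep_l2 u x - of_real (0 + hI w x)" for x
 have mh: "hI w \<in> borel_measurable borel" by (rule borel_measurable_continuous_onI[OF hI_continuous])
 note [measurable] = mh
 have mK[measurable]: "K \<in> borel_measurable borel" unfolding K_def[abs_def] by measurable
 have iK: "integrable lborel (%x. indicator {0..R} x * K x)" for R
 proof -
  have "integrable lborel (%x. indicator {0..R} x *\<^sub>R complex_of_real (hI w x))"
   by (rule borel_integrable_compact) (auto intro!: continuous_intros continuous_on_subset[OF hI_continuous])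
  moreover have "(%x. indicator {0..R} x *\<^sub>R complex_of_real (hI w x)) = (%x. indicator {0..R} x * complex_of_real (hI w x))"
   by (auto simp: indicator_def)
  ultimately have "integrable lborel (%x. indicator {0..R} x * rep_l2 u x - indicator {0..R} x * complex_of_real (hI w x))"
   by (intro Bochner_Integration.integrable_diff I_integrable) simp
  thus ?thesis by (simp add: K_def right_diff_distrib)
 qed
 have orth: "(LINT x|lborel. K x * of_real (deriv \<phi> x)) = 0" if \<phi>: "test_fun \<phi>" for \<phi>
 proof -
  note t = test_funD[OF \<phi>]
  obtain B where B: "B > 0" "!!x. x \<notin> {0..B} ==> \<phi> x = 0 \<and> deriv \<phi> x = 0" using t(4) by blast
  have s1: "sqi (%x. of_real (\<phi> x))" by (rule sqi_supported[OF t(2), of B]) (use B in auto)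
  have s2: "sqi (%x. of_real (deriv \<phi> x))" by (rule sqi_supported[OF t(3), of B]) (use B in auto)
  note p1 = test_pairing[OF f t(3) s2] and p2 = test_pairing[OF g t(2) s1]
  note ib = hac_ibp[OF hh \<phi>]
  have "(LINT x|Lpos. f x * deriv \<phi> x) = - (LINT x|Lpos. g x * \<phi> x)"
   using wd \<phi> unfolding weak_deriv_def by blast
  hence "complex_of_real (LINT x|Lpos. f x * deriv \<phi> x) = - of_real (LINT x|Lpos. g x * \<phi> x)"
   by simp
  hence "(LINT x|lborel. rep_l2 u x * of_real (deriv \<phi> x)) = (LINT x|lborel. of_real (0 + hI w x) * of_real (deriv \<phi> x))"
   unfolding p1(2) p2(2) ib(1) .
  moreover have "(LINT x|lborel. K x * of_real (deriv \<phi> x)) = (LINT x|lborel. rep_l2 u x * of_real (deriv \<phi> x)) - (LINT x|lborel. of_real (0 + hI w x) * of_real (deriv \<phi> x))"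
   unfolding K_def left_diff_distrib
   by (rule Bochner_Integration.integral_diff[OF sqi_mult_integrable[OF rep_l2_sqi s2] ib(2)])
  ultimately show ?thesis by simp
 qed
 define c where "c = (LINT x|lborel. indicator {1..2} x * K x)"
 have mean: "(LINT x|lborel. indicator {a..b} x * K x) = c * of_real (b - a)" if "0 < a" "a <= b" for a b :: real
  unfolding c_def by (rule du_bois_reymond_mean[OF mK iK orth that])
 \<comment> \<open>A priori K - c is not in L^2, and means are known only away from 0. On these
   compact intervals \<open>I_zero_imp_zero\<close> applies, and they exhaust the open half
   line.\<close>
 have Nz: "AE x in lborel. indicator {1 / real (Suc N)..real (Suc N)} x * (K x - c) = 0" for N
 proof -
  let ?S = "{1 / real (Suc N)..real (Suc N)}"
  let ?k = "%x. indicator ?S x * (K x - c)"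
  have le: "1 / real (Suc N) <= real (Suc N)" by (rule order_trans[of _ 1]) simp_all
  have S: "0 <= real (Suc N)" by simp
  have "\<exists>B. \<forall>x\<in>?S. cmod (of_real (hI w x) + c) <= B"
  proof -
   have "compact ((%x. of_real (hI w x) + c) ` ?S)"
    by (intro compact_continuous_image continuous_intros continuous_on_subset[OF hI_continuous]) auto
   from compact_imp_bounded[OF this] show ?thesis unfolding bounded_iff by auto
  qed
  then obtain B where B: "!!x. x \<in> ?S ==> cmod (of_real (hI w x) + c) <= B" by blast
  have s2: "sqi (%x. indicator ?S x * (of_real (hI w x) + c))"
   by (rule l2_bounded_support(1)[OF _ _ _ le, where e = "max 0 B"]) (use B in "auto simp: indicator_def le_max_iff_disj")
  have s1: "sqi (%x. indicator ?S x * rep_l2 u x)"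
   by (rule sqi_mulf[where C = 1]) (auto simp: bm_def indicator_def)
  have s: "sqi ?k" using sqi_diff[OF s1 s2] by (simp add: K_def algebra_simps)
  have "abs_l2 ?k = 0"
  proof (rule I_zero_imp_zero)
   fix a b :: real assume "a <= b"
   let ?a = "max a (1 / real (Suc N))" and ?b = "min b (real (Suc N))"
   have 1: "I a b (abs_l2 ?k) = (LINT x|lborel. indicator {a..b} x * ?k x)" by (rule I_cong[OF s rep_abs_l2[OF s]])
   show "I a b (abs_l2 ?k) = 0"
   proof (cases "?a <= ?b")
    case True
    have pos: "0 < ?a" by (simp add: less_max_iff_disj)
    have "(LINT x|lborel. indicator {a..b} x * ?k x) = (LINT x|lborel. indicator {?a..?b} x * K x - indicator {?a..?b} x * c)"
     by (rule Bint_cong) (auto simp: indicator_def)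
    also have "... = (LINT x|lborel. indicator {?a..?b} x * K x) - (LINT x|lborel. indicator {?a..?b} x * c)"
    proof (rule Bochner_Integration.integral_diff)
     have "integrable lborel (%x. indicator {?a..?b} x *\<^sub>R (indicator {0..?b} x * K x))"
      by (rule integrable_mult_indicator[OF _ iK]) simp
     moreover have "(%x. indicator {?a..?b} x *\<^sub>R (indicator {0..?b} x * K x)) = (%x. indicator {?a..?b} x * K x)"
      using pos by (auto simp: fun_eq_iff indicator_def)
     ultimately show "integrable lborel (%x. indicator {?a..?b} x * K x)" by simp
     show "integrable lborel (%x. indicator {?a..?b} x * c)"
      using sqi_mult_integrable[OF sqi_indicator sqi_cmult[OF sqi_indicator, of c]]
      by (rule Bint_bound) (auto simp: indicator_def)
    qed
    also have "(LINT x|lborel. indicator {?a..?b} x * c) = (LINT x|lborel. indicator {?a..?b} x *\<^sub>R c)"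
     by (rule Bint_cong) (auto simp: indicator_def)
    also have "... = c * of_real (?b - ?a)"
     using True by (simp add: scaleR_conv_of_real)
    finally show ?thesis using mean[OF pos True] 1 by simp
   next
    case False
    have "(LINT x|lborel. indicator {a..b} x * ?k x) = (LINT x|lborel. (%x::real. 0) x)"
     by (rule Bint_cong) (use False in "auto simp: indicator_def")
    thus ?thesis using 1 by simp
   qed
  qed
  thus ?thesis using rep_abs_l2[OF s] rep_zero by (auto elim: AE_mp)
 qed
 hence "AE x in lborel. \<forall>N. indicator {1 / real (Suc N)..real (Suc N)} x * (K x - c) = 0" by (simp only: AE_all_countable) blast
 hence Kc: "AE x in lborel. 0 < x --> K x = c"
 proof eventually_elim
  case (elim x)
  show ?case
  proof
   assume x: "0 < x"
   obtain N where N: "max x (1 / x) <= real N" using real_arch_simple by blast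
   hence "x <= real (Suc N)" "1 / x <= real (Suc N)" by auto
   hence "x \<in> {1 / real (Suc N)..real (Suc N)}" using x by (auto simp: divide_le_eq mult.commute)
   thus "K x = c" using elim[rule_format, of N] by simp
  qed
 qed
 have ae: "AE x in lborel. rep_l2 u x = (if 0 < x then of_real (f x) else 0)" using f by (simp add: zx_def)
 have hc: "hac (%x. Re c + hI w x) w" by (rule hI_hac[OF rw])
 have "zx (%x. Re c + hI w x) u"
 proof (rule zx_cong[OF f hac_measurable[OF hc]])
  show "AE x in lborel. 0 < x --> f x = Re c + hI w x" using ae Kc
  proof eventually_elim
   case (elim x)
   show ?case
   proof
    assume x: "0 < x"
    hence "c = of_real (f x) - of_real (hI w x)" using elim by (simp add: K_def)
    hence "Re c = f x - hI w x" by simp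
    thus "f x = Re c + hI w x" by simp
   qed
  qed
 qed
 thus ?thesis unfolding hd1_def using rw hc by blast
qed

lemma hac_unique:
 assumes h: "zx h u" "hac h w" and k: "zx k u" "hac k z" and x: "0 <= x" shows "h x = k x"
proof -
 have 1: "h y = k y" if "0 < y" for y
 proof (rule AE_continuous_eq[where S = "{0<..}" and f = h and g = k])
  show "continuous_on {0<..} h" "continuous_on {0<..} k"
   by (rule continuous_on_subset[OF hac_continuous[OF h(2)]] continuous_on_subset[OF hac_continuous[OF k(2)]], auto)+
  show "AE x in lborel. x \<in> {0<..} --> h x = k x" using zx_AE_eq[OF h(1) k(1)] by simp
 qed (use that in auto)
 show ?thesis
 proof (cases "x = 0")
  case True
  have lim: "(f ---> f 0) (at 0 within {0<..})" if "cont0 f" for f :: "real => real"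
   by (rule tendsto_within_subset[of _ _ _ "{0..}"]) (use that in "auto simp: continuous_on_def")
  have "\<forall>\<^sub>F y in at 0 within {0<..}. h y = k y" by (auto simp: eventually_at_filter 1)
  from tendsto_cong[OF this] have "(k ---> h 0) (at 0 within {0<..})" using lim[OF hac_continuous[OF h(2)]] by simp
  from tendsto_unique[OF _ this lim[OF hac_continuous[OF k(2)]]] have "h 0 = k 0" by simp
  thus ?thesis using True by simp
 qed (use 1 x in auto)
qed

lemma rp_half: assumes "rp u" shows "I a b u = I (max 0 a) (max 0 b) u"
proof -
 obtain g where ae: "AE x in lborel. rep_l2 u x = (if 0 < x then of_real (g x) else 0)"
  using assms unfolding rp_def zx_def by blast
 have "AE x in lborel. indicator {a..b} x * rep_l2 u x = indicator {max 0 a..max 0 b} x * rep_l2 u x"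
  using ae AE_lborel_singleton[of 0] by eventually_elim (auto simp: indicator_def)
 thus ?thesis unfolding I_def by (rule integral_cong_AE[rotated 2]) measurable
qed

lemma hd1_unique: assumes "hd1 u w" "hd1 u z" shows "w = z"
proof -
 obtain h k where h: "zx h u" "hac h w" and k: "zx k u" "hac k z" and r: "rp w" "rp z" using assms unfolding hd1_def by blast
 have I: "I a b w = I a b z" if "0 <= a" "a <= b" for a b
  using h(2) k(2) that hac_unique[OF h k, of a] hac_unique[OF h k, of b] unfolding hac_def by (metis order_trans)
 have "w - z = 0"
 proof (rule I_zero_imp_zero)
  fix a b :: real assume "a <= b"
  thus "I a b (w - z) = 0"
   unfolding I_diff rp_half[OF r(1), of a] rp_half[OF r(2), of a] using I[of "max 0 a" "max 0 b"] by auto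
 qed
 thus ?thesis by simp
qed

section \<open>Sobolev spaces on the half line as chains of derivatives in L^2\<close>

definition ch :: "nat => (real => real) => (nat => l2) => bool" where
 "ch k f X \<longleftrightarrow> zx f (X 0) \<and> (\<forall>j<k. hd1 (X j) (X (Suc j)))"

lemma ch_rp: assumes "ch k f X" "j <= k" shows "rp (X j)"
 using assms by (cases j) (auto simp: ch_def rp_def hd1_def)

lemma ch_sobolev: assumes "ch k f X" obtains g where "sobolev_derivs k f g" "!!j. j <= k ==> zx (g j) (X j)"
proof -
 define g where "g j = (if j = 0 then f else SOME h. zx h (X j))" for j
 have g: "zx (g j) (X j)" if "j <= k" for j
 proof (cases "j = 0")
  case True thus ?thesis using assms by (simp add: g_def ch_def)
 next
  case False thus ?thesis using someI_ex[OF ch_rp[OF assms that, unfolded rp_def]] by (simp add: g_def)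
 qed
 have "sobolev_derivs k f g" unfolding sobolev_derivs_def
  using g zx_L2(1) assms by (auto simp: g_def[of 0] ch_def intro!: hd1_weak_deriv)
 thus ?thesis using g by (rule that)
qed

lemma sobolev_ch: assumes "sobolev_derivs k f g" obtains X where "ch k f X" "!!j. j <= k ==> zx (g j) (X j)"
proof -
 have "\<forall>j. \<exists>u. j <= k --> zx (g j) u" using assms L2_zx unfolding sobolev_derivs_def by metis
 then obtain X where X: "!!j. j <= k ==> zx (g j) (X j)" by metis
 have "ch k f X" unfolding ch_def
  using X[of 0] assms by (auto simp: sobolev_derivs_def intro!: weak_deriv_hd1 X)
 thus ?thesis using X by (rule that)
qed

lemma ch_Hk: "ch k f X ==> f \<in> Hk k"
 by (elim ch_sobolev) (auto simp: Hk_def)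

lemma Hk_ch: assumes "f \<in> Hk k" obtains X where "ch k f X"
 using assms unfolding Hk_def by (auto elim: sobolev_ch)

lemma ch_unique: assumes "ch k f X" "ch k f V" "j <= k" shows "X j = V j"
 using assms(3)
proof (induction j)
 case 0 thus ?case using assms zx_unique by (auto simp: ch_def)
next
 case (Suc j)
 have "hd1 (X j) (X (Suc j))" "hd1 (V j) (V (Suc j))" using Suc.prems assms(1,2) by (simp_all add: ch_def)
 moreover have "X j = V j" using Suc by simp
 ultimately show ?case using hd1_unique by metis
qed

text \<open>The functions picked by \<open>SOME\<close> in \<open>wder\<close> form some chain for
  f; as chains are unique in \<open>l2\<close>, the choice affects them only on null sets.\<close>

lemma ch_wder: assumes "ch k f X" "j <= k" shows "zx (wder k j f) (X j)"
proof -
 obtain g where "sobolev_derivs k f g" using assms(1) by (rule ch_sobolev)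
 hence "sobolev_derivs k f (SOME g. sobolev_derivs k f g)" by (rule someI[of "sobolev_derivs k f"])
 then obtain V where V: "ch k f V" "!!j. j <= k ==> zx ((SOME g. sobolev_derivs k f g) j) (V j)" using sobolev_ch by blast
 show ?thesis unfolding wder_def using V(2)[OF assms(2)] ch_unique[OF assms(1) V(1) assms(2)] by simp
qed

lemma ch_norm: assumes "ch k f X" shows "Hk_norm k f = sqrt (\<Sum>j\<le>k. (norm (X j))^2)"
 unfolding Hk_norm_def using zx_L2(2)[OF ch_wder[OF assms]] by simp

lemma hac_lin: assumes "hac h w" "hac k z" shows "hac (%x. a * h x + b * k x) (a *\<^sub>R w + b *\<^sub>R z)"
 unfolding hac_def
proof (intro allI impI)
 fix c d :: real assume cd: "0 <= c" "c <= d"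
 have "complex_of_real (h d - h c) = I c d w" "complex_of_real (k d - k c) = I c d z" using assms cd unfolding hac_def by auto
 hence "I c d (a *\<^sub>R w + b *\<^sub>R z) = of_real a * of_real (h d - h c) + of_real b * of_real (k d - k c)"
  by (simp add: I_add I_scaleR scaleR_conv_of_real)
 thus "complex_of_real (a * h d + b * k d - (a * h c + b * k c)) = I c d (a *\<^sub>R w + b *\<^sub>R z)"
  by (simp add: algebra_simps)
qed

lemma rp_lin: assumes "rp u" "rp v" shows "rp (a *\<^sub>R u + b *\<^sub>R v)"
 using assms zx_lin unfolding rp_def by blast

lemma hd1_lin: assumes "hd1 u w" "hd1 v z" shows "hd1 (a *\<^sub>R u + b *\<^sub>R v) (a *\<^sub>R w + b *\<^sub>R z)"
 using assms zx_lin hac_lin rp_lin unfolding hd1_def by blast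

lemma ch_lin: assumes "ch k f X" "ch k g V" shows "ch k (%x. a * f x + b * g x) (%j. a *\<^sub>R X j + b *\<^sub>R V j)"
 using assms unfolding ch_def by (auto intro: zx_lin hd1_lin)

lemma ch_diff: assumes "ch k f X" "ch k g V" shows "ch k (%x. f x - g x) (%j. X j - V j)"
 using ch_lin[OF assms, of 1 "-1"] by simp

text \<open>Continuous functions on the closed half line that agree a.e. agree at 0 too, so the
  description in \<open>trace0\<close> picks the value of any continuous representative.\<close>

lemma ch_trace0: assumes "ch k f X" "j < k" "zx h (X j)" "hac h w" shows "trace0 (wder k j f) = h 0"
 unfolding trace0_def
proof (rule the_equality)
 have ae: "AE x in lborel. 0 < x --> h x = wder k j f x"
  by (rule zx_AE_eq[OF assms(3) ch_wder[OF assms(1)]]) (use assms(2) in simp)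
 show "\<exists>g. cont0 g \<and> (AE s in Lpos. g s = wder k j f s) \<and> g 0 = h 0"
  using hac_continuous[OF assms(4)] ae unfolding lebesgue_on_AE_iff by blast
 fix c assume "\<exists>g. cont0 g \<and> (AE s in Lpos. g s = wder k j f s) \<and> g 0 = c"
 then obtain g where g: "cont0 g" "AE s in lborel. 0 < s --> g s = wder k j f s" "g 0 = c"
  unfolding lebesgue_on_AE_iff by blast
 have hc: "cont0 h" by (rule hac_continuous[OF assms(4)])
 have 1: "g y = h y" if "0 < y" for y
 proof (rule AE_continuous_eq[where S = "{0<..}" and f = g and g = h])
  show "continuous_on {0<..} g" "continuous_on {0<..} h"
   by (rule continuous_on_subset[OF g(1)] continuous_on_subset[OF hc], auto)+
  show "AE x in lborel. x \<in> {0<..} --> g x = h x" using g(2) ae by eventually_elim auto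
 qed (use that in auto)
 have lim: "(f ---> f 0) (at 0 within {0<..})" if "cont0 f" for f :: "real => real"
  by (rule tendsto_within_subset[of _ _ _ "{0..}"]) (use that in "auto simp: continuous_on_def")
 have "\<forall>\<^sub>F y in at 0 within {0<..}. g y = h y" by (auto simp: eventually_at_filter 1)
 from tendsto_cong[OF this] have "(h ---> g 0) (at 0 within {0<..})" using lim[OF g(1)] by simp
 from tendsto_unique[OF _ this lim[OF hc]] show "c = h 0" using g(3) by simp
qed

lemma sum_norm_tendsto_0_iff:
 fixes V :: "'b => nat => 'a::real_normed_vector"
 shows "((%t. sqrt (\<Sum>j\<le>k. (norm (V t j))^2)) ---> 0) F \<longleftrightarrow> (\<forall>j\<le>k. ((%t. V t j) ---> 0) F)"
proof
 assume L: "((%t. sqrt (\<Sum>j\<le>k. (norm (V t j))^2)) ---> 0) F"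
 show "\<forall>j\<le>k. ((%t. V t j) ---> 0) F"
 proof (intro allI impI)
  fix j assume j: "j <= k"
  have "norm (V t j) <= sqrt (\<Sum>j\<le>k. (norm (V t j))^2)" for t
   by (rule real_le_rsqrt) (rule member_le_sum, use j in auto)
  thus "((%t. V t j) ---> 0) F"
   by (intro Lim_null_comparison[OF always_eventually L]) auto
 qed
next
 assume R: "\<forall>j\<le>k. ((%t. V t j) ---> 0) F"
 have "((%t. sqrt (\<Sum>j\<le>k. (norm (V t j))^2)) ---> sqrt (\<Sum>j\<le>k. (norm (0::'a))^2)) F"
  by (intro tendsto_intros) (use R in auto)
 thus "((%t. sqrt (\<Sum>j\<le>k. (norm (V t j))^2)) ---> 0) F" by simp
qed

lemma ch_tendsto:
 assumes X: "!!t. 0 <= t ==> ch k (%s. u s t) (X t)" and t0: "0 <= t0"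
 shows "((%t. Hk_norm k (%s. u s t - u s t0)) ---> 0) (at0 t0) \<longleftrightarrow> (\<forall>j\<le>k. ((%t. X t j) ---> X t0 j) (at0 t0))"
proof -
 have "\<forall>\<^sub>F t in at0 t0. Hk_norm k (%s. u s t - u s t0) = sqrt (\<Sum>j\<le>k. (norm (X t j - X t0 j))^2)"
  unfolding eventually_at_filter by (intro always_eventually) (auto simp: ch_norm[OF ch_diff[OF X X[OF t0]]])
 from tendsto_cong[OF this, of 0] show ?thesis
  using sum_norm_tendsto_0_iff[of "%t j. X t j - X t0 j" k] by (simp add: LIM_zero_iff)
qed

text \<open>Differentiability in the norm of H^k amounts to L^2 differentiability of each derivative
  separately, since difference quotients of chains are chains again.\<close>

lemma ch_hvd:
 assumes X: "!!t. 0 <= t ==> ch k (%s. u s t) (X t)" and W: "ch k w W" and t0: "0 <= t0"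
 shows "((%t. Hk_norm k (%s. (u s t - u s t0) / (t - t0) - w s)) ---> 0) (at0 t0) \<longleftrightarrow>
  (\<forall>j\<le>k. ((%t. X t j) hvd W j) (at0 t0))"
proof -
 have "\<forall>\<^sub>F t in at0 t0. Hk_norm k (%s. (u s t - u s t0) / (t - t0) - w s)
   = sqrt (\<Sum>j\<le>k. (norm ((X t j - X t0 j) /\<^sub>R (t - t0) - W j))^2)"
  unfolding eventually_at_filter
 proof (intro always_eventually allI impI)
  fix t :: real assume "t \<in> {0..}"
  hence "ch k (%s. inverse (t - t0) * (u s t - u s t0) + (-1) * w s) (%j. inverse (t - t0) *\<^sub>R (X t j - X t0 j) + (-1) *\<^sub>R W j)"
   by (intro ch_lin ch_diff X t0 W) simp
  hence "ch k (%s. (u s t - u s t0) / (t - t0) - w s) (%j. (X t j - X t0 j) /\<^sub>R (t - t0) - W j)"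
   by (simp add: divide_inverse mult.commute)
  from ch_norm[OF this] show "Hk_norm k (%s. (u s t - u s t0) / (t - t0) - w s) = sqrt (\<Sum>j\<le>k. (norm ((X t j - X t0 j) /\<^sub>R (t - t0) - W j))^2)" .
 qed
 from tendsto_cong[OF this, of 0] show ?thesis
  using sum_norm_tendsto_0_iff[of "%t j. (X t j - X t0 j) /\<^sub>R (t - t0) - W j" k] by (simp add: hvd_iff LIM_zero_iff)
qed

lemma C0H_I:
 assumes X: "!!t. 0 <= t ==> ch k (%s. u s t) (X t)" and c: "!!j. j <= k ==> cont0 (%t. X t j)"
 shows "C0H k u"
 using ch_tendsto[of k u X, OF X] ch_Hk[OF X] c unfolding C0H_def continuous_on_def by simp

lemma C0H_E:
 assumes "C0H k u"
 obtains X where "!!t. 0 <= t ==> ch k (%s. u s t) (X t)" "!!j. j <= k ==> cont0 (%t. X t j)"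
proof -
 have "\<forall>t. \<exists>V. 0 <= t --> ch k (%s. u s t) V" using assms Hk_ch unfolding C0H_def by metis
 then obtain X where X: "!!t. 0 <= t ==> ch k (%s. u s t) (X t)" by metis
 show ?thesis by (rule that[OF X]) (use ch_tendsto[of k u X, OF X] assms in "simp_all add: C0H_def continuous_on_def")
qed

lemma C1H_I:
 assumes X: "!!t. 0 <= t ==> ch k (%s. u s t) (X t)"
  and W: "!!t. 0 <= t ==> ch k (%s. w s t) (W t)" and c: "!!j. j <= k ==> cont0 (%t. W t j)"
  and d: "!!t j. 0 <= t ==> j <= k ==> ((%t. X t j) hvd W t j) (at0 t)"
 shows "C1H k u"
 unfolding C1H_def
proof (intro conjI allI impI exI[of _ w] C0H_I[OF W c])
 show "(%s. u s t) \<in> Hk k" if "0 <= t" for t by (rule ch_Hk[OF X[OF that]])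
 show "((%t. Hk_norm k (%s. (u s t - u s t0) / (t - t0) - w s t0)) ---> 0) (at0 t0)" if "0 <= t0" for t0
  using ch_hvd[of k u X, OF X W[OF that] that] d[OF that] by simp
qed

lemma C1H_E:
 assumes "C1H k u"
 obtains X W w where "!!t. 0 <= t ==> ch k (%s. u s t) (X t)" "!!t. 0 <= t ==> ch k (%s. w s t) (W t)"
  "!!t j. 0 <= t ==> j <= k ==> ((%t. X t j) hvd W t j) (at0 t)"
proof -
 have "\<forall>t. \<exists>V. 0 <= t --> ch k (%s. u s t) V" using assms Hk_ch unfolding C1H_def by metis
 then obtain X where X: "!!t. 0 <= t ==> ch k (%s. u s t) (X t)" by metis
 obtain w where w: "C0H k w" "!!t0. 0 <= t0 ==> ((%t. Hk_norm k (%s. (u s t - u s t0) / (t - t0) - w s t0)) ---> 0) (at0 t0)"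
  using assms unfolding C1H_def by blast
 obtain W where W: "!!t. 0 <= t ==> ch k (%s. w s t) (W t)" using C0H_E[OF w(1)] by blast
 have "((%t. X t j) hvd W t j) (at0 t)" if "0 <= t" "j <= k" for t j
  using iffD1[OF ch_hvd[of k u X, OF X W[OF that(1)] that(1)] w(2)[OF that(1)]] that(2) by blast
 with X W show ?thesis by (rule that)
qed

section \<open>Restriction to the half line, reflection, multiplication by a frame\<close>

definition hf :: "l2 => l2" where "hf = mulf (indicator {0<..})"

lemma bm_hf: "bm (indicator {0<..}) 1" by (auto simp: bm_def indicator_def)
lemma lin_hf: "bounded_linear hf" unfolding hf_def by (rule lin_mulf[OF bm_hf])

lemma zx_hf:
 assumes "cj u = u" "f \<in> borel_measurable (Lpos)" "AE x in lborel. 0 < x --> rep_l2 u x = of_real (f x)"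
 shows "zx f (hf u)"
proof -
 have "AE x in lborel. rep_l2 (hf u) x = (if 0 < x then of_real (f x) else 0)"
  using rep_mulf[OF bm_hf, of u] assms(3) unfolding hf_def by eventually_elim (auto simp: indicator_def)
 thus ?thesis using assms(2) by (simp add: zx_def)
qed

lemma cj_real: assumes "cj u = u" shows "AE x in lborel. rep_l2 u x = of_real (Re (rep_l2 u x))"
proof -
 have "AE x in lborel. rep_l2 u x = cnj (rep_l2 u x)" using rep_cj[of u] unfolding assms .
 thus ?thesis by eventually_elim (simp add: complex_eq_iff)
qed

lemma rp_hf: assumes "cj u = u" shows "rp (hf u)"
proof -
 have "(%x. Re (rep_l2 u x)) \<in> borel_measurable lebesgue" by (rule measurable_completion) measurable
 hence "(%x. Re (rep_l2 u x)) \<in> borel_measurable (Lpos)" by (rule measurable_restrict_space1)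
 moreover have "AE x in lborel. 0 < x --> rep_l2 u x = of_real (Re (rep_l2 u x))" using cj_real[OF assms] by eventually_elim simp
 ultimately show ?thesis using zx_hf[OF assms] unfolding rp_def by blast
qed

lemma has_D_real: assumes "has_D u w" "cj u = u" shows "cj w = w"
 using has_D_unique[OF has_D_cj[OF assms(1)]] assms by simp

text \<open>Cutting off at 0 does not change integrals over intervals in the half line, so the
  derivative of the cut function is the cut derivative and no boundary term appears.\<close>

lemma hd1_hf: assumes "has_D u w" "cj u = u" shows "hd1 (hf u) (hf w)"
proof -
 let ?h = "%x. Re (ev (cb u) x)"
 have rw: "rp (hf w)" by (rule rp_hf[OF has_D_real[OF assms]])
 have "ccnj (cb u) = cb u" using cb_cj[OF assms(1)] assms(2) by simp
 hence re: "of_real (?h x) = ev (cb u) x" for x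
  using apply_ccnj[of "cb u" x] by (simp add: complex_eq_iff)
 have I: "I a b (hf w) = I a b w" if "0 <= a" for a b
  unfolding I_def
 proof (rule integral_cong_AE)
  show "AE x in lborel. indicator {a..b} x * rep_l2 (hf w) x = indicator {a..b} x * rep_l2 w x"
   using rep_mulf[OF bm_hf, of w] AE_lborel_singleton[of 0] unfolding hf_def
   by eventually_elim (use that in "auto simp: indicator_def")
 qed measurable
 have hac: "hac ?h (hf w)" unfolding hac_def
 proof (intro allI impI)
  fix a b :: real assume "0 <= a" "a <= b"
  thus "of_real (?h b - ?h a) = I a b (hf w)"
   using has_D_cb(2)[OF assms(1)] unfolding of_real_diff re I[OF \<open>0 <= a\<close>] acb_def by blast
 qed
 have "zx ?h (hf u)"
 proof (rule zx_hf[OF assms(2) hac_measurable[OF hac]])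
  show "AE x in lborel. 0 < x --> rep_l2 u x = of_real (?h x)"
   using has_D_cb(1)[OF assms(1)] unfolding isrep_def re by eventually_elim simp
 qed
 with rw hac show ?thesis unfolding hd1_def by blast
qed

lemma D_pow_real: assumes "Hs k u" "cj u = u" "j <= k" shows "cj ((D ^^ j) u) = (D ^^ j) u"
 using assms(3)
proof (induction j)
 case (Suc j) thus ?case using has_D_real[OF Hs_has_D[OF assms(1), of j]] by simp
qed (use assms in simp)

lemma ch_hf: assumes "Hs k u" "cj u = u" "f \<in> borel_measurable (Lpos)" "AE x in lborel. 0 < x --> rep_l2 u x = of_real (f x)"
 shows "ch k f (%j. hf ((D ^^ j) u))"
 unfolding ch_def using zx_hf[OF assms(2-4)] Hs_has_D[OF assms(1)] D_pow_real[OF assms(1,2)]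
 by (auto intro!: hd1_hf simp del: funpow.simps(2))

lemma CH_D: "CH k u ==> j <= k ==> cont0 (%t. (D ^^ j) (u t))"
proof (induction j arbitrary: k u)
 case 0 thus ?case by (simp add: CH_continuous)
next
 case (Suc j)
 then obtain k' where k: "k = Suc k'" by (cases k) auto
 obtain w where w: "!!t. 0 <= t ==> has_D (u t) (w t)" "CH k' w" using Suc.prems(1) unfolding k by (elim CH_SucE) (rule that, assumption+)
 have "cont0 (%t. (D ^^ j) (w t))" using Suc.IH[OF w(2)] Suc.prems(2) k by simp
 thus ?case by (rule continuous_on_eq) (simp add: D_eq[OF w(1)] funpow_swap1)
qed

lemma CH_Hs: "CH k u ==> 0 <= t ==> Hs k (u t)"
proof (induction k arbitrary: u)
 case (Suc k)
 obtain w where w: "!!t. 0 <= t ==> has_D (u t) (w t)" "CH k w" using Suc.prems(1) by (elim CH_SucE) (rule that, assumption+)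
 show ?case by (rule Hs_SucI[OF w(1)[OF Suc.prems(2)] Suc.IH[OF w(2) Suc.prems(2)]])
qed simp

text \<open>Even and odd reflection, for u supported on the half line.\<close>

definition ext :: "real => l2 => l2" where "ext \<sigma> u = u + \<sigma> *\<^sub>R rfl u"

lemma lin_ext: "bounded_linear (ext \<sigma>)"
 unfolding ext_def by (intro bounded_linear_add bounded_linear_ident bounded_linear_const_scaleR lin_aff) simp

lemma rep_ext: "AE x in lborel. rep_l2 (ext \<sigma> u) x = rep_l2 u x + \<sigma> *\<^sub>R rep_l2 u (- x)"
 using rep_add[of u "\<sigma> *\<^sub>R rfl u"] rep_scaleR[of \<sigma> "rfl u"] rep_aff[of "-1" 0 u, OF zero_neq_neg_one[symmetric]] unfolding ext_def
 by eventually_elim simp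

lemma AE_reflect: assumes "AE x in lborel. P (x::real)" shows "AE x in lborel. P (- x)"
proof -
 obtain N where N: "{x. \<not> P x} \<subseteq> N" "N \<in> sets lborel" "emeasure lborel N = 0" using assms by (auto elim: AE_E simp: eventually_ae_filter null_sets_def)
 have "AE x in lborel. x \<notin> N" using N by (intro AE_not_in) (auto simp: null_sets_def)
 hence "AE x in lborel. 0 + (-1) * x \<notin> N" using N(2) by (intro AE_borel_affine[of "-1" "%x. x \<notin> N"]) auto
 thus ?thesis by eventually_elim (use N(1) in auto)
qed

lemma zx_ext: assumes "zx h u" shows "AE x in lborel. rep_l2 (ext \<sigma> u) x = (if 0 <= x then of_real (h x) else of_real (\<sigma> * h (- x)))"
proof -
 have ae: "AE x in lborel. rep_l2 u x = (if 0 < x then of_real (h x) else 0)" using assms by (simp add: zx_def)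
 show ?thesis using ae AE_reflect[OF ae] AE_lborel_singleton[of 0] rep_ext[of \<sigma> u]
  by eventually_elim (auto simp: scaleR_conv_of_real)
qed

lemma acb_ext:
 assumes h: "hac h w" "rp w" and \<sigma>: "\<sigma> = 1 \<or> h 0 = 0" and ab: "a <= b"
  and f: "f = (%x. if 0 <= x then of_real (h x) else of_real (\<sigma> * h (- x)))"
  and s: "\<sigma> = 1 \<or> \<sigma> = -1"
 shows "f b - f a = I a b (ext (- \<sigma>) w)"
proof -
 have H: "I x y w = of_real (h y - h x)" if "0 <= x" "x <= y" for x y using h(1) that unfolding hac_def by simp
 have E: "I a b (ext (- \<sigma>) w) = I (max 0 a) (max 0 b) w - of_real \<sigma> * I (max 0 (- b)) (max 0 (- a)) w"
  unfolding ext_def I_add I_scaleR I_rfl rp_half[OF h(2), of a b] rp_half[OF h(2), of "- b" "- a"] by (simp add: scaleR_conv_of_real)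
 consider "0 <= a" | "a < 0" "0 <= b" | "b < 0" by linarith
 thus ?thesis
 proof cases
  case 1 thus ?thesis unfolding E f using ab H[of a b] by simp
 next
  case 2 thus ?thesis unfolding E f using H[of 0 b] H[of 0 "- a"] \<sigma> s by auto
 next
  case 3
  have h3: "I (- b) (- a) w = of_real (h (- a)) - of_real (h (- b))" using 3 ab H[of "- b" "- a"] by simp
  show ?thesis unfolding E f using 3 ab by (simp add: h3 algebra_simps)
 qed
qed

text \<open>The even reflection of an H^1 function is always in H^1, whereas the odd one is
  continuous across 0 only if the trace vanishes. In both cases differentiation reverses the
  parity.\<close>

lemma has_D_ext:
 assumes "zx h u" "hac h w" "rp w" "\<sigma> = 1 \<or> \<sigma> = -1" "\<sigma> = 1 \<or> h 0 = 0"
 shows "has_D (ext \<sigma> u) (ext (- \<sigma>) w)" "ev (cb (ext \<sigma> u)) = (%x. if 0 <= x then of_real (h x) else of_real (\<sigma> * h (- x)))"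
 by (rule has_DI[OF zx_ext[OF assms(1), of \<sigma>] acb_ext[OF assms(2,3,5) _ refl assms(4)]]; assumption)+

text \<open>The frame equations replace a derivative of m or v by a product with q, and the results
  are again frame times L^2 element. Regularity can thus be propagated without differentiating the
  frame further.\<close>

lemma mul_acb_D:
 assumes m: "acb m (- mul v q)" and v: "acb v (rel (mul m (cj q)))" and u: "has_D u w"
 shows "has_D (mul m u) (mul m w - mul v (pr u q))"
  "has_D (mul v u) (mul v w + (1/2) *\<^sub>R (mul m (pr u (cj q)) + mul (ccnj m) (pr u q)))"
proof -
 have "mul (cb u) (- mul v q) = - mul v (pr u q)"
  unfolding pr_def mul_commute[of v] by (rule bounded_bilinear.minus_right[OF bil_mul])
 thus "has_D (mul m u) (mul m w - mul v (pr u q))" using has_D_mul[OF m u] by simp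
 have "mul (cb u) (rel (mul m (cj q))) = (1/2) *\<^sub>R (mul (cb u) (mul m (cj q)) + mul (cb u) (mul (ccnj m) q))"
  unfolding rel_def cj_mul cj_cj
  by (simp only: bounded_bilinear.scaleR_right[OF bil_mul] bounded_bilinear.add_right[OF bil_mul])
 also have "... = (1/2) *\<^sub>R (mul m (pr u (cj q)) + mul (ccnj m) (pr u q))"
  unfolding pr_def mul_commute[of m] mul_commute[of "ccnj m"] by simp
 finally show "has_D (mul v u) (mul v w + (1/2) *\<^sub>R (mul m (pr u (cj q)) + mul (ccnj m) (pr u q)))"
  using has_D_mul[OF v u] by simp
qed

lemma mul_ccnj: "mul (ccnj m) u = cj (mul m (cj u))" by (simp add: cj_mul)

lemma CH_pr0: assumes "CH (Suc k) u" "CH k v" shows "CH k (%t. pr (u t) (v t))"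
proof (cases k)
 case 0
 thus ?thesis using assms
  by (auto simp: pr_def intro!: bil_cont[OF bil_mul] CH_cb)
next
 case (Suc l) thus ?thesis using CH_pr[of l u v] assms CH_pred by auto
qed

text \<open>Neither v nor m needs to lie in L^2, yet multiplication by them preserves H^k. A
  derivative falling on the frame costs a factor q, so q is needed with one order less; this gap of
  one order makes the bootstrap for the initial q possible.\<close>

lemma CH_mul_frame:
 assumes cv: "cont0 v" and cm: "cont0 m"
  and av: "!!t. 0 <= t ==> acb (v t) (rel (mul (m t) (cj (q t))))" and am: "!!t. 0 <= t ==> acb (m t) (- mul (v t) (q t))"
 shows "CH (k - 1) q ==> CH k u ==> CH k (%t. mul (m t) (u t)) \<and> CH k (%t. mul (v t) (u t))"
proof (induction k arbitrary: u)
 case 0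
 thus ?case using cv cm by (auto intro!: bil_cont[OF bil_mul])
next
 case (Suc k)
 have q: "CH k q" using Suc.prems by simp
 have q': "CH (k - 1) q" by (rule CH_mono[OF _ q]) simp
 obtain w where w: "cont0 u" "!!t. 0 <= t ==> has_D (u t) (w t)" "CH k w"
  using Suc.prems(2) by (elim CH_SucE) (rule that, assumption+)
 have p1: "CH k (%t. pr (u t) (q t))" by (rule CH_pr0[OF Suc.prems(2) q])
 have p2: "CH k (%t. pr (u t) (cj (q t)))" by (rule CH_pr0[OF Suc.prems(2) CH_cj[OF q]])
 note IH = Suc.IH[OF q']
 have i1: "CH k (%t. mul (m t) (w t) - mul (v t) (pr (u t) (q t)))"
  using IH[OF w(3)] IH[OF p1] by (intro CH_diff) auto
 have "CH k (%t. mul (ccnj (m t)) (pr (u t) (q t)))"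
  unfolding mul_ccnj using IH[OF CH_cj[OF p1]] by (intro CH_cj) auto
 hence i2: "CH k (%t. mul (v t) (w t) + (1/2) *\<^sub>R (mul (m t) (pr (u t) (cj (q t))) + mul (ccnj (m t)) (pr (u t) (q t))))"
  using IH[OF w(3)] IH[OF p2] by (intro CH_add CH_scaleR) auto
 show ?case
 proof (intro conjI)
  show "CH (Suc k) (%t. mul (m t) (u t))"
   by (rule CH_SucI[OF bil_cont[OF bil_mul cm w(1)] mul_acb_D(1)[OF am av w(2)] i1])
  show "CH (Suc k) (%t. mul (v t) (u t))"
   by (rule CH_SucI[OF bil_cont[OF bil_mul cv w(1)] mul_acb_D(2)[OF am av w(2)] i2])
 qed
qed

lemma Hs_CH: "Hs k u ==> CH k (%t. u)"
proof (induction k arbitrary: u)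
 case (Suc k)
 obtain w where "has_D u w" "Hs k w" using Suc.prems by (rule Hs_SucE)
 thus ?case using Suc.IH by (intro CH_SucI[where w = "%t. w"]) auto
qed simp

lemma Hs_mul_frame:
 assumes "acb v (rel (mul m (cj q)))" "acb m (- mul v q)" "Hs (k - 1) q" "Hs k u"
 shows "Hs k (mul m u)"
 using CH_mul_frame[of "%t. v" "%t. m" "%t. q" k "%t. u"] assms Hs_CH CH_Hs[of k "%t. mul m u" 0] by auto

text \<open>\<phi> is the reflection of h with parity \<tau>, so its derivative has parity - \<tau>.
  The fundamental theorem is applied on each side of 0 and the two halves are joined there.\<close>

lemma acb_two_sided:
 fixes h g :: "real => complex"
 assumes d: "!!x. 0 <= x ==> (h hvd g x) (at0 x)" and c: "cont0 g"
  and p: "!!x. 0 <= x ==> ev \<phi> x = h x" and n: "!!x. 0 <= x ==> ev \<phi> (- x) = of_real \<tau> * h x"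
  and w: "AE x in lborel. 0 < x --> rep_l2 w x = g x" "AE x in lborel. 0 < x --> rep_l2 w (- x) = - of_real \<tau> * g x"
 shows "acb \<phi> w"
proof -
 have half: "I a b u = \<kappa> * (h b - h a)" if ab: "0 <= a" "a <= b" and ae: "AE x in lborel. 0 < x --> rep_l2 u x = \<kappa> * g x" for a b u \<kappa>
 proof -
  have cab: "continuous_on {a..b} g" by (rule continuous_on_subset[OF c]) (use ab in auto)
  have i: "integrable lborel (%x. indicator {a..b} x *\<^sub>R g x)"
   by (rule borel_integrable_compact[OF compact_Icc cab])
  have "I a b u = (LINT x|lborel. \<kappa> * (indicator {a..b} x *\<^sub>R g x))"
   unfolding I_def
  proof (rule integral_cong_AE)
   show "AE x in lborel. indicator {a..b} x * rep_l2 u x = \<kappa> * (indicator {a..b} x *\<^sub>R g x)"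
    using ae AE_lborel_singleton[of 0] by eventually_elim (use ab in "auto simp: indicator_def")
   show "(%x. \<kappa> * (indicator {a..b} x *\<^sub>R g x)) \<in> borel_measurable lborel"
    using borel_measurable_integrable[OF i] by (rule borel_measurable_times[OF borel_measurable_const])
  qed measurable
  also have "... = \<kappa> * (LINT x|lborel. indicator {a..b} x *\<^sub>R g x)" by (rule integral_mult_right_zero)
  also have "(LINT x|lborel. indicator {a..b} x *\<^sub>R g x) = h b - h a"
   by (rule integral_FTC_atLeastAtMost[OF ab(2) _ cab]) (use ab in "auto intro!: has_vector_derivative_within_subset[OF d]")
  finally show ?thesis .
 qed
 have P: "I a b w = ev \<phi> b - ev \<phi> a" if "0 <= a" "a <= b" for a b
  using half[of a b w 1] that w(1) p by simp
 have "AE x in lborel. 0 < x --> rep_l2 (rfl w) x = - of_real \<tau> * g x"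
  using w(2) rep_aff[of "-1" 0 w, OF zero_neq_neg_one[symmetric]] by eventually_elim simp
 note hn = half[OF _ _ this]
 have N: "I a b w = ev \<phi> b - ev \<phi> a" if "a <= b" "b <= 0" for a b
 proof -
  have "I a b w = I (- b) (- a) (rfl w)" using I_rfl[of "- b" "- a" w] by simp
  also have "... = - of_real \<tau> * (h (- a) - h (- b))" by (rule hn) (use that in auto)
  also have "... = ev \<phi> b - ev \<phi> a" using n[of "- a"] n[of "- b"] that by (simp add: algebra_simps)
  finally show ?thesis .
 qed
 show ?thesis unfolding acb_def
 proof (intro allI impI)
  fix a b :: real assume ab: "a <= b"
  consider "0 <= a" | "b <= 0" | "a <= 0" "0 <= b" by linarith
  thus "ev \<phi> b - ev \<phi> a = I a b w"
  proof cases
   case 3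
   show ?thesis unfolding I_combine[OF 3, symmetric] P[OF order_refl 3(2)] N[OF 3(1) order_refl] by simp
  qed (use ab P N in auto)
 qed
qed

section \<open>Initial data: reflection, traces at 0 and the parallel frame\<close>

definition refl_bcf :: "real => (real => complex) => cbf" where
 "refl_bcf \<tau> h = Bcontfun (%x. if 0 <= x then h x else of_real \<tau> * h (- x))"

lemma apply_refl_bcf:
 assumes "cont0 h" "!!x. 0 <= x ==> cmod (h x) <= B" "\<tau> = 1 \<or> \<tau> = -1" "\<tau> = 1 \<or> h 0 = 0"
 shows "0 <= x ==> ev (refl_bcf \<tau> h) x = h x" "0 <= x ==> ev (refl_bcf \<tau> h) (- x) = of_real \<tau> * h x"
proof -
 let ?f = "%x. if 0 <= x then h x else of_real \<tau> * h (- x)"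
 have "continuous_on ({0..} \<union> {..0}) (%x. if x \<in> {0..} then h x else of_real \<tau> * h (- x))"
 proof (rule continuous_on_cases)
  have "continuous_on {..0} (%x. h (- x))"
   by (rule continuous_on_compose2[OF assms(1)]) (auto intro!: continuous_intros)
  thus "continuous_on {..0} (%x. of_real \<tau> * h (- x))" by (intro continuous_intros)
  show "\<forall>x. x \<in> {0..} \<and> x \<notin> {0..} \<or> x \<in> {..0} \<and> x \<in> {0..} --> h x = of_real \<tau> * h (- x)" using assms(4) by auto
 qed (use assms in auto)
 moreover have "{0..} \<union> {..0} = (UNIV :: real set)" by auto
 ultimately have "continuous_on UNIV ?f" by simp
 hence "?f \<in> bcontfun" by (rule bcontfun_normI[where b = B]) (use assms(2,3) in "auto simp: norm_mult")
 hence a: "ev (refl_bcf \<tau> h) = ?f" unfolding refl_bcf_def by (rule Bcontfun_inverse)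
 show "0 <= x ==> ev (refl_bcf \<tau> h) x = h x" by (simp add: a)
 show "0 <= x ==> ev (refl_bcf \<tau> h) (- x) = of_real \<tau> * h x" using assms(4) by (auto simp: a)
qed

text \<open>The induction step of the Leibniz formula for derivatives of a square, phrased for a
  chain of functions w j so that one-sided derivatives at 0 are covered; Pascal's rule joins the two
  sums.\<close>

lemma leibniz_deriv:
 fixes w :: "nat => real => real"
 assumes d: "!!j. j <= n ==> (w j has_real_derivative w (Suc j) s) (at s within S)"
 shows "((%s. \<Sum>i\<le>n. real (n choose i) * (w i s * w (n - i) s)) has_real_derivative
   (\<Sum>i\<le>Suc n. real (Suc n choose i) * (w i s * w (Suc n - i) s))) (at s within S)"
proof -
 let ?A = "%i. w (Suc i) s * w (n - i) s" and ?B = "%i. w i s * w (Suc n - i) s"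
 have "((%s. \<Sum>i\<le>n. real (n choose i) * (w i s * w (n - i) s)) has_real_derivative
   (\<Sum>i\<le>n. real (n choose i) * (w i s * w (Suc (n - i)) s + w (Suc i) s * w (n - i) s))) (at s within S)"
  by (intro DERIV_sum DERIV_cmult DERIV_mult' d) auto
 moreover have "(\<Sum>i\<le>n. real (n choose i) * (w i s * w (Suc (n - i)) s + w (Suc i) s * w (n - i) s))
   = (\<Sum>i\<le>n. real (n choose i) * ?B i) + (\<Sum>i\<le>n. real (n choose i) * ?A i)"
  by (simp add: sum.distrib distrib_left Suc_diff_le)
 moreover have "(\<Sum>i\<le>Suc n. real (Suc n choose i) * ?B i) = ?B 0 + (\<Sum>i\<le>n. real (Suc n choose Suc i) * ?A i)"
  by (subst sum.atMost_Suc_shift) simp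
 moreover have "(\<Sum>i\<le>n. real (Suc n choose Suc i) * ?A i) = (\<Sum>i\<le>n. real (n choose i) * ?A i) + (\<Sum>i\<le>n. real (n choose Suc i) * ?A i)"
  by (simp add: sum.distrib distrib_right)
 moreover have "(\<Sum>i\<le>n. real (n choose i) * ?B i) = ?B 0 + (\<Sum>i\<le>n. real (n choose Suc i) * ?A i)"
 proof -
  have z: "real (n choose Suc n) = 0" by simp
  have "(\<Sum>i\<le>Suc n. real (n choose i) * ?B i) = (\<Sum>i\<le>n. real (n choose i) * ?B i) + real (n choose Suc n) * ?B (Suc n)"
   by (rule sum.atMost_Suc)
  hence "(\<Sum>i\<le>Suc n. real (n choose i) * ?B i) = (\<Sum>i\<le>n. real (n choose i) * ?B i)"
   by (simp only: z mult_zero_left add_0_right)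
  moreover have "(\<Sum>i\<le>Suc n. real (n choose i) * ?B i) = real (n choose 0) * ?B 0 + (\<Sum>i\<le>n. real (n choose Suc i) * ?B (Suc i))"
   by (rule sum.atMost_Suc_shift)
  ultimately show ?thesis by (simp only: binomial_n_0 diff_zero diff_Suc_Suc of_nat_1 mult_1)
 qed
 ultimately show ?thesis by (simp only: add_ac)
qed

lemma at_within_Ici_nontrivial: "0 <= (s::real) ==> at0 s ~= bot"
proof -
 assume s: "0 <= s"
 have "s islimpt {s..s+1}" by (rule islimpt_Icc[THEN iffD2]) auto
 hence "s islimpt {0..}" by (rule islimpt_subset) (use s in auto)
 thus ?thesis by (simp add: trivial_limit_within)
qed

lemma vector_deriv_unique_Ici:
 assumes "(f hvd a) (at0 s)" "(f hvd b) (at0 s)" "0 <= s"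
 shows "a = b"
 by (rule vector_derivative_unique_within[OF at_within_Ici_nontrivial[OF assms(3)] assms(1,2)])

lemma deriv_unique_Ici:
 fixes f :: "real => real"
 assumes "(f has_real_derivative a) (at0 s)" "(f has_real_derivative b) (at0 s)" "0 <= s"
 shows "a = b"
 using assms vector_deriv_unique_Ici[of f a s b] by (simp add: hrd_iff)

text \<open>The compatibility condition involves only the components orthogonal to e3. The third
  component is handled by differentiating |v|^2 = 1 an odd number j of times: in the other
  components every product contains a derivative of even order, which vanishes at 0.\<close>

lemma odd_derivs_vanish:
 fixes w :: "3 => nat => real => real"
 assumes d: "!!c j s. j < k ==> 0 <= s ==> (w c j has_real_derivative w c (Suc j) s) (at0 s)"
  and unit: "!!s. 0 <= s ==> (\<Sum>c\<in>UNIV. (w c 0 s)^2) = 1"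
  and ev: "!!c j. c ~= 3 ==> even j ==> j <= k ==> w c j 0 = 0" and w3: "w 3 0 0 = 1"
 shows "odd j ==> j <= k ==> w 3 j 0 = 0"
proof -
 define L where "L n s = (\<Sum>c\<in>UNIV. \<Sum>i\<le>n. real (n choose i) * (w c i s * w c (n - i) s))" for n s
 have dL: "(L n has_real_derivative L (Suc n) s) (at0 s)" if "n < k" "0 <= s" for n s
  unfolding L_def[abs_def] by (intro DERIV_sum leibniz_deriv d) (use that in auto)
 have L0: "L 0 s = 1" if "0 <= s" for s using unit[OF that] by (simp add: L_def power2_eq_square)
 have LZ: "L (Suc n) s = 0" if "n < k" "0 <= s" for n s
  using that
 proof (induction n arbitrary: s)
  case 0
  have "(L 0 has_real_derivative 0) (at0 s)"
   by (rule has_field_derivative_transform_within[OF DERIV_const[of 1], of 1]) (use 0 L0 in auto)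
  thus ?case using deriv_unique_Ici[OF dL] 0 by auto
 next
  case (Suc n)
  have "(L (Suc n) has_real_derivative 0) (at0 s)"
   by (rule has_field_derivative_transform_within[OF DERIV_const[of 0], of 1]) (use Suc in auto)
  thus ?case using deriv_unique_Ici[OF dL] Suc.prems by auto
 qed
 show "odd j ==> j <= k ==> w 3 j 0 = 0"
 proof (induction j rule: less_induct)
  case (less j)
  have j0: "0 < j" using less.prems by (cases j) auto
  have z: "(\<Sum>i\<le>j. real (j choose i) * (w c i 0 * w c (j - i) 0)) = 0" if "c ~= 3" for c
  proof (rule sum.neutral, intro ballI)
   fix i assume i: "i \<in> {..j}"
   have "even i \<or> even (j - i)" using less.prems i by auto
   thus "real (j choose i) * (w c i 0 * w c (j - i) 0) = 0"
   proof
    assume "even i" thus ?thesis using ev[OF that, of i] i less.prems by simp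
   next
    assume "even (j - i)" thus ?thesis using ev[OF that, of "j - i"] i less.prems by simp
   qed
  qed
  have "L j 0 = 0" using LZ[of "j - 1" 0] j0 less.prems by simp
  moreover have "L j 0 = (\<Sum>i\<le>j. real (j choose i) * (w 3 i 0 * w 3 (j - i) 0))"
   unfolding L_def by (subst sum.remove[of _ 3]) (auto intro!: sum.neutral z)
  \<comment> \<open>For 0 < i < j one of the orders i, j - i is odd and smaller than j, so by
    induction only the end terms survive; they give 2 times the j-th derivative.\<close>
  moreover have "(\<Sum>i\<le>j. real (j choose i) * (w 3 i 0 * w 3 (j - i) 0)) = (\<Sum>i\<in>{0, j}. real (j choose i) * (w 3 i 0 * w 3 (j - i) 0))"
  proof (rule sum.mono_neutral_right)
   show "\<forall>i\<in>{..j} - {0, j}. real (j choose i) * (w 3 i 0 * w 3 (j - i) 0) = 0"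
   proof
    fix i assume i: "i \<in> {..j} - {0, j}"
    have "odd i \<or> odd (j - i)" using less.prems i by auto
    thus "real (j choose i) * (w 3 i 0 * w 3 (j - i) 0) = 0"
     using less.IH[of i] less.IH[of "j - i"] i less.prems by auto
   qed
  qed auto
  ultimately show ?case using j0 w3 by simp
 qed
qed

lemma bil_cross3: "bounded_bilinear cross3"
 using bilinear_cross by (simp add: bilinear_conv_bounded_bilinear)

lemma frame_cross:
 fixes v e :: "real^3" assumes "v \<bullet> v = 1" "e \<bullet> e = 1" "e \<bullet> v = 0"
 shows "cross3 v (cross3 v e) = - e" "cross3 e (cross3 v e) = v" "cross3 v e \<bullet> cross3 v e = 1"
  "x = (x \<bullet> v) *\<^sub>R v + (x \<bullet> e) *\<^sub>R e + (x \<bullet> cross3 v e) *\<^sub>R cross3 v e"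
proof -
 let ?f = "cross3 v e"
 have ve: "v \<bullet> e = 0" using assms(3) by (simp add: inner_commute)
 show "cross3 v ?f = - e" "cross3 e ?f = v" unfolding Lagrange using assms ve by auto
 have "(norm ?f)^2 = 1" using norm_cross_dot[of v e] assms ve by (simp add: norm_eq_sqrt_inner)
 thus ff: "?f \<bullet> ?f = 1" by (simp add: power2_norm_eq_inner)
 define y where "y = x - ((x \<bullet> v) *\<^sub>R v + (x \<bullet> e) *\<^sub>R e + (x \<bullet> ?f) *\<^sub>R ?f)"
 have vf: "v \<bullet> ?f = 0" "e \<bullet> ?f = 0" "?f \<bullet> v = 0" "?f \<bullet> e = 0" by (simp_all add: dot_cross_self)
 have y: "y \<bullet> v = 0" "y \<bullet> e = 0" "y \<bullet> ?f = 0"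
  unfolding y_def using assms ve vf ff by (simp_all add: inner_diff_left inner_add_left)
 have "cross3 y ?f = 0" unfolding Lagrange using y by simp
 hence "(norm y * norm ?f)^2 = 0" using norm_cross_dot[of y ?f] y by simp
 hence "y = 0" using ff by (auto simp: norm_eq_sqrt_inner)
 thus "x = (x \<bullet> v) *\<^sub>R v + (x \<bullet> e) *\<^sub>R e + (x \<bullet> ?f) *\<^sub>R ?f" by (simp add: y_def)
qed

lemma const_Ici:
 fixes f :: "real => 'a::real_normed_vector"
 assumes "!!t. 0 <= t ==> (f hvd 0) (at0 t)" "0 <= t"
 shows "f t = f 0"
proof (rule zero_deriv_const[where \<tau> = t])
 show "(f hvd 0) (at s within {0..t})" if "s \<in> {0..t}" for s
  by (rule has_vector_derivative_within_subset[OF assms(1)]) (use that in auto)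
qed (use assms(2) in auto)

text \<open>v is the primitive of its derivative a. Changing a on a null set does not affect the
  integral, and the primitive of a continuous function has it as derivative at every point.\<close>

lemma ae_deriv:
 fixes v :: "real => real"
 assumes d: "!!s. 0 <= s ==> (v hvd a s) (at0 s)"
  and ae: "AE x in lborel. 0 < x --> a x = g x" and c: "cont0 g" and s: "0 <= s"
 shows "(v hvd g s) (at0 s)"
proof -
 have "AE x in lebesgue. 0 < x --> a x = g x" using ae by (simp add: AE_completion_iff)
 then obtain N where N: "N \<in> null_sets lebesgue" "{x. \<not> (0 < x --> a x = g x)} \<subseteq> N"
  by (auto simp: eventually_ae_filter)
 have neg: "negligible (insert 0 N)" using N(1) by (simp add: negligible_iff_null_sets)
 have eq: "v b = v 0 + integral {0..b} g" if "0 <= b" for b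
 proof -
  have i: "(a has_integral v b - v 0) {0..b}" by (rule FTC_Ici[OF d]) (use that in auto)
  have "(g has_integral v b - v 0) {0..b}"
  proof (rule has_integral_spike[OF neg _ i])
   fix x assume "x \<in> {0..b} - insert 0 N"
   hence "0 < x" "x \<notin> N" by auto
   from contra_subsetD[OF N(2) this(2)] this(1) show "g x = a x" by simp
  qed
  thus ?thesis by (simp add: integral_unique)
 qed
 show ?thesis
 proof (rule has_vector_derivative_transform[OF _ _ integral_has_vector_derivative_Ici[OF c s]])
  show "v x = v 0 + integral {0..x} g" if "x \<in> {0..}" for x by (rule eq) (use that in simp)
 qed (use s in simp)
qed

lemma hac_deriv:
 assumes h: "hac h w" and z: "zx g w" and c: "cont0 g" and s: "0 <= s"
 shows "(h hvd g s) (at0 s)"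
proof -
 have ae: "AE x in lborel. rep_l2 w x = (if 0 < x then of_real (g x) else 0)" using z by (simp add: zx_def)
 have eq: "h b = h 0 + integral {0..b} g" if "0 <= b" for b
 proof -
  have cb: "continuous_on {0..b} g" by (rule continuous_on_subset[OF c]) auto
  have i: "set_integrable lborel {0..b} g"
   unfolding set_integrable_def by (rule borel_integrable_compact[OF compact_Icc cb])
  have "of_real (h b - h 0) = I 0 b w" using h that by (simp add: hac_def)
  also have "... = (LINT x|lborel. of_real (indicator {0..b} x *\<^sub>R g x))"
   unfolding I_def
  proof (rule integral_cong_AE)
   show "AE x in lborel. indicator {0..b} x * rep_l2 w x = of_real (indicator {0..b} x *\<^sub>R g x)"
    using ae AE_lborel_singleton[of 0] by eventually_elim (auto simp: indicator_def)
   show "(%x. complex_of_real (indicator {0..b} x *\<^sub>R g x)) \<in> borel_measurable lborel"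
    using borel_measurable_integrable[OF i[unfolded set_integrable_def]] by measurable
  qed measurable
  also have "... = of_real (LINT x|lborel. indicator {0..b} x *\<^sub>R g x)" by (rule integral_complex_of_real)
  also have "(LINT x|lborel. indicator {0..b} x *\<^sub>R g x) = integral {0..b} g"
   using set_borel_integral_eq_integral(2)[OF i] by (simp add: set_lebesgue_integral_def)
  finally have "h b - h 0 = integral {0..b} g" by (simp only: of_real_eq_iff)
  thus ?thesis by simp
 qed
 show ?thesis
 proof (rule has_vector_derivative_transform[OF _ _ integral_has_vector_derivative_Ici[OF c s]])
  show "h x = h 0 + integral {0..x} g" if "x \<in> {0..}" for x by (rule eq) (use that in simp)
 qed (use s in simp)
qed

text \<open>The parity alternates with the order of the derivative, so the j-th derivative is
  reflected with sign s (-1)^j, and only the odd reflections require a vanishing trace.\<close>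

lemma Hs_ext:
 assumes "!!j. j < k ==> zx (h j) (X j) \<and> hac (h j) (X (Suc j)) \<and> rp (X (Suc j))"
  "!!j. j < k ==> s * (-1) ^ j = 1 \<or> h j 0 = 0" "s = 1 \<or> s = (-1::real)"
 shows "Hs k (ext s (X 0))"
 using assms
proof (induction k arbitrary: s h X)
 case (Suc k)
 have "has_D (ext s (X 0)) (ext (- s) (X 1))"
  by (rule has_D_ext[where h = "h 0"]) (use Suc.prems(1)[of 0] Suc.prems(2)[of 0] Suc.prems(3) in auto)
 moreover have "Hs k (ext (- s) (X (Suc 0)))"
 proof (rule Suc.IH[where h = "%j. h (Suc j)" and X = "%j. X (Suc j)"])
  show "- s * (-1) ^ j = 1 \<or> h (Suc j) 0 = 0" if "j < k" for j using Suc.prems(2)[of "Suc j"] that by simp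
 qed (use Suc.prems in auto)
 ultimately show ?case using Hs_SucI by simp
qed simp

text \<open>e solves the linear equation of parallel transport, whose right hand side has only a
  tangential part. It starts from the first basis vector, which is orthogonal to v 0 = e3; the cross
  product of v and e then obeys the same law.\<close>

lemma frame_initial:
 fixes v Hv :: "real => real^3"
 assumes dv: "!!s. 0 <= s ==> (v hvd Hv s) (at0 s)" and cH: "cont0 Hv"
  and unit: "!!s. 0 <= s ==> norm (v s) = 1" and v0: "v 0 = e3"
 obtains e where "e 0 = axis 1 1" "!!s. 0 <= s ==> (e hvd (- (e s \<bullet> Hv s)) *\<^sub>R v s) (at0 s)"
  "!!s. 0 <= s ==> ((%s. cross3 (v s) (e s)) hvd (- (cross3 (v s) (e s) \<bullet> Hv s)) *\<^sub>R v s) (at0 s)"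
  "!!s. 0 <= s ==> e s \<bullet> e s = 1" "!!s. 0 <= s ==> e s \<bullet> v s = 0" "!!s. 0 <= s ==> v s \<bullet> v s = 1" "!!s. 0 <= s ==> Hv s \<bullet> v s = 0"
proof -
 have cv: "cont0 v" by (rule continuous_on_vector_derivative[of _ _ Hv]) (use dv in auto)
 obtain e where e: "cont0 e" "e 0 = axis 1 1"
  "!!s. 0 <= s ==> (e hvd (- (e s \<bullet> Hv s)) *\<^sub>R v s) (at0 s)"
 proof (rule picard[of UNIV "axis 1 1" "%s e. (- (e \<bullet> Hv s)) *\<^sub>R v s" "%s. norm (Hv s)"])
  fix t :: real and x y assume t: "0 <= t"
  have "norm ((- (x \<bullet> Hv t)) *\<^sub>R v t - (- (y \<bullet> Hv t)) *\<^sub>R v t) = \<bar>(x - y) \<bullet> Hv t\<bar>"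
   using unit[OF t] by (simp add: inner_diff_left scaleR_diff_left[symmetric] abs_minus_commute)
  also have "... <= norm (x - y) * norm (Hv t)" by (rule Cauchy_Schwarz_ineq2)
  finally show "norm ((- (x \<bullet> Hv t)) *\<^sub>R v t - (- (y \<bullet> Hv t)) *\<^sub>R v t) <= norm (Hv t) * norm (x - y)" by (simp add: mult.commute)
 next
  show "cont0 (%s. norm (Hv s))" by (intro continuous_intros cH)
  fix y :: "real => real^3" assume "cont0 y"
  thus "cont0 (%t. (- (y t \<bullet> Hv t)) *\<^sub>R v t)" by (intro continuous_intros cv cH)
 qed (auto intro: that)
 have vv: "v s \<bullet> v s = 1" if "0 <= s" for s using unit[OF that] by (simp add: norm_eq_1)
 have Hv: "Hv s \<bullet> v s = 0" if s: "0 <= s" for s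
 proof -
  have "((%s. v s \<bullet> v s) hvd (v s \<bullet> Hv s + Hv s \<bullet> v s)) (at0 s)"
   by (rule bil_hvd[OF bounded_bilinear_inner dv[OF s] dv[OF s]])
  moreover have "((%s. v s \<bullet> v s) hvd 0) (at0 s)"
   by (rule has_vector_derivative_transform[OF _ _ has_vector_derivative_const[of 1]]) (use s vv in auto)
  ultimately have "v s \<bullet> Hv s + Hv s \<bullet> v s = 0" using vector_deriv_unique_Ici s by blast
  thus ?thesis by (simp add: inner_commute)
 qed
 have ev: "e s \<bullet> v s = 0" if s: "0 <= s" for s
 proof -
  have "((%s. e s \<bullet> v s) hvd 0) (at0 s)" if "0 <= s" for s
   using bil_hvd[OF bounded_bilinear_inner e(3)[OF that] dv[OF that]] vv[OF that] by simp
  from const_Ici[OF this s] show ?thesis by (simp add: e(2) v0 e3_def inner_axis_axis)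
 qed
 have ee: "e s \<bullet> e s = 1" if s: "0 <= s" for s
 proof -
  have "((%s. e s \<bullet> e s) hvd 0) (at0 s)" if "0 <= s" for s
   using bil_hvd[OF bounded_bilinear_inner e(3)[OF that] e(3)[OF that]] ev[OF that] by (simp add: inner_commute)
  from const_Ici[OF this s] show ?thesis by (simp add: e(2) inner_axis_axis)
 qed
 have fd: "((%s. cross3 (v s) (e s)) hvd (- (cross3 (v s) (e s) \<bullet> Hv s)) *\<^sub>R v s) (at0 s)" if s: "0 <= s" for s
 proof -
  have 1: "((%s. cross3 (v s) (e s)) hvd (cross3 (v s) ((- (e s \<bullet> Hv s)) *\<^sub>R v s) + cross3 (Hv s) (e s))) (at0 s)"
   by (rule bil_hvd[OF bil_cross3 dv[OF s] e(3)[OF s]])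
  let ?f = "cross3 (v s) (e s)"
  note fc = frame_cross[OF vv[OF s] ee[OF s] ev[OF s]]
  have "Hv s = (e s \<bullet> Hv s) *\<^sub>R e s + (?f \<bullet> Hv s) *\<^sub>R ?f" using fc(4)[of "Hv s"] Hv[OF s] by (simp add: inner_commute)
  hence "cross3 (Hv s) (e s) = cross3 ((e s \<bullet> Hv s) *\<^sub>R e s + (?f \<bullet> Hv s) *\<^sub>R ?f) (e s)" by simp
  also have "... = (?f \<bullet> Hv s) *\<^sub>R cross3 ?f (e s)" by (simp add: cross_add_left cross_mult_left)
  also have "cross3 ?f (e s) = - v s" using fc(2) cross_skew[of ?f "e s"] by simp
  finally show ?thesis using 1 by (simp add: cross_mult_right)
 qed
 from e(2,3) fd ee ev vv Hv show ?thesis by (rule that)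
qed

lemma hvd_vec:
 fixes f :: "real => real^3"
 assumes "!!c. ((%s. f s $ c) hvd g $ c) (at t within S)"
 shows "(f hvd g) (at t within S)"
proof -
 have "((%s. \<Sum>c\<in>UNIV. (f s $ c) *\<^sub>R axis c (1::real)) hvd (\<Sum>c\<in>UNIV. (g $ c) *\<^sub>R axis c 1)) (at t within S)"
  by (intro has_vector_derivative_sum lin_hvd[OF bounded_linear_scaleR_left] assms)
 moreover have "(\<Sum>c\<in>UNIV. (x $ c) *\<^sub>R axis c (1::real)) = x" for x :: "real^3"
  using basis_expansion[of x] by (simp add: scalar_mult_eq_scaleR)
 ultimately show ?thesis by simp
qed

section \<open>Existence\<close>

locale frame_data =
 fixes k :: nat and v0 e :: "real => real^3" and V M :: "3 => cbf" and q0 :: l2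
 assumes q0: "Hs k q0" "rfl q0 = q0" and Im: "!!c x. Im (ev (V c) x) = 0"
  and aV: "!!c. acb (V c) (rel (mul (M c) (cj q0)))" and aM: "!!c. acb (M c) (- mul (V c) q0)"
  and V: "!!c x. 0 <= x ==> ev (V c) x = of_real (v0 x $ c)" and M: "!!c x. 0 <= x ==> ev (M c) x = Complex (e x $ c) (cross3 (v0 x) (e x) $ c)"
  and on: "!!x. 0 <= x ==> v0 x \<bullet> v0 x = 1" "!!x. 0 <= x ==> e x \<bullet> e x = 1" "!!x. 0 <= x ==> e x \<bullet> v0 x = 0"

text \<open>On the whole line the first two components of v become odd and the third even; m and the
  derivative of v have the opposite parities. The vanishing traces that H^k regularity demands come
  from the compatibility condition for components 1 and 2, and from \<open>odd_derivs_vanish\<close>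
  for component 3.\<close>

lemma initial_data:
 fixes v0 a0 :: "real => real^3"
 assumes dv0: "!!s. s >= 0 ==> (v0 hvd a0 s) (at0 s)"
  and a0H: "!!i. (%s. a0 s $ i) \<in> Hk k" and k2: "2 <= k"
  and unit: "!!s. s >= 0 ==> norm (v0 s) = 1"
  and compat: "compat_A (k div 2) v0 a0 k"
 obtains V M q0 e where "frame_data k v0 e V M q0"
proof -
 have "\<forall>c. \<exists>X. ch k (%s. a0 s $ c) X" using a0H Hk_ch by metis
 then obtain X where X: "!!c. ch k (%s. a0 s $ c) (X c)" by metis
 have "\<forall>c j. \<exists>h. j < k --> zx h (X c j) \<and> hac h (X c (Suc j)) \<and> rp (X c (Suc j))"
  using X unfolding ch_def hd1_def by metis
 then obtain h where h: "!!c j. j < k ==> zx (h c j) (X c j) \<and> hac (h c j) (X c (Suc j)) \<and> rp (X c (Suc j))" by metis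
 \<comment> \<open>w c j is the j-th derivative of v0 and h c i the i-th derivative of a0, so the
   indices differ by one; this matches the order 2 l - 1 in \<open>compat_A\<close>.\<close>
 define w where "w c j = (case j of 0 => (%s. v0 s $ c) | Suc i => h c i)" for c j
 have w0: "w c 0 = (%s. v0 s $ c)" and wS: "w c (Suc i) = h c i" for c i by (simp_all add: w_def)
 have ch: "cont0 (h c j)" if "j < k" for c j using h[OF that] hac_continuous by blast
 have k0: "0 < k" using k2 by simp
 have dvc: "((%s. v0 s $ c) hvd h c 0 s) (at0 s)" if s: "0 <= s" for c s
 proof (rule ae_deriv[OF _ _ ch[OF k0] s])
  show "((%s. v0 s $ c) hvd a0 s $ c) (at0 s)" if "0 <= s" for s
   by (rule lin_hvd[OF bounded_linear_vec_nth dv0[OF that]])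
  show "AE x in lborel. 0 < x --> a0 x $ c = h c 0 x"
   by (rule zx_AE_eq[where u = "X c 0"]) (use X[of c] h[OF k0, of c] in "auto simp: ch_def")
 qed
 have dw: "(w c j has_real_derivative w c (Suc j) s) (at0 s)" if "j < k" "0 <= s" for c j s
 proof (cases j)
  case 0 thus ?thesis using dvc[OF that(2), of c] by (simp add: w0 wS hrd_iff)
 next
  case (Suc i)
  have ik: "i < k" using that Suc by simp
  have "(h c i hvd h c j s) (at0 s)"
   by (rule hac_deriv[where w = "X c j"]) (use h[OF ik, of c] h[OF that(1), of c] ch[OF that(1)] that Suc in auto)
  thus ?thesis by (simp add: Suc wS hrd_iff)
 qed
 have v00: "v0 0 = e3" using compat by (simp add: compat_A_def)
 have e3c: "e3 $ c = (if c = 3 then 1 else 0)" for c :: 3 by (simp add: e3_def axis_def)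
 have ev: "w c j 0 = 0" if c: "c ~= 3" and j: "even j" "j <= k" for c j
 proof (cases j)
  case 0 thus ?thesis using c by (simp add: w0 v00 e3c)
 next
  case (Suc i)
  obtain l where l: "j = 2 * l" using j(1) by (elim evenE)
  have ik: "i < k" using Suc j by simp
  have "1 <= l" "l <= k div 2" using l j Suc by auto
  hence "cross3 (v0 0) (dtrace0 k (2 * l - 1) a0) = 0" using compat unfolding compat_A_def by blast
  moreover have "2 * l - 1 = i" using l Suc by simp
  ultimately have "cross3 e3 (dtrace0 k i a0) = 0" by (simp add: v00)
  hence z: "dtrace0 k i a0 $ 1 = 0" "dtrace0 k i a0 $ 2 = 0"
   by (auto simp: cross3_def e3c vec_eq_iff forall_3 vector_def)
  have zi: "zx (h c i) (X c i)" "hac (h c i) (X c (Suc i))" using h[OF ik, of c] by auto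
  have "dtrace0 k i a0 $ c = h c i 0" unfolding dtrace0_def
   by (simp add: ch_trace0[OF X[of c] ik zi])
  thus ?thesis using z c exhaust_3[of c] by (auto simp: Suc wS)
 qed
 have unit2: "(\<Sum>c\<in>UNIV. (w c 0 s)^2) = 1" if "0 <= s" for s
  using unit[OF that] by (simp add: w0 norm_eq_1 inner_vec_def power2_eq_square)
 have w3: "w 3 0 0 = 1" by (simp add: w0 v00 e3c)
 note od = odd_derivs_vanish[of k w, OF dw unit2 ev w3]
 \<comment> \<open>\<sigma> c is the parity of the c-th components of a0 and of m, and - \<sigma> c
   that of v0.\<close>
 define \<sigma> where "\<sigma> c = (if c = 3 then -1 else (1::real))" for c :: 3
 have s1: "\<sigma> c = 1 \<or> \<sigma> c = -1" and ss: "\<sigma> c * \<sigma> c = 1" for c by (auto simp: \<sigma>_def)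
 define A where "A c = ext (\<sigma> c) (X c 0)" for c
 have HA: "Hs k (A c)" for c unfolding A_def
 proof (rule Hs_ext[where h = "h c"])
  show "\<sigma> c * (-1) ^ j = 1 \<or> h c j 0 = 0" if "j < k" for j
  proof (cases "c = 3")
   case True
   thus ?thesis using od[of "Suc j"] that by (cases "even j") (auto simp: wS \<sigma>_def)
  next
   case False
   thus ?thesis using ev[OF False, of "Suc j"] that by (cases "even j") (auto simp: wS \<sigma>_def)
  qed
 qed (use h s1 in auto)
 define Hv where "Hv s = (\<chi> c. h c 0 s)" for s
 have Hvc: "Hv s $ c = h c 0 s" for s c by (simp add: Hv_def)
 have cH: "cont0 Hv" unfolding Hv_def by (intro continuous_on_vec_lambda ch k0)
 have dv: "(v0 hvd Hv s) (at0 s)" if "0 <= s" for s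
  by (rule hvd_vec) (use dvc[OF that] in "simp add: Hvc")
 obtain e where e: "e 0 = axis 1 1" "!!s. 0 <= s ==> (e hvd (- (e s \<bullet> Hv s)) *\<^sub>R v0 s) (at0 s)"
  "!!s. 0 <= s ==> ((%s. cross3 (v0 s) (e s)) hvd (- (cross3 (v0 s) (e s) \<bullet> Hv s)) *\<^sub>R v0 s) (at0 s)"
  "!!s. 0 <= s ==> e s \<bullet> e s = 1" "!!s. 0 <= s ==> e s \<bullet> v0 s = 0" "!!s. 0 <= s ==> v0 s \<bullet> v0 s = 1" "!!s. 0 <= s ==> Hv s \<bullet> v0 s = 0"
  using frame_initial[OF dv cH unit v00] by blast
 define f where "f s = cross3 (v0 s) (e s)" for s
 define mm where "mm c s = Complex (e s $ c) (f s $ c)" for c s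
 define vv where "vv c s = complex_of_real (v0 s $ c)" for c s
 define Q where "Q s = Complex (e s \<bullet> Hv s) (f s \<bullet> Hv s)" for s
 note fd = e(3)[folded f_def] and fc = frame_cross[OF e(6) e(4) e(5), folded f_def]
 have cv: "cont0 v0" by (rule continuous_on_vector_derivative[of _ _ Hv]) (use dv in auto)
 have ce: "cont0 e" by (rule continuous_on_vector_derivative) (use e(2) in auto)
 have cf: "cont0 f" unfolding f_def by (intro continuous_on_cross cv ce)
 have mm_eq: "mm c s = of_real (e s $ c) + \<i> * of_real (f s $ c)" for c s by (simp add: mm_def complex_eq_iff)
 have Q_eq: "Q s = of_real (e s \<bullet> Hv s) + \<i> * of_real (f s \<bullet> Hv s)" for s by (simp add: Q_def complex_eq_iff)
 have cmm: "cont0 (mm c)" for c unfolding mm_eq[abs_def]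
  by (intro continuous_intros ce cf)
 have cvv: "cont0 (vv c)" for c unfolding vv_def[abs_def] by (intro continuous_intros cv)
 have cQ: "cont0 Q" unfolding Q_eq[abs_def] by (intro continuous_intros ce cf cH)
 have dmm: "(mm c hvd - Q s * vv c s) (at0 s)" if s: "0 <= s" for c s
 proof -
  have "((%s. e s $ c) hvd - (e s \<bullet> Hv s) * v0 s $ c) (at0 s)"
   using lin_hvd[OF bounded_linear_vec_nth e(2)[OF s], of c] by simp
  from has_vector_derivative_of_real[OF this[folded hrd_iff]]
  have 1: "((%s. complex_of_real (e s $ c)) hvd of_real (- (e s \<bullet> Hv s) * v0 s $ c)) (at0 s)" .
  have "((%s. f s $ c) hvd - (f s \<bullet> Hv s) * v0 s $ c) (at0 s)"
   using lin_hvd[OF bounded_linear_vec_nth fd[OF s], of c] by simp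
  from has_vector_derivative_of_real[OF this[folded hrd_iff]]
  have 2: "((%s. complex_of_real (f s $ c)) hvd of_real (- (f s \<bullet> Hv s) * v0 s $ c)) (at0 s)" .
  have "(mm c hvd (of_real (- (e s \<bullet> Hv s) * v0 s $ c) + \<i> * of_real (- (f s \<bullet> Hv s) * v0 s $ c))) (at0 s)"
   unfolding mm_eq[abs_def] by (intro has_vector_derivative_add has_vector_derivative_mult_right 1 2)
  thus ?thesis by (simp add: Q_eq vv_def algebra_simps)
 qed
 have dvv: "(vv c hvd of_real (h c 0 s)) (at0 s)" if s: "0 <= s" for c s
  unfolding vv_def[abs_def]
  by (rule has_vector_derivative_of_real[OF dvc[OF s, folded hrd_iff]])
 have ReQ: "Re (mm c s * cnj (Q s)) = h c 0 s" if s: "0 <= s" for c s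
 proof -
  have "Hv s $ c = (e s \<bullet> Hv s) * e s $ c + (f s \<bullet> Hv s) * f s $ c"
   using arg_cong[OF fc(4)[OF s s s, of "Hv s"], of "%x. x $ c"] e(7)[OF s] by (simp add: inner_commute)
  thus ?thesis by (simp add: mm_def Q_def Hvc algebra_simps)
 qed
 have sumQ: "(\<Sum>c\<in>UNIV. mm c s * of_real (h c 0 s)) = Q s" for s
  by (simp add: mm_def Q_def complex_eq_iff inner_vec_def Hvc)
 define V where "V c = refl_bcf (- \<sigma> c) (vv c)" for c
 define M where "M c = refl_bcf (\<sigma> c) (mm c)" for c
 have Bv: "cmod (vv c s) <= 1" if "0 <= s" for c s
  using component_le_norm_cart[of "v0 s" c] unit[OF that] by (simp add: vv_def)
 have Bm: "cmod (mm c s) <= 2" if s: "0 <= s" for c s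
 proof -
  have "\<bar>e s $ c\<bar> <= 1" "\<bar>f s $ c\<bar> <= 1"
   using component_le_norm_cart[of "e s" c] component_le_norm_cart[of "f s" c] e(4)[OF s] fc(3)[OF s s s]
   by (simp_all add: norm_eq_1[THEN iffD2])
  thus ?thesis using cmod_le[of "mm c s"] by (simp add: mm_def)
 qed
 have V0: "- \<sigma> c = 1 \<or> vv c 0 = 0" for c by (auto simp: \<sigma>_def vv_def v00 e3c)
 have M0: "\<sigma> c = 1 \<or> mm c 0 = 0" for c
  by (auto simp: \<sigma>_def mm_def f_def v00 e(1) e3_def cross3_def complex_eq_iff axis_def)
 have s1': "- \<sigma> c = 1 \<or> - \<sigma> c = -1" for c using s1[of c] by auto
 have aV: "0 <= x ==> ev (V c) x = vv c x" "0 <= x ==> ev (V c) (- x) = of_real (- \<sigma> c) * vv c x" for c x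
  unfolding V_def using apply_refl_bcf[OF cvv _ s1' V0, where B = 1] Bv by blast+
 have aM: "0 <= x ==> ev (M c) x = mm c x" "0 <= x ==> ev (M c) (- x) = of_real (\<sigma> c) * mm c x" for c x
  unfolding M_def using apply_refl_bcf[OF cmm _ s1 M0, where B = 2] Bm by blast+
 have zA: "AE x in lborel. 0 < x --> rep_l2 (A c) x = of_real (h c 0 x) \<and> rep_l2 (A c) (- x) = of_real (\<sigma> c * h c 0 x)" for c
 proof -
  have "AE x in lborel. rep_l2 (A c) x = (if 0 <= x then of_real (h c 0 x) else of_real (\<sigma> c * h c 0 (- x)))"
   unfolding A_def by (rule zx_ext) (use h[OF k0] in auto)
  with AE_reflect[OF this] show ?thesis by eventually_elim auto
 qed
 \<comment> \<open>q is obtained by pairing the derivative of v with m. In each product both factors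
   have parity \<sigma> c, so q0 is even.\<close>
 define q0 where "q0 = mul (M 1) (A 1) + mul (M 2) (A 2) + mul (M 3) (A 3)"
 have rq: "AE x in lborel. rep_l2 q0 x = ev (M 1) x * rep_l2 (A 1) x + ev (M 2) x * rep_l2 (A 2) x + ev (M 3) x * rep_l2 (A 3) x"
  using rep_add[of "mul (M 1) (A 1) + mul (M 2) (A 2)" "mul (M 3) (A 3)"] rep_add[of "mul (M 1) (A 1)" "mul (M 2) (A 2)"]
   rep_mul[of "M 1" "A 1"] rep_mul[of "M 2" "A 2"] rep_mul[of "M 3" "A 3"]
  unfolding q0_def by eventually_elim simp
 have zq: "AE x in lborel. 0 < x --> rep_l2 q0 x = Q x \<and> rep_l2 q0 (- x) = Q x"
  using rq AE_reflect[OF rq] zA[of 1] zA[of 2] zA[of 3]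
 proof eventually_elim
  case (elim x)
  show ?case
  proof
   assume x: "0 < x"
   have sc: "of_real (\<sigma> c) * m * of_real (\<sigma> c * y) = m * of_real y" for c and m :: complex and y :: real
   proof -
    have "of_real (\<sigma> c) * m * of_real (\<sigma> c * y) = of_real (\<sigma> c * \<sigma> c) * (m * of_real y)"
     by (simp only: of_real_mult mult_ac)
    thus ?thesis by (simp only: ss of_real_1 mult_1)
   qed
   have x': "0 <= x" using x by simp
   have A: "rep_l2 (A 1) x = of_real (h 1 0 x)" "rep_l2 (A 2) x = of_real (h 2 0 x)" "rep_l2 (A 3) x = of_real (h 3 0 x)"
    "rep_l2 (A 1) (- x) = of_real (\<sigma> 1 * h 1 0 x)" "rep_l2 (A 2) (- x) = of_real (\<sigma> 2 * h 2 0 x)" "rep_l2 (A 3) (- x) = of_real (\<sigma> 3 * h 3 0 x)"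
    using elim(3-5) x by blast+
   show "rep_l2 q0 x = Q x \<and> rep_l2 q0 (- x) = Q x"
    unfolding elim(1,2) A aM(1)[OF x'] aM(2)[OF x'] sc using sumQ[of x] unfolding sum_3 by simp
  qed
 qed
 have rfl: "rfl q0 = q0"
 proof (rule l2_eqI)
  show "AE x in lborel. rep_l2 (rfl q0) x = rep_l2 q0 x"
   using zq AE_reflect[OF zq] AE_lborel_singleton[of 0] rep_aff[of "-1" 0 q0, OF zero_neq_neg_one[symmetric]]
  proof eventually_elim
   case (elim x)
   thus ?case by (cases "0 < x") auto
  qed
 qed
 have aaV: "acb (V c) (rel (mul (M c) (cj q0)))" for c
 proof (rule acb_two_sided[OF dvv _ aV])
  show "cont0 (%s. complex_of_real (h c 0 s))" by (intro continuous_intros ch k0)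
  have r: "AE x in lborel. rep_l2 (rel (mul (M c) (cj q0))) x = of_real (Re (ev (M c) x * cnj (rep_l2 q0 x)))"
   using rep_rel[of "mul (M c) (cj q0)"] rep_mul[of "M c" "cj q0"] rep_cj[of q0] by eventually_elim simp
  show "AE x in lborel. 0 < x --> rep_l2 (rel (mul (M c) (cj q0))) x = complex_of_real (h c 0 x)"
   using r zq
  proof eventually_elim
   case (elim x)
   show ?case
   proof
    assume x: "0 < x"
    hence "0 <= x" "rep_l2 q0 x = Q x" using elim by auto
    thus "rep_l2 (rel (mul (M c) (cj q0))) x = complex_of_real (h c 0 x)"
     unfolding elim(1) by (simp only: aM(1) ReQ)
   qed
  qed
  show "AE x in lborel. 0 < x --> rep_l2 (rel (mul (M c) (cj q0))) (- x) = - complex_of_real (- \<sigma> c) * of_real (h c 0 x)"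
   using AE_reflect[OF r] zq
  proof eventually_elim
   case (elim x)
   show ?case
   proof
    assume x: "0 < x"
    hence x': "0 <= x" "rep_l2 q0 (- x) = Q x" using elim by auto
    have "rep_l2 (rel (mul (M c) (cj q0))) (- x) = of_real (Re (of_real (\<sigma> c) * (mm c x * cnj (Q x))))"
     unfolding elim(1) x'(2) aM(2)[OF x'(1)] mult.assoc ..
    also have "... = of_real (\<sigma> c * Re (mm c x * cnj (Q x)))" by simp
    also have "... = of_real (\<sigma> c * h c 0 x)" by (simp only: ReQ[OF x'(1)])
    finally show "rep_l2 (rel (mul (M c) (cj q0))) (- x) = - complex_of_real (- \<sigma> c) * of_real (h c 0 x)" by simp
   qed
  qed
 qed
 have aaM: "acb (M c) (- mul (V c) q0)" for c
 proof (rule acb_two_sided[OF dmm _ aM])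
  show "cont0 (%s. - Q s * vv c s)" by (intro continuous_intros cQ cvv)
  have r: "AE x in lborel. rep_l2 (- mul (V c) q0) x = - (ev (V c) x * rep_l2 q0 x)"
   using rep_uminus[of "mul (V c) q0"] rep_mul[of "V c" q0] by eventually_elim simp
  show "AE x in lborel. 0 < x --> rep_l2 (- mul (V c) q0) x = - Q x * vv c x"
   using r zq by eventually_elim (use aV(1)[of _ c] in auto)
  show "AE x in lborel. 0 < x --> rep_l2 (- mul (V c) q0) (- x) = - of_real (\<sigma> c) * (- Q x * vv c x)"
   using AE_reflect[OF r] zq by eventually_elim (use aV(2)[of _ c] in auto)
 qed
 \<comment> \<open>Bootstrap: if q0 is in H^j, then multiplication by the frame preserves H^(j + 1),
   so q0, a sum of products of M and A, lies in H^(j + 1).\<close>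
 have "j <= k ==> Hs j q0" for j
 proof (induction j)
  case (Suc j)
  have "Hs (Suc j) (mul (M c) (A c))" for c
   by (rule Hs_mul_frame[OF aaV aaM]) (use Suc Hs_mono[OF _ HA] in auto)
  thus ?case unfolding q0_def by (intro Hs_add)
 qed simp
 hence Hq: "Hs k q0" by simp
 have ImV: "Im (ev (V c) x) = 0" for c x
  using aV(1)[of x c] aV(2)[of "- x" c] by (cases "0 <= x") (auto simp: vv_def)
 show ?thesis
 proof (rule that, unfold_locales)
  show "ev (V c) x = of_real (v0 x $ c)" if "0 <= x" for c x using aV(1)[OF that] by (simp add: vv_def)
  show "ev (M c) x = Complex (e x $ c) (cross3 (v0 x) (e x) $ c)" if "0 <= x" for c x
   using aM(1)[OF that] by (simp add: mm_def f_def)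
 qed (use Hq rfl aaV aaM ImV e in auto)
qed

section \<open>Orthonormality of the frame, integrals of closed relations\<close>

lemma lin_eval: "bounded_linear (%\<phi>::cbf. ev \<phi> x)"
 by (rule bounded_linear_intro[where K = 1]) (auto simp: bcontfun_le)

text \<open>The defects X, Y, Z of the cross product relations satisfy a linear system with skew
  coefficients, so their square sum is constant. The sum of the squares of v, e, f is conserved for
  the same reason; with the relations, triple products show that the three vectors have equal
  length, which fixes it to 1.\<close>

lemma frame_invariant:
 fixes v e f :: "real => real^3" and \<alpha> \<beta> \<theta> :: "real => real"
 assumes dv: "!!t. 0 <= t ==> (v hvd \<alpha> t *\<^sub>R e t + \<beta> t *\<^sub>R f t) (at0 t)"
  and de: "!!t. 0 <= t ==> (e hvd - (\<theta> t *\<^sub>R f t) - \<alpha> t *\<^sub>R v t) (at0 t)"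
  and df: "!!t. 0 <= t ==> (f hvd \<theta> t *\<^sub>R e t - \<beta> t *\<^sub>R v t) (at0 t)"
  and init: "cross3 (v 0) (e 0) = f 0" "cross3 (e 0) (f 0) = v 0" "cross3 (f 0) (v 0) = e 0" "v 0 \<bullet> v 0 = 1"
  and t: "0 <= t"
 shows "cross3 (v t) (e t) = f t" "cross3 (e t) (f t) = v t" "cross3 (f t) (v t) = e t" "v t \<bullet> v t = 1"
proof -
 define X where "X t = cross3 (v t) (e t) - f t" for t
 define Y where "Y t = cross3 (e t) (f t) - v t" for t
 define Z where "Z t = cross3 (f t) (v t) - e t" for t
 note cr = bil_hvd[OF bil_cross3]
 note cs = cross_add_left cross_add_right cross_mult_left cross_mult_right Cross3.left_diff_distrib Cross3.right_diff_distrib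
 have sk: "cross3 (f s) (e s) = - cross3 (e s) (f s)" "cross3 (e s) (v s) = - cross3 (v s) (e s)" "cross3 (v s) (f s) = - cross3 (f s) (v s)" for s
  by (rule cross_skew)+
 have dX: "(X hvd \<theta> s *\<^sub>R Z s - \<beta> s *\<^sub>R Y s) (at0 s)" if "0 <= s" for s
  unfolding X_def[abs_def]
  by (rule has_vector_derivative_eq_rhs[OF has_vector_derivative_diff[OF cr[OF dv[OF that] de[OF that]] df[OF that]]])
    (simp add: cs sk Y_def Z_def algebra_simps)
 have dY: "(Y hvd \<alpha> s *\<^sub>R Z s + \<beta> s *\<^sub>R X s) (at0 s)" if "0 <= s" for s
  unfolding Y_def[abs_def]
  by (rule has_vector_derivative_eq_rhs[OF has_vector_derivative_diff[OF cr[OF de[OF that] df[OF that]] dv[OF that]]])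
    (simp add: cs sk X_def Z_def algebra_simps)
 have dZ: "(Z hvd - (\<theta> s *\<^sub>R X s) - \<alpha> s *\<^sub>R Y s) (at0 s)" if "0 <= s" for s
  unfolding Z_def[abs_def]
  by (rule has_vector_derivative_eq_rhs[OF has_vector_derivative_diff[OF cr[OF df[OF that] dv[OF that]] de[OF that]]])
    (simp add: cs sk X_def Y_def algebra_simps)
 note ip = bil_hvd[OF bounded_bilinear_inner]
 have "((%t. X t \<bullet> X t + Y t \<bullet> Y t + Z t \<bullet> Z t) hvd 0) (at0 s)" if "0 <= s" for s
  by (rule has_vector_derivative_eq_rhs[OF has_vector_derivative_add[OF has_vector_derivative_add[OF ip[OF dX[OF that] dX[OF that]] ip[OF dY[OF that] dY[OF that]]] ip[OF dZ[OF that] dZ[OF that]]]])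
    (simp add: inner_diff_left inner_diff_right inner_add_left inner_add_right inner_commute algebra_simps)
 from const_Ici[OF this t] have "X t \<bullet> X t + Y t \<bullet> Y t + Z t \<bullet> Z t = 0" by (simp add: X_def Y_def Z_def init)
 moreover have "0 <= X t \<bullet> X t" "0 <= Y t \<bullet> Y t" "0 <= Z t \<bullet> Z t" by simp_all
 ultimately have "X t \<bullet> X t = 0" "Y t \<bullet> Y t = 0" "Z t \<bullet> Z t = 0" by linarith+
 thus c: "cross3 (v t) (e t) = f t" "cross3 (e t) (f t) = v t" "cross3 (f t) (v t) = e t" by (simp_all add: X_def Y_def Z_def)
 have tri: "a \<bullet> cross3 b c = b \<bullet> cross3 c a" for a b c :: "real^3" by (simp add: cross3_simps)
 have eq: "v s \<bullet> v s = e s \<bullet> e s" "v s \<bullet> v s = f s \<bullet> f s"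
  if "cross3 (v s) (e s) = f s" "cross3 (e s) (f s) = v s" "cross3 (f s) (v s) = e s" for s
  using tri[of "v s" "e s" "f s"] tri[of "e s" "f s" "v s"] that by simp_all
 have "((%t. v t \<bullet> v t + e t \<bullet> e t + f t \<bullet> f t) hvd 0) (at0 s)" if "0 <= s" for s
  by (rule has_vector_derivative_eq_rhs[OF has_vector_derivative_add[OF has_vector_derivative_add[OF ip[OF dv[OF that] dv[OF that]] ip[OF de[OF that] de[OF that]]] ip[OF df[OF that] df[OF that]]]])
    (simp add: inner_diff_left inner_diff_right inner_add_left inner_add_right inner_commute algebra_simps)
 from const_Ici[OF this t] show "v t \<bullet> v t = 1" using eq[OF c] eq[OF init(1-3)] init(4) by simp
qed

lemma acb_isrep_deriv:
 assumes "acb \<phi> u" "isrep \<psi> u" shows "(ev \<phi> hvd ev \<psi> s) (at s)"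
proof -
 have c: "continuous_on S (ev \<psi>)" for S by (rule continuous_on_apply_bcontfun)
 have eq: "ev \<phi> x = ev \<phi> (s - 1) + integral {s - 1..x} (ev \<psi>)" if "s - 1 <= x" for x
 proof -
  have i: "set_integrable lborel {s - 1..x} (ev \<psi>)"
   unfolding set_integrable_def by (rule borel_integrable_compact[OF compact_Icc c])
  have "ev \<phi> x - ev \<phi> (s - 1) = I (s - 1) x u" using assms(1) that unfolding acb_def by blast
  also have "... = (LINT y|lborel. indicator {s - 1..x} y *\<^sub>R ev \<psi> y)"
   unfolding I_def by (rule integral_cong_AE) (use assms(2) in "auto simp: isrep_def indicator_def elim!: eventually_mono")
  also have "... = integral {s - 1..x} (ev \<psi>)"
   using set_borel_integral_eq_integral(2)[OF i] by (simp add: set_lebesgue_integral_def)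
  finally show ?thesis by (simp add: diff_eq_eq add.commute)
 qed
 have "((%x. ev \<phi> (s - 1) + integral {s - 1..x} (ev \<psi>)) hvd 0 + ev \<psi> s) (at s within {s - 1..s + 1})"
  by (intro has_vector_derivative_add has_vector_derivative_const integral_has_vector_derivative c) auto
 hence "((%x. ev \<phi> (s - 1) + integral {s - 1..x} (ev \<psi>)) hvd ev \<psi> s) (at s within {s - 1..s + 1})" by simp
 hence "(ev \<phi> hvd ev \<psi> s) (at s within {s - 1..s + 1})"
  by (rule has_vector_derivative_transform[rotated 2]) (auto intro: eq)
 moreover have "at s within {s - 1..s + 1} = at s" by (rule at_within_interior) auto
 ultimately show ?thesis by simp
qed

text \<open>The relations \<open>has_D\<close> and \<open>isrep\<close> are closed subspaces of a
  product space; integrals over t of pairs in such a subspace stay in it.\<close>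

lemma closed_graph_integral:
 fixes u :: "real => 'a::banach" and w :: "real => 'b::banach"
 assumes S: "closed S" "subspace S" and c: "cont0 u" "cont0 w" and r: "!!t. 0 <= t ==> (u t, w t) \<in> S"
 shows "(integral {0..t} u, integral {0..t} w) \<in> S"
proof -
 have cc: "continuous_on {0..t} (%t. (u t, w t))" by (intro continuous_on_Pair continuous_on_subset[OF c(1)] continuous_on_subset[OF c(2)]) auto
 have "integral {0..t} (%t. (u t, w t)) \<in> S"
  by (rule integral_in_subspace[OF S integrable_continuous_real[OF cc]]) (use r in auto)
 moreover have "integral {0..t} (%t. (u t, w t)) = (integral {0..t} u, integral {0..t} w)"
  using integral_linear[OF integrable_continuous_real[OF cc] bounded_linear_fst] integral_linear[OF integrable_continuous_real[OF cc] bounded_linear_snd]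
  by (simp add: o_def prod_eq_iff)
 ultimately show ?thesis by simp
qed

lemma has_D_integral:
 fixes u w :: "real => l2"
 assumes "cont0 u" "cont0 w" "!!t. 0 <= t ==> has_D (u t) (w t)"
 shows "has_D (integral {0..t} u) (integral {0..t} w)"
proof -
 let ?S = "{p. has_D (fst p) (snd p)}"
 have cl: "closed ?S" unfolding closed_sequential_limits
 proof (intro allI impI)
  fix p and l :: "l2 \<times> l2" assume a: "(\<forall>n. p n \<in> ?S) \<and> p ----> l"
  hence p: "has_D (fst (p n)) (snd (p n))" for n by auto
  from has_D_closed(1)[OF p tendsto_fst[OF conjunct2[OF a]] tendsto_snd[OF conjunct2[OF a]]] show "l \<in> ?S" by simp
 qed
 have "subspace ?S" unfolding subspace_def by (auto intro: has_D_add has_D_scaleR has_D_zero)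
 from closed_graph_integral[OF cl this assms(1,2)] assms(3) show ?thesis by auto
qed

lemma isrep_integral:
 fixes u :: "real => l2" and \<phi> :: "real => cbf"
 assumes "cont0 \<phi>" "cont0 u" "!!t. 0 <= t ==> isrep (\<phi> t) (u t)"
 shows "isrep (integral {0..t} \<phi>) (integral {0..t} u)"
proof -
 let ?S = "{p. isrep (fst p) (snd p)}"
 have cl: "closed ?S" unfolding closed_sequential_limits
 proof (intro allI impI)
  fix p and l :: "cbf \<times> l2" assume a: "(\<forall>n. p n \<in> ?S) \<and> p ----> l"
  hence p: "isrep (fst (p n)) (snd (p n))" for n by auto
  from isrep_closed[OF p tendsto_fst[OF conjunct2[OF a]] tendsto_snd[OF conjunct2[OF a]]] show "l \<in> ?S" by simp
 qed
 have "subspace ?S" unfolding subspace_def by (auto intro: isrep_add isrep_scaleR isrep_zero)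
 from closed_graph_integral[OF cl this assms(1,2)] assms(3) show ?thesis by auto
qed

lemma CH_integral_D:
 assumes "CH k w" "j <= k" shows "(D ^^ j) (integral {0..t} w) = integral {0..t} (%\<tau>. (D ^^ j) (w \<tau>))"
 using assms(2)
proof (induction j)
 case (Suc j)
 have "has_D (integral {0..t} (%\<tau>. (D ^^ j) (w \<tau>))) (integral {0..t} (%\<tau>. (D ^^ Suc j) (w \<tau>)))"
  by (rule has_D_integral) (use Suc.prems CH_D[OF assms(1)] Hs_has_D[OF CH_Hs[OF assms(1)]] in "auto simp del: funpow.simps(2)")
 thus ?case using Suc by (simp add: D_eq)
qed simp

lemma integral_continuous_Ici:
 fixes f :: "real => 'a::banach" assumes "cont0 f" shows "cont0 (%t. integral {0..t} f)"
 by (rule continuous_on_vector_derivative[of _ _ f]) (use integral_has_vector_derivative_Ici[OF assms, of _ 0] in auto)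

lemma odd_at_zero: assumes "has_D u w" "rfl u = - u" shows "ev (cb u) 0 = 0"
proof -
 have "caff (-1) 0 (cb u) = cb (rfl u)" by (rule isrep_cb[symmetric]) (rule isrep_aff, rule has_D_cb[OF assms(1)], simp)
 also have "... = - cb u" using cb_scaleR[OF assms(1), of "-1"] assms(2) by simp
 finally have "ev (caff (-1) 0 (cb u)) 0 = ev (- cb u) 0" by simp
 thus ?thesis by simp
qed

lemma cj_rel: "cj (rel u) = rel u"
 unfolding rel_def by (simp add: cj_scaleR cj_add add.commute)

lemma isrep_rel: "isrep \<phi> u ==> isrep (cre \<phi>) (rel u)"
 unfolding cre_def rel_def by (intro isrep_scaleR isrep_add isrep_cj)

lemma cmul_commute: "cmul \<phi> \<psi> = cmul \<psi> \<phi>" by (rule bcontfun_eqI) (simp add: mult.commute)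

context nls_sol begin

text \<open>Both stand for a component of x_t = Re (conj (i q) m), \<open>tv\<close> as a bounded
  continuous function and \<open>tv2\<close> as an element of L^2.\<close>

definition tv :: "(real => cbf) => real => cbf" where "tv m t = cre (cmul (m t) (ccnj (ci (cb (q t)))))"
definition tv2 :: "(real => cbf) => real => l2" where "tv2 m t = rel (mul (m t) (cj (J (q t))))"

text \<open>The time integral of Re (conj (i q) m) is a component of x - x0. Its s-derivative is the
  time integral of v_t, that is v t - v 0, and the derivative of that is given by the frame equation
  with values in H^k. This is the gain of two orders over q.\<close>

lemma component:
 assumes CHq': "CH k q"
  and fr: "frame v m"
 shows "!!t. 0 <= t ==> isrep (integral {0..t} (tv m)) (integral {0..t} (tv2 m))" "!!t. 0 <= t ==> cj (integral {0..t} (tv2 m)) = integral {0..t} (tv2 m)"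
  "CH (k + 2) (%t. integral {0..t} (tv2 m))" "CH k (tv2 m)"
  "!!t. 0 <= t ==> isrep (tv m t) (tv2 m t)" "!!t. 0 <= t ==> cj (tv2 m t) = tv2 m t"
  "!!t j. 0 <= t ==> j <= k ==> ((%t. (D ^^ j) (integral {0..t} (tv2 m))) hvd (D ^^ j) (tv2 m t)) (at0 t)"
  "!!t s. 0 <= t ==> (ev (integral {0..t} (tv m)) hvd ev (v t) s - ev (v 0) s) (at s)"
  "!!t s. 0 <= t ==> (ev (v t) hvd of_real (Re (ev (m t) s * cnj (ev (cb (q t)) s)))) (at s)"
  "!!t s. 0 <= t ==> ((%t. ev (integral {0..t} (tv m)) s) hvd ev (tv m t) s) (at0 t)"
proof -
 have cv: "cont0 v" and cm: "cont0 m"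
  and dv: "!!t. 0 <= t ==> (v hvd cre (cmul (ccnj (b t)) (m t))) (at0 t)"
  and Im: "!!t x. 0 <= t ==> Im (ev (v t) x) = 0"
  and av: "!!t. 0 <= t ==> acb (v t) (rel (mul (m t) (cj (q t))))" and am: "!!t. 0 <= t ==> acb (m t) (- mul (v t) (q t))"
  using fr unfolding frame_def by blast+
 define w1 where "w1 t = rel (mul (m t) (cj (J (w t))))" for t
 define VV where "VV t = rel (mul (m t) (cj (q t)))" for t
 have isq: "isrep (cb (q t)) (q t)" if "0 <= t" for t using has_D_cb(1)[OF qw[OF that]] .
 have ciJ: "isrep (ci (cb (q t))) (J (q t))" if "0 <= t" for t unfolding ci_def by (rule isrep_J[OF isq[OF that]])
 show r0: "isrep (tv m t) (tv2 m t)" if "0 <= t" for t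
  unfolding tv_def tv2_def by (intro isrep_rel isrep_mul isrep_cj ciJ that)
 show cj0: "cj (tv2 m t) = tv2 m t" for t unfolding tv2_def by (rule cj_rel)
 have ctv: "cont0 (tv m)" unfolding tv_def[abs_def]
  by (intro lin_cont[OF lin_cre] bil_cont[OF bil_cmul] cm
    lin_cont[OF lin_ccnj] lin_cont[OF lin_ci] cb_continuous)
 have CHr: "CH k u ==> CH k (%t. rel (u t))" for u by (rule CH_bounded_linear[OF lin_rel has_D_rel])
 have qp: "CH (k - 1) q" by (rule CH_mono[OF _ CHq']) simp
 note mf = CH_mul_frame[OF cv cm av am qp]
 show CHtv2: "CH k (tv2 m)" unfolding tv2_def[abs_def] by (intro CHr mf[THEN conjunct1] CH_cj CH_J CHq')
 have CHV: "CH k VV" unfolding VV_def[abs_def] by (intro CHr mf[THEN conjunct1] CH_cj CHq')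
 have ctv2: "cont0 (tv2 m)" by (rule CH_continuous[OF CHtv2])
 have cw1: "cont0 w1" unfolding w1_def[abs_def]
  by (intro lin_cont[OF lin_rel] bil_cont[OF bil_mul] cm
    lin_cont[OF lin_cj] lin_cont[OF lin_J] cw)
 have d01: "has_D (tv2 m t) (w1 t)" if t: "0 <= t" for t
 proof -
  let ?u = "cj (J (q t))"
  have du: "has_D ?u (cj (J (w t)))" by (intro has_D_cj has_D_J qw t)
  have 1: "has_D (tv2 m t) (rel (mul (m t) (cj (J (w t))) - mul (v t) (pr ?u (q t))))"
   unfolding tv2_def by (intro has_D_rel mul_acb_D(1)[OF am[OF t] av[OF t] du])
  \<comment> \<open>The term where the derivative falls on m is v |q|^2 times a power of i with real
    part 0, as v is real.\<close>
  have "rel (mul (v t) (pr ?u (q t))) = 0"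
  proof (rule l2_eqI)
   have "AE x in lborel. rep_l2 ?u x = ev (cb ?u) x" using has_D_cb(1)[OF du] by (simp add: isrep_def)
   thus "AE x in lborel. rep_l2 (rel (mul (v t) (pr ?u (q t)))) x = rep_l2 0 x"
    using rep_rel[of "mul (v t) (pr ?u (q t))"] rep_mul[of "v t" "pr ?u (q t)"] rep_mul[of "cb ?u" "q t"] rep_cj[of "J (q t)"] rep_J[of "q t"] rep_zero
    unfolding pr_def
   proof eventually_elim
    case (elim x)
    have c: "ev (cb ?u) x = cnj (\<i> * rep_l2 (q t) x)" unfolding elim(1)[symmetric] elim(5) elim(6) ..
    show ?case unfolding elim(2-4) elim(7) c using Im[OF t, of x] by (simp add: mult.commute)
   qed
  qed
  thus ?thesis using 1 unfolding w1_def linear_diff[OF lin[OF lin_rel]] by simp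
 qed
 have isv: "isrep (cre (cmul (ccnj (b t)) (m t))) (w1 t)" if "0 <= t" for t
  unfolding w1_def b_def cmul_commute[of "ccnj _"]
  by (intro isrep_rel isrep_mul isrep_cj has_D_cb(1)[OF has_D_J[OF wz[OF that]]])
 have cv': "cont0 (%t. cre (cmul (ccnj (b t)) (m t)))"
  by (intro lin_cont[OF lin_cre] bil_cont[OF bil_cmul] cm
    lin_cont[OF lin_ccnj] b_continuous)
 show r: "isrep (integral {0..t} (tv m)) (integral {0..t} (tv2 m))" for t
  by (rule isrep_integral[OF ctv ctv2 r0])
 have iv: "isrep (v t - v 0) (integral {0..t} w1)" if t: "0 <= t" for t
 proof -
  have "((%t. cre (cmul (ccnj (b t)) (m t))) has_integral v t - v 0) {0..t}" by (rule FTC_Ici[OF dv]) (use t in auto)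
  hence "integral {0..t} (%t. cre (cmul (ccnj (b t)) (m t))) = v t - v 0" by (rule integral_unique)
  with isrep_integral[OF cv' cw1 isv, of t] show ?thesis by simp
 qed
 have h01: "has_D (integral {0..t} (tv2 m)) (integral {0..t} w1)" for t
  by (rule has_D_integral[OF ctv2 cw1 d01])
 \<comment> \<open>v t and v 0 do not decay, but by \<open>iv\<close> their difference represents an
   L^2 element, and its derivative is read off from the frame equations at the times t and
   0.\<close>
 have h12: "has_D (integral {0..t} w1) (VV t - VV 0)" if t: "0 <= t" for t
  unfolding has_D_def
 proof (intro exI[of _ "v t - v 0"] conjI iv[OF t])
  show "acb (v t - v 0) (VV t - VV 0)"
   using av[OF t] av[of 0] unfolding acb_def VV_def I_diff by (simp add: algebra_simps)
 qed
 have CHV0: "CH k (%t. VV t - VV 0)" by (rule CH_diff[OF CHV Hs_CH[OF CH_Hs[OF CHV order_refl]]])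
 show "CH (k + 2) (%t. integral {0..t} (tv2 m))"
  unfolding numeral_2_eq_2 add_Suc_right add_0_right
  by (rule CH_SucI[OF integral_continuous_Ici[OF ctv2] h01 CH_SucI[OF integral_continuous_Ici[OF cw1] h12 CHV0]])
 show "cj (integral {0..t} (tv2 m)) = integral {0..t} (tv2 m)" if "0 <= t" for t
 proof -
  have "tv2 m integrable_on {0..t}" by (rule integrable_continuous_real[OF continuous_on_subset[OF ctv2]]) auto
  from integral_linear[OF this lin_cj, symmetric] have "cj (integral {0..t} (tv2 m)) = integral {0..t} (cj \<circ> tv2 m)" .
  also have "cj \<circ> tv2 m = tv2 m" by (simp add: fun_eq_iff cj0)
  finally show ?thesis .
 qed
 show "((%t. (D ^^ j) (integral {0..t} (tv2 m))) hvd (D ^^ j) (tv2 m t)) (at0 t)" if "0 <= t" "j <= k" for t j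
  using integral_has_vector_derivative_Ici[OF CH_D[OF CHtv2 that(2)] that(1), of 0] by (simp add: CH_integral_D[OF CHtv2 that(2)])
 show "(ev (integral {0..t} (tv m)) hvd ev (v t) s - ev (v 0) s) (at s)" if "0 <= t" for t s
 proof -
  have "acb (integral {0..t} (tv m)) (integral {0..t} w1)" using has_D_cb(2)[OF h01[of t]] isrep_cb[OF r[of t]] by simp
  from acb_isrep_deriv[OF this iv[OF that]] show ?thesis by simp
 qed
 show "(ev (v t) hvd of_real (Re (ev (m t) s * cnj (ev (cb (q t)) s)))) (at s)" if t: "0 <= t" for t s
 proof -
  have "isrep (cre (cmul (m t) (ccnj (cb (q t))))) (rel (mul (m t) (cj (q t))))" by (intro isrep_rel isrep_mul isrep_cj isq t)
  from acb_isrep_deriv[OF av[OF t] this, of s] show ?thesis by (simp del: times_complex.sel)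
 qed
 show "((%t. ev (integral {0..t} (tv m)) s) hvd ev (tv m t) s) (at0 t)" if t: "0 <= t" for t s
  using lin_hvd[OF lin_eval integral_has_vector_derivative_Ici[OF ctv t, of 0], of s] by simp
qed

end

section \<open>Uniqueness\<close>

text \<open>In contrast to \<open>hd1\<close>, f is itself the continuous representative, so that
  pointwise values, in particular the one at 0, can be used.\<close>

definition hH1 :: "(real => real) => l2 => l2 => bool" where
 "hH1 f u w \<longleftrightarrow> zx f u \<and> hac f w \<and> rp w"

lemma hH1_ext: assumes "hH1 f u w" shows "has_D (ext 1 u) (ext (-1) w)" "0 <= s ==> ev (cb (ext 1 u)) s = of_real (f s)"
 "f 0 = 0 ==> has_D (ext (-1) u) (ext 1 w)"
 using has_D_ext[of f u w 1] has_D_ext[of f u w "-1"] assms by (auto simp: hH1_def)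

lemma hH1_rp: "hH1 f u w ==> rp u" by (auto simp: hH1_def rp_def)

text \<open>u and the reflection of v are supported on complementary half lines, so the mixed terms
  vanish; for \<sigma> = 1 and \<sigma> = -1 the inner product is doubled.\<close>

lemma inner_ext: assumes "rp u" "rp v" shows "ext \<sigma> u \<bullet> ext \<sigma> v = (1 + \<sigma> * \<sigma>) * (u \<bullet> v)"
proof -
 have o: "u \<bullet> rfl v = 0" if uv: "rp u" "rp v" for u v
 proof -
  obtain f g where f: "zx f u" and g: "zx g v" using uv by (auto simp: rp_def)
  have u: "AE x in lborel. rep_l2 u x = (if 0 < x then of_real (f x) else 0)" using f by (simp add: zx_def)
  have v: "AE x in lborel. rep_l2 v x = (if 0 < x then of_real (g x) else 0)" using g by (simp add: zx_def)
  have "AE x in lborel. rep_l2 u x \<bullet> rep_l2 (rfl v) x = 0"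
   using u AE_reflect[OF v] rep_aff[of "-1" 0 v, OF zero_neq_neg_one[symmetric]] by eventually_elim auto
  thus ?thesis unfolding inner_l2_rep by (rule integral_eq_zero_AE)
 qed
 have "rfl u \<bullet> rfl v = u \<bullet> v" by (rule inner_aff) simp
 thus ?thesis using o[OF assms] o[OF assms(2,1)]
  by (simp add: ext_def inner_add_left inner_add_right algebra_simps inner_commute[of "rfl u" v])
qed

text \<open>The formula on the line is applied to the odd extension of f, which needs f 0 = 0, and
  to the even extension of g, so no boundary term arises.\<close>

lemma half_ibp: assumes f: "hH1 f u w" "f 0 = 0" and g: "hH1 g v z" shows "w \<bullet> v = - (u \<bullet> z)"
 using inner_D[OF hH1_ext(3)[OF f] hH1_ext(1)[OF g]] inner_ext[of w v 1] inner_ext[of u z "-1"] hH1_rp[OF f(1)] hH1_rp[OF g] f(1) g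
 by (simp add: hH1_def)

lemma hH1_sup: assumes "hH1 f u w" "0 <= s" shows "\<bar>f s\<bar> <= 2 * (norm u + norm w)"
proof -
 have e: "norm (ext \<sigma> u) <= 2 * norm u" if "\<bar>\<sigma>\<bar> = 1" for \<sigma> u
  using norm_triangle_ineq[of u "\<sigma> *\<^sub>R rfl u"] that by (simp add: ext_def norm_aff)
 have "\<bar>f s\<bar> <= norm (cb (ext 1 u))"
  using bcontfun_le[of "cb (ext 1 u)" s] hH1_ext(2)[OF assms] by simp
 also have "... <= norm (ext 1 u) + norm (ext (-1) w)" by (rule norm_cb[OF hH1_ext(1)[OF assms(1)]])
 also have "... <= 2 * (norm u + norm w)" using e[of 1 u] e[of "-1" w] by simp
 finally show ?thesis .
qed

lemma zx_mul: assumes "zx g v" "!!s. 0 < s ==> ev \<phi> s = of_real (f s)" shows "zx (%s. f s * g s) (mul \<phi> v)"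
 unfolding zx_def
proof
 have m: "(%s. Re (ev \<phi> s)) \<in> borel_measurable (Lpos)"
  by (rule measurable_restrict_space1, rule measurable_completion) measurable
 have "(%s. Re (ev \<phi> s) * g s) \<in> borel_measurable (Lpos)"
  by (rule borel_measurable_times[OF m]) (use assms(1) in "simp add: zx_def")
 moreover have "(%s. Re (ev \<phi> s) * g s) \<in> borel_measurable (Lpos) \<longleftrightarrow> (%s. f s * g s) \<in> borel_measurable (Lpos)"
  by (rule measurable_cong) (use assms(2) in auto)
 ultimately show "(%s. f s * g s) \<in> borel_measurable (Lpos)" by blast
 have "AE x in lborel. rep_l2 v x = (if 0 < x then of_real (g x) else 0)" using assms(1) by (simp add: zx_def)
 with rep_mul[of \<phi> v] show "AE x in lborel. rep_l2 (mul \<phi> v) x = (if 0 < x then of_real (f x * g x) else 0)"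
  by eventually_elim (auto simp: assms(2))
qed

text \<open>Even extensions reduce the product rule to \<open>acb_cmul\<close> on the line;
  integrals over intervals in the half line do not see the reflected parts.\<close>

lemma hH1_mult:
 assumes f: "hH1 f u w" "zx f' w" and g: "hH1 g v z" "zx g' z"
 shows "hH1 (%s. f s * g s) (mul (cb (ext 1 u)) v) (mul (cb (ext 1 u)) z + mul (cb (ext 1 v)) w)"
  "zx (%s. f s * g' s + f' s * g s) (mul (cb (ext 1 u)) z + mul (cb (ext 1 v)) w)"
proof -
 let ?U = "cb (ext 1 u)" and ?V = "cb (ext 1 v)"
 let ?p = "mul ?U z + mul ?V w"
 show z: "zx (%s. f s * g' s + f' s * g s) ?p"
  using zx_lin[OF zx_mul[OF g(2), of ?U f] zx_mul[OF f(2), of ?V g], of 1 1] hH1_ext(2)[OF f(1)] hH1_ext(2)[OF g(1)]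
  by (simp add: mult.commute)
 have a: "acb (cmul ?U ?V) (mul ?U (ext (-1) z) + mul ?V (ext (-1) w))"
  by (rule acb_cmul) (rule has_D_cb(2)[OF hH1_ext(1)[OF f(1)]] has_D_cb(2)[OF hH1_ext(1)[OF g(1)]])+
 have I: "I a b (mul \<phi> (ext (-1) x)) = I a b (mul \<phi> x)" if "0 <= a" "rp x" for a b \<phi> x
  unfolding I_mul
 proof (rule integral_cong_AE)
  obtain h where h: "zx h x" using \<open>rp x\<close> by (auto simp: rp_def)
  hence "AE s in lborel. rep_l2 x s = (if 0 < s then of_real (h s) else 0)" by (simp add: zx_def)
  with zx_ext[OF h, of "-1"] AE_lborel_singleton[of 0]
  show "AE s in lborel. indicator {a..b} s * (ev \<phi> s * rep_l2 (ext (-1) x) s) = indicator {a..b} s * (ev \<phi> s * rep_l2 x s)"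
   by eventually_elim (use that in "auto simp: indicator_def")
 qed measurable
 have "hac (%s. f s * g s) ?p" unfolding hac_def
 proof (intro allI impI)
  fix a b :: real assume ab: "0 <= a" "a <= b"
  hence "ev (cmul ?U ?V) b - ev (cmul ?U ?V) a = I a b (mul ?U (ext (-1) z) + mul ?V (ext (-1) w))"
   using a unfolding acb_def by blast
  also have "... = I a b ?p" unfolding I_add using I[OF ab(1)] f(1) g(1) by (simp add: hH1_def)
  finally show "of_real (f b * g b - f a * g a) = I a b ?p"
   using ab by (simp add: hH1_ext(2)[OF f(1)] hH1_ext(2)[OF g(1)])
 qed
 moreover have "zx (%s. f s * g s) (mul ?U v)"
  by (rule zx_mul) (use g(1) hH1_ext(2)[OF f(1)] in "auto simp: hH1_def")
 ultimately show "hH1 (%s. f s * g s) (mul ?U v) ?p" using z unfolding hH1_def rp_def by blast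
qed

lemma hH1_diff: "hH1 f u w ==> hH1 g v z ==> hH1 (%s. f s - g s) (u - v) (w - z)"
 using zx_lin[of f u g v 1 "-1"] hac_lin[of f w g z 1 "-1"] rp_lin[of w z 1 "-1"] by (simp add: hH1_def)

lemma hH1_add: "hH1 f u w ==> hH1 g v z ==> hH1 (%s. f s + g s) (u + v) (w + z)"
 using zx_lin[of f u g v 1 1] hac_lin[of f w g z 1 1] rp_lin[of w z 1 1] by (simp add: hH1_def)

text \<open>Allows the cross product algebra to be done pointwise in s, and only then
  integrated.\<close>

lemma sum_inner_le:
 fixes u v P Q :: "'c::finite => l2" and f g p q :: "'c => real => real"
 assumes z: "!!c. zx (f c) (u c)" "!!c. zx (g c) (v c)" "!!c. zx (p c) (P c)" "!!c. zx (q c) (Q c)"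
  and le: "AE x in lborel. 0 < x --> (\<Sum>c\<in>UNIV. f c x * g c x) <= \<alpha> * (\<Sum>c\<in>UNIV. (p c x)^2) + \<beta> * (\<Sum>c\<in>UNIV. (q c x)^2)"
 shows "(\<Sum>c\<in>UNIV. u c \<bullet> v c) <= \<alpha> * (\<Sum>c\<in>UNIV. (norm (P c))^2) + \<beta> * (\<Sum>c\<in>UNIV. (norm (Q c))^2)"
proof -
 have i: "integrable lborel (%x. rep_l2 u x \<bullet> rep_l2 v x)" for u v
  by (rule sqi_inner_integrable) (rule rep_l2_sqi)+
 have i2: "integrable lborel (%x. (cmod (rep_l2 u x))^2)" for u by (rule sqi_integrable[OF rep_l2_sqi])
 have ae: "AE x in lborel. \<forall>c. rep_l2 (u c) x = (if 0 < x then of_real (f c x) else 0)" if "!!c. zx (f c) (u c)" for u :: "'c => l2" and f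
  using that by (intro eventually_all_finite) (auto simp: zx_def)
 have "(\<Sum>c\<in>UNIV. u c \<bullet> v c) = (LINT x|lborel. (\<Sum>c\<in>UNIV. rep_l2 (u c) x \<bullet> rep_l2 (v c) x))"
  by (simp add: inner_l2_rep i)
 also have "... <= (LINT x|lborel. \<alpha> * (\<Sum>c\<in>UNIV. (cmod (rep_l2 (P c) x))^2) + \<beta> * (\<Sum>c\<in>UNIV. (cmod (rep_l2 (Q c) x))^2))"
 proof (rule integral_mono_AE)
  show "AE x in lborel. (\<Sum>c\<in>UNIV. rep_l2 (u c) x \<bullet> rep_l2 (v c) x)
   <= \<alpha> * (\<Sum>c\<in>UNIV. (cmod (rep_l2 (P c) x))^2) + \<beta> * (\<Sum>c\<in>UNIV. (cmod (rep_l2 (Q c) x))^2)"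
  using ae[of f u, OF z(1)] ae[of g v, OF z(2)] ae[of p P, OF z(3)] ae[of q Q, OF z(4)] le
  proof eventually_elim
   case (elim x) thus ?case by (cases "0 < x") (simp_all add: inner_complex_def)
  qed
 qed (auto intro!: Bochner_Integration.integrable_add integrable_mult_right Bochner_Integration.integrable_sum i i2)
 also have "... = \<alpha> * (\<Sum>c\<in>UNIV. (norm (P c))^2) + \<beta> * (\<Sum>c\<in>UNIV. (norm (Q c))^2)"
  by (simp add: norm_l2_sq i2)
 finally show ?thesis .
qed

text \<open>Arithmetic in the index type 3 is modulo 3, so one cyclic formula serves all three
  components.\<close>

lemma cross3_nth: "cross3 x y $ c = x $ (c + 1) * y $ (c + 2) - x $ (c + 2) * y $ (c + 1)"
proof -
 have f45: "(4::3) = 1" "(5::3) = 2" by simp_all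
 have "\<forall>c. cross3 x y $ c = x $ (c + 1) * y $ (c + 2) - x $ (c + 2) * y $ (c + 1)"
  unfolding forall_3 by (simp add: cross3_def f45)
 thus ?thesis by blast
qed

lemma hH1_cross:
 assumes f: "!!c. hH1 (%s. f s $ c) (u c) (w c)" "!!c. zx (%s. f' s $ c) (w c)"
  and g: "!!c. hH1 (%s. g s $ c) (v c) (z c)" "!!c. zx (%s. g' s $ c) (z c)"
 obtains p p' where "!!c. hH1 (%s. cross3 (f s) (g s) $ c) (p c) (p' c)"
  "!!c. zx (%s. (cross3 (f s) (g' s) + cross3 (f' s) (g s)) $ c) (p' c)"
proof -
 define p where "p a b = mul (cb (ext 1 (u a))) (v b)" for a b
 define p' where "p' a b = mul (cb (ext 1 (u a))) (z b) + mul (cb (ext 1 (v b))) (w a)" for a b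
 have p: "hH1 (%s. f s $ a * g s $ b) (p a b) (p' a b)" "zx (%s. f s $ a * g' s $ b + f' s $ a * g s $ b) (p' a b)" for a b
  unfolding p_def p'_def by (rule hH1_mult[OF f g])+
 show ?thesis
 proof
  fix c
  show "hH1 (%s. cross3 (f s) (g s) $ c) (p (c+1) (c+2) - p (c+2) (c+1)) (p' (c+1) (c+2) - p' (c+2) (c+1))"
   unfolding cross3_nth by (rule hH1_diff[OF p(1) p(1)])
  show "zx (%s. (cross3 (f s) (g' s) + cross3 (f' s) (g s)) $ c) (p' (c+1) (c+2) - p' (c+2) (c+1))"
   using zx_lin[OF p(2) p(2), of 1 "c+1" "c+2" "-1" "c+2" "c+1"] by (simp add: cross3_nth algebra_simps)
 qed
qed

lemma hH1_deriv:
 fixes f g :: "real => real^3"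
 assumes "!!c. hH1 (%s. f s $ c) (u c) (w c)" "!!c. hH1 (%s. g s $ c) (w c) (z c)" "0 <= s"
 shows "(f hvd g s) (at0 s)"
 by (rule hvd_vec, rule hac_deriv) (use assms hac_continuous in "auto simp: hH1_def")

text \<open>Here z_j, x_j and y1 are s-derivatives of z = y - x, of x and of y at a fixed time, and
  w0, w1, W2 those of z_t of orders 0, 1, 2; the left side is half the time derivative of E. In both
  sums one derivative is moved from the time derivative of z to z, after which the top term is a
  triple product with a repeated factor. The remaining product of z3 with z1 and x3 is not
  controlled by E and is integrated by parts once more; this brings in x4, which is only in L^2 and
  is paired with the sup norm of z1.\<close>

lemma energy_point:
 fixes y1 z1 z2 z3 x2 x3 x4 w0 w1 :: "real => real^3" and Z1 Z2 Z3 Z4 X3 X4 W0 W1 W2 :: "3 => l2"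
 assumes z: "!!c. hH1 (%s. z1 s $ c) (Z1 c) (Z2 c)" "!!c. hH1 (%s. z2 s $ c) (Z2 c) (Z3 c)" "!!c. hH1 (%s. z3 s $ c) (Z3 c) (Z4 c)"
  and x: "!!c. hH1 (%s. x3 s $ c) (X3 c) (X4 c)" "!!c. zx (%s. x4 s $ c) (X4 c)"
  and w: "!!c. hH1 (%s. w0 s $ c) (W0 c) (W1 c)" "!!c. hH1 (%s. w1 s $ c) (W1 c) (W2 c)"
  and tr: "z1 0 = 0" "!!c. has_D (ext (-1) (W1 c)) (ext 1 (W2 c))"
  and eq: "!!s. 0 < s ==> w0 s = cross3 (y1 s) (z2 s) + cross3 (z1 s) (x2 s)"
  and dy: "!!s. 0 < s ==> (y1 hvd x2 s + z2 s) (at0 s)"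
  and dx: "!!s. 0 < s ==> (x2 hvd x3 s) (at0 s)"
  and B: "0 <= B" "!!s. 0 < s ==> norm (x2 s) <= B" and M: "(\<Sum>c\<in>UNIV. (norm (X4 c))^2) <= M"
  and E: "E = (\<Sum>c\<in>UNIV. (norm (Z1 c))^2) + (\<Sum>c\<in>UNIV. (norm (Z2 c))^2)"
 shows "(\<Sum>c\<in>UNIV. Z1 c \<bullet> W1 c) + (\<Sum>c\<in>UNIV. Z2 c \<bullet> W2 c) <= (B + 1 + 4 * M) * E"
proof -
 have n2: "(norm (a::real^3))^2 = (\<Sum>c\<in>UNIV. (a $ c)^2)" for a
  unfolding power2_norm_eq_inner inner_vec_def by (simp add: power2_eq_square)
 have ip: "(\<Sum>c\<in>UNIV. a $ c * b $ c) = a \<bullet> b" for a b :: "real^3" by (simp add: inner_vec_def)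
 have cr: "\<bar>a \<bullet> cross3 b c\<bar> <= norm a * (norm b * norm c)" for a b c
 proof -
  have "(norm (cross3 b c))^2 <= (norm b * norm c)^2" using norm_cross_dot[of b c] zero_le_power2[of "b \<bullet> c"] by linarith
  hence "norm (cross3 b c) <= norm b * norm c" by (rule power2_le_imp_le) simp
  thus ?thesis using order_trans[OF Cauchy_Schwarz_ineq2[of a "cross3 b c"] mult_left_mono[OF _ norm_ge_zero]] by blast
 qed
 have mz: "zx (%s. (- f s) $ c) (- U c)" if "!!c. zx (%s. f s $ c) (U c)" for f :: "real => real^3" and U c
  using zx_lin[OF that[of c] that[of c], of "-1" 0] by simp
 note zz = z[unfolded hH1_def, THEN conjunct1] and ww = w[unfolded hH1_def, THEN conjunct1]
 have "Z2 c \<bullet> W0 c = - (Z1 c \<bullet> W1 c)" for c by (rule half_ibp[OF z(1) _ w(1)]) (simp add: tr)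
 hence "(\<Sum>c\<in>UNIV. Z1 c \<bullet> W1 c) = (\<Sum>c\<in>UNIV. - Z2 c \<bullet> W0 c)" by simp
 also have "... <= B / 2 * (\<Sum>c\<in>UNIV. (norm (Z1 c))^2) + B / 2 * (\<Sum>c\<in>UNIV. (norm (Z2 c))^2)"
 proof (rule sum_inner_le[where f = "%c s. (- z2 s) $ c" and g = "%c s. w0 s $ c" and p = "%c s. z1 s $ c" and q = "%c s. z2 s $ c"])
  show "zx (%s. (- z2 s) $ c) (- Z2 c)" for c by (rule mz[OF zz(2)])
  show "AE s in lborel. 0 < s --> (\<Sum>c\<in>UNIV. (- z2 s) $ c * w0 s $ c) <= B / 2 * (\<Sum>c\<in>UNIV. (z1 s $ c)^2) + B / 2 * (\<Sum>c\<in>UNIV. (z2 s $ c)^2)"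
  proof (intro AE_I2 impI)
   fix s :: real assume s: "0 < s"
   have "- z2 s \<bullet> w0 s = - (z2 s \<bullet> cross3 (z1 s) (x2 s))" by (simp add: eq[OF s] inner_add_right dot_cross_self)
   also have "... <= norm (z2 s) * (norm (z1 s) * norm (x2 s))" using cr[of "z2 s" "z1 s" "x2 s"] by linarith
   also have "... <= norm (z2 s) * (norm (z1 s) * B)" using B(2)[OF s] by (intro mult_left_mono) auto
   also have "... = B / 2 * (2 * norm (z1 s) * norm (z2 s))" by simp
   also have "... <= B / 2 * ((norm (z1 s))^2 + (norm (z2 s))^2)"
    using sum_squares_bound[of "norm (z1 s)" "norm (z2 s)"] B(1) by (intro mult_left_mono) auto
   finally show "(\<Sum>c\<in>UNIV. (- z2 s) $ c * w0 s $ c) <= B / 2 * (\<Sum>c\<in>UNIV. (z1 s $ c)^2) + B / 2 * (\<Sum>c\<in>UNIV. (z2 s $ c)^2)"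
    unfolding ip n2 by (simp add: distrib_left)
  qed
 qed (rule zz ww)+
 also have "... = B / 2 * E" by (simp add: E distrib_left)
 finally have 1: "(\<Sum>c\<in>UNIV. Z1 c \<bullet> W1 c) <= B / 2 * E" .
 \<comment> \<open>The factor 8 is the square of the constant 2 in \<open>hH1_sup\<close> times the
   2 from squaring a sum.\<close>
 have sup: "(norm (z1 s))^2 <= 8 * E" if "0 <= s" for s
 proof -
  have "(z1 s $ c)^2 <= 8 * ((norm (Z1 c))^2 + (norm (Z2 c))^2)" for c
  proof -
   have "(z1 s $ c)^2 <= (2 * (norm (Z1 c) + norm (Z2 c)))^2"
    using hH1_sup[OF z(1) that, of c] by (intro abs_le_square_iff[THEN iffD1]) simp
   also have "... <= 8 * ((norm (Z1 c))^2 + (norm (Z2 c))^2)"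
    using sum_squares_bound[of "norm (Z1 c)" "norm (Z2 c)"] by (simp add: power2_eq_square algebra_simps)
   finally show ?thesis .
  qed
  hence "(\<Sum>c\<in>UNIV. (z1 s $ c)^2) <= (\<Sum>c\<in>UNIV. 8 * ((norm (Z1 c))^2 + (norm (Z2 c))^2))" by (intro sum_mono)
  thus ?thesis by (simp add: n2 E sum.distrib sum_distrib_left distrib_left)
 qed
 obtain P P' where P: "!!c. hH1 (%s. cross3 (z1 s) (x3 s) $ c) (P c) (P' c)"
  "!!c. zx (%s. (cross3 (z1 s) (x4 s) + cross3 (z2 s) (x3 s)) $ c) (P' c)"
  by (rule hH1_cross[OF z(1) zz(2) x]) (rule that)
 \<comment> \<open>Differentiating w0 also yields the cross products of x2 with z2 and of z2 with
   x2, which cancel, so w1 has the same structure as w0 one order higher.\<close>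
 have w1: "w1 s = cross3 (y1 s) (z3 s) + cross3 (z1 s) (x3 s)" if s: "0 < s" for s
 proof -
  have "at0 s = at s" by (rule at_within_interior) (use s in auto)
  hence d: "(w0 hvd w1 s) (at s)" "(y1 hvd x2 s + z2 s) (at s)" "(x2 hvd x3 s) (at s)"
   "(z1 hvd z2 s) (at s)" "(z2 hvd z3 s) (at s)"
   using hH1_deriv[OF w, of s] dy[OF s] dx[OF s] hH1_deriv[OF z(1,2), of s] hH1_deriv[OF z(2,3), of s] s by auto
  have "((%s. cross3 (y1 s) (z2 s) + cross3 (z1 s) (x2 s)) hvd
   (cross3 (y1 s) (z3 s) + cross3 (x2 s + z2 s) (z2 s)) + (cross3 (z1 s) (x3 s) + cross3 (z2 s) (x2 s))) (at s)"
   by (intro has_vector_derivative_add bil_hvd[OF bil_cross3] d)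
  hence "(w0 hvd
   (cross3 (y1 s) (z3 s) + cross3 (x2 s + z2 s) (z2 s)) + (cross3 (z1 s) (x3 s) + cross3 (z2 s) (x2 s))) (at s)"
   by (rule has_vector_derivative_transform_within_open[of _ _ _ "{0<..}"]) (use s eq in auto)
  from vector_derivative_unique_at[OF d(1) this] show ?thesis
   using cross_skew[of "z2 s" "x2 s"] by (simp add: cross_add_left)
 qed
 \<comment> \<open>The boundary term is absent because z_st vanishes at 0; this enters in the form
   that the odd extension of W1 has a derivative in L^2.\<close>
 have "Z2 c \<bullet> W2 c = - (Z3 c \<bullet> W1 c)" for c
  using inner_D[OF tr(2) hH1_ext(1)[OF z(2)], of c] inner_ext[of "W2 c" "Z2 c" 1] inner_ext[of "W1 c" "Z3 c" "-1"]
   hH1_rp[OF z(2)] hH1_rp[OF z(3)] hH1_rp[OF w(2)] w(2)[of c] by (simp add: hH1_def inner_commute)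
 hence "(\<Sum>c\<in>UNIV. Z2 c \<bullet> W2 c) = (\<Sum>c\<in>UNIV. - Z3 c \<bullet> (W1 c - P c)) + (\<Sum>c\<in>UNIV. - Z3 c \<bullet> P c)"
  by (simp add: inner_diff_right sum_subtractf sum_negf)
 also have "(\<Sum>c\<in>UNIV. - Z3 c \<bullet> (W1 c - P c)) <= 0 * (\<Sum>c\<in>UNIV. (norm (Z1 c))^2) + 0 * (\<Sum>c\<in>UNIV. (norm (Z1 c))^2)"
 proof (rule sum_inner_le[where f = "%c s. (- z3 s) $ c" and g = "%c s. w1 s $ c - cross3 (z1 s) (x3 s) $ c"])
  show "zx (%s. (- z3 s) $ c) (- Z3 c)" for c by (rule mz[OF zz(3)])
  show "zx (%s. w1 s $ c - cross3 (z1 s) (x3 s) $ c) (W1 c - P c)" for c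
   using zx_lin[OF ww(2), of "%s. cross3 (z1 s) (x3 s) $ c" "P c" 1 c "-1"] P(1) by (simp add: hH1_def)
  show "AE s in lborel. 0 < s --> (\<Sum>c\<in>UNIV. (- z3 s) $ c * (w1 s $ c - cross3 (z1 s) (x3 s) $ c))
    <= 0 * (\<Sum>c\<in>UNIV. (z1 s $ c)^2) + 0 * (\<Sum>c\<in>UNIV. (z1 s $ c)^2)"
   by (intro AE_I2 impI) (simp only: vector_minus_component[symmetric] ip, simp add: w1 dot_cross_self)
 qed (rule zz)+
 \<comment> \<open>P stands for the cross product of z1 and x3, which vanishes at 0 together with
   z1, so the derivative can be moved off z2.\<close>
 also have "(\<Sum>c\<in>UNIV. - Z3 c \<bullet> P c) = (\<Sum>c\<in>UNIV. P' c \<bullet> Z2 c)"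
 proof (rule sum.cong)
  fix c
  have "cross3 (z1 0) (x3 0) $ c = 0" by (simp add: tr(1))
  from half_ibp[OF P(1) this z(2)] show "- Z3 c \<bullet> P c = P' c \<bullet> Z2 c" by (simp add: inner_commute[of "Z3 c"])
 qed simp
 also have "... <= (1/2) * (\<Sum>c\<in>UNIV. (norm (Z2 c))^2) + 4 * E * (\<Sum>c\<in>UNIV. (norm (X4 c))^2)"
 proof (rule sum_inner_le[OF P(2) zz(2) zz(2) x(2)], intro AE_I2 impI)
  fix s :: real assume s: "0 < s"
  let ?a = "norm (z2 s)" and ?b = "norm (z1 s) * norm (x4 s)"
  have "(cross3 (z1 s) (x4 s) + cross3 (z2 s) (x3 s)) \<bullet> z2 s = z2 s \<bullet> cross3 (z1 s) (x4 s)"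
   unfolding inner_commute[of _ "z2 s"] by (simp add: inner_add_right dot_cross_self)
  also have "... <= ?a * ?b" using cr[of "z2 s" "z1 s" "x4 s"] by linarith
  also have "... <= (1/2) * ?a^2 + (1/2) * ?b^2" using sum_squares_bound[of ?a ?b] by simp
  also have "?b^2 <= 8 * E * (norm (x4 s))^2"
   unfolding power_mult_distrib by (rule mult_right_mono[OF sup]) (use s in auto)
  finally show "(\<Sum>c\<in>UNIV. (cross3 (z1 s) (x4 s) + cross3 (z2 s) (x3 s)) $ c * z2 s $ c)
    <= (1/2) * (\<Sum>c\<in>UNIV. (z2 s $ c)^2) + 4 * E * (\<Sum>c\<in>UNIV. (x4 s $ c)^2)" unfolding ip n2 by simp
 qed
 finally have "(\<Sum>c\<in>UNIV. Z2 c \<bullet> W2 c) <= (1/2) * (\<Sum>c\<in>UNIV. (norm (Z2 c))^2) + 4 * E * (\<Sum>c\<in>UNIV. (norm (X4 c))^2)" by simp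
 also have "... <= E + 4 * E * M"
 proof (rule add_mono)
  have "0 <= (\<Sum>c\<in>UNIV. (norm (Z1 c))^2)" "0 <= (\<Sum>c\<in>UNIV. (norm (Z2 c))^2)" by (auto intro: sum_nonneg)
  thus "(1/2) * (\<Sum>c\<in>UNIV. (norm (Z2 c))^2) <= E" "4 * E * (\<Sum>c\<in>UNIV. (norm (X4 c))^2) <= 4 * E * M"
   using M by (auto simp: E intro!: mult_left_mono)
 qed
 finally have "(\<Sum>c\<in>UNIV. Z2 c \<bullet> W2 c) <= (1 + 4 * M) * E" by (simp add: algebra_simps)
 moreover have "B / 2 * E <= B * E" using B(1) by (intro mult_right_mono) (auto simp: E intro!: add_nonneg_nonneg sum_nonneg)
 ultimately show ?thesis using 1 by (simp add: algebra_simps)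
qed

section \<open>Pointwise representatives of a solution\<close>

lemma ch3_reps:
 fixes f :: "real => real^3"
 assumes "!!c. ch k (%s. f s $ c) (X c)"
 obtains h :: "nat => real => real^3" where "!!j c. j < k ==> hH1 (%s. h j s $ c) (X c j) (X c (Suc j))" "!!c. zx (%s. h k s $ c) (X c k)"
proof -
 have "\<exists>g. (j < k --> hH1 g (X c j) (X c (Suc j))) \<and> (j = k --> zx g (X c k))" for j c
 proof (cases "j < k")
  case True
  hence "hd1 (X c j) (X c (Suc j))" using assms by (simp add: ch_def)
  thus ?thesis using True unfolding hd1_def hH1_def by auto
 next
  case False
  thus ?thesis using ch_rp[OF assms order_refl, of c] unfolding rp_def by auto
 qed
 then obtain g where "!!j c. (j < k --> hH1 (g j c) (X c j) (X c (Suc j))) \<and> (j = k --> zx (g j c) (X c k))" by metis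
 thus ?thesis by (intro that[of "%j s. \<chi> c. g j c s"]) simp_all
qed

text \<open>If u and its derivative are differentiable in t with values in L^2, the sup bound
  \<open>hH1_sup\<close> applies to the difference quotients minus their limit, so the derivative
  exists pointwise for every s.\<close>

lemma hH1_hvd:
 assumes f: "!!t. 0 <= t ==> hH1 (f t) (u t) (u' t)" and g: "hH1 g w w'"
  and d: "(u hvd w) (at0 t)" "(u' hvd w') (at0 t)" and t: "0 <= t" and s: "0 <= s"
 shows "((%t. f t s) hvd g s) (at0 t)"
proof -
 let ?q = "%u r. (u r - u t) /\<^sub>R (r - t)"
 have sc: "hH1 (%s. r * h s) (r *\<^sub>R v) (r *\<^sub>R z)" if "hH1 h v z" for r h v z
  using zx_lin[of h v h v r 0] hac_lin[of h z h z r 0] rp_lin[of z z r 0] that by (simp add: hH1_def)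
 have q: "((%r. ?q u r - w) ---> 0) (at0 t)" "((%r. ?q u' r - w') ---> 0) (at0 t)"
  using d unfolding hvd_iff by (auto simp: Lim_null[symmetric])
 have "((%r. 2 * (norm (?q u r - w) + norm (?q u' r - w'))) ---> 2 * (norm (0::l2) + norm (0::l2))) (at0 t)"
  by (intro tendsto_intros q)
 hence lim: "((%r. 2 * (norm (?q u r - w) + norm (?q u' r - w'))) ---> 0) (at0 t)" by simp
 have "((%r. ?q (%t. f t s) r - g s) ---> 0) (at0 t)"
 proof (rule Lim_null_comparison[OF _ lim])
  show "\<forall>\<^sub>F r in at0 t. norm (?q (%t. f t s) r - g s) <= 2 * (norm (?q u r - w) + norm (?q u' r - w'))"
   unfolding eventually_at_filter
  proof (intro always_eventually allI impI)
   fix r :: real assume r: "r \<in> {0..}"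
   have "hH1 (%s. inverse (r - t) * (f r s - f t s) - g s) (?q u r - w) (?q u' r - w')"
    by (intro hH1_diff sc f g t) (use r in simp)
   from hH1_sup[OF this s] show "norm (?q (%t. f t s) r - g s) <= 2 * (norm (?q u r - w) + norm (?q u' r - w'))" by simp
  qed
 qed
 thus ?thesis unfolding hvd_iff by (simp add: Lim_null[symmetric])
qed

text \<open>A function with derivative 0 is constant, and a square integrable constant on the half
  line is 0; quantitatively, the sup bound over length l tends to 0 as l grows.\<close>

lemma hH1_zero: assumes "hH1 f u 0" "0 <= s" shows "f s = 0"
proof (rule ccontr)
 assume a: "f s ~= 0"
 have D: "has_D (ext 1 u) 0" using hH1_ext(1)[OF assms(1)] by (simp add: linear_0[OF lin[OF lin_ext]])
 have le: "\<bar>f s\<bar> <= norm (ext 1 u) / sqrt l" if "0 < l" for l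
  using order_trans[OF bcontfun_le[of "cb (ext 1 u)" s] norm_cb_le[OF D that]] by (simp add: hH1_ext(2)[OF assms])
 have "((%l. norm (ext 1 u) / sqrt l) ---> 0) at_top" by real_asymp
 hence "\<forall>\<^sub>F l in at_top. norm (ext 1 u) / sqrt l < \<bar>f s\<bar>" by (rule order_tendstoD) (use a in simp)
 hence "\<forall>\<^sub>F l::real in at_top. False" using eventually_gt_at_top[of 0] by eventually_elim (use le in fastforce)
 thus False by simp
qed

lemma ch_zero: assumes "ch k f X" "!!s. 0 < s ==> f s = 0" "j <= k" shows "X j = 0"
proof -
 have z0: "zx f 0" using assms(1,2) rep_zero by (auto simp: ch_def zx_def elim!: AE_mp)
 have "zx (%_. 0) 0" using rep_zero by (simp add: zx_def)
 moreover have "hac (%_. 0) 0" by (simp add: hac_def linear_0[OF lin[OF lin_I]])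
 ultimately have "hd1 0 0" unfolding hd1_def rp_def by blast
 hence "ch k f (%_. 0)" using z0 by (simp add: ch_def)
 from ch_unique[OF assms(1) this assms(3)] show ?thesis .
qed

text \<open>X t c j is the j-th s-derivative of component c of y - x0, and W that of its time
  derivative, both in L^2; h and g are their representatives. The equation and the boundary
  condition are available only for t > 0, which is why the last assumptions exclude t = 0.\<close>

locale sol_rep =
 fixes x0 v0 \<alpha> :: "real => real^3" and y :: "real => real => real^3" and h g :: "real => nat => real => real^3" and X W :: "real => 3 => nat => l2"
 assumes h: "!!t j c. 0 <= t ==> j < 4 ==> hH1 (%s. h t j s $ c) (X t c j) (X t c (Suc j))" and h4: "!!t c. 0 <= t ==> zx (%s. h t 4 s $ c) (X t c 4)"
  and cX: "!!c j. j <= 4 ==> cont0 (%t. X t c j)" and dX: "!!t c j. 0 <= t ==> j <= 2 ==> ((%t. X t c j) hvd W t c j) (at0 t)"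
  and g: "!!t j c. 0 <= t ==> j < 2 ==> hH1 (%s. g t j s $ c) (W t c j) (W t c (Suc j))"
  and X0: "!!c j. j <= 4 ==> X 0 c j = 0" and yh: "!!t s. 0 < t ==> 0 < s ==> y s t = x0 s + h t 0 s" and h10: "!!t. 0 < t ==> h t 1 0 = 0"
  and g0: "!!t s. 0 < t ==> 0 < s ==> g t 0 s = cross3 (v0 s + h t 1 s) (\<alpha> s + h t 2 s)"

text \<open>\<open>solves_LIA\<close> speaks of classical derivatives, the function classes of weak
  ones. Continuity of the representatives identifies the two, so that the equation holds for h and g
  at every s > 0.\<close>

lemma sol_data:
 fixes x0 v0 \<alpha> :: "real => real^3"
 assumes dx0: "!!s. 0 <= s ==> (x0 hvd v0 s) (at0 s)"
  and dv0: "!!s. 0 <= s ==> (v0 hvd \<alpha> s) (at0 s)" and v00: "v0 0 = e3"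
  and sol: "solves_LIA x0 y" and C0: "!!i. C0H (4 + m) (%s t. (y s t - x0 s) $ i)" and C1: "!!i. C1H (2 + m) (%s t. (y s t - x0 s) $ i)"
 obtains h g X W where "sol_rep x0 v0 \<alpha> y h g X W"
proof -
 have "\<exists>X. (\<forall>t\<ge>0. ch (4 + m) (%s. (y s t - x0 s) $ i) (X t)) \<and> (\<forall>j\<le>4 + m. cont0 (%t. X t j))" for i
  by (rule C0H_E[OF C0[of i]]) blast
 from choice[OF allI, OF this] obtain X0 where "\<forall>i. (\<forall>t\<ge>0. ch (4 + m) (%s. (y s t - x0 s) $ i) (X0 i t)) \<and> (\<forall>j\<le>4 + m. cont0 (%t. X0 i t j))" ..
 hence X: "!!t i. 0 <= t ==> ch (4 + m) (%s. (y s t - x0 s) $ i) (X0 i t)" and cX: "!!j i. j <= 4 + m ==> cont0 (%t. X0 i t j)"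
  by auto
 have "\<exists>W. (\<forall>t\<ge>0. \<exists>w. ch (2 + m) w (W t)) \<and> (\<forall>t\<ge>0. \<forall>j\<le>2 + m. ((%t. X0 i t j) hvd W t j) (at0 t))" for i
 proof (rule C1H_E[OF C1[of i]])
  fix X' W w
  assume X': "!!t. 0 <= t ==> ch (2 + m) (%s. (y s t - x0 s) $ i) (X' t)" and W: "!!t. 0 <= t ==> ch (2 + m) (%s. w s t) (W t)"
   and d: "!!t j. 0 <= t ==> j <= 2 + m ==> ((%t. X' t j) hvd W t j) (at0 t)"
  have "X0 i t j = X' t j" if "0 <= t" "j <= 2 + m" for t j
   by (rule ch_unique[OF _ X'[OF that(1)] that(2)]) (use X[OF that(1), of i] in "simp add: ch_def")
  hence "((%t. X0 i t j) hvd W t j) (at0 t)" if "0 <= t" "j <= 2 + m" for t j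
   by (intro has_vector_derivative_transform[OF _ _ d[OF that]]) (use that in auto)
  with W show ?thesis by blast
 qed
 from choice[OF allI, OF this] obtain W0 where "\<forall>i. (\<forall>t\<ge>0. \<exists>w. ch (2 + m) w (W0 i t)) \<and> (\<forall>t\<ge>0. \<forall>j\<le>2 + m. ((%t. X0 i t j) hvd W0 i t j) (at0 t))" ..
 hence W: "!!t i. 0 <= t ==> \<exists>w. ch (2 + m) w (W0 i t)"
  and dX: "!!t i j. 0 <= t ==> j <= 2 + m ==> ((%t. X0 i t j) hvd W0 i t j) (at0 t)" by auto
 have "\<exists>h :: nat => real => real^3. 0 <= t --> (\<forall>j<4. \<forall>c. hH1 (%s. h j s $ c) (X0 c t j) (X0 c t (Suc j))) \<and> (\<forall>c. zx (%s. h 4 s $ c) (X0 c t 4))" for t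
 proof (cases "0 <= t")
  case True
  have c: "ch 4 (%s. (y s t - x0 s) $ c) (X0 c t)" for c using X[OF True, of c] by (simp add: ch_def)
  show ?thesis by (rule ch3_reps[where f = "%s. y s t - x0 s", OF c]) blast
 qed simp
 from choice[OF allI, OF this] obtain h :: "real => nat => real => real^3" where "\<forall>t. 0 <= t --> (\<forall>j<4. \<forall>c. hH1 (%s. h t j s $ c) (X0 c t j) (X0 c t (Suc j))) \<and> (\<forall>c. zx (%s. h t 4 s $ c) (X0 c t 4))" ..
 hence h: "!!t j c. 0 <= t ==> j < 4 ==> hH1 (%s. h t j s $ c) (X0 c t j) (X0 c t (Suc j))" and h4: "!!t c. 0 <= t ==> zx (%s. h t 4 s $ c) (X0 c t 4)"
  by auto
 have "\<exists>g :: nat => real => real^3. 0 <= t --> (\<forall>j<2. \<forall>c. hH1 (%s. g j s $ c) (W0 c t j) (W0 c t (Suc j)))" for t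
 proof (cases "0 <= t")
  case True
  from choice[OF allI, OF W[OF True]] obtain w where w: "\<forall>c. ch (2 + m) (w c) (W0 c t)" ..
  have c: "ch 2 (%s. (\<chi> c. w c s) $ c) (W0 c t)" for c using w by (simp add: ch_def)
  show ?thesis by (rule ch3_reps[where f = "%s. \<chi> c. w c s", OF c]) blast
 qed simp
 from choice[OF allI, OF this] obtain g :: "real => nat => real => real^3" where "\<forall>t. 0 <= t --> (\<forall>j<2. \<forall>c. hH1 (%s. g t j s $ c) (W0 c t j) (W0 c t (Suc j)))" ..
 hence g: "!!t j c. 0 <= t ==> j < 2 ==> hH1 (%s. g t j s $ c) (W0 c t j) (W0 c t (Suc j))" by auto
 have hd: "(h t j hvd h t (Suc j) s) (at0 s)" if "0 <= t" "0 <= s" "j < 3" for t j s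
  by (rule hH1_deriv[OF h h]) (use that in auto)
 have atw: "at0 s = at s" if "0 < s" for s :: real by (rule at_within_interior) (use that in auto)
 have ci: "cont0 f" if "!!s. 0 <= s ==> (f hvd f' s) (at0 s)" for f f' :: "real => real^3"
  by (rule continuous_on_vector_derivative[of _ _ f']) (use that in auto)
 have ch0: "cont0 (h t 0)" if "0 <= t" for t by (rule ci[OF hd]) (use that in auto)
 have cx0: "cont0 x0" by (rule ci[OF dx0])
 \<comment> \<open>For t > 0 the solution is differentiable in s, hence continuous, so it coincides
   with the continuous representative everywhere and not only a.e.\<close>
 have yh: "y s t = x0 s + h t 0 s" if t: "0 < t" and s: "0 < s" for s t
 proof -
  have "(y s t - x0 s) $ c = h t 0 s $ c" for c
  proof (rule AE_continuous_eq[of "{0<..}" "%s. (y s t - x0 s) $ c" "%s. h t 0 s $ c"])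
   have "continuous_on {0<..} (%s. y s t)"
    by (rule differentiable_imp_continuous_on, rule differentiable_at_imp_differentiable_on) (use sol t in "simp add: solves_LIA_def")
   thus "continuous_on {0<..} (%s. (y s t - x0 s) $ c)"
    by (intro continuous_intros continuous_on_subset[OF cx0]) auto
   show "continuous_on {0<..} (%s. h t 0 s $ c)" by (intro continuous_intros continuous_on_subset[OF ch0]) (use t in auto)
   have "zx (%s. (y s t - x0 s) $ c) (X0 c t 0)" using X[of t c] t by (simp add: ch_def)
   from zx_AE_eq[OF this, of "%s. h t 0 s $ c"] h[of t 0 c] t
   show "AE s in lborel. s \<in> {0<..} --> (y s t - x0 s) $ c = h t 0 s $ c" by (simp add: hH1_def)
  qed (use s in auto)
  thus ?thesis by (simp add: vec_eq_iff algebra_simps)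
 qed
 have xs: "xs y s t = v0 s + h t 1 s" if t: "0 < t" and s: "0 < s" for s t
  unfolding xs_def
 proof (rule vector_derivative_at, rule has_vector_derivative_transform_within_open[of _ _ _ "{0<..}"])
  show "((%s. x0 s + h t 0 s) hvd v0 s + h t 1 s) (at s)"
   using has_vector_derivative_add[OF dx0 hd[of t s 0]] t s by (simp add: atw)
 qed (use s yh[OF t] in auto)
 have xss: "vector_derivative (%s. xs y s t) (at s) = \<alpha> s + h t 2 s" if t: "0 < t" and s: "0 < s" for s t
 proof (rule vector_derivative_at, rule has_vector_derivative_transform_within_open[of _ _ _ "{0<..}"])
  show "((%s. v0 s + h t 1 s) hvd \<alpha> s + h t 2 s) (at s)"
   using has_vector_derivative_add[OF dv0 hd[of t s 1]] t s by (simp add: atw numeral_2_eq_2)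
 qed (use s xs[OF t] in auto)
 show thesis
 proof (rule that[of h g "%t c. X0 c t" "%t c. W0 c t"], unfold_locales)
  show "X0 c 0 j = 0" if "j <= 4" for c j
   by (rule ch_zero[OF X[OF order_refl]]) (use that sol in "auto simp: solves_LIA_def")
  \<comment> \<open>The one-sided derivative at 0 makes y continuous there, so the identity with x0
    + h extends to s = 0 and the derivatives e3 and v0 0 + h t 1 0 can be compared.\<close>
  show "h t 1 0 = 0" if t: "0 < t" for t
  proof -
   have dy: "((%s. y s t) hvd e3) (at0 0)" using sol t by (simp add: solves_LIA_def)
   have d: "((%s. x0 s + h t 0 s) hvd v0 0 + h t 1 0) (at0 0)"
    using has_vector_derivative_add[OF dx0 hd[of t 0 0]] t by simp
   have tr: "at0 (0::real) ~= bot" by (rule at_within_Ici_nontrivial) simp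
   have ev: "\<forall>\<^sub>F s in at0 0. x0 s + h t 0 s = y s t"
    using yh[OF t] by (auto simp: eventually_at_filter)
   have "((%s. y s t) ---> y 0 t) (at0 0)" and l: "((%s. x0 s + h t 0 s) ---> x0 0 + h t 0 0) (at0 0)"
    using has_vector_derivative_continuous[OF dy] has_vector_derivative_continuous[OF d] by (simp_all add: continuous_within)
   from tendsto_unique[OF tr this(1) Lim_transform_eventually[OF l ev]] have "y 0 t = x0 0 + h t 0 0" .
   hence "((%s. y s t) hvd v0 0 + h t 1 0) (at0 0)"
    by (intro has_vector_derivative_transform[OF _ _ d]) (use yh[OF t] in "auto simp: le_less")
   from vector_deriv_unique_Ici[OF this dy] v00 show ?thesis by simp
  qed
  show "g t 0 s = cross3 (v0 s + h t 1 s) (\<alpha> s + h t 2 s)" if t: "0 < t" and s: "0 < s" for t s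
  proof -
   \<comment> \<open>The time derivative in the sense of L^2 is also a pointwise one, so it can be
     compared with the classical derivative in the equation.\<close>
   have dh: "((%t. h t 0 s) hvd g t 0 s) (at0 t)"
   proof (rule hvd_vec)
    fix c
    show "((%t. h t 0 s $ c) hvd g t 0 s $ c) (at0 t)"
     by (rule hH1_hvd[where f = "%t s. h t 0 s $ c", OF h g dX dX]) (use t s in auto)
   qed
   hence "((%t. x0 s + h t 0 s) hvd g t 0 s) (at t)"
    using has_vector_derivative_add[OF has_vector_derivative_const[of "x0 s"] dh] t by (simp add: atw)
   hence "((%t. y s t) hvd g t 0 s) (at t)"
    by (rule has_vector_derivative_transform_within_open[of _ _ _ "{0<..}"]) (use t s yh in auto)
   moreover have "((%t. y s t) hvd cross3 (v0 s + h t 1 s) (\<alpha> s + h t 2 s)) (at t)"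
    using sol t s unfolding solves_LIA_def by (simp add: xs xss)
   ultimately show ?thesis by (rule vector_derivative_unique_at)
  qed
 qed (use h h4 cX dX g yh in auto)
qed

lemma existence:
 fixes m :: nat
  and x0 v0 a0 :: "real => real^3"
 assumes dx0: "!!s. s >= 0 ==> (x0 hvd v0 s) (at0 s)"
  and dv0: "!!s. s >= 0 ==> (v0 hvd a0 s) (at0 s)"
  and a0H: "!!i. (%s. a0 s $ i) \<in> Hk (2 + m)"
  and unit: "!!s. s >= 0 ==> norm (v0 s) = 1"
  and compat: "compat_A ((2 + m) div 2) v0 a0 (2 + m)"
 obtains x where "solves_LIA x0 x"
  "!!i. C0H (4 + m) (%s t. (x s t - x0 s) $ i)" "!!i. C1H (2 + m) (%s t. (x s t - x0 s) $ i)"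
  "!!s t. 0 < s ==> 0 <= t ==> norm (xs x s t) = 1"
proof -
 obtain V M q0 e where "frame_data (2 + m) v0 e V M q0"
  by (rule initial_data[OF dv0 a0H le_add1 unit compat]) (assumption, assumption, rule that)
 then interpret init: frame_data "2 + m" v0 e V M q0 .
 obtain q where q: "q 0 = q0" "CH (2 + m) q" "!!t. 0 <= t ==> rfl (q t) = q t"
  "!!t. 0 <= t ==> (q hvd J (D (D (q t)) + NL (q t))) (at0 t)"
  by (rule nls_global[OF init.q0 le_add1]) (rule that, assumption+)
 have q2: "CH (Suc (Suc m)) q" using q(2) by simp
 obtain w where w: "cont0 q" "!!t. 0 <= t ==> has_D (q t) (w t)" "CH (Suc m) w"
  by (rule CH_SucE[OF q2]) (rule that, assumption+)
 obtain z where z: "cont0 w" "!!t. 0 <= t ==> has_D (w t) (z t)" "CH m z"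
  by (rule CH_SucE[OF w(3)]) (rule that, assumption+)
 interpret S: nls_sol q w z
 proof
  show "(q hvd J (z t + NL (q t))) (at0 t)" if "0 <= t" for t
   using q(4)[OF that] D_eq[OF w(2)[OF that]] D_eq[OF z(2)[OF that]] by simp
 qed (use w z CH_continuous in auto)
 \<comment> \<open>The coefficients of the transport system depend on q alone, so the three
   components of the frame are solved for separately; the geometric relations between them are
   recovered by \<open>frame_invariant\<close>.\<close>
 have "\<exists>p. fst p 0 = V c \<and> snd p 0 = M c \<and> S.frame (fst p) (snd p)" for c
 proof -
  have a: "acb (V c) (rel (mul (M c) (cj (q 0))))" "acb (M c) (- mul (V c) (q 0))" using init.aV init.aM q(1) by simp_all
  show ?thesis by (rule S.frame_exists[OF init.Im a]) auto
 qed
 from choice[OF allI, OF this] obtain pp where pp: "\<forall>c. fst (pp c) 0 = V c \<and> snd (pp c) 0 = M c \<and> S.frame (fst (pp c)) (snd (pp c))" ..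
 define v where "v c = fst (pp c)" for c
 define mm where "mm c = snd (pp c)" for c
 have fr: "S.frame (v c) (mm c)" and vm: "v c 0 = V c" "mm c 0 = M c" for c using pp by (simp_all add: v_def mm_def)
 have dv: "!!t. 0 <= t ==> (v c hvd cre (cmul (ccnj (S.b t)) (mm c t))) (at0 t)"
  and dm: "!!t. 0 <= t ==> (mm c hvd cmul (S.ith t) (mm c t) - cmul (S.b t) (v c t)) (at0 t)"
  and Im: "!!t x. 0 <= t ==> Im (ev (v c t) x) = 0" for c
  using fr[of c] unfolding S.frame_def by blast+
 note comp = S.component[OF q(2) fr]
 define P where "P c t = integral {0..t} (S.tv (mm c))" for c t
 define x where "x s t = x0 s + (\<chi> c. Re (ev (P c t) s))" for s t
 define vv where "vv s t = (\<chi> c. Re (ev (v c t) s))" for s t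
 define ee where "ee s t = (\<chi> c. Re (ev (mm c t) s))" for s t
 define ff where "ff s t = (\<chi> c. Im (ev (mm c t) s))" for s t
 \<comment> \<open>This is x_ss: it is Re (conj q m) written out for m = e + i f.\<close>
 define X2 where "X2 s t = Re (ev (cb (q t)) s) *\<^sub>R ee s t + Im (ev (cb (q t)) s) *\<^sub>R ff s t" for s t
 have frame: "cross3 (vv s t) (ee s t) = ff s t" "cross3 (ee s t) (ff s t) = vv s t" "cross3 (ff s t) (vv s t) = ee s t" "vv s t \<bullet> vv s t = 1"
  if s: "0 <= s" and t: "0 <= t" for s t
 proof -
  let ?a = "%t. Re (ev (S.b t) s)" and ?b = "%t. Im (ev (S.b t) s)" and ?h = "%t. (cmod (ev (cb (q t)) s))^2 / 2"
  have bl: "((%t. Re (ev (f t) s)) hvd Re (ev g s)) (at t within T)"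
   "((%t. Im (ev (f t) s)) hvd Im (ev g s)) (at t within T)"
   if "(f hvd g) (at t within T)" for f :: "real => cbf" and g t T
   by (rule lin_hvd[OF bounded_linear_compose[OF bounded_linear_Re lin_eval] that]
     lin_hvd[OF bounded_linear_compose[OF bounded_linear_Im lin_eval] that])+
  have ith: "ev (S.ith t) s = \<i> * of_real (?h t)" for t by (simp add: S.ith_def apply_dens)
  have 1: "(vv s hvd ?a t *\<^sub>R ee s t + ?b t *\<^sub>R ff s t) (at0 t)" if "0 <= t" for t
   unfolding vv_def[abs_def] by (rule hvd_vec) (use bl(1)[OF dv[OF that]] in "simp add: ee_def ff_def")
  have 2: "(ee s hvd - (?h t *\<^sub>R ff s t) - ?a t *\<^sub>R vv s t) (at0 t)" if "0 <= t" for t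
   unfolding ee_def[abs_def] by (rule hvd_vec) (use bl(1)[OF dm[OF that]] Im[OF that] in "simp add: vv_def ff_def ith")
  have 3: "(ff s hvd ?h t *\<^sub>R ee s t - ?b t *\<^sub>R vv s t) (at0 t)" if "0 <= t" for t
   unfolding ff_def[abs_def] by (rule hvd_vec) (use bl(2)[OF dm[OF that]] Im[OF that] in "simp add: vv_def ee_def ith")
  have i: "vv s 0 = v0 s" "ee s 0 = e s" "ff s 0 = cross3 (v0 s) (e s)"
   using s by (simp_all add: vv_def ee_def ff_def vm(1,2) init.V init.M)
  note fc = frame_cross[OF init.on[OF s]]
  have 4: "cross3 (vv s 0) (ee s 0) = ff s 0" "cross3 (ee s 0) (ff s 0) = vv s 0" "cross3 (ff s 0) (vv s 0) = ee s 0" "vv s 0 \<bullet> vv s 0 = 1"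
   unfolding i using fc(1,2) init.on(1)[OF s] cross_skew[of "cross3 (v0 s) (e s)" "v0 s"] by simp_all
  show "cross3 (vv s t) (ee s t) = ff s t" "cross3 (ee s t) (ff s t) = vv s t" "cross3 (ff s t) (vv s t) = ee s t" "vv s t \<bullet> vv s t = 1"
   using frame_invariant[OF 1 2 3 4 t] by blast+
 qed
 have dP: "((%s. (\<chi> c. Re (ev (P c t) s)) :: real^3) hvd vv s t - v0 s) (at s within S)" if "0 <= s" "0 <= t" for s t S
 proof (rule hvd_vec)
  fix c
  have "(ev (P c t) hvd ev (v c t) s - ev (v c 0) s) (at s within S)"
   unfolding P_def by (rule has_vector_derivative_at_within[OF comp(8)[OF that(2)]])
  from lin_hvd[OF bounded_linear_Re this]
  show "((%s. (\<chi> c. Re (ev (P c t) s)) $ c) hvd (vv s t - v0 s) $ c) (at s within S)"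
   using that by (simp add: vv_def vm(1) init.V)
 qed
 have dx: "((%s. x s t) hvd vv s t) (at0 s)" if "0 <= s" "0 <= t" for s t
  unfolding x_def using has_vector_derivative_add[OF dx0[OF that(1)] dP[OF that]] by simp
 have atw: "at0 s = at s" if "0 < s" for s :: real by (rule at_within_interior) (use that in auto)
 have dx': "((%s. x s t) hvd vv s t) (at s)" if "0 < s" "0 <= t" for s t
  using dx[of s t] that atw by simp
 have xs: "xs x s t = vv s t" if "0 < s" "0 <= t" for s t
  unfolding xs_def by (rule vector_derivative_at[OF dx'[OF that]])
 have dvv: "((%s. vv s t) hvd X2 s t) (at s)" if "0 <= t" for s t
  unfolding vv_def
  by (rule hvd_vec) (use lin_hvd[OF bounded_linear_Re comp(9)[OF that]] in "simp add: X2_def ee_def ff_def mult.commute")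
 have dxs: "((%s. xs x s t) hvd X2 s t) (at s)" if "0 < s" "0 <= t" for s t
  by (rule has_vector_derivative_transform_within_open[OF dvv[OF that(2)], of "{0<..}"]) (use that xs in auto)
 have dt: "((%t. x s t) hvd cross3 (vv s t) (X2 s t)) (at0 t)" if "0 <= s" "0 <= t" for s t
 proof -
  have "((%t. (\<chi> c. Re (ev (P c t) s)) :: real^3) hvd
    Re (ev (cb (q t)) s) *\<^sub>R ff s t - Im (ev (cb (q t)) s) *\<^sub>R ee s t) (at0 t)"
   by (rule hvd_vec) (use lin_hvd[OF bounded_linear_Re comp(10)[OF that(2)]] in
     \<open>simp add: P_def S.tv_def ee_def ff_def mult.commute\<close>)
  \<comment> \<open>For q = a + i b the cross product of v with a e + b f is a f - b e, that is Re
    (conj (i q) m), the integrand in the definition of x.\<close>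
  moreover have "cross3 (vv s t) (X2 s t) = Re (ev (cb (q t)) s) *\<^sub>R ff s t - Im (ev (cb (q t)) s) *\<^sub>R ee s t"
   using frame(1,3)[OF that] cross_skew[of "vv s t" "ff s t"] by (simp add: X2_def cross_add_right cross_mult_right)
  ultimately show ?thesis unfolding x_def using has_vector_derivative_add[OF has_vector_derivative_const[of "x0 s"]] by force
 qed
 have vv0: "vv 0 t = e3" if t: "0 <= t" for t
 proof -
  have b0: "ev (S.b t) 0 = 0" if t: "0 <= t" for t unfolding S.b_def
  proof (rule odd_at_zero[OF has_D_J[OF z(2)[OF t]]])
   have "has_D (q t) (- rfl (w t))" using has_D_rfl[OF w(2)[OF t]] q(3)[OF t] by simp
   hence "w t = - rfl (w t)" using w(2)[OF t] has_D_unique by blast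
   hence "rfl (w t) = - w t" by (metis minus_minus)
   thus "rfl (J (w t)) = - J (w t)" by (simp add: aff_J linear_neg[OF lin[OF lin_J]])
  qed
  have "(vv 0 hvd 0) (at0 t)" if t: "0 <= t" for t
   unfolding vv_def[abs_def]
   by (rule hvd_vec) (use lin_hvd[OF bounded_linear_compose[OF bounded_linear_Re lin_eval[of 0]] dv[OF t]]
     in "simp add: b0[OF t]")
  from const_Ici[OF this t] have "vv 0 t = vv 0 0" .
  also have "... = v0 0" by (simp add: vv_def vm(1) init.V)
  also have "... = e3" using compat by (simp add: compat_A_def)
  finally show ?thesis .
 qed
 have diff: "(x s t - x0 s) $ i = Re (ev (P i t) s)" for s t i by (simp add: x_def)
 have meas: "(%s. Re (ev \<phi> s)) \<in> borel_measurable (Lpos)" for \<phi> :: cbf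
  by (rule measurable_restrict_space1, rule measurable_completion) measurable
 have ae: "AE s in lborel. 0 < s --> rep_l2 u s = of_real (Re (ev \<phi> s))" if "isrep \<phi> u" "cj u = u" for \<phi> u
  using cj_real[OF that(2)] that(1) unfolding isrep_def by eventually_elim simp
 have "2 + m + 2 = 4 + m" by simp
 note comp3 = comp(3)[unfolded this]
 have chX: "ch (4 + m) (%s. (x s t - x0 s) $ i) (%j. hf ((D ^^ j) (integral {0..t} (S.tv2 (mm i)))))" if "0 <= t" for t i
  unfolding diff P_def by (rule ch_hf[OF CH_Hs[OF comp3 that] comp(2)[OF that] meas ae[OF comp(1)[OF that] comp(2)[OF that]]])
 show thesis
 proof (rule that[of x])
  show "norm (xs x s t) = 1" if "0 < s" "0 <= t" for s t
   using frame(4)[of s t] that by (simp add: xs norm_eq_1)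
  show "C0H (4 + m) (%s t. (x s t - x0 s) $ i)" for i
  proof (rule C0H_I[OF chX])
   show "cont0 (%t. hf ((D ^^ j) (integral {0..t} (S.tv2 (mm i)))))" if "j <= 4 + m" for j
    by (rule lin_cont[OF lin_hf CH_D[OF comp3]]) (use that in simp)
  qed
  show "C1H (2 + m) (%s t. (x s t - x0 s) $ i)" for i
  proof (rule C1H_I[where X = "%t j. hf ((D ^^ j) (integral {0..t} (S.tv2 (mm i))))" and w = "%s t. Re (ev (S.tv (mm i) t) s)"
     and W = "%t j. hf ((D ^^ j) (S.tv2 (mm i) t))"])
   show "ch (2 + m) (%s. (x s t - x0 s) $ i) (%j. hf ((D ^^ j) (integral {0..t} (S.tv2 (mm i)))))" if "0 <= t" for t
    using chX[OF that, of i] by (simp add: ch_def)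
   show "ch (2 + m) (%s. Re (ev (S.tv (mm i) t) s)) (%j. hf ((D ^^ j) (S.tv2 (mm i) t)))" if "0 <= t" for t
    by (rule ch_hf[OF CH_Hs[OF comp(4) that] comp(6)[OF that] meas ae[OF comp(5)[OF that] comp(6)[OF that]]])
   show "cont0 (%t. hf ((D ^^ j) (S.tv2 (mm i) t)))" if "j <= 2 + m" for j
    by (rule lin_cont[OF lin_hf CH_D[OF comp(4) that]])
   show "((%t. hf ((D ^^ j) (integral {0..t} (S.tv2 (mm i))))) hvd hf ((D ^^ j) (S.tv2 (mm i) t))) (at0 t)"
    if "0 <= t" "j <= 2 + m" for t j
    by (rule lin_hvd[OF lin_hf comp(7)[OF that]])
  qed
  show "solves_LIA x0 x" unfolding solves_LIA_def
  proof (intro conjI allI impI)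
   fix s t :: real assume s: "0 < s" and t: "0 < t"
   note st = s less_imp_le[OF t]
   show "(%s'. x s' t) differentiable (at s)" by (rule differentiableI_vector[OF dx'[OF st]])
   show "(%s'. xs x s' t) differentiable (at s)" by (rule differentiableI_vector[OF dxs[OF st]])
   show "((%t'. x s t') hvd cross3 (xs x s t) (vector_derivative (%s'. xs x s' t) (at s))) (at t)"
    using dt[of s t] s t atw[OF t] by (simp add: xs vector_derivative_at[OF dxs[OF st]])
  next
   show "x s 0 = x0 s" for s by (simp add: x_def P_def vec_eq_iff)
   show "((%s. x s t) hvd e3) (at0 0)" if "0 < t" for t
    using dx[of 0 t] vv0[of t] that by simp
  qed
 qed
qed

lemma uniqueness:
 fixes x0 v0 a0 :: "real => real^3"
 assumes dx0: "!!s. s >= 0 ==> (x0 hvd v0 s) (at0 s)"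
  and dv0: "!!s. s >= 0 ==> (v0 hvd a0 s) (at0 s)"
  and a0H: "!!i. (%s. a0 s $ i) \<in> Hk (2 + m)" and v00: "v0 0 = e3"
  and x: "solves_LIA x0 x" "!!i. C0H (4 + m) (%s t. (x s t - x0 s) $ i)" "!!i. C1H (2 + m) (%s t. (x s t - x0 s) $ i)"
  and y: "solves_LIA x0 y" "!!i. C0H (4 + m) (%s t. (y s t - x0 s) $ i)" "!!i. C1H (2 + m) (%s t. (y s t - x0 s) $ i)"
  and s: "0 < s" and t: "0 <= t"
 shows "y s t = x s t"
proof -
 have "\<exists>A. ch (2 + m) (%s. a0 s $ i) A" for i using Hk_ch[OF a0H[of i]] by blast
 from choice[OF allI, OF this] obtain A where A: "\<forall>i. ch (2 + m) (%s. a0 s $ i) (A i)" ..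
 hence A2: "ch 2 (%s. a0 s $ c) (A c)" for c by (simp add: ch_def)
 obtain a :: "nat => real => real^3" where a: "!!j c. j < 2 ==> hH1 (%s. a j s $ c) (A c j) (A c (Suc j))" "!!c. zx (%s. a 2 s $ c) (A c 2)"
  by (rule ch3_reps[where f = a0, OF A2]) (rule that, assumption+)
 have da: "(a 0 hvd a 1 s) (at0 s)" if "0 <= s" for s
  by (rule hH1_deriv[where u = "%c. A c 0" and w = "%c. A c 1" and z = "%c. A c 2"])
    (use a(1)[of 0] a(1)[of 1] that in "simp_all add: eval_nat_numeral")
 \<comment> \<open>a 0 is the continuous representative of a0; it is again the derivative of v0, at
   every point.\<close>
 have dv: "(v0 hvd a 0 s) (at0 s)" if s: "0 <= s" for s
 proof (rule hvd_vec, rule ae_deriv[OF _ _ _ s])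
  fix c
  show "((%s. v0 s $ c) hvd a0 s $ c) (at0 s)" if "0 <= s" for s
   by (rule lin_hvd[OF bounded_linear_vec_nth dv0[OF that]])
  show "AE s in lborel. 0 < s --> a0 s $ c = a 0 s $ c"
   using zx_AE_eq[of "%s. a0 s $ c" "A c 0" "%s. a 0 s $ c"] A2[of c] a(1)[of 0 c] by (simp add: ch_def hH1_def)
  show "cont0 (%s. a 0 s $ c)" using a(1)[of 0 c] by (auto simp: hH1_def intro: hac_continuous)
 qed
 have x_0: "x s 0 = x0 s" and y_0: "y s 0 = x0 s" using x(1) y(1) s by (simp_all add: solves_LIA_def)
 obtain hx gx X V where "sol_rep x0 v0 (a 0) x hx gx X V" by (rule sol_data[OF dx0 dv v00 x]) (assumption, assumption, rule that)
 then interpret x: sol_rep x0 v0 "a 0" x hx gx X V .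
 obtain hy gy Y W where "sol_rep x0 v0 (a 0) y hy gy Y W" by (rule sol_data[OF dx0 dv v00 y]) (assumption, assumption, rule that)
 then interpret y: sol_rep x0 v0 "a 0" y hy gy Y W .
 define Z where "Z t c j = Y t c j - X t c j" for t c j
 define Z' where "Z' t c j = W t c j - V t c j" for t c j
 have z: "hH1 (%s. (hy t j s - hx t j s) $ c) (Z t c j) (Z t c (Suc j))" if "0 <= t" "j < 4" for t j c
  unfolding Z_def vector_minus_component by (rule hH1_diff[OF y.h[OF that] x.h[OF that]])
 have z': "hH1 (%s. (gy t j s - gx t j s) $ c) (Z' t c j) (Z' t c (Suc j))" if "0 <= t" "j < 2" for t j c
  unfolding Z'_def vector_minus_component by (rule hH1_diff[OF y.g[OF that] x.g[OF that]])
 have dZ: "((%t. Z t c j) hvd Z' t c j) (at0 t)" if "0 <= t" "j <= 2" for t c j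
  unfolding Z_def Z'_def by (rule has_vector_derivative_diff[OF y.dX[OF that] x.dX[OF that]])
 have Z0: "Z 0 c j = 0" if "j <= 4" for c j using x.X0[OF that] y.X0[OF that] by (simp add: Z_def)
 \<comment> \<open>Order 0 is left out: z itself is recovered at the end from z_s = 0 and square
   integrability.\<close>
 define E where "E t = (\<Sum>c\<in>UNIV. (norm (Z t c 1))^2) + (\<Sum>c\<in>UNIV. (norm (Z t c 2))^2)" for t
 define E' where "E' t = 2 * ((\<Sum>c\<in>UNIV. Z t c 1 \<bullet> Z' t c 1) + (\<Sum>c\<in>UNIV. Z t c 2 \<bullet> Z' t c 2))" for t
 have dE: "(E hvd E' t) (at0 t)" if "0 <= t" for t
 proof -
  have "((%t. (\<Sum>c\<in>UNIV. Z t c 1 \<bullet> Z t c 1) + (\<Sum>c\<in>UNIV. Z t c 2 \<bullet> Z t c 2)) hvd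
    ((\<Sum>c\<in>UNIV. Z t c 1 \<bullet> Z' t c 1 + Z' t c 1 \<bullet> Z t c 1) + (\<Sum>c\<in>UNIV. Z t c 2 \<bullet> Z' t c 2 + Z' t c 2 \<bullet> Z t c 2))) (at0 t)"
   by (intro has_vector_derivative_add has_vector_derivative_sum bil_hvd[OF bounded_bilinear_inner] dZ) (use that in auto)
  thus ?thesis
   unfolding E_def[abs_def] E'_def power2_norm_eq_inner by (simp add: inner_commute[of "Z' _ _ _"] sum.distrib sum_distrib_left)
 qed
 have E0: "E 0 = 0" by (simp add: E_def Z0)
 have Z0': "Z t c 1 = 0" if t: "0 < t" for t c
 proof -
  \<comment> \<open>b bounds the sup norm of x_ss through \<open>hH1_sup\<close>, and mu is the
    squared L^2 norm of the fourth derivative of x; both are continuous in time, hence bounded on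
    [0, t].\<close>
  define b where "b r = (\<Sum>c\<in>UNIV. 2 * (norm (A c 0 + X r c 2) + norm (A c 1 + X r c 3)))" for r
  define mu where "mu r = (\<Sum>c\<in>UNIV. (norm (A c 2 + X r c 4))^2)" for r
  have "cont0 b" "cont0 mu" unfolding b_def[abs_def] mu_def[abs_def]
   by (intro continuous_intros x.cX; simp)+
  then obtain B M where B: "0 <= B" "!!r. r \<in> {0..t} ==> norm (b r) <= B" and M: "0 <= M" "!!r. r \<in> {0..t} ==> norm (mu r) <= M"
   using continuous_Ici_bounded[of b t] continuous_Ici_bounded[of mu t] by metis
  let ?K = "B + 1 + 4 * M"
  have bound: "E' r <= 2 * ?K * E r" if r: "r \<in> {0..t}" for r
  proof (cases "r = 0")
   case True thus ?thesis by (simp add: E0 E'_def Z0)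
  next
   case False
   hence r0: "0 < r" and r1: "0 <= r" using r by auto
   have cc: "hH1 (%s. (a j s + hx r (j + 2) s) $ c) (A c j + X r c (j + 2)) (A c (Suc j) + X r c (Suc (j + 2)))" if "j < 2" for j c
    unfolding vector_add_component by (rule hH1_add[OF a(1)[OF that] x.h[OF r1]]) (use that in simp)
   have hyd: "(hy r 1 hvd hy r 2 s) (at0 s)" and hxd: "(hx r 2 hvd hx r 3 s) (at0 s)" if "0 <= s" for s
    by (rule hH1_deriv[where u = "%c. Y r c 1" and w = "%c. Y r c 2" and z = "%c. Y r c 3"],
      use y.h[OF r1, of 1] y.h[OF r1, of 2] that in "simp_all add: eval_nat_numeral")
      (rule hH1_deriv[where u = "%c. X r c 2" and w = "%c. X r c 3" and z = "%c. X r c 4"],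
      use x.h[OF r1, of 2] x.h[OF r1, of 3] that in "simp_all add: eval_nat_numeral")
   have "(\<Sum>c\<in>UNIV. Z r c 1 \<bullet> Z' r c 1) + (\<Sum>c\<in>UNIV. Z r c 2 \<bullet> Z' r c 2) <= ?K * E r"
   proof (rule energy_point[where ?z1.0 = "%s. hy r 1 s - hx r 1 s" and ?z2.0 = "%s. hy r 2 s - hx r 2 s" and ?z3.0 = "%s. hy r 3 s - hx r 3 s"
      and ?Z3.0 = "%c. Z r c 3" and ?Z4.0 = "%c. Z r c 4" and ?x2.0 = "%s. a 0 s + hx r 2 s" and ?x3.0 = "%s. a 1 s + hx r 3 s"
      and ?X3.0 = "%c. A c 1 + X r c 3" and ?X4.0 = "%c. A c 2 + X r c 4" and ?x4.0 = "%s. a 2 s + hx r 4 s"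
      and ?w0.0 = "%s. gy r 0 s - gx r 0 s" and ?w1.0 = "%s. gy r 1 s - gx r 1 s" and ?W0.0 = "%c. Z' r c 0" and ?y1.0 = "%s. v0 s + hy r 1 s"])
    show "hH1 (%s. (hy r 1 s - hx r 1 s) $ c) (Z r c 1) (Z r c 2)" "hH1 (%s. (hy r 2 s - hx r 2 s) $ c) (Z r c 2) (Z r c 3)"
     "hH1 (%s. (hy r 3 s - hx r 3 s) $ c) (Z r c 3) (Z r c 4)" for c
     using z[OF r1, of 1] z[OF r1, of 2] z[OF r1, of 3] by (simp_all add: numeral_2_eq_2 numeral_3_eq_3 eval_nat_numeral)
    show "hH1 (%s. (gy r 0 s - gx r 0 s) $ c) (Z' r c 0) (Z' r c 1)" "hH1 (%s. (gy r 1 s - gx r 1 s) $ c) (Z' r c 1) (Z' r c 2)" for c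
     using z'[OF r1, of 0] z'[OF r1, of 1] by (simp_all add: numeral_2_eq_2)
    show "hH1 (%s. (a 1 s + hx r 3 s) $ c) (A c 1 + X r c 3) (A c 2 + X r c 4)" for c
     using cc[of 1] by (simp add: eval_nat_numeral)
    show "zx (%s. (a 2 s + hx r 4 s) $ c) (A c 2 + X r c 4)" for c
     using zx_lin[OF a(2) x.h4[OF r1], of 1 c 1 c] by simp
    show "hy r 1 0 - hx r 1 0 = 0" using x.h10[OF r0] y.h10[OF r0] by simp
    show "gy r 0 s - gx r 0 s = cross3 (v0 s + hy r 1 s) (hy r 2 s - hx r 2 s) + cross3 (hy r 1 s - hx r 1 s) (a 0 s + hx r 2 s)" if "0 < s" for s
     unfolding x.g0[OF r0 that] y.g0[OF r0 that] by (simp add: cross3_simps vec_eq_iff forall_3)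
    show "((%s. v0 s + hy r 1 s) hvd a 0 s + hx r 2 s + (hy r 2 s - hx r 2 s)) (at0 s)" if "0 < s" for s
     using has_vector_derivative_add[OF dv hyd, of s] that by simp
    show "((%s. a 0 s + hx r 2 s) hvd a 1 s + hx r 3 s) (at0 s)" if "0 < s" for s
     using has_vector_derivative_add[OF da hxd, of s] that by simp
    show "norm (a 0 s + hx r 2 s) <= B" if "0 < s" for s
    proof -
     have "norm (a 0 s + hx r 2 s) <= (\<Sum>c\<in>UNIV. \<bar>(a 0 s + hx r 2 s) $ c\<bar>)" by (rule norm_le_l1_cart)
     also have "... <= b r" unfolding b_def
      by (rule sum_mono) (use hH1_sup[OF cc[of 0]] that in "simp add: numeral_3_eq_3 numeral_2_eq_2")
     finally show ?thesis using B(2)[OF r] by simp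
    qed
    show "(\<Sum>c\<in>UNIV. (norm (A c 2 + X r c 4))^2) <= M" using M(2)[OF r] by (simp add: mu_def)
    \<comment> \<open>z_s vanishes at s = 0 for all positive times, so the odd extensions of its
      difference quotients in time are in H^1. Their limit inherits this by closedness of the
      derivative, which encodes z_st = 0 at s = 0.\<close>
    show "has_D (ext (-1) (Z' r c 1)) (ext 1 (Z' r c 2))" for c
    proof -
     have tr: "at0 r ~= bot" by (rule at_within_Ici_nontrivial[OF r1])
     have q: "has_D (ext (-1) ((Z p c 1 - Z r c 1) /\<^sub>R (p - r))) (ext 1 ((Z p c 2 - Z r c 2) /\<^sub>R (p - r)))" if p: "0 < p" for p
     proof -
      have d: "has_D (ext (-1) (Z p c 1)) (ext 1 (Z p c 2))" if "0 < p" for p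
       by (rule hH1_ext(3)[where f = "%s. (hy p 1 s - hx p 1 s) $ c"])
         (use z[of p 1 c] x.h10[of p] y.h10[of p] that in "auto simp: numeral_2_eq_2")
      from has_D_scaleR[OF has_D_diff[OF d[OF p] d[OF r0]], of "inverse (p - r)"] show ?thesis
       by (simp add: linear_diff[OF lin[OF lin_ext]] linear_scale[OF lin[OF lin_ext]])
     qed
     have lim: "(%n. ext \<sigma> ((Z (r + eps n) c j - Z r c j) /\<^sub>R (r + eps n - r))) ----> ext \<sigma> (Z' r c j)" if "j <= 2" for \<sigma> j
     proof (rule bounded_linear.tendsto[OF lin_ext], rule filterlim_compose[OF dZ[OF r1 that, unfolded hvd_iff]])
      show "filterlim (%n. r + eps n) (at0 r) sequentially"
       unfolding filterlim_at
      proof (intro conjI always_eventually allI)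
       have "(%n. r + eps n) ----> r + 0" by (intro tendsto_intros LIMSEQ_inverse_real_of_nat)
       thus "(%n. r + eps n) ----> r" by simp
      qed (use r1 in "auto simp: field_simps")
     qed
     show ?thesis by (rule has_D_closed(1)[OF q lim lim]) (use r0 in "auto intro: add_pos_pos")
    qed
   qed (simp_all add: B(1) E_def)
   thus ?thesis unfolding E'_def mult.assoc by (rule mult_left_mono) simp
  qed
  have "E t <= 0 * exp (2 * ?K * t)"
  proof (rule gronwall_integral)
   have cE: "cont0 E" by (rule continuous_on_vector_derivative[of _ _ E']) (use dE in auto)
   show "continuous_on {0..t} E" by (rule continuous_on_subset[OF cE]) auto
   show "E r <= 0 + 2 * ?K * integral {0..r} E" if r: "r \<in> {0..t}" for r
   proof -
    have i: "(E' has_integral E r - E 0) {0..r}" by (rule FTC_Ici[OF dE]) (use r in auto)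
    have c: "continuous_on {0..r} E" by (rule continuous_on_subset[OF cE]) auto
    have "E r - E 0 <= integral {0..r} (%r. 2 * ?K * E r)"
    proof (rule has_integral_le[OF i])
     show "((%r. 2 * ?K * E r) has_integral integral {0..r} (%r. 2 * ?K * E r)) {0..r}"
      by (intro integrable_integral integrable_continuous_real continuous_intros c)
    qed (use bound r in auto)
    thus ?thesis by (simp add: E0)
   qed
  qed (use B(1) M(1) t in auto)
  hence "(\<Sum>c\<in>UNIV. (norm (Z t c 1))^2) + (\<Sum>c\<in>UNIV. (norm (Z t c 2))^2) <= 0" by (simp add: E_def)
  moreover have "0 <= (\<Sum>c\<in>UNIV. (norm (Z t c 2))^2)" by (intro sum_nonneg) simp
  moreover have "(norm (Z t c 1))^2 <= (\<Sum>c\<in>UNIV. (norm (Z t c 1))^2)" by (rule member_le_sum) auto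
  ultimately have "(norm (Z t c 1))^2 <= 0" by linarith
  thus ?thesis by simp
 qed
 show ?thesis
 proof (cases "t = 0")
  case True thus ?thesis using x_0 y_0 by simp
 next
  case False
  hence t0: "0 < t" using t by simp
  \<comment> \<open>The s-derivative of z is 0 in L^2 and z is square integrable, so
    \<open>hH1_zero\<close> gives z = 0.\<close>
  have "(hy t 0 s - hx t 0 s) $ c = 0" for c
   using hH1_zero[of "%s. (hy t 0 s - hx t 0 s) $ c" "Z t c 0" s] z[OF t, of 0 c] Z0'[OF t0, of c] s by simp
  thus ?thesis using x.yh[OF t0 s] y.yh[OF t0 s] by (simp add: vec_eq_iff)
 qed
qed

theorem theorem5p2:
  fixes m :: nat
    and x0 v0 a0 :: "real \<Rightarrow> real^3"
  assumes dx0: "\<And>s. s \<ge> 0 \<Longrightarrow> (x0 has_vector_derivative v0 s) (at s within {0..})"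
    and dv0: "\<And>s. s \<ge> 0 \<Longrightarrow> (v0 has_vector_derivative a0 s) (at s within {0..})"
    and a0H: "\<And>i. (\<lambda>s. a0 s $ i) \<in> Hk (2 + m)"
    and unit: "\<And>s. s \<ge> 0 \<Longrightarrow> norm (v0 s) = 1"
    and x03: "x0 0 $ 3 = 0"
    and compat: "compat_A ((2 + m) div 2) v0 a0 (2 + m)"
  shows "\<exists>x. solves_LIA x0 x \<and>
             (\<forall>i. C0H (4 + m) (\<lambda>s t. (x s t - x0 s) $ i) \<and>
                  C1H (2 + m) (\<lambda>s t. (x s t - x0 s) $ i)) \<and>
             (\<forall>s>0. \<forall>t\<ge>0. norm (xs x s t) = 1) \<and>
             (\<forall>y. solves_LIA x0 y \<and>
                  (\<forall>i. C0H (4 + m) (\<lambda>s t. (y s t - x0 s) $ i) \<and>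
                       C1H (2 + m) (\<lambda>s t. (y s t - x0 s) $ i))
                  \<longrightarrow> (\<forall>s>0. \<forall>t\<ge>0. y s t = x s t))"
proof -
 obtain x where x: "solves_LIA x0 x"
  "!!i. C0H (4 + m) (%s t. (x s t - x0 s) $ i)" "!!i. C1H (2 + m) (%s t. (x s t - x0 s) $ i)"
  "!!s t. 0 < s ==> 0 <= t ==> norm (xs x s t) = 1"
  by (rule existence[OF dx0 dv0 a0H unit compat]) (assumption, assumption, assumption, rule that)
 have v00: "v0 0 = e3" using compat by (simp add: compat_A_def)
 show ?thesis
 proof (intro exI[of _ x] conjI allI impI)
  fix y and s t :: real
  assume y: "solves_LIA x0 y \<and> (\<forall>i. C0H (4 + m) (%s t. (y s t - x0 s) $ i) \<and> C1H (2 + m) (%s t. (y s t - x0 s) $ i))"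
   and "0 < s" "0 <= t"
  show "y s t = x s t"
   by (rule uniqueness[OF dx0 dv0 a0H v00 x(1-3)]) (use y \<open>0 < s\<close> \<open>0 <= t\<close> in auto)
 qed (use x in auto)
qed

end
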